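(* Let $\phi_1,\phi_2\in H^{-1/2-}(\mathbb{T})$ be of the form $$\phi_1=\sum_{n\in\mathbb{N}^*}a_n^1\sin(nx),\qquad \phi_2=\sum_{n\in\mathbb{N}}a_n^2\cos(nx),$$ with real coefficients such that $a_0^2\neq0$ and, for some constants $c,C>0$, $c<|a_n^k|<C$ for all $k\in\{1,2\}$ and $n\in\mathbb{N}^*$. Then for any $\lambda>0$ there exist linear feedback functionals $K_1,K_2$, bounded on $H^{1/2+}(\mathbb{T})$, such that for any $y_0\in L^2(\mathbb{T})$ the equation $$\partial_t y-\Delta y+\partial_x(y^2/2)=K_1(y)\phi_1+K_2(y)\phi_2,\qquad y(0)=y_0,$$ on $(0,+\infty)\times\mathbb{T}$ has a unique solution $$y\in C^0([0,+\infty);L^2(\mathbb{T}))\cap L^2_{loc}((0,+\infty);H^1(\mathbb{T}))\cap H^1_{loc}((0,+\infty);H^{-1}(\mathbb{T})).$$ Moreover, there exists $\delta>0$ such that for any $y_0$ with $\|y_0\|_{L^2}<\delta$, $$\|y(t,\cdot)\|_{L^2}\le C' e^{-\lambda t}\|y_0\|_{L^2},\qquad\forall t\in[0,+\infty),$$ where $C'=C'(\lambda)$ is a constant independent of $y_0$.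
   Context: $\mathbb{T}=\mathbb{R}/2\pi\mathbb{Z}$, $\mathbb{N}=\{0,1,2,\dots\}$, $\mathbb{N}^*=\{1,2,\dots\}$, $\Delta=\partial_x^2$; all functions are real valued. $H^s(\mathbb{T})$ is the usual Sobolev space, $s\in\mathbb{R}$. "$y\in H^{s-}$" means $y\in H^{s-\varepsilon}$ for all $\varepsilon>0$; "a functional is bounded on $H^{s+}$" means that it is a bounded functional $H^{s+\varepsilon}\to\mathbb{R}$ for all $\varepsilon>0$. The equation is understood to hold in $L^2_{loc}((0,+\infty);H^{-1}(\mathbb{T}))$. *)

theory Defs
  imports "HOL-Analysis.Analysis"
begin

section \<open>Smooth functions on the torus\<close>

text \<open>Functions on the torus \<open>\<real>/2\<pi>\<int>\<close> are \<open>2\<pi>\<close>-periodic functions on the real line.\<close>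

definition smooth :: "(real \<Rightarrow> real) \<Rightarrow> bool" where
  "smooth f \<longleftrightarrow> (\<forall>n x. (deriv ^^ n) f differentiable (at x))"

lemma smooth_differentiable: "smooth f \<Longrightarrow> (deriv ^^ n) f differentiable (at x)"
  by (simp add: smooth_def)

lemma smooth_has_deriv:
  assumes "smooth f"
  shows "((deriv ^^ n) f has_real_derivative (deriv ^^ Suc n) f x) (at x)"
  using smooth_differentiable[OF assms, of n x]
  by (metis DERIV_imp_deriv comp_apply funpow.simps(2) real_differentiable_def)

lemma higher_deriv_lincomb:
  assumes "smooth f" "smooth g"
  shows "(deriv ^^ n) (\<lambda>x. a * f x + b * g x) = (\<lambda>x. a * (deriv ^^ n) f x + b * (deriv ^^ n) g x)"
proof (induction n)
  case (Suc n)
  have "((\<lambda>x. a * (deriv ^^ n) f x + b * (deriv ^^ n) g x) has_real_derivative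
      (a * (deriv ^^ Suc n) f x + b * (deriv ^^ Suc n) g x)) (at x)" for x
    by (intro DERIV_add DERIV_cmult smooth_has_deriv assms)
  then have "deriv (\<lambda>x. a * (deriv ^^ n) f x + b * (deriv ^^ n) g x)
      = (\<lambda>x. a * (deriv ^^ Suc n) f x + b * (deriv ^^ Suc n) g x)"
    by (intro ext DERIV_imp_deriv)
  then show ?case by (simp add: Suc)
qed simp

lemma smooth_lincomb:
  assumes "smooth f" "smooth g"
  shows "smooth (\<lambda>x. a * f x + b * g x)"
  unfolding smooth_def higher_deriv_lincomb[OF assms]
  by (auto intro!: derivative_intros smooth_differentiable assms)

lemma smooth_zero: "smooth (\<lambda>x. 0)"
proof -
  have "(deriv ^^ n) (\<lambda>x::real. 0::real) = (\<lambda>x. 0)" for n by (induction n) auto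
  then show ?thesis by (simp add: smooth_def)
qed

lemma smooth_add: "smooth f \<Longrightarrow> smooth g \<Longrightarrow> smooth (\<lambda>x. f x + g x)"
  using smooth_lincomb[of f g 1 1] by simp

lemma smooth_diff: "smooth f \<Longrightarrow> smooth g \<Longrightarrow> smooth (\<lambda>x. f x - g x)"
  using smooth_lincomb[of f g 1 "-1"] by simp

lemma smooth_scale: "smooth f \<Longrightarrow> smooth (\<lambda>x. r * f x)"
  using smooth_lincomb[OF _ smooth_zero, of f r 0] by simp

lemma smooth_minus: "smooth f \<Longrightarrow> smooth (\<lambda>x. - f x)"
  using smooth_scale[of f "-1"] by simp

lemma smooth_deriv_add:
  "smooth f \<Longrightarrow> smooth g \<Longrightarrow> deriv (\<lambda>x. f x + g x) = (\<lambda>x. deriv f x + deriv g x)"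
  using higher_deriv_lincomb[of f g "Suc 0" 1 1] by simp

lemma smooth_deriv_scale: "smooth f \<Longrightarrow> deriv (\<lambda>x. r * f x) = (\<lambda>x. r * deriv f x)"
  using higher_deriv_lincomb[of f "\<lambda>x. 0" "Suc 0" r 0] smooth_zero by simp

lemma smooth_deriv: "smooth f \<Longrightarrow> smooth (deriv f)"
  unfolding smooth_def by (metis comp_apply funpow_Suc_right)

lemma deriv_periodic:
  fixes f :: "real \<Rightarrow> real"
  assumes "smooth f" "\<And>x. f (x + p) = f x"
  shows "deriv f (x + p) = deriv f x"
proof -
  have "(f has_real_derivative deriv f (x + p)) (at (x + p))"
    using smooth_has_deriv[OF assms(1), of 0] by simp
  then have "((\<lambda>x. f (x + p)) has_real_derivative deriv f (x + p)) (at x)"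
    by (simp add: DERIV_shift)
  then show ?thesis using assms(2) by (simp add: DERIV_imp_deriv)
qed

lemma smooth_cos_sin: "smooth (\<lambda>x. a * cos (k * x) + b * sin (k * x))"
proof -
  have d: "deriv (\<lambda>x. a * cos (k * x) + b * sin (k * x))
      = (\<lambda>x. (b * k) * cos (k * x) + (- a * k) * sin (k * x))" for a b
    by (rule ext, rule DERIV_imp_deriv) (auto intro!: derivative_eq_intros simp: algebra_simps)
  have "\<exists>c d. (deriv ^^ n) (\<lambda>x. a * cos (k * x) + b * sin (k * x))
      = (\<lambda>x. c * cos (k * x) + d * sin (k * x))" for n
  proof (induction n)
    case 0 then show ?case by auto
  next
    case (Suc n)
    then obtain c d where "(deriv ^^ n) (\<lambda>x. a * cos (k * x) + b * sin (k * x))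
      = (\<lambda>x. c * cos (k * x) + d * sin (k * x))" by blast
    then have "(deriv ^^ Suc n) (\<lambda>x. a * cos (k * x) + b * sin (k * x))
      = (\<lambda>x. (d * k) * cos (k * x) + (- c * k) * sin (k * x))" using d[of c d] by simp
    then show ?case by blast
  qed
  moreover have "(\<lambda>x. c * cos (k * x) + d * sin (k * x)) differentiable (at x)" for c d x
  proof -
    have "((\<lambda>x. c * cos (k * x) + d * sin (k * x)) has_real_derivative
        d * k * cos (k * x) + - c * k * sin (k * x)) (at x)"
      by (auto intro!: derivative_eq_intros simp: algebra_simps)
    then show ?thesis by (auto simp: real_differentiable_def)
  qed
  ultimately show ?thesis unfolding smooth_def by metis
qed

typedef test_fun = "{f. smooth f \<and> (\<forall>x. f (x + 2 * pi) = f x)}"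
  morphisms test_apply Test_fun
  using smooth_zero by force

setup_lifting type_definition_test_fun

instantiation test_fun :: real_vector
begin

lift_definition zero_test_fun :: test_fun is "\<lambda>x. 0"
  by (simp add: smooth_zero)
lift_definition plus_test_fun :: "test_fun \<Rightarrow> test_fun \<Rightarrow> test_fun" is "\<lambda>f g x. f x + g x"
  by (simp add: smooth_add)
lift_definition minus_test_fun :: "test_fun \<Rightarrow> test_fun \<Rightarrow> test_fun" is "\<lambda>f g x. f x - g x"
  by (simp add: smooth_diff)
lift_definition uminus_test_fun :: "test_fun \<Rightarrow> test_fun" is "\<lambda>f x. - f x"
  by (simp add: smooth_minus)
lift_definition scaleR_test_fun :: "real \<Rightarrow> test_fun \<Rightarrow> test_fun" is "\<lambda>r f x. r * f x"
  by (simp add: smooth_scale)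

instance
  by standard (transfer, simp add: algebra_simps)+

end

lift_definition test_deriv :: "test_fun \<Rightarrow> test_fun" is deriv
  by (auto simp: smooth_deriv deriv_periodic)

lift_definition cos_test :: "int \<Rightarrow> test_fun" is "\<lambda>n x. cos (real_of_int n * x)"
proof -
  fix n :: int
  have "cos (real_of_int n * (x + 2 * pi)) = cos (real_of_int n * x)" for x
    by (simp add: distrib_left cos_add mult.commute[of _ "2 * pi"])
  then show "smooth (\<lambda>x. cos (real_of_int n * x)) \<and>
      (\<forall>x. cos (real_of_int n * (x + 2 * pi)) = cos (real_of_int n * x))"
    using smooth_cos_sin[of 1 "real_of_int n" 0] by simp
qed

lift_definition sin_test :: "int \<Rightarrow> test_fun" is "\<lambda>n x. sin (real_of_int n * x)"
proof -
  fix n :: int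
  have "sin (real_of_int n * (x + 2 * pi)) = sin (real_of_int n * x)" for x
    by (simp add: distrib_left sin_add mult.commute[of _ "2 * pi"])
  then show "smooth (\<lambda>x. sin (real_of_int n * x)) \<and>
      (\<forall>x. sin (real_of_int n * (x + 2 * pi)) = sin (real_of_int n * x))"
    using smooth_cos_sin[of 0 "real_of_int n" 1] by simp
qed


section \<open>Distributions on the torus\<close>

text \<open>Real distributions: linear forms on the smooth periodic functions that are continuous, i.e.
  bounded by a multiple of \<open>max\<^bsub>j \<le> k\<^esub> sup\<^bsub>x\<^esub> \<bar>\<psi>\<^bsup>(j)\<^esup> x\<bar>\<close> for some order \<open>k\<close>; the bound \<open>M\<close>
  below ranges over the upper bounds of that maximum.\<close>

definition dist_continuous :: "(test_fun \<Rightarrow> real) \<Rightarrow> bool" where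
  "dist_continuous T \<longleftrightarrow> (\<exists>C k. \<forall>\<psi> M. (\<forall>j\<le>k. \<forall>x. \<bar>(deriv ^^ j) (test_apply \<psi>) x\<bar> \<le> M)
     \<longrightarrow> \<bar>T \<psi>\<bar> \<le> C * M)"

lemma dist_continuousE:
  assumes "dist_continuous T"
  obtains C k where "C \<ge> 0"
    "\<And>\<psi> M. (\<And>j x. j \<le> k \<Longrightarrow> \<bar>(deriv ^^ j) (test_apply \<psi>) x\<bar> \<le> M) \<Longrightarrow> \<bar>T \<psi>\<bar> \<le> C * M"
proof -
  obtain C k where *: "\<And>\<psi> M. (\<And>j x. j \<le> k \<Longrightarrow> \<bar>(deriv ^^ j) (test_apply \<psi>) x\<bar> \<le> M) \<Longrightarrow> \<bar>T \<psi>\<bar> \<le> C * M"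
    using assms unfolding dist_continuous_def by metis
  have "\<bar>T \<psi>\<bar> \<le> \<bar>C\<bar> * M" if "\<And>j x. j \<le> k \<Longrightarrow> \<bar>(deriv ^^ j) (test_apply \<psi>) x\<bar> \<le> M" for \<psi> M
  proof -
    have "0 \<le> M" using that[of 0 0] abs_ge_zero order_trans by blast
    then show ?thesis using *[OF that] mult_right_mono[OF abs_ge_self[of C], of M] by fastforce
  qed
  then show thesis using that abs_ge_zero by blast
qed

lemma dist_continuous_lincomb:
  assumes "dist_continuous S" "dist_continuous T"
  shows "dist_continuous (\<lambda>\<psi>. a * S \<psi> + b * T \<psi>)"
proof -
  obtain C k where C: "C \<ge> 0"
    "\<And>\<psi> M. (\<And>j x. j \<le> k \<Longrightarrow> \<bar>(deriv ^^ j) (test_apply \<psi>) x\<bar> \<le> M) \<Longrightarrow> \<bar>S \<psi>\<bar> \<le> C * M"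
    using dist_continuousE[OF assms(1)] by blast
  obtain D l where D: "D \<ge> 0"
    "\<And>\<psi> M. (\<And>j x. j \<le> l \<Longrightarrow> \<bar>(deriv ^^ j) (test_apply \<psi>) x\<bar> \<le> M) \<Longrightarrow> \<bar>T \<psi>\<bar> \<le> D * M"
    using dist_continuousE[OF assms(2)] by blast
  show ?thesis
    unfolding dist_continuous_def
  proof (intro exI allI impI)
    fix \<psi> M assume M: "\<forall>j\<le>max k l. \<forall>x. \<bar>(deriv ^^ j) (test_apply \<psi>) x\<bar> \<le> M"
    have "\<bar>S \<psi>\<bar> \<le> C * M" "\<bar>T \<psi>\<bar> \<le> D * M" using M by (auto intro!: C(2) D(2))
    then have "\<bar>a\<bar> * \<bar>S \<psi>\<bar> + \<bar>b\<bar> * \<bar>T \<psi>\<bar> \<le> \<bar>a\<bar> * (C * M) + \<bar>b\<bar> * (D * M)"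
      by (intro add_mono mult_left_mono) auto
    moreover have "\<bar>a * S \<psi> + b * T \<psi>\<bar> \<le> \<bar>a\<bar> * \<bar>S \<psi>\<bar> + \<bar>b\<bar> * \<bar>T \<psi>\<bar>"
      using abs_triangle_ineq[of "a * S \<psi>" "b * T \<psi>"] by (simp add: abs_mult)
    ultimately show "\<bar>a * S \<psi> + b * T \<psi>\<bar> \<le> (\<bar>a\<bar> * C + \<bar>b\<bar> * D) * M"
      by (simp add: algebra_simps)
  qed
qed

lemma dist_continuous_zero: "dist_continuous (\<lambda>\<psi>. 0)"
  unfolding dist_continuous_def by (intro exI[of _ 0]) simp

lemma dist_continuous_add:
  "dist_continuous S \<Longrightarrow> dist_continuous T \<Longrightarrow> dist_continuous (\<lambda>\<psi>. S \<psi> + T \<psi>)"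
  using dist_continuous_lincomb[of S T 1 1] by simp

lemma dist_continuous_diff:
  "dist_continuous S \<Longrightarrow> dist_continuous T \<Longrightarrow> dist_continuous (\<lambda>\<psi>. S \<psi> - T \<psi>)"
  using dist_continuous_lincomb[of S T 1 "-1"] by simp

lemma dist_continuous_scale: "dist_continuous T \<Longrightarrow> dist_continuous (\<lambda>\<psi>. r * T \<psi>)"
  using dist_continuous_lincomb[OF _ dist_continuous_zero, of T r 0] by simp

lemma dist_continuous_minus: "dist_continuous T \<Longrightarrow> dist_continuous (\<lambda>\<psi>. - T \<psi>)"
  using dist_continuous_scale[of T "-1"] by simp

typedef distribution = "{T. linear T \<and> dist_continuous T}"
  morphisms dist_apply Distribution
  using dist_continuous_zero by (intro exI[of _ "\<lambda>\<psi>. 0"]) (simp add: linear_iff)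

setup_lifting type_definition_distribution

instantiation distribution :: real_vector
begin

lift_definition zero_distribution :: distribution is "\<lambda>\<psi>. 0"
  by (simp add: dist_continuous_zero linear_iff)
lift_definition plus_distribution :: "distribution \<Rightarrow> distribution \<Rightarrow> distribution"
  is "\<lambda>S T \<psi>. S \<psi> + T \<psi>"
  by (simp add: dist_continuous_add linear_iff algebra_simps)
lift_definition minus_distribution :: "distribution \<Rightarrow> distribution \<Rightarrow> distribution"
  is "\<lambda>S T \<psi>. S \<psi> - T \<psi>"
  by (simp add: dist_continuous_diff linear_iff algebra_simps)
lift_definition uminus_distribution :: "distribution \<Rightarrow> distribution" is "\<lambda>T \<psi>. - T \<psi>"
  by (simp add: dist_continuous_minus linear_iff)
lift_definition scaleR_distribution :: "real \<Rightarrow> distribution \<Rightarrow> distribution" is "\<lambda>r T \<psi>. r * T \<psi>"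
  by (simp add: dist_continuous_scale linear_iff algebra_simps)

instance
  by standard (transfer, simp add: algebra_simps)+

end

lift_definition dist_deriv :: "distribution \<Rightarrow> distribution" is "\<lambda>T \<psi>. - T (test_deriv \<psi>)"
proof -
  fix T assume T: "linear T \<and> dist_continuous T"
  have d: "test_deriv (\<psi> + \<rho>) = test_deriv \<psi> + test_deriv \<rho>" for \<psi> \<rho>
    by transfer (auto simp: smooth_deriv_add)
  have s: "test_deriv (r *\<^sub>R \<psi>) = r *\<^sub>R test_deriv \<psi>" for r \<psi>
    by transfer (auto simp: smooth_deriv_scale)
  obtain C k where C: "C \<ge> 0"
    "\<And>\<psi> M. (\<And>j x. j \<le> k \<Longrightarrow> \<bar>(deriv ^^ j) (test_apply \<psi>) x\<bar> \<le> M) \<Longrightarrow> \<bar>T \<psi>\<bar> \<le> C * M"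
    using dist_continuousE T by blast
  have "dist_continuous (\<lambda>\<psi>. - T (test_deriv \<psi>))"
    unfolding dist_continuous_def
  proof (intro exI allI impI)
    fix \<psi> M assume M: "\<forall>j\<le>Suc k. \<forall>x. \<bar>(deriv ^^ j) (test_apply \<psi>) x\<bar> \<le> M"
    have "(deriv ^^ j) (test_apply (test_deriv \<psi>)) = (deriv ^^ Suc j) (test_apply \<psi>)" for j
      by (simp add: test_deriv.rep_eq funpow_swap1)
    then show "\<bar>- T (test_deriv \<psi>)\<bar> \<le> C * M"
      unfolding abs_minus_cancel using M by (intro C(2)) auto
  qed
  then show "linear (\<lambda>\<psi>. - T (test_deriv \<psi>)) \<and> dist_continuous (\<lambda>\<psi>. - T (test_deriv \<psi>))"
    using T by (auto simp: linear_iff d s)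
qed

lemma test_fun_integrable_mult:
  assumes "set_integrable lebesgue {0..2 * pi} f"
  shows "set_integrable lebesgue {0..2 * pi} (\<lambda>x. f x * test_apply \<psi> x)"
proof -
  have "smooth (test_apply \<psi>)" using test_apply by blast
  then have c: "continuous_on {0..2 * pi} (test_apply \<psi>)"
    using smooth_has_deriv[of "test_apply \<psi>" 0]
    by (auto intro!: continuous_at_imp_continuous_on intro: DERIV_isCont)
  have "set_integrable lebesgue {0..2 * pi} (\<lambda>x. test_apply \<psi> x * f x)"
    by (rule absolutely_integrable_bounded_measurable_product_real)
       (use c assms in \<open>auto intro!: compact_imp_bounded compact_continuous_image
          continuous_imp_measurable_on_sets_lebesgue\<close>)
  then show ?thesis by (simp add: mult.commute)
qed

text \<open>The regular distribution of a function that is integrable on the torus; for other functions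
  it is the junk value 0.\<close>

lift_definition distr_of :: "(real \<Rightarrow> real) \<Rightarrow> distribution"
  is "\<lambda>f \<psi>. if set_integrable lebesgue {0..2 * pi} f
        then LINT x:{0..2 * pi}|lebesgue. f x * test_apply \<psi> x else 0"
proof -
  fix f :: "real \<Rightarrow> real"
  let ?T = "\<lambda>\<psi>. LINT x:{0..2 * pi}|lebesgue. f x * test_apply \<psi> x"
  have "linear ?T \<and> dist_continuous ?T" if f: "set_integrable lebesgue {0..2 * pi} f"
  proof
    note i = test_fun_integrable_mult[OF f]
    show "linear ?T"
      by (simp add: linear_iff plus_test_fun.rep_eq scaleR_test_fun.rep_eq distrib_left
          set_integral_add i mult.left_commute)
    have "\<bar>?T \<psi>\<bar> \<le> (LINT x:{0..2 * pi}|lebesgue. \<bar>f x\<bar>) * M"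
      if M: "\<forall>j\<le>0. \<forall>x. \<bar>(deriv ^^ j) (test_apply \<psi>) x\<bar> \<le> M" for \<psi> M
    proof -
      have "\<bar>?T \<psi>\<bar> \<le> (LINT x:{0..2 * pi}|lebesgue. \<bar>f x * test_apply \<psi> x\<bar>)"
        using set_integral_norm_bound[OF i[of \<psi>]] by simp
      also have "\<dots> \<le> (LINT x:{0..2 * pi}|lebesgue. \<bar>f x\<bar> * M)"
        using M f by (intro set_integral_mono set_integrable_abs i)
          (auto simp: abs_mult intro!: mult_left_mono set_integrable_mult_left set_integrable_abs)
      finally show ?thesis by simp
    qed
    then show "dist_continuous ?T" unfolding dist_continuous_def by blast
  qed
  then show "linear (\<lambda>\<psi>. if set_integrable lebesgue {0..2 * pi} f then ?T \<psi> else 0) \<and>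
      dist_continuous (\<lambda>\<psi>. if set_integrable lebesgue {0..2 * pi} f then ?T \<psi> else 0)"
    by (cases "set_integrable lebesgue {0..2 * pi} f")
       (auto simp: dist_continuous_zero linear_iff)
qed

text \<open>Convergence of a series in the sense of distributions.\<close>

definition dist_sums :: "(nat \<Rightarrow> distribution) \<Rightarrow> distribution \<Rightarrow> bool" where
  "dist_sums u S \<longleftrightarrow> (\<forall>\<psi>. (\<lambda>n. dist_apply (u n) \<psi>) sums dist_apply S \<psi>)"


section \<open>Lebesgue and Sobolev spaces on the torus\<close>

text \<open>\<open>L\<^sup>2(\<T>)\<close> consists of functions; equality in it is equality almost everywhere.\<close>

definition L2 :: "(real \<Rightarrow> real) set" where
  "L2 = {f. f \<in> borel_measurable lebesgue \<and> (\<forall>x. f (x + 2 * pi) = f x) \<and>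
            set_integrable lebesgue {0..2 * pi} (\<lambda>x. (f x)\<^sup>2)}"

definition L2_norm :: "(real \<Rightarrow> real) \<Rightarrow> real" where
  "L2_norm f = sqrt (LINT x:{0..2 * pi}|lebesgue. (f x)\<^sup>2)"

text \<open>\<open>\<langle>u, exp (- i n x)\<rangle> / (2 \<pi>)\<close>\<close>

definition fourier_coeff :: "distribution \<Rightarrow> int \<Rightarrow> complex" where
  "fourier_coeff u n =
     Complex (dist_apply u (cos_test n)) (- dist_apply u (sin_test n)) / (2 * of_real pi)"

definition sobolev :: "real \<Rightarrow> distribution set" where
  "sobolev s = {u. (\<lambda>n::int. (1 + (real_of_int n)\<^sup>2) powr s * (cmod (fourier_coeff u n))\<^sup>2)
                     summable_on UNIV}"

definition sobolev_norm :: "real \<Rightarrow> distribution \<Rightarrow> real" where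
  "sobolev_norm s u =
     sqrt (\<Sum>\<^sub>\<infinity>n::int. (1 + (real_of_int n)\<^sup>2) powr s * (cmod (fourier_coeff u n))\<^sup>2)"

text \<open>Linear functionals bounded on \<open>H\<^bsup>s+\<^esup>\<close>, the union of all \<open>H\<^bsup>s+\<epsilon>\<^esup>\<close> with \<open>\<epsilon> > 0\<close>; their values
  outside that union are irrelevant.\<close>

definition bounded_functional_plus :: "real \<Rightarrow> (distribution \<Rightarrow> real) \<Rightarrow> bool" where
  "bounded_functional_plus s K \<longleftrightarrow> (\<forall>\<epsilon>>0.
     (\<forall>u\<in>sobolev (s + \<epsilon>). \<forall>v\<in>sobolev (s + \<epsilon>). K (u + v) = K u + K v) \<and>
     (\<forall>u\<in>sobolev (s + \<epsilon>). \<forall>r. K (r *\<^sub>R u) = r * K u) \<and>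
     (\<exists>C. \<forall>u\<in>sobolev (s + \<epsilon>). \<bar>K u\<bar> \<le> C * sobolev_norm (s + \<epsilon>) u))"


section \<open>Sobolev-valued functions of time\<close>

text \<open>Bochner measurability on \<open>(0, \<infinity>)\<close>: almost everywhere limit of simple functions.\<close>

definition sobolev_measurable :: "real \<Rightarrow> (real \<Rightarrow> distribution) \<Rightarrow> bool" where
  "sobolev_measurable s u \<longleftrightarrow> (\<exists>f :: nat \<Rightarrow> real \<Rightarrow> distribution.
     (\<forall>n. simple_function (lebesgue_on {0<..}) (f n) \<and> (\<forall>t>0. f n t \<in> sobolev s)) \<and>
     (AE t in lebesgue_on {0<..}. u t \<in> sobolev s \<and> (\<lambda>n. sobolev_norm s (f n t - u t)) \<longlonglongrightarrow> 0))"

text \<open>\<open>L\<^sup>2\<^bsub>loc\<^esub>((0, \<infinity>); H\<^sup>s)\<close>: square integrability on the compact subintervals of the open half-line.\<close>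

definition L2_loc :: "real \<Rightarrow> (real \<Rightarrow> distribution) \<Rightarrow> bool" where
  "L2_loc s u \<longleftrightarrow> sobolev_measurable s u \<and>
     (\<forall>a b. 0 < a \<longrightarrow> a < b \<longrightarrow> set_integrable lebesgue {a..b} (\<lambda>t. (sobolev_norm s (u t))\<^sup>2))"

definition time_test :: "(real \<Rightarrow> real) \<Rightarrow> bool" where
  "time_test \<theta> \<longleftrightarrow> smooth \<theta> \<and> (\<exists>a b. 0 < a \<and> a < b \<and> (\<forall>t. t \<notin> {a..b} \<longrightarrow> \<theta> t = 0))"

text \<open>\<open>v\<close> is the weak time derivative of \<open>u\<close> on \<open>(0, \<infinity>)\<close>: \<open>\<integral> \<theta>' u = - \<integral> \<theta> v\<close> for all test
  functions \<open>\<theta>\<close>, an identity between distributions on the torus.\<close>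

definition weak_time_deriv :: "(real \<Rightarrow> distribution) \<Rightarrow> (real \<Rightarrow> distribution) \<Rightarrow> bool" where
  "weak_time_deriv u v \<longleftrightarrow> (\<forall>\<theta> \<psi>. time_test \<theta> \<longrightarrow>
     (LINT t:{0<..}|lebesgue. deriv \<theta> t * dist_apply (u t) \<psi>)
       = - (LINT t:{0<..}|lebesgue. \<theta> t * dist_apply (v t) \<psi>))"

definition C0_L2 :: "(real \<Rightarrow> real \<Rightarrow> real) \<Rightarrow> bool" where
  "C0_L2 y \<longleftrightarrow> (\<forall>t\<ge>0. y t \<in> L2) \<and>
     (\<forall>t\<ge>0. ((\<lambda>s. L2_norm (\<lambda>x. y s x - y t x)) \<longlongrightarrow> 0) (at t within {0..}))"


section \<open>The closed-loop Burgers equation\<close>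

text \<open>The first three conditions together with the existence of \<open>v\<close> say that \<open>y\<close> lies in
  \<open>C\<^sup>0([0, \<infinity>); L\<^sup>2) \<inter> L\<^sup>2\<^bsub>loc\<^esub>((0, \<infinity>); H\<^sup>1) \<inter> H\<^sup>1\<^bsub>loc\<^esub>((0, \<infinity>); H\<^bsup>-1\<^esup>)\<close>, where \<open>v\<close> is the time
  derivative of \<open>y\<close>.\<close>

definition burgers_solution ::
  "distribution \<Rightarrow> distribution \<Rightarrow> (distribution \<Rightarrow> real) \<Rightarrow> (distribution \<Rightarrow> real) \<Rightarrow>
   (real \<Rightarrow> real) \<Rightarrow> (real \<Rightarrow> real \<Rightarrow> real) \<Rightarrow> bool" where
  "burgers_solution \<phi>1 \<phi>2 K1 K2 y0 y \<longleftrightarrow>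
     C0_L2 y \<and>
     L2_loc 1 (\<lambda>t. distr_of (y t)) \<and>
     L2_loc (-1) (\<lambda>t. distr_of (y t)) \<and>
     (\<exists>v. L2_loc (-1) v \<and> weak_time_deriv (\<lambda>t. distr_of (y t)) v \<and>
        (AE t in lebesgue_on {0<..}.
           v t - dist_deriv (dist_deriv (distr_of (y t))) + dist_deriv (distr_of (\<lambda>x. (y t x)\<^sup>2 / 2))
             = K1 (distr_of (y t)) *\<^sub>R \<phi>1 + K2 (distr_of (y t)) *\<^sub>R \<phi>2)) \<and>
     (AE x in lebesgue. y 0 x = y0 x)"

end

theory Submission
  imports Defs
begin

text \<open>The Fourier coefficients of a solution form a curve in the space \<open>ell2\<close> of square-summable
  Hermitian sequences obeying \<open>c\<^sub>n' = - n\<^sup>2 c\<^sub>n - (i n / 2) (c * c)\<^sub>n + k\<^sub>1 p\<^sub>n + k\<^sub>2 q\<^sub>n\<close>, with \<open>p\<close> and \<open>q\<close>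
  the coefficients of \<open>\<phi>1\<close> and \<open>\<phi>2\<close>: testing the weak equation with \<open>cos (n x)\<close> and \<open>sin (n x)\<close> gives one
  direction by the du Bois-Reymond lemma, parabolic smoothing gives the other. In sequence space, solutions of
  the equation with truncated nonlinearity exist by Picard iteration in a norm with exponential
  weight in time, which is contractive since \<open>n / (n\<^sup>2 + \<omega>)\<close> is small in \<open>\<ell>\<^sup>2\<close> for large \<open>\<omega>\<close>; the quadratic term does no work,
  so the energy bound makes them global and the truncation inactive.

  The feedback sees only the modes \<open>n \<le> N\<close>. The sine and cosine modes are decoupled, simple and each
  controlled by one input, so explicit gains coming from a Cauchy matrix give the low linear modes a quadratic
  Lyapunov function decaying at any prescribed rate. Add to a large multiple of it the energy of the high
  modes. These are damped at rate at least \<open>(N + 1)\<^sup>2\<close>, and the Lyapunov identity leaves a term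
  \<open>- (k\<^sub>1\<^sup>2 + k\<^sub>2\<^sup>2)\<close> that pays for the action of the inputs on them. Because the cubic terms cancel over all
  modes, only their low-mode part enters, which is bounded by a constant times \<open>\<parallel>c\<parallel>\<^sup>3\<close> and is absorbed for
  small data.\<close>

section \<open>Square-summable Hermitian sequences\<close>

text \<open>The obstacle is the roughness of the inputs: their coefficients are bounded but not
  square summable, so the source never lies in the state space. Estimates are therefore made one
  mode at a time, and the gain \<open>1 / (n\<^sup>2 + om)\<close> of the heat kernel restores
  square summability only afterwards. The same roughness shapes the stabilization: an input that
  moves the low modes excites all high modes with comparable strength. With D = diag(mu - i^2),
  input vector b and gain w, a matrix P with D P + P D = w w^T and P b = w satisfies P (D - b w^T) =
  - D P. The feedback thus reflects the shifted spectrum, and the quadratic form of P decays at rate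
  2 mu with a surplus of exactly u^2. It is this surplus, and not smallness of the gains, that
  dominates the spillover. P is a Cauchy matrix up to scaling, so it is positive definite and the
  gains are explicit. Reading finitely many modes keeps the feedback bounded on L2, so in the
  well-posedness argument it is a mere Lipschitz perturbation. Continuity in time makes the rate of
  each mode continuous, so that a weak solution has classically differentiable coefficients.\<close>

definition jb :: "int \<Rightarrow> real" where "jb n = 1 + \<bar>real_of_int n\<bar>"

lemma jb_ge1: "1 \<le> jb n" by (simp add: jb_def)

lemma jb_pos: "0 < jb n" by (simp add: jb_def add_pos_nonneg)

lemma jb_minus [simp]: "jb (- n) = jb n" by (simp add: jb_def)

text \<open>Peetre-type inequality: in a convolution sum, negative powers of
  \<open>jb k * jb (n - k)\<close> are dominated by the same powers of \<open>jb n\<close>.\<close>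

lemma jb_mult: "jb n \<le> jb k * jb (n - k)"
proof -
  have "\<bar>real_of_int n\<bar> \<le> \<bar>real_of_int k\<bar> + \<bar>real_of_int (n - k)\<bar>" by simp
  then have "jb n \<le> 1 + \<bar>real_of_int k\<bar> + \<bar>real_of_int (n - k)\<bar>" by (simp add: jb_def)
  also have "\<dots> \<le> jb k * jb (n - k)" by (simp add: jb_def algebra_simps)
  finally show ?thesis .
qed

lemma jb_sq: "(jb n)\<^sup>2 \<le> 2 * (1 + (real_of_int n)\<^sup>2)"
  using sum_squares_bound[of 1 "\<bar>real_of_int n\<bar>"] by (simp add: jb_def power2_sum)

lemma jb_sq_ge: "1 + (real_of_int n)\<^sup>2 \<le> (jb n)\<^sup>2"
  by (simp add: jb_def power2_sum)

text \<open>The exponent 3/2 sits between 1 and 2: it is summable, and against the decay of order 2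
  of \<open>(jb n / (n\<^sup>2 + om))\<^sup>2\<close> it leaves half a power from which smallness
  for large \<open>om\<close> is drawn.\<close>

lemma summable_jb: "(\<lambda>n. jb n powr (- 3 / 2)) summable_on UNIV"
proof -
  have "summable (\<lambda>n. real (Suc n) powr (- 3 / 2))"
    using summable_Suc_iff[of "\<lambda>n. real n powr (- 3 / 2)"] by (simp add: summable_real_powr_iff)
  then have "(\<lambda>n. real (Suc n) powr (- 3 / 2)) summable_on UNIV"
    by (subst summable_on_UNIV_nonneg_real_iff) auto
  then have s: "(\<lambda>n. jb (int n) powr (- 3 / 2)) summable_on UNIV"
    by (simp add: jb_def add.commute)
  have "(\<lambda>n. jb n powr (- 3 / 2)) summable_on (range int)"
    using s by (subst summable_on_reindex) (auto simp: o_def)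
  moreover have "(\<lambda>n. jb n powr (- 3 / 2)) summable_on (range (\<lambda>n. - int n))"
    using s by (subst summable_on_reindex) (auto simp: o_def inj_def)
  moreover have "range int \<union> range (\<lambda>n. - int n) = UNIV"
  proof -
    have "n \<in> range int \<union> range (\<lambda>n. - int n)" for n :: int
    proof (cases "n \<ge> 0")
      case True then have "n = int (nat n)" by simp
      then show ?thesis by blast
    next
      case False then have "n = - int (nat (- n))" by simp
      then show ?thesis by blast
    qed
    then show ?thesis by auto
  qed
  ultimately show ?thesis by (metis summable_on_union)
qed

definition JS :: real where "JS = (\<Sum>\<^sub>\<infinity>n. jb n powr (- 3 / 2))"

lemma JS_ge1: "1 \<le> JS"
  using finite_sum_le_infsum[OF summable_jb, of "{0}"] by (simp add: JS_def jb_def)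

lemma jb_powr_le: "p \<le> q \<Longrightarrow> jb n powr p \<le> jb n powr q"
  using jb_ge1 by (simp add: powr_mono)

lemma jb_powr_summable: "p \<le> - 3 / 2 \<Longrightarrow> (\<lambda>n. jb n powr p) summable_on UNIV"
  by (rule summable_on_comparison_test[OF summable_jb]) (auto intro: jb_powr_le)

lemma jb_powr_sum_le: "p \<le> - 3 / 2 \<Longrightarrow> (\<Sum>\<^sub>\<infinity>n. jb n powr p) \<le> JS"
  unfolding JS_def by (intro infsum_mono summable_jb jb_powr_summable) (auto intro: jb_powr_le)

lemma summable_on_mult_squares:
  fixes f g :: "'a \<Rightarrow> real"
  assumes "(\<lambda>x. (f x)\<^sup>2) summable_on A" "(\<lambda>x. (g x)\<^sup>2) summable_on A"
  shows "(\<lambda>x. \<bar>f x * g x\<bar>) summable_on A"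
proof (rule summable_on_comparison_test)
  show "(\<lambda>x. (f x)\<^sup>2 + (g x)\<^sup>2) summable_on A" using assms by (rule summable_on_add)
  show "\<bar>f x * g x\<bar> \<le> (f x)\<^sup>2 + (g x)\<^sup>2" for x
    using sum_squares_bound[of "\<bar>f x\<bar>" "\<bar>g x\<bar>"] abs_ge_zero[of "f x * g x"]
    unfolding abs_mult power2_abs by linarith
qed simp

lemma infsum_Cauchy_Schwarz:
  fixes f g :: "'a \<Rightarrow> real"
  assumes "(\<lambda>x. (f x)\<^sup>2) summable_on A" "(\<lambda>x. (g x)\<^sup>2) summable_on A"
  shows "(\<Sum>\<^sub>\<infinity>x\<in>A. \<bar>f x * g x\<bar>) \<le> sqrt (\<Sum>\<^sub>\<infinity>x\<in>A. (f x)\<^sup>2) * sqrt (\<Sum>\<^sub>\<infinity>x\<in>A. (g x)\<^sup>2)"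
proof (rule infsum_le_finite_sums[OF summable_on_mult_squares[OF assms]])
  fix F assume F: "finite F" "F \<subseteq> A"
  have "(\<Sum>x\<in>F. \<bar>f x * g x\<bar>) \<le> L2_set f F * L2_set g F"
    using L2_set_mult_ineq[of f g F] by (simp add: abs_mult)
  also have "\<dots> \<le> sqrt (\<Sum>\<^sub>\<infinity>x\<in>A. (f x)\<^sup>2) * sqrt (\<Sum>\<^sub>\<infinity>x\<in>A. (g x)\<^sup>2)"
    unfolding L2_set_def using F assms
    by (intro mult_mono real_sqrt_le_mono finite_sum_le_infsum) (auto intro!: sum_nonneg infsum_nonneg)
  finally show "(\<Sum>x\<in>F. \<bar>f x * g x\<bar>) \<le> sqrt (\<Sum>\<^sub>\<infinity>x\<in>A. (f x)\<^sup>2) * sqrt (\<Sum>\<^sub>\<infinity>x\<in>A. (g x)\<^sup>2)" .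
qed

text \<open>The symmetry characterizes coefficients of real functions. It makes the type a real
  vector space although the entries are complex, so that reality never has to be tracked
  separately.\<close>

typedef ell2 = "{c :: int \<Rightarrow> complex. (\<lambda>n. (cmod (c n))\<^sup>2) summable_on UNIV \<and> (\<forall>n. c (- n) = cnj (c n))}"
  morphisms cf Abs_ell2
  by (rule exI[of _ "\<lambda>_. 0"]) simp

setup_lifting type_definition_ell2

lemma cf_summable: "(\<lambda>n. (cmod (cf c n))\<^sup>2) summable_on UNIV"
  using cf[of c] by auto

lemma cf_minus: "cf c (- n) = cnj (cf c n)"
  using cf[of c] by auto

lemma ell2_eqI: "(\<And>n. cf c n = cf d n) \<Longrightarrow> c = d"
  by (simp add: cf_inject[symmetric] fun_eq_iff)

lemma cmod_add_sq: "(cmod (a + b))\<^sup>2 \<le> 2 * (cmod a)\<^sup>2 + 2 * (cmod b)\<^sup>2"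
proof -
  have "(cmod (a + b))\<^sup>2 \<le> (cmod a + cmod b)\<^sup>2" by (simp add: norm_triangle_ineq power_mono)
  also have "\<dots> \<le> 2 * (cmod a)\<^sup>2 + 2 * (cmod b)\<^sup>2"
    using sum_squares_bound[of "cmod a" "cmod b"] by (simp add: power2_sum)
  finally show ?thesis .
qed

lemma sq_summable_add:
  fixes c d :: "'a \<Rightarrow> complex"
  assumes "(\<lambda>n. (cmod (c n))\<^sup>2) summable_on A" "(\<lambda>n. (cmod (d n))\<^sup>2) summable_on A"
  shows "(\<lambda>n. (cmod (c n + d n))\<^sup>2) summable_on A"
proof (rule summable_on_comparison_test)
  show "(\<lambda>n. 2 * (cmod (c n))\<^sup>2 + 2 * (cmod (d n))\<^sup>2) summable_on A"
    by (intro summable_on_add summable_on_cmult_right assms)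
  show "(cmod (c n + d n))\<^sup>2 \<le> 2 * (cmod (c n))\<^sup>2 + 2 * (cmod (d n))\<^sup>2" for n by (rule cmod_add_sq)
qed simp

lemma sq_summable_cmult:
  fixes c :: "'a \<Rightarrow> complex"
  shows "(\<lambda>n. (cmod (c n))\<^sup>2) summable_on A \<Longrightarrow> (\<lambda>n. (cmod (a * c n))\<^sup>2) summable_on A"
  unfolding norm_mult power_mult_distrib by (rule summable_on_cmult_right)

section \<open>Linear and Hilbert space structure of \<open>ell2\<close>\<close>

instantiation ell2 :: real_vector
begin

lift_definition zero_ell2 :: ell2 is "\<lambda>n. 0" by simp
lift_definition plus_ell2 :: "ell2 \<Rightarrow> ell2 \<Rightarrow> ell2" is "\<lambda>c d n. c n + d n"
  by (simp add: sq_summable_add)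
lift_definition uminus_ell2 :: "ell2 \<Rightarrow> ell2" is "\<lambda>c n. - c n" by simp
lift_definition minus_ell2 :: "ell2 \<Rightarrow> ell2 \<Rightarrow> ell2" is "\<lambda>c d n. c n - d n"
proof -
  fix c d :: "int \<Rightarrow> complex"
  assume c: "(\<lambda>n. (cmod (c n))\<^sup>2) summable_on UNIV \<and> (\<forall>n. c (- n) = cnj (c n))"
    and d: "(\<lambda>n. (cmod (d n))\<^sup>2) summable_on UNIV \<and> (\<forall>n. d (- n) = cnj (d n))"
  then show "(\<lambda>n. (cmod (c n - d n))\<^sup>2) summable_on UNIV \<and> (\<forall>n. c (- n) - d (- n) = cnj (c n - d n))"
    using sq_summable_add[of c UNIV "\<lambda>n. - d n"] by simp
qed
lift_definition scaleR_ell2 :: "real \<Rightarrow> ell2 \<Rightarrow> ell2" is "\<lambda>r c n. of_real r * c n"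
  by (metis (mono_tags) sq_summable_cmult complex_cnj_mult complex_cnj_complex_of_real)

instance by standard (transfer, auto simp: algebra_simps)+

end

lemma cf_0 [simp]: "cf 0 n = 0" by transfer simp
lemma cf_add [simp]: "cf (c + d) n = cf c n + cf d n" by transfer simp
lemma cf_diff [simp]: "cf (c - d) n = cf c n - cf d n" by transfer simp
lemma cf_scaleR [simp]: "cf (r *\<^sub>R c) n = of_real r * cf c n" by transfer simp

lemma cf_inner_summable: "(\<lambda>n. \<bar>cmod (cf c n) * cmod (cf d n)\<bar>) summable_on UNIV"
  by (rule summable_on_mult_squares) (rule cf_summable)+

lemma cf_cnj_summable: "(\<lambda>n. cf c n * cnj (cf d n)) summable_on UNIV"
  by (rule abs_summable_summable) (use cf_inner_summable in \<open>simp add: norm_mult\<close>)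

lemma cf_Re_summable: "(\<lambda>n. Re (cf c n * cnj (cf d n))) summable_on UNIV"
  by (rule summable_on_Re[OF cf_cnj_summable])

instantiation ell2 :: real_inner
begin

text \<open>The complex sum is already real by Hermitian symmetry; \<open>Re\<close> produces the
  real type.\<close>

definition inner_ell2 :: "ell2 \<Rightarrow> ell2 \<Rightarrow> real" where
  "inner_ell2 c d = (\<Sum>\<^sub>\<infinity>n. Re (cf c n * cnj (cf d n)))"
definition norm_ell2 :: "ell2 \<Rightarrow> real" where "norm_ell2 c = sqrt (c \<bullet> c)"
definition dist_ell2 :: "ell2 \<Rightarrow> ell2 \<Rightarrow> real" where "dist_ell2 c d = norm (c - d)"
definition sgn_ell2 :: "ell2 \<Rightarrow> ell2" where "sgn_ell2 c = inverse (norm c) *\<^sub>R c"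
definition uniformity_ell2 :: "(ell2 \<times> ell2) filter" where
  "uniformity_ell2 = (INF e\<in>{0 <..}. principal {(x, y). dist x y < e})"
definition open_ell2 :: "ell2 set \<Rightarrow> bool" where
  "open_ell2 U = (\<forall>x\<in>U. \<forall>\<^sub>F (x', y) in uniformity. x' = x \<longrightarrow> y \<in> U)"

instance
proof
  fix c d e :: ell2 and r :: real and U :: "ell2 set"
  show "dist c d = norm (c - d)" by (rule dist_ell2_def)
  show "sgn c = inverse (norm c) *\<^sub>R c" by (rule sgn_ell2_def)
  show "uniformity = (INF e\<in>{0 <..}. principal {(x :: ell2, y). dist x y < e})"
    by (rule uniformity_ell2_def)
  show "open U = (\<forall>x\<in>U. \<forall>\<^sub>F (x', y) in uniformity. x' = x \<longrightarrow> y \<in> U)" by (rule open_ell2_def)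
  show "c \<bullet> d = d \<bullet> c" unfolding inner_ell2_def by (simp add: algebra_simps)
  have "(\<lambda>n. Re (cf (c + d) n * cnj (cf e n))) = (\<lambda>n. Re (cf c n * cnj (cf e n)) + Re (cf d n * cnj (cf e n)))"
    by (auto simp: algebra_simps)
  then show "(c + d) \<bullet> e = c \<bullet> e + d \<bullet> e" unfolding inner_ell2_def
    by (simp only: infsum_add[OF cf_Re_summable cf_Re_summable])
  have "(\<lambda>n. Re (cf (r *\<^sub>R c) n * cnj (cf d n))) = (\<lambda>n. r * Re (cf c n * cnj (cf d n)))"
    by (auto simp: algebra_simps)
  then show "(r *\<^sub>R c) \<bullet> d = r * (c \<bullet> d)" unfolding inner_ell2_def
    by (simp only: infsum_cmult_right')
  have nn: "0 \<le> Re (cf c n * cnj (cf c n))" for n by simp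
  show "0 \<le> c \<bullet> c" unfolding inner_ell2_def by (rule infsum_nonneg) (rule nn)
  show "(c \<bullet> c = 0) = (c = 0)"
  proof
    assume "c \<bullet> c = 0"
    then have "Re (cf c n * cnj (cf c n)) = 0" for n
      using nonneg_infsum_le_0D[OF _ cf_Re_summable[of c c], of n] nn by (simp add: inner_ell2_def)
    then have "cf c n = 0" for n
      by (simp add: complex_eq_iff sum_squares_eq_zero_iff)
    then show "c = 0" by (intro ell2_eqI) simp
  qed (simp add: inner_ell2_def)
  show "norm c = sqrt (c \<bullet> c)" by (rule norm_ell2_def)
qed

end

lemma norm_ell2_sq: "(norm c)\<^sup>2 = (\<Sum>\<^sub>\<infinity>n. (cmod (cf c n))\<^sup>2)"
proof -
  have "(norm c)\<^sup>2 = c \<bullet> c" by (simp add: power2_norm_eq_inner)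
  also have "\<dots> = (\<Sum>\<^sub>\<infinity>n. (cmod (cf c n))\<^sup>2)" unfolding inner_ell2_def cmod_power2
    by (intro infsum_cong) (simp add: power2_eq_square)
  finally show ?thesis .
qed

lemma norm_ell2_eq: "norm c = sqrt (\<Sum>\<^sub>\<infinity>n. (cmod (cf c n))\<^sup>2)"
  by (metis norm_ell2_sq norm_ge_zero real_sqrt_unique)

lemma sum_cf_le_norm: "finite F \<Longrightarrow> (\<Sum>n\<in>F. (cmod (cf c n))\<^sup>2) \<le> (norm c)\<^sup>2"
  unfolding norm_ell2_sq by (rule finite_sum_le_infsum[OF cf_summable]) auto

lemma cf_le_norm: "cmod (cf c n) \<le> norm c"
  using sum_cf_le_norm[of "{n}" c] by (simp add: abs_le_square_iff[symmetric])

lemma norm_ell2_leI: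
  assumes "\<And>n. (cmod (cf c n))\<^sup>2 \<le> g n" "(g has_sum s) UNIV" "s \<le> b\<^sup>2" "0 \<le> b"
  shows "norm c \<le> b"
proof -
  have "(norm c)\<^sup>2 \<le> infsum g UNIV"
    unfolding norm_ell2_sq using assms(1,2)
    by (intro infsum_mono cf_summable) (auto intro: has_sum_imp_summable)
  also have "\<dots> \<le> b\<^sup>2" using assms(2,3) by (simp add: infsumI)
  finally show ?thesis using assms(4) by (rule power2_le_imp_le)
qed

lemma bounded_linear_cf: "bounded_linear (\<lambda>c. cf c n)"
  by (rule bounded_linear_intro[where K=1]) (auto simp: cf_le_norm scaleR_conv_of_real)

lemmas continuous_on_cf = bounded_linear.continuous_on[OF bounded_linear_cf]

text \<open>Fatou argument: the coefficients converge one by one, and a bound on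
  \<open>norm (d - X m)\<close> passes to the limit in every finite partial sum with a constant
  independent of the finite set.\<close>

instance ell2 :: banach
proof
  fix X :: "nat \<Rightarrow> ell2" assume X: "Cauchy X"
  have "Cauchy (\<lambda>m. cf (X m) n)" for n
    by (rule bounded_linear.Cauchy[OF bounded_linear_cf X])
  then obtain l where l: "\<And>n. (\<lambda>m. cf (X m) n) \<longlonglongrightarrow> l n"
    unfolding Cauchy_convergent_iff convergent_def by metis
  have fat: "(\<Sum>n\<in>F. (cmod (cf d n - l n))\<^sup>2) \<le> e\<^sup>2"
    if "finite F" "\<And>m. m \<ge> N \<Longrightarrow> norm (d - X m) \<le> e" for F N e d
  proof (rule tendsto_le[of sequentially])
    show "(\<lambda>m. \<Sum>n\<in>F. (cmod (cf d n - cf (X m) n))\<^sup>2) \<longlonglongrightarrow> (\<Sum>n\<in>F. (cmod (cf d n - l n))\<^sup>2)"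
      by (intro tendsto_intros l)
    show "\<forall>\<^sub>F m in sequentially. (\<Sum>n\<in>F. (cmod (cf d n - cf (X m) n))\<^sup>2) \<le> e\<^sup>2"
      unfolding eventually_sequentially
    proof (intro exI allI impI)
      fix m assume "N \<le> m"
      then have "(norm (d - X m))\<^sup>2 \<le> e\<^sup>2" using that(2) by (intro power_mono) auto
      then show "(\<Sum>n\<in>F. (cmod (cf d n - cf (X m) n))\<^sup>2) \<le> e\<^sup>2"
        using sum_cf_le_norm[OF that(1), of "d - X m"] by simp
    qed
  qed auto
  have ex: "\<exists>N. \<forall>m\<ge>N. \<forall>k\<ge>N. norm (X k - X m) \<le> e" if "e > 0" for e
    using X that unfolding Cauchy_def dist_norm by (meson less_imp_le)
  obtain N where N: "\<And>m. m \<ge> N \<Longrightarrow> norm (X N - X m) \<le> 1" using ex[of 1] by auto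
  have s1: "(\<lambda>n. (cmod (cf (X N) n - l n))\<^sup>2) summable_on UNIV"
    by (rule nonneg_bdd_above_summable_on) (auto intro!: bdd_aboveI2[where M="1\<^sup>2"] fat[where N=N] N)
  have "(\<lambda>n. (cmod (cf (X N) n + - 1 * (cf (X N) n - l n)))\<^sup>2) summable_on UNIV"
    by (intro sq_summable_add sq_summable_cmult s1 cf_summable)
  then have s: "(\<lambda>n. (cmod (l n))\<^sup>2) summable_on UNIV" by simp
  have sym: "l (- n) = cnj (l n)" for n
    by (rule LIMSEQ_unique[OF l]) (use tendsto_cnj[OF l[of n]] in \<open>simp add: cf_minus\<close>)
  define L where "L = Abs_ell2 l"
  have L: "cf L n = l n" for n using s sym by (simp add: L_def Abs_ell2_inverse)
  have "X \<longlonglongrightarrow> L"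
    unfolding lim_sequentially dist_norm
  proof (intro allI impI)
    fix r :: real assume "0 < r"
    then obtain N where N: "\<And>m k. m \<ge> N \<Longrightarrow> k \<ge> N \<Longrightarrow> norm (X k - X m) \<le> r / 2"
      using ex[of "r / 2"] by auto
    have "norm (X k - L) < r" if "k \<ge> N" for k
    proof -
      have "(norm (X k - L))\<^sup>2 \<le> (r / 2)\<^sup>2" unfolding norm_ell2_sq
        proof (rule infsum_le_finite_sums[OF cf_summable])
          fix F :: "int set" assume F: "finite F"
          show "(\<Sum>n\<in>F. (cmod (cf (X k - L) n))\<^sup>2) \<le> (r / 2)\<^sup>2"
            using fat[OF F, of N "X k" "r / 2"] N[OF _ that] by (simp add: L)
        qed
      then have "norm (X k - L) \<le> r / 2" by (rule power2_le_imp_le) (use \<open>0 < r\<close> in simp)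
      then show ?thesis using \<open>0 < r\<close> by linarith
    qed
    then show "\<exists>N. \<forall>n\<ge>N. norm (X n - L) < r" by blast
  qed
  then show "convergent X" unfolding convergent_def by blast
qed

text \<open>Dominated convergence: a finite set of modes carries all but
  \<open>r\<^sup>2 / 2\<close> of the majorant, and on that set coefficientwise convergence
  suffices.\<close>

lemma ell2_tendstoI:
  assumes "\<And>n. (\<lambda>m. cf (X m) n) \<longlonglongrightarrow> cf L n"
    and "\<And>n m. (cmod (cf (X m) n - cf L n))\<^sup>2 \<le> g n" and "g summable_on UNIV"
  shows "X \<longlonglongrightarrow> L"
  unfolding lim_sequentially dist_norm
proof (intro allI impI)
  fix r :: real assume r: "0 < r"
  have "(sum g \<longlongrightarrow> infsum g UNIV) (finite_subsets_at_top UNIV)" by (rule infsum_tendsto[OF assms(3)])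
  then have "\<forall>\<^sub>F F in finite_subsets_at_top UNIV. dist (sum g F) (infsum g UNIV) < r\<^sup>2 / 2"
    using r by (intro tendstoD) simp_all
  then obtain F where F: "finite F" "dist (sum g F) (infsum g UNIV) < r\<^sup>2 / 2"
    by (auto simp: eventually_finite_subsets_at_top)
  have "(\<lambda>m. \<Sum>n\<in>F. (cmod (cf (X m) n - cf L n))\<^sup>2) \<longlonglongrightarrow> (\<Sum>n\<in>F. (cmod (cf L n - cf L n))\<^sup>2)"
    by (intro tendsto_intros assms(1))
  then have "(\<lambda>m. \<Sum>n\<in>F. (cmod (cf (X m) n - cf L n))\<^sup>2) \<longlonglongrightarrow> 0" by simp
  then have "\<forall>\<^sub>F m in sequentially. (\<Sum>n\<in>F. (cmod (cf (X m) n - cf L n))\<^sup>2) < r\<^sup>2 / 2"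
    using r by (intro order_tendstoD(2)[where y=0]) simp_all
  then obtain N where N: "\<And>m. m \<ge> N \<Longrightarrow> (\<Sum>n\<in>F. (cmod (cf (X m) n - cf L n))\<^sup>2) < r\<^sup>2 / 2"
    by (auto simp: eventually_sequentially)
  have "norm (X m - L) < r" if "m \<ge> N" for m
  proof -
    let ?h = "\<lambda>n. (cmod (cf (X m) n - cf L n))\<^sup>2"
    have sh: "?h summable_on UNIV" using cf_summable[of "X m - L"] by simp
    have "infsum ?h UNIV = infsum ?h F + infsum ?h (- F)"
      by (subst infsum_Un_disjoint[symmetric]) (auto intro: summable_on_subset_banach[OF sh])
    also have "infsum ?h (- F) \<le> infsum g (- F)"
      by (intro infsum_mono assms(2) summable_on_subset_banach[OF sh] summable_on_subset_banach[OF assms(3)]) auto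
    also have "infsum g (- F) = infsum g UNIV - sum g F"
      using infsum_Un_disjoint[of g F "- F"] F(1) summable_on_subset_banach[OF assms(3), of "- F"] by simp
    also have "infsum ?h F < r\<^sup>2 / 2" using N[OF that] F(1) by simp
    also have "infsum g UNIV - sum g F \<le> r\<^sup>2 / 2" 
      using F(2) abs_ge_minus_self[of "sum g F - infsum g UNIV"] unfolding dist_real_def by linarith
    finally have "(norm (X m - L))\<^sup>2 < r\<^sup>2" unfolding norm_ell2_sq by simp
    then show ?thesis by (rule power2_less_imp_less) (use r in simp)
  qed
  then show "\<exists>N. \<forall>n\<ge>N. norm (X n - L) < r" by blast
qed

text \<open>Continuity into \<open>ell2\<close> is obtained from the modes and a majorant
  independent of time. The Picard iterates and the weighted coefficient curves of Sobolev-valued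
  functions are treated this way.\<close>

lemma ell2_continuous_onI:
  fixes u :: "'a::metric_space \<Rightarrow> ell2"
  assumes "\<And>n. continuous_on S (\<lambda>t. cf (u t) n)"
    and "\<And>n t. t \<in> S \<Longrightarrow> (cmod (cf (u t) n))\<^sup>2 \<le> g n" and "g summable_on UNIV"
  shows "continuous_on S u"
  unfolding continuous_on_sequentially
proof (intro allI ballI impI)
  fix x a assume a: "a \<in> S" and x: "(\<forall>n. x n \<in> S) \<and> x \<longlonglongrightarrow> a"
  show "(u \<circ> x) \<longlonglongrightarrow> u a"
  proof (rule ell2_tendstoI)
    show "(\<lambda>m. cf ((u \<circ> x) m) n) \<longlonglongrightarrow> cf (u a) n" for n
      using assms(1)[of n] a x unfolding continuous_on_sequentially o_def by blast
    show "(cmod (cf ((u \<circ> x) m) n - cf (u a) n))\<^sup>2 \<le> 4 * g n" for n m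
      using cmod_add_sq[of "cf (u (x m)) n" "- cf (u a) n"] assms(2)[of "x m" n] assms(2)[of a n] a x by simp
    show "(\<lambda>n. 4 * g n) summable_on UNIV" by (intro summable_on_cmult_right assms(3))
  qed
qed

subsection \<open>Convolution\<close>

text \<open>For the coefficients of a real function this gives those of its square. The result is
  bounded but in general not square summable, hence a bare sequence and not an element of
  \<open>ell2\<close>.\<close>

definition conv :: "ell2 \<Rightarrow> ell2 \<Rightarrow> int \<Rightarrow> complex" where
  "conv c d n = (\<Sum>\<^sub>\<infinity>k. cf c k * cf d (n - k))"

lemma bij_betw_diff_int: "bij_betw (\<lambda>k. n - k) UNIV (UNIV :: int set)"
  by (rule bij_betwI[where g="\<lambda>k. n - k"]) auto

lemma sq_summable_shift: "(\<lambda>k. (cmod (cf d (n - k)))\<^sup>2) summable_on UNIV"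
  using summable_on_reindex_bij_betw[OF bij_betw_diff_int, of "\<lambda>k. (cmod (cf d k))\<^sup>2" n] cf_summable by simp

lemma conv_abs_summable: "(\<lambda>k. norm (cf c k * cf d (n - k))) summable_on UNIV"
  using summable_on_mult_squares[OF cf_summable[of c] sq_summable_shift[of d n]] by (simp add: norm_mult)

lemmas conv_summable = abs_summable_summable[OF conv_abs_summable]

text \<open>Young's inequality from l2 times l2 to bounded sequences, by Cauchy-Schwarz and the
  reflection \<open>k \<mapsto> n - k\<close>. After the derivative the quadratic source thus grows
  at most like \<open>\<bar>n\<bar>\<close>.\<close>

lemma conv_bound: "cmod (conv c d n) \<le> norm c * norm d"
proof -
  have "cmod (conv c d n) \<le> (\<Sum>\<^sub>\<infinity>k. \<bar>cmod (cf c k) * cmod (cf d (n - k))\<bar>)"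
    unfolding conv_def using norm_infsum_bound[OF conv_abs_summable] by (simp add: norm_mult)
  also have "\<dots> \<le> sqrt (\<Sum>\<^sub>\<infinity>k. (cmod (cf c k))\<^sup>2) * sqrt (\<Sum>\<^sub>\<infinity>k. (cmod (cf d (n - k)))\<^sup>2)"
    by (rule infsum_Cauchy_Schwarz[OF cf_summable sq_summable_shift])
  also have "(\<Sum>\<^sub>\<infinity>k. (cmod (cf d (n - k)))\<^sup>2) = (\<Sum>\<^sub>\<infinity>k. (cmod (cf d k))\<^sup>2)"
    by (rule infsum_reindex_bij_betw[OF bij_betw_diff_int])
  finally show ?thesis by (simp add: norm_ell2_eq)
qed

lemma conv_diff_left: "conv (c - d) e n = conv c e n - conv d e n"
proof -
  have "conv c e n + - conv d e n = (\<Sum>\<^sub>\<infinity>k. cf c k * cf e (n - k) + - (cf d k * cf e (n - k)))"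
    unfolding conv_def infsum_uminus[symmetric]
    by (rule infsum_add[symmetric, OF conv_summable]) (simp add: conv_summable summable_on_uminus)
  then show ?thesis by (simp add: conv_def algebra_simps)
qed

lemma conv_commute: "conv c d n = conv d c n"
  unfolding conv_def
  using infsum_reindex_bij_betw[OF bij_betw_diff_int[of n], of "\<lambda>k. cf c k * cf d (n - k)"]
  by (simp add: mult.commute)

lemma conv_diff_right: "conv e (c - d) n = conv e c n - conv e d n"
  by (metis conv_commute conv_diff_left)

lemma conv_scaleR: "conv (r *\<^sub>R c) (s *\<^sub>R d) n = of_real (r * s) * conv c d n"
proof -
  have "(\<lambda>k. cf (r *\<^sub>R c) k * cf (s *\<^sub>R d) (n - k)) = (\<lambda>k. of_real (r * s) * (cf c k * cf d (n - k)))"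
    by auto
  then show ?thesis unfolding conv_def by (simp only: infsum_cmult_right')
qed

lemma conv_minus: "conv c d (- n) = cnj (conv c d n)"
proof -
  have "conv c d (- n) = (\<Sum>\<^sub>\<infinity>k. cf c (- k) * cf d (- n - - k))"
    unfolding conv_def
    by (rule infsum_reindex_bij_betw[symmetric, of uminus]) (rule bij_betwI[where g=uminus], auto)
  also have "\<dots> = (\<Sum>\<^sub>\<infinity>k. cnj (cf c k * cf d (n - k)))"
    by (rule infsum_cong) (use cf_minus[of d "n - k" for k] in \<open>simp add: cf_minus\<close>)
  finally show ?thesis unfolding conv_def infsum_cnj .
qed

lemma conv_quad_diff: "cmod (conv c c n - conv d d n) \<le> (norm c + norm d) * norm (c - d)"
proof -
  have "conv c c n - conv d d n = conv (c - d) c n + conv d (c - d) n"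
    by (simp add: conv_diff_left conv_diff_right)
  then have "cmod (conv c c n - conv d d n) \<le> cmod (conv (c - d) c n) + cmod (conv d (c - d) n)"
    by (simp add: norm_triangle_ineq)
  also have "\<dots> \<le> norm (c - d) * norm c + norm d * norm (c - d)"
    by (intro add_mono conv_bound)
  finally show ?thesis by (simp add: algebra_simps)
qed

section \<open>The heat flow with a source\<close>

lemma at_within_initial: "t < b \<Longrightarrow> at t within {0..b} = at t within {0..}" for t :: real
  by (rule at_within_nhd[of _ "{..<b}"]) auto

text \<open>With the integrating factor \<open>exp (a * (t - t0))\<close> only the source remains in
  the derivative, and the mean value inequality compares it with an explicit majorant. The weight
  \<open>om\<close> is the free parameter that makes the gain \<open>1 / (a + om)\<close>
  small.\<close>

lemma Duhamel_bound:
  fixes z h :: "real \<Rightarrow> complex"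
  assumes "t0 \<le> t1" and a: "0 < a + om" and "0 \<le> H"
    and der: "\<And>t. t0 \<le> t \<Longrightarrow> t \<le> t1 \<Longrightarrow>
      (z has_vector_derivative (- of_real a * z t + h t)) (at t within {t0..t1})"
    and bnd: "\<And>t. t0 < t \<Longrightarrow> t < t1 \<Longrightarrow> cmod (h t) \<le> H * exp (om * (t - t0))"
  shows "cmod (z t1) \<le> exp (- a * (t1 - t0)) * cmod (z t0) + H * exp (om * (t1 - t0)) / (a + om)"
proof (cases "t0 = t1")
  case True
  then show ?thesis using assms by simp
next
  case False
  define f where "f t = exp (a * (t - t0)) *\<^sub>R z t" for t
  \<comment> \<open>An antiderivative of \<open>H * exp ((a + om) * (t - t0))\<close>, the bound on
    the derivative of \<open>f\<close>.\<close>
  define \<phi> where "\<phi> t = H * exp ((a + om) * (t - t0)) / (a + om)" for t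
  have df: "(f has_vector_derivative exp (a * (t - t0)) *\<^sub>R h t) (at t within {t0..t1})"
    if "t0 \<le> t" "t \<le> t1" for t
    unfolding f_def
    by (rule derivative_eq_intros der that refl)+ (simp add: scaleR_conv_of_real algebra_simps)
  have "norm (f t1 - f t0) \<le> \<phi> t1 - \<phi> t0"
  proof (rule differentiable_bound_general)
    show "t0 < t1" using False assms(1) by simp
    show "continuous_on {t0..t1} f"
      by (rule continuous_on_vector_derivative) (use df in auto)
    show "continuous_on {t0..t1} \<phi>" unfolding \<phi>_def using a by (intro continuous_intros) auto
    fix t assume t: "t0 < t" "t < t1"
    show "(f has_vector_derivative exp (a * (t - t0)) *\<^sub>R h t) (at t)"
      using df[of t] t by (simp add: at_within_Icc_at)
    show "(\<phi> has_vector_derivative H * exp ((a + om) * (t - t0))) (at t)"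
      unfolding \<phi>_def has_real_derivative_iff_has_vector_derivative[symmetric]
      by (rule derivative_eq_intros refl | use a in simp)+
    show "norm (exp (a * (t - t0)) *\<^sub>R h t) \<le> H * exp ((a + om) * (t - t0))"
      using mult_left_mono[OF bnd[OF t], of "exp (a * (t - t0))"]
      by (simp add: exp_add[symmetric] algebra_simps)
  qed
  moreover have "norm (f t0) = cmod (z t0)" by (simp add: f_def)
  moreover have "0 \<le> \<phi> t0" using assms by (simp add: \<phi>_def)
  moreover have "norm (f t1) \<le> norm (f t1 - f t0) + norm (f t0)"
    using norm_triangle_ineq[of "f t1 - f t0" "f t0"] by simp
  ultimately have "norm (f t1) \<le> cmod (z t0) + \<phi> t1" by linarith
  then have "exp (- a * (t1 - t0)) * norm (f t1) \<le> exp (- a * (t1 - t0)) * (cmod (z t0) + \<phi> t1)"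
    by (intro mult_left_mono) auto
  moreover have "exp (- a * (t1 - t0)) * norm (f t1) = cmod (z t1)"
    by (simp add: f_def exp_add[symmetric] mult.assoc[symmetric])
  moreover have "exp (- a * (t1 - t0)) * \<phi> t1 = H * exp (om * (t1 - t0)) / (a + om)"
    unfolding \<phi>_def by (simp add: exp_add[symmetric] algebra_simps)
  ultimately show ?thesis by (simp add: distrib_left)
qed

text \<open>The equation is imposed mode by mode because neither the source nor the Laplacian term
  belongs to \<open>ell2\<close>. Continuity in \<open>ell2\<close> is the only link between the
  modes; the derivative at time 0 is one-sided.\<close>

definition heat_flow :: "(real \<Rightarrow> ell2) \<Rightarrow> (real \<Rightarrow> int \<Rightarrow> complex) \<Rightarrow> bool" where
  "heat_flow c G \<longleftrightarrow> continuous_on {0..} c \<and>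
     (\<forall>t\<ge>0. \<forall>n. ((\<lambda>s. cf (c s) n) has_vector_derivative
        (- of_real ((real_of_int n)\<^sup>2) * cf (c t) n + G t n)) (at t within {0..}))"

lemma heat_flow_derivative:
  assumes "heat_flow c G" "0 \<le> t" "S \<subseteq> {0..}"
  shows "((\<lambda>s. cf (c s) n) has_vector_derivative
    (- of_real ((real_of_int n)\<^sup>2) * cf (c t) n + G t n)) (at t within S)"
  by (rule has_vector_derivative_within_subset[OF _ assms(3)])
     (rule assms(1)[unfolded heat_flow_def, THEN conjunct2, rule_format, OF assms(2)])

lemma heat_flow_derivative_at:
  assumes "heat_flow c G" "0 < t"
  shows "((\<lambda>s. cf (c s) n) has_vector_derivative
    (- of_real ((real_of_int n)\<^sup>2) * cf (c t) n + G t n)) (at t)"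
proof -
  have "t \<in> {0<..}" "{0<..} \<subseteq> {0 :: real..}" using assms(2) by auto
  then show ?thesis
    using heat_flow_derivative[OF assms(1), of t "{0<..}" n] assms(2)
    unfolding at_within_open[OF \<open>t \<in> {0<..}\<close> open_greaterThan] by simp
qed

text \<open>In terms of \<open>r = sqrt (jb n)\<close> the claim reads
  \<open>r ^ 7 \<le> e * D\<^sup>2\<close> with \<open>D \<ge> r ^ 4 / 2 + P\<close>. For
  \<open>r \<ge> 4 / e\<close> the first summand alone suffices, since its square is
  \<open>r ^ 8 / 4\<close>; for smaller \<open>r\<close> the constant \<open>P\<close> does.\<close>

lemma jb_heat_ratio:
  assumes "0 < e"
  shows "\<exists>om\<ge>1. \<forall>n. (jb n / ((real_of_int n)\<^sup>2 + om))\<^sup>2 \<le> e * jb n powr (- 3 / 2)"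
proof -
  \<comment> \<open>For \<open>1 \<le> r < 4 / e\<close> the quantity \<open>r ^ 7 / e\<close> is at
    most \<open>(4 / e) ^ 8 / e\<close>; the added 1 gives \<open>P \<le> P\<^sup>2\<close>.\<close>
  define P where "P = ((4 / e)\<^sup>2) ^ 4 / e + 1"
  have P: "1 \<le> P" using assms by (simp add: P_def)
  have "(jb n / ((real_of_int n)\<^sup>2 + (P + 1)))\<^sup>2 \<le> e * jb n powr (- 3 / 2)" for n
  proof -
    define m where "m = jb n"
    define r where "r = sqrt m"
    have m: "1 \<le> m" using jb_ge1 by (simp add: m_def)
    have r: "1 \<le> r" "m = r\<^sup>2" using m by (simp_all add: r_def)
    have mp: "m powr (- 3 / 2) = 1 / r ^ 3"
    proof -
      have "m powr (- 3 / 2) = (r powr 2) powr (- 3 / 2)" using r by simp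
      also have "\<dots> = r powr (- 3)" by (simp only: powr_powr) simp
      also have "\<dots> = 1 / r ^ 3" using r by (simp add: powr_minus inverse_eq_divide)
      finally show ?thesis .
    qed
    define D where "D = (real_of_int n)\<^sup>2 + (P + 1)"
    \<comment> \<open>The 1 in \<open>om = P + 1\<close> completes \<open>n\<^sup>2\<close> to
      \<open>1 + n\<^sup>2\<close>, which is at least half of \<open>m\<^sup>2\<close>.\<close>
    have D: "m\<^sup>2 / 2 + P \<le> D" using jb_sq[of n] by (simp add: D_def m_def)
    have D0: "0 < D" using P by (simp add: D_def add_nonneg_pos)
    have "r ^ 7 / e \<le> D\<^sup>2"
    proof (cases "4 / e \<le> r")
      case True
      have "r ^ 7 / e \<le> r ^ 7 * (r / 4)"
        using True r assms by (simp add: field_simps)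
      also have "\<dots> = (m\<^sup>2 / 2)\<^sup>2" by (simp add: r(2) power2_eq_square eval_nat_numeral)
      also have "\<dots> \<le> D\<^sup>2" using D P by (intro power_mono) auto
      finally show ?thesis .
    next
      case False
      have "r ^ 7 \<le> r ^ 8" using r by (intro power_increasing) auto
      also have "\<dots> \<le> (4 / e) ^ 8" using False r by (intro power_mono) auto
      finally have "r ^ 7 / e \<le> (4 / e) ^ 8 / e" using assms by (intro divide_right_mono) auto
      also have "\<dots> \<le> P" by (simp add: P_def power_mult[symmetric])
      also have "\<dots> \<le> P\<^sup>2" using P by (simp add: power2_eq_square)
      also have "\<dots> \<le> D\<^sup>2" using D P zero_le_power2[of m] by (intro power_mono) linarith+
      finally show ?thesis .
    qed
    then have "r ^ 7 \<le> e * D\<^sup>2" using assms by (simp add: field_simps)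
    then have "m\<^sup>2 * r ^ 3 \<le> e * D\<^sup>2" by (simp add: r(2) eval_nat_numeral mult.assoc)
    then have "(m / D)\<^sup>2 \<le> e * (1 / r ^ 3)"
      using r D0 by (simp add: power_divide field_simps)
    then show ?thesis unfolding mp[symmetric] m_def D_def .
  qed
  then show ?thesis using P by (intro exI[of _ "P + 1"]) auto
qed

text \<open>The passage from modewise Duhamel bounds back to \<open>ell2\<close>: each mode carries
  the factor \<open>jb n\<close> of one derivative over the heat gain, and this ratio is square
  summable.\<close>

lemma norm_ell2_ratio_le:
  assumes "\<And>n. cmod (cf d n) \<le> K * (jb n / ((real_of_int n)\<^sup>2 + om))" "0 \<le> K"
    and "\<And>n. (jb n / ((real_of_int n)\<^sup>2 + om))\<^sup>2 \<le> e * jb n powr (- 3 / 2)" "0 \<le> e"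
  shows "norm d \<le> K * sqrt (e * JS)"
proof (rule norm_ell2_leI)
  show "(cmod (cf d n))\<^sup>2 \<le> K\<^sup>2 * (e * jb n powr (- 3 / 2))" for n
  proof -
    have "(cmod (cf d n))\<^sup>2 \<le> (K * (jb n / ((real_of_int n)\<^sup>2 + om)))\<^sup>2" by (intro power_mono assms) auto
    then show ?thesis using mult_left_mono[OF assms(3)[of n] zero_le_power2[of K]]
      unfolding power_mult_distrib[of K] by linarith
  qed
  show "((\<lambda>n. K\<^sup>2 * (e * jb n powr (- 3 / 2))) has_sum K\<^sup>2 * (e * JS)) UNIV"
    unfolding JS_def by (intro has_sum_cmult_right has_sum_infsum summable_jb)
  show "K\<^sup>2 * (e * JS) \<le> (K * sqrt (e * JS))\<^sup>2" using assms(4) JS_ge1 by (simp add: power_mult_distrib)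
  show "0 \<le> K * sqrt (e * JS)" using assms JS_ge1 by simp
qed

lemma contraction_rate:
  assumes "0 \<le> L"
  obtains om e where "1 \<le> om" "0 \<le> e" "L * sqrt (e * JS) \<le> 1 / 2"
    "\<And>n. (jb n / ((real_of_int n)\<^sup>2 + om))\<^sup>2 \<le> e * jb n powr (- 3 / 2)"
proof -
  \<comment> \<open>Then \<open>L\<^sup>2 * e * JS\<close> equals
    \<open>L\<^sup>2 / (4 * (L\<^sup>2 + 1))\<close>, which is below 1/4; the added 1 covers
    \<open>L = 0\<close>.\<close>
  define e where "e = 1 / (4 * (L\<^sup>2 + 1) * JS)"
  have e: "0 < e" using JS_ge1 by (simp add: e_def add_nonneg_pos)
  obtain om where om: "1 \<le> om" "\<And>n. (jb n / ((real_of_int n)\<^sup>2 + om))\<^sup>2 \<le> e * jb n powr (- 3 / 2)"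
    using jb_heat_ratio[OF e] by blast
  have "(L * sqrt (e * JS))\<^sup>2 = L\<^sup>2 / (4 * (L\<^sup>2 + 1))"
    using JS_ge1 e by (simp add: power_mult_distrib e_def)
  also have "\<dots> \<le> (1 / 2)\<^sup>2" by (simp add: field_simps power2_eq_square add_pos_nonneg)
  finally have "L * sqrt (e * JS) \<le> 1 / 2" by (rule power2_le_imp_le) simp
  then show ?thesis using om e by (intro that[of om e]) auto
qed

text \<open>The distance weighted by \<open>exp (- om * s)\<close> attains its maximum on the
  compact interval. Duhamel's bound at the maximum point shows that the maximum is at most half of
  itself, hence zero.\<close>

lemma heat_flow_unique:
  assumes c: "heat_flow c Gc" and d: "heat_flow d Gd" and init: "c 0 = d 0" and L: "0 \<le> L"
    and lip: "\<And>t n. 0 \<le> t \<Longrightarrow> t \<le> T \<Longrightarrow> cmod (Gc t n - Gd t n) \<le> L * jb n * norm (c t - d t)"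
    and t: "0 \<le> t" "t \<le> T"
  shows "c t = d t"
proof -
  obtain om e where om: "1 \<le> om" "0 \<le> e" "L * sqrt (e * JS) \<le> 1 / 2"
    "\<And>n. (jb n / ((real_of_int n)\<^sup>2 + om))\<^sup>2 \<le> e * jb n powr (- 3 / 2)"
    using contraction_rate[OF L] by blast
  define f where "f s = exp (- om * s) * norm (c s - d s)" for s
  have "continuous_on {0..T} c" "continuous_on {0..T} d"
    using c d by (auto simp: heat_flow_def intro: continuous_on_subset)
  then have "continuous_on {0..T} f" unfolding f_def by (intro continuous_intros)
  then obtain s where s: "s \<in> {0..T}" "\<And>x. x \<in> {0..T} \<Longrightarrow> f x \<le> f s"
    using continuous_attains_sup[of "{0..T}" f] t by fastforce
  have nb: "norm (c x - d x) \<le> f s * exp (om * x)" if "x \<in> {0..T}" for x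
    using mult_right_mono[OF s(2)[OF that], of "exp (om * x)"]
    by (simp add: f_def mult.assoc mult.commute[of _ "exp (om * x)"] exp_minus_inverse flip: exp_add)
       (simp add: mult.left_commute exp_minus field_simps)
  have fs: "0 \<le> f s" by (simp add: f_def)
  have "norm (c s - d s) \<le> (L * f s * exp (om * s)) * sqrt (e * JS)"
  proof (rule norm_ell2_ratio_le[OF _ _ om(4,2)])
    fix n
    have "cmod (cf (c s) n - cf (d s) n) \<le> exp (- (real_of_int n)\<^sup>2 * (s - 0)) * cmod (cf (c 0) n - cf (d 0) n)
        + (L * jb n * f s) * exp (om * (s - 0)) / ((real_of_int n)\<^sup>2 + om)"
    proof (rule Duhamel_bound)
      show "0 \<le> s" "0 < (real_of_int n)\<^sup>2 + om" using s om by (auto simp: add_nonneg_pos)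
      show "0 \<le> L * jb n * f s" using L fs jb_pos[of n] by simp
      fix x assume x: "0 \<le> x" "x \<le> s"
      show "((\<lambda>s. cf (c s) n - cf (d s) n) has_vector_derivative
         - of_real ((real_of_int n)\<^sup>2) * (cf (c x) n - cf (d x) n) + (Gc x n - Gd x n)) (at x within {0..s})"
        by (rule has_vector_derivative_eq_rhs,
            rule has_vector_derivative_diff[OF heat_flow_derivative[OF c] heat_flow_derivative[OF d]])
           (use x in \<open>auto simp: algebra_simps\<close>)
    next
      fix x assume x: "0 < x" "x < s"
      have "cmod (Gc x n - Gd x n) \<le> L * jb n * norm (c x - d x)" using x s by (intro lip) auto
      also have "\<dots> \<le> L * jb n * (f s * exp (om * x))"
        using nb[of x] x s L jb_pos[of n] by (intro mult_left_mono) auto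
      finally show "cmod (Gc x n - Gd x n) \<le> L * jb n * f s * exp (om * (x - 0))" by (simp add: mult.assoc)
    qed
    then show "cmod (cf (c s - d s) n) \<le> L * f s * exp (om * s) * (jb n / ((real_of_int n)\<^sup>2 + om))"
      using init by (simp add: algebra_simps)
  qed (use L fs in simp)
  also have "\<dots> = (L * sqrt (e * JS)) * (f s * exp (om * s))" by simp
  also have "\<dots> \<le> 1 / 2 * (f s * exp (om * s))" using om(3) fs by (intro mult_right_mono) auto
  also have "f s * exp (om * s) = norm (c s - d s)" by (simp add: f_def exp_minus field_simps)
  finally have "norm (c s - d s) \<le> 0" by simp
  then have "f s = 0" by (simp add: f_def)
  then show ?thesis using nb[of t] t by simp
qed

text \<open>Banach's fixed point theorem in the bounded continuous functions \<open>w\<close> with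
  \<open>c t = exp (om * t) *\<^sub>R w t\<close>. The weight makes the contraction hold on the
  whole half-line at once, so no continuation of local solutions is needed.\<close>

lemma heat_flow_exists_Lipschitz:
  fixes G :: "ell2 \<Rightarrow> int \<Rightarrow> complex"
  assumes L: "0 \<le> L" and lip: "\<And>c d n. cmod (G c n - G d n) \<le> L * jb n * norm (c - d)"
    and zero: "\<And>n. G 0 n = 0" and sym: "\<And>c n. G c (- n) = cnj (G c n)"
  shows "\<exists>c. heat_flow c (\<lambda>t. G (c t)) \<and> c 0 = c0"
proof -
  obtain om e where om: "1 \<le> om" "0 \<le> e" "L * sqrt (e * JS) \<le> 1 / 2"
    "\<And>n. (jb n / ((real_of_int n)\<^sup>2 + om))\<^sup>2 \<le> e * jb n powr (- 3 / 2)"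
    using contraction_rate[OF L] by blast
  define F where "F w n s = G (exp (om * s) *\<^sub>R apply_bcontfun w s) n" for w :: "real \<Rightarrow>\<^sub>C ell2" and n s
  have Fd: "cmod (F w n s - F v n s) \<le> L * jb n * norm (w - v) * exp (om * s)" for w v n s
  proof -
    have "cmod (F w n s - F v n s) \<le> L * jb n * (exp (om * s) * norm (apply_bcontfun (w - v) s))"
      using lip[of "exp (om * s) *\<^sub>R apply_bcontfun w s" n "exp (om * s) *\<^sub>R apply_bcontfun v s"]
      by (simp add: F_def flip: scaleR_diff_right)
    also have "\<dots> \<le> L * jb n * (exp (om * s) * norm (w - v))"
      using L jb_pos[of n] norm_bounded[of "w - v" s] by (intro mult_left_mono) auto
    finally show ?thesis by (simp add: algebra_simps)
  qed
  have F0: "F 0 n s = 0" for n s by (simp add: F_def zero)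
  have contG: "continuous_on UNIV (\<lambda>c. G c n)" for n
  proof (rule continuous_on_iff[THEN iffD2], intro ballI allI impI)
    fix c :: ell2 and r :: real assume r: "0 < r"
    have "dist (G d n) (G c n) < r" if d: "dist d c < r / (L * jb n + 1)" for d
    proof -
      have p: "0 < L * jb n + 1" using L jb_pos[of n] by (simp add: add_nonneg_pos)
      have "dist (G d n) (G c n) \<le> (L * jb n + 1) * norm (d - c)"
        using lip[of d n c] by (simp add: dist_norm algebra_simps) (smt (verit) norm_ge_zero)
      also have "\<dots> < (L * jb n + 1) * (r / (L * jb n + 1))"
        using d p by (intro mult_strict_left_mono) (auto simp: dist_norm)
      finally show ?thesis using p by simp
    qed
    moreover have "0 < r / (L * jb n + 1)" using r L jb_pos[of n] by (simp add: add_nonneg_pos)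
    ultimately show "\<exists>r'>0. \<forall>d\<in>UNIV. dist d c < r' \<longrightarrow> dist (G d n) (G c n) < r" by blast
  qed
  have contF: "continuous_on S (F w n)" for w n S
    unfolding F_def
    by (rule continuous_on_compose2[OF contG]) (auto intro!: continuous_intros)
  \<comment> \<open>Variation of constants for mode \<open>n\<close>, with the source evaluated
    along the previous iterate \<open>w\<close>.\<close>
  define z where "z w n t = exp (- (real_of_int n)\<^sup>2 * t) *\<^sub>R
      (cf c0 n + integral {0..t} (\<lambda>s. exp ((real_of_int n)\<^sup>2 * s) *\<^sub>R F w n s))" for w n t
  have zder: "((z w n) has_vector_derivative (- of_real ((real_of_int n)\<^sup>2) * z w n t + F w n t)) (at t within {0..b})"
    if "0 \<le> t" "t \<le> b" for w n t b
  proof -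
    have "((\<lambda>u. integral {0..u} (\<lambda>s. exp ((real_of_int n)\<^sup>2 * s) *\<^sub>R F w n s)) has_vector_derivative
        exp ((real_of_int n)\<^sup>2 * t) *\<^sub>R F w n t) (at t within {0..b})"
      using that by (intro integral_has_vector_derivative continuous_intros contF) auto
    then have *: "((\<lambda>u. cf c0 n + integral {0..u} (\<lambda>s. exp ((real_of_int n)\<^sup>2 * s) *\<^sub>R F w n s)) has_vector_derivative
        exp ((real_of_int n)\<^sup>2 * t) *\<^sub>R F w n t) (at t within {0..b})"
      by (simp add: has_vector_derivative_add_const add.commute[of "cf c0 n"])
    have "((\<lambda>t. exp (- (real_of_int n)\<^sup>2 * t)) has_field_derivative
        exp (- (real_of_int n)\<^sup>2 * t) * - (real_of_int n)\<^sup>2) (at t within {0..b})"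
      by (rule derivative_eq_intros refl)+ simp
    from has_vector_derivative_scaleR[OF this *] show ?thesis unfolding z_def
      by (rule has_vector_derivative_eq_rhs)
         (simp add: scaleR_conv_of_real exp_minus field_simps)
  qed
  have z0: "z w n 0 = cf c0 n" for w n by (simp add: z_def)
  have zd: "cmod (z w n t - z v n t) \<le> L * norm (w - v) * exp (om * t) * (jb n / ((real_of_int n)\<^sup>2 + om))"
    if "0 \<le> t" for w v n t
  proof -
    have "cmod (z w n t - z v n t) \<le> exp (- (real_of_int n)\<^sup>2 * (t - 0)) * cmod (z w n 0 - z v n 0)
        + (L * jb n * norm (w - v)) * exp (om * (t - 0)) / ((real_of_int n)\<^sup>2 + om)"
    proof (rule Duhamel_bound)
      show "0 < (real_of_int n)\<^sup>2 + om" using om by (auto simp: add_nonneg_pos)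
      show "0 \<le> L * jb n * norm (w - v)" using L jb_pos[of n] by simp
      fix x assume x: "0 \<le> x" "x \<le> t"
      show "((\<lambda>t. z w n t - z v n t) has_vector_derivative
         - of_real ((real_of_int n)\<^sup>2) * (z w n x - z v n x) + (F w n x - F v n x)) (at x within {0..t})"
        by (rule has_vector_derivative_eq_rhs, rule has_vector_derivative_diff[OF zder zder])
           (use x in \<open>auto simp: algebra_simps\<close>)
    qed (use that Fd in auto)
    then show ?thesis by (simp add: z0 algebra_simps)
  qed
  have zzero: "z 0 n t = exp (- (real_of_int n)\<^sup>2 * t) *\<^sub>R cf c0 n" for n t by (simp add: z_def F0)
  have zsym: "z w (- n) t = cnj (z w n t)" for w n t
  proof -
    have "cnj (F w n s) = F w (- n) s" for s by (simp add: F_def sym)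
    then show ?thesis
      unfolding z_def by (simp add: cf_minus integral_cnj)
  qed
  \<comment> \<open>The weight is removed again, and the value at 0 is extended to negative times,
    because bounded continuous functions live on the whole real line.\<close>
  define u where "u w t n = exp (- om * max 0 t) *\<^sub>R z w n (max 0 t)" for w t n
  \<comment> \<open>Majorant uniform in time: the first part controls the free evolution
    \<open>z 0\<close>, whose source vanishes, the second the deviation of \<open>z w\<close> from
    it.\<close>
  define g where "g w n = 2 * (cmod (cf c0 n))\<^sup>2 + 2 * ((L * norm w)\<^sup>2 * (e * jb n powr (- 3 / 2)))" for w :: "real \<Rightarrow>\<^sub>C ell2" and n
  have gs: "g w summable_on UNIV" for w
    unfolding g_def by (intro summable_on_add summable_on_cmult_right summable_jb cf_summable)
  have ub: "(cmod (u w t n))\<^sup>2 \<le> g w n" for w t n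
  proof -
    define s where "s = max 0 t"
    have s: "0 \<le> s" by (simp add: s_def)
    have "exp (- om * s) * cmod (z w n s - z 0 n s) \<le> exp (- om * s) * (L * norm (w - 0) * exp (om * s) * (jb n / ((real_of_int n)\<^sup>2 + om)))"
      by (intro mult_left_mono zd s) auto
    also have "\<dots> = L * norm w * (jb n / ((real_of_int n)\<^sup>2 + om))" by (simp add: exp_minus field_simps)
    finally have "(exp (- om * s) * cmod (z w n s - z 0 n s))\<^sup>2 \<le> (L * norm w * (jb n / ((real_of_int n)\<^sup>2 + om)))\<^sup>2"
      by (rule power_mono) simp
    also have "\<dots> \<le> (L * norm w)\<^sup>2 * (e * jb n powr (- 3 / 2))"
      unfolding power_mult_distrib[of "L * norm w"] by (intro mult_left_mono om(4)) auto
    finally have 1: "(cmod (exp (- om * s) *\<^sub>R (z w n s - z 0 n s)))\<^sup>2 \<le> (L * norm w)\<^sup>2 * (e * jb n powr (- 3 / 2))" by simp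
    have "exp (- om * s) * exp (- (real_of_int n)\<^sup>2 * s) \<le> 1" using om(1) s by (intro mult_le_one) auto
    then have "cmod (exp (- om * s) *\<^sub>R z 0 n s) \<le> cmod (cf c0 n)"
      unfolding zzero by (simp add: mult_left_le_one_le flip: mult.assoc)
    then have 2: "(cmod (exp (- om * s) *\<^sub>R z 0 n s))\<^sup>2 \<le> (cmod (cf c0 n))\<^sup>2" by (rule power_mono) simp
    have u: "u w t n = exp (- om * s) *\<^sub>R z 0 n s + exp (- om * s) *\<^sub>R (z w n s - z 0 n s)"
      by (simp add: u_def s_def algebra_simps)
    show ?thesis
      unfolding u g_def by (rule order_trans[OF cmod_add_sq]) (intro add_mono mult_left_mono 1 2, auto)
  qed
  define U where "U w t = Abs_ell2 (u w t)" for w t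
  have cfU: "cf (U w t) n = u w t n" for w t n
  proof -
    have "(\<lambda>n. (cmod (u w t n))\<^sup>2) summable_on UNIV"
      by (rule summable_on_comparison_test[OF gs ub]) simp
    moreover have "u w t (- n) = cnj (u w t n)" for n by (simp add: u_def zsym)
    ultimately show ?thesis unfolding U_def by (subst Abs_ell2_inverse) auto
  qed
  have contz: "continuous_on {0..} (z w n)" for w n
  proof -
    have "continuous (at t within {0..}) (z w n)" if "0 \<le> t" for t
      using has_vector_derivative_continuous[OF zder[of t "t + 1" w n]] that
        at_within_initial[of t "t + 1"] by simp
    then show ?thesis by (simp add: continuous_on_eq_continuous_within)
  qed
  have contU: "continuous_on UNIV (U w)" for w
  proof (rule ell2_continuous_onI[OF _ _ gs])
    show "continuous_on UNIV (\<lambda>t. cf (U w t) n)" for n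
      unfolding cfU u_def
      by (intro continuous_intros continuous_on_compose2[OF contz]) auto
    show "(cmod (cf (U w t) n))\<^sup>2 \<le> g w n" for n t unfolding cfU by (rule ub)
  qed
  have bU: "U w \<in> bcontfun" for w
  proof (rule bcontfun_normI[OF contU])
    fix t show "norm (U w t) \<le> sqrt (infsum (g w) UNIV)"
    proof (rule norm_ell2_leI[OF _ has_sum_infsum[OF gs[of w]]])
      have "0 \<le> infsum (g w) UNIV" by (rule infsum_nonneg) (use ub[of w 0] in \<open>meson order_trans zero_le_power2\<close>)
      then show "infsum (g w) UNIV \<le> (sqrt (infsum (g w) UNIV))\<^sup>2" "0 \<le> sqrt (infsum (g w) UNIV)" by auto
      show "(cmod (cf (U w t) n))\<^sup>2 \<le> g w n" for n unfolding cfU by (rule ub)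
    qed
  qed
  define Phi where "Phi w = Bcontfun (U w)" for w
  have ap: "apply_bcontfun (Phi w) t = U w t" for w t
    unfolding Phi_def by (simp add: Bcontfun_inverse bU)
  have "dist (Phi w) (Phi v) \<le> 1 / 2 * dist w v" for w v
  proof (rule dist_bound)
    fix t :: real
    define s where "s = max 0 t"
    have s: "0 \<le> s" by (simp add: s_def)
    have "norm (U w t - U v t) \<le> (L * norm (w - v)) * sqrt (e * JS)"
    proof (rule norm_ell2_ratio_le[OF _ _ om(4,2)])
      fix n
      have "cmod (cf (U w t - U v t) n) = exp (- om * s) * cmod (z w n s - z v n s)"
        by (simp add: cfU u_def s_def flip: scaleR_diff_right)
      also have "\<dots> \<le> exp (- om * s) * (L * norm (w - v) * exp (om * s) * (jb n / ((real_of_int n)\<^sup>2 + om)))"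
        by (intro mult_left_mono zd s) auto
      also have "\<dots> = L * norm (w - v) * (jb n / ((real_of_int n)\<^sup>2 + om))" by (simp add: exp_minus field_simps)
      finally show "cmod (cf (U w t - U v t) n) \<le> L * norm (w - v) * (jb n / ((real_of_int n)\<^sup>2 + om))" .
    qed (use L in simp)
    also have "\<dots> = (L * sqrt (e * JS)) * norm (w - v)" by simp
    also have "\<dots> \<le> 1 / 2 * norm (w - v)" using om(3) by (intro mult_right_mono) auto
    finally show "dist (apply_bcontfun (Phi w) t) (apply_bcontfun (Phi v) t) \<le> 1 / 2 * dist w v"
      by (simp add: ap dist_norm)
  qed
  then obtain w where w: "Phi w = w" using banach_fix_type[of "1 / 2" Phi] by auto
  define c where "c t = exp (om * t) *\<^sub>R apply_bcontfun w t" for t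
  have cz: "cf (c t) n = z w n t" if "0 \<le> t" for t n
  proof -
    have "cf (c t) n = exp (om * t) *\<^sub>R u w t n"
      unfolding c_def by (subst w[symmetric]) (simp add: ap cfU scaleR_conv_of_real)
    then show ?thesis using that by (simp add: u_def max_def flip: exp_add)
  qed
  have "((\<lambda>s. cf (c s) n) has_vector_derivative (- of_real ((real_of_int n)\<^sup>2) * cf (c t) n + G (c t) n)) (at t within {0..})"
    if t: "0 \<le> t" for t n
  proof -
    have "(z w n has_vector_derivative (- of_real ((real_of_int n)\<^sup>2) * z w n t + F w n t)) (at t within {0..})"
      using zder[of t "t + 1" w n] t at_within_initial[of t "t + 1"] by simp
    then have "((\<lambda>s. cf (c s) n) has_vector_derivative (- of_real ((real_of_int n)\<^sup>2) * z w n t + F w n t)) (at t within {0..})"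
      by (rule has_vector_derivative_transform_within[where d=1]) (use t cz in auto)
    then show ?thesis using cz[OF t] by (simp add: F_def c_def)
  qed
  moreover have "continuous_on {0..} c" unfolding c_def by (intro continuous_intros continuous_on_apply_bcontfun)
  moreover have "c 0 = c0" by (rule ell2_eqI) (simp add: cz z0)
  ultimately show ?thesis unfolding heat_flow_def by blast
qed

subsection \<open>Smoothing\<close>

text \<open>Of the decay \<open>q\<close> of both factors, \<open>q - 3 / 4\<close> is converted
  into decay in \<open>n\<close> by \<open>jb_mult\<close>. The remaining 3/4 on each factor become,
  by the arithmetic-geometric mean, two summable terms of order 3/2.\<close>

lemma conv_decay:
  assumes q: "3 / 4 \<le> q" and C: "0 \<le> C" and c: "\<And>n. cmod (cf c n) \<le> C * jb n powr (- q)"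
  shows "cmod (conv c c n) \<le> C\<^sup>2 * JS * jb n powr (- (q - 3 / 4))"
proof -
  define K where "K = C\<^sup>2 * jb n powr (- (q - 3 / 4))"
  have K0: "0 \<le> K" by (simp add: K_def)
  have t: "norm (cf c k * cf c (n - k)) \<le> K / 2 * (jb k powr (- 3 / 2) + jb (n - k) powr (- 3 / 2))" for k
  proof -
    have "norm (cf c k * cf c (n - k)) \<le> (C * jb k powr (- q)) * (C * jb (n - k) powr (- q))"
      unfolding norm_mult using C by (intro mult_mono c) auto
    also have "\<dots> = C\<^sup>2 * (jb k * jb (n - k)) powr (- (q - 3 / 4)) * ((jb k powr (- 3 / 4)) * (jb (n - k) powr (- 3 / 4)))"
      using jb_pos[of k] jb_pos[of "n - k"]
      by (simp add: powr_mult power2_eq_square powr_add[symmetric])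
         (simp add: mult.assoc mult.left_commute powr_add[symmetric])
    also have "\<dots> \<le> K * ((jb k powr (- 3 / 4)) * (jb (n - k) powr (- 3 / 4)))"
    proof (rule mult_right_mono)
      have "(jb k * jb (n - k)) powr (- (q - 3 / 4)) \<le> jb n powr (- (q - 3 / 4))"
        using q jb_mult[of n k] jb_pos[of n] by (intro powr_mono2') auto
      then show "C\<^sup>2 * (jb k * jb (n - k)) powr (- (q - 3 / 4)) \<le> K"
        unfolding K_def by (intro mult_left_mono) auto
    qed simp
    also have "\<dots> \<le> K * ((jb k powr (- 3 / 2) + jb (n - k) powr (- 3 / 2)) / 2)"
    proof (rule mult_left_mono[OF _ K0])
      have e: "x powr (- 3 / 2) = (x powr (- 3 / 4))\<^sup>2" for x :: real
        by (simp add: power2_eq_square powr_add[symmetric])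
      show "(jb k powr (- 3 / 4)) * (jb (n - k) powr (- 3 / 4)) \<le> (jb k powr (- 3 / 2) + jb (n - k) powr (- 3 / 2)) / 2"
        unfolding e using sum_squares_bound[of "jb k powr (- 3 / 4)" "jb (n - k) powr (- 3 / 4)"] by simp
    qed
    finally show ?thesis by (simp add: mult.assoc)
  qed
  have s2: "(\<lambda>k. jb (n - k) powr (- 3 / 2)) summable_on UNIV"
    using summable_on_reindex_bij_betw[OF bij_betw_diff_int, of "\<lambda>k. jb k powr (- 3 / 2)" n] summable_jb by simp
  have i2: "(\<Sum>\<^sub>\<infinity>k. jb (n - k) powr (- 3 / 2)) = JS"
    unfolding JS_def by (rule infsum_reindex_bij_betw[OF bij_betw_diff_int])
  have "cmod (conv c c n) \<le> (\<Sum>\<^sub>\<infinity>k. norm (cf c k * cf c (n - k)))"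
    unfolding conv_def by (rule norm_infsum_bound[OF conv_abs_summable])
  also have "\<dots> \<le> (\<Sum>\<^sub>\<infinity>k. K / 2 * (jb k powr (- 3 / 2) + jb (n - k) powr (- 3 / 2)))"
    by (intro infsum_mono conv_abs_summable t summable_on_cmult_right summable_on_add summable_jb s2)
  also have "\<dots> = K / 2 * (JS + JS)"
    by (simp only: infsum_cmult_right' infsum_add[OF summable_jb s2] i2 JS_def[symmetric])
  finally show ?thesis by (simp add: K_def mult.assoc mult.commute)
qed

text \<open>Duhamel's bound from time \<open>a\<close> with weight 1. Once a positive time has
  elapsed the semigroup decays like \<open>jb n powr (- 2)\<close>, and division by
  \<open>n\<^sup>2 + 1\<close> improves the source by order 2.\<close>

lemma heat_flow_gain:
  assumes c: "heat_flow c G" and a: "0 \<le> a" "a < a'" and q: "q \<le> 2" and "0 \<le> H" "0 \<le> M"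
    and G: "\<And>t n. a \<le> t \<Longrightarrow> t \<le> T \<Longrightarrow> cmod (G t n) \<le> H * jb n powr (2 - q)"
    and M: "norm (c a) \<le> M"
  shows "\<exists>C\<ge>0. \<forall>t n. a' \<le> t \<longrightarrow> t \<le> T \<longrightarrow> cmod (cf (c t) n) \<le> C * jb n powr (- q)"
proof -
  \<comment> \<open>The minimum with 1 gives
    \<open>d * (1 + n\<^sup>2) \<le> 1 + n\<^sup>2 * (t - a)\<close>, and the right-hand side is
    below the exponential.\<close>
  define d where "d = min 1 (a' - a)"
  have d: "0 < d" "d \<le> 1" "d \<le> a' - a" using a by (auto simp: d_def)
  define C where "C = 2 * M / d + 2 * H * exp T"
  have r: "1 / (1 + (real_of_int n)\<^sup>2) \<le> 2 * jb n powr (- 2)" for n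
    using jb_sq[of n] jb_pos[of n] by (simp add: powr_minus field_simps add_pos_nonneg)
  have b: "cmod (cf (c t) n) \<le> C * jb n powr (- q)" if t: "a' \<le> t" "t \<le> T" for t n
  proof -
    have "cmod (cf (c t) n) \<le> exp (- (real_of_int n)\<^sup>2 * (t - a)) * cmod (cf (c a) n)
        + (H * jb n powr (2 - q)) * exp (1 * (t - a)) / ((real_of_int n)\<^sup>2 + 1)"
    proof (rule Duhamel_bound)
      show "a \<le> t" "0 < (real_of_int n)\<^sup>2 + 1" using a t by (auto simp: add_nonneg_pos)
      show "0 \<le> H * jb n powr (2 - q)" using assms(5) by simp
      fix x assume x: "a \<le> x" "x \<le> t"
      show "((\<lambda>s. cf (c s) n) has_vector_derivative
         - of_real ((real_of_int n)\<^sup>2) * cf (c x) n + G x n) (at x within {a..t})"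
        by (rule heat_flow_derivative[OF c]) (use x a in auto)
    next
      fix x assume x: "a < x" "x < t"
      then have "cmod (G x n) \<le> H * jb n powr (2 - q) * 1" using G[of x n] t by simp
      also have "\<dots> \<le> H * jb n powr (2 - q) * exp (1 * (x - a))"
        using x assms(5) by (intro mult_left_mono) auto
      finally show "cmod (G x n) \<le> H * jb n powr (2 - q) * exp (1 * (x - a))" .
    qed
    also have "exp (- (real_of_int n)\<^sup>2 * (t - a)) * cmod (cf (c a) n) \<le> (2 * M / d) * jb n powr (- q)"
    proof -
      have "(real_of_int n)\<^sup>2 * d \<le> (real_of_int n)\<^sup>2 * (t - a)" using t d by (intro mult_left_mono) auto
      then have "d * (1 + (real_of_int n)\<^sup>2) \<le> 1 + (real_of_int n)\<^sup>2 * (t - a)" using d by (simp add: algebra_simps)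
      also have "\<dots> \<le> exp ((real_of_int n)\<^sup>2 * (t - a))" by (rule exp_ge_add_one_self)
      finally have "1 / exp ((real_of_int n)\<^sup>2 * (t - a)) \<le> 1 / (d * (1 + (real_of_int n)\<^sup>2))"
        using d by (intro divide_left_mono) (auto intro!: mult_pos_pos simp: add_pos_nonneg)
      then have "exp (- (real_of_int n)\<^sup>2 * (t - a)) \<le> 1 / (d * (1 + (real_of_int n)\<^sup>2))"
        by (simp add: exp_minus inverse_eq_divide)
      also have "\<dots> = (1 / d) * (1 / (1 + (real_of_int n)\<^sup>2))" by simp
      also have "\<dots> \<le> (1 / d) * (2 * jb n powr (- 2))" using d r by (intro mult_left_mono) auto
      also have "\<dots> \<le> (1 / d) * (2 * jb n powr (- q))" using d q by (intro mult_left_mono jb_powr_le) auto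
      finally have "exp (- (real_of_int n)\<^sup>2 * (t - a)) * cmod (cf (c a) n) \<le> (1 / d) * (2 * jb n powr (- q)) * M"
        using d M cf_le_norm[of "c a" n] by (intro mult_mono) auto
      then show ?thesis by (simp add: mult.commute mult.left_commute)
    qed
    also have "(H * jb n powr (2 - q)) * exp (1 * (t - a)) / ((real_of_int n)\<^sup>2 + 1) \<le> (2 * H * exp T) * jb n powr (- q)"
    proof -
      have "(H * jb n powr (2 - q)) * exp (1 * (t - a)) / ((real_of_int n)\<^sup>2 + 1)
          = (H * jb n powr (2 - q)) * exp (t - a) * (1 / (1 + (real_of_int n)\<^sup>2))" by (simp add: add.commute)
      also have "\<dots> \<le> (H * jb n powr (2 - q)) * exp T * (2 * jb n powr (- 2))"
        using r assms(5) t a by (intro mult_mono) auto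
      also have "\<dots> = (2 * H * exp T) * jb n powr (- q)"
        using powr_add[of "jb n" "2 - q" "- 2"] by (simp add: mult_ac)
      finally show ?thesis .
    qed
    finally show ?thesis unfolding C_def by (simp add: distrib_right)
  qed
  have "0 \<le> C" unfolding C_def using d assms(5,6) by simp
  then show ?thesis using b by blast
qed

lemma heat_flow_bounded:
  assumes "heat_flow c G" shows "\<exists>M\<ge>0. \<forall>t. 0 \<le> t \<longrightarrow> t \<le> T \<longrightarrow> norm (c t) \<le> M"
proof -
  have "continuous_on {0..T} c" using assms by (auto simp: heat_flow_def intro: continuous_on_subset)
  then have "bounded (c ` {0..T})" by (intro compact_imp_bounded compact_continuous_image) auto
  then obtain M where M: "M > 0" "\<And>x. x \<in> c ` {0..T} \<Longrightarrow> norm x \<le> M" unfolding bounded_pos by blast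
  then show ?thesis by (intro exI[of _ M]) auto
qed

text \<open>Starting from bounded convolutions, each step gains \<open>1/4\<close> power of decay of the coefficients:
  decay of order \<open>q\<close> gives order \<open>q - 3/4\<close> for the convolution, hence \<open>q - 7/4\<close> for the source, and the
  heat semigroup gains \<open>2\<close>.\<close>

lemma heat_flow_smoothing:
  assumes c: "heat_flow c G" and B: "0 \<le> B"
    and G: "\<And>t n. 0 \<le> t \<Longrightarrow> t \<le> T \<Longrightarrow> cmod (G t n) \<le> B + \<bar>real_of_int n\<bar> * cmod (conv (c t) (c t) n)"
    and a: "0 < a"
  shows "\<exists>C\<ge>0. \<forall>t n. a \<le> t \<longrightarrow> t \<le> T \<longrightarrow> cmod (cf (c t) n) \<le> C * jb n powr (- 2)"
proof -
  obtain M where M: "0 \<le> M" "\<And>t. 0 \<le> t \<Longrightarrow> t \<le> T \<Longrightarrow> norm (c t) \<le> M"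
    using heat_flow_bounded[OF c, of T] by blast
  have nj: "\<bar>real_of_int n\<bar> \<le> jb n powr 1" for n using jb_pos[of n] by (simp add: jb_def)
  have gain: "\<exists>C\<ge>0. \<forall>t n. a' \<le> t \<longrightarrow> t \<le> T \<longrightarrow> cmod (cf (c t) n) \<le> C * jb n powr (- q)"
    if a': "0 \<le> a''" "a'' < a'" and q: "q \<le> 2" and K: "0 \<le> K"
      "\<And>t n. a'' \<le> t \<Longrightarrow> t \<le> T \<Longrightarrow> cmod (conv (c t) (c t) n) \<le> K * jb n powr (1 - q)" for a' a'' q K
  proof (cases "a'' \<le> T")
    case True
    show ?thesis
    proof (rule heat_flow_gain[OF c a' q _ M(1), of "B + K"])
      show "0 \<le> B + K" using B K by simp
      show "norm (c a'') \<le> M" using M(2) a' True by simp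
      fix t n assume t: "a'' \<le> t" "t \<le> T"
      have "\<bar>real_of_int n\<bar> * cmod (conv (c t) (c t) n) \<le> jb n powr 1 * (K * jb n powr (1 - q))"
        by (intro mult_mono nj K t) auto
      also have "\<dots> = K * jb n powr (2 - q)" using jb_pos[of n] powr_add[of "jb n" 1 "1 - q"] by simp
      finally have "\<bar>real_of_int n\<bar> * cmod (conv (c t) (c t) n) \<le> K * jb n powr (2 - q)" .
      moreover have "1 \<le> jb n powr (2 - q)" using q jb_ge1[of n] by (simp add: ge_one_powr_ge_zero)
      then have "B * 1 \<le> B * jb n powr (2 - q)" using B by (intro mult_left_mono)
      ultimately show "cmod (G t n) \<le> (B + K) * jb n powr (2 - q)"
        using G[of t n] t a' by (simp add: distrib_right)
    qed
  qed (use a' in \<open>auto intro: exI[of _ 0]\<close>)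
  \<comment> \<open>Four gains lead from order 1 to order 2. Each uses up half of the time at its
    disposal, so every positive starting time is reached.\<close>
  have "\<exists>C\<ge>0. \<forall>t n. a' \<le> t \<longrightarrow> t \<le> T \<longrightarrow> cmod (cf (c t) n) \<le> C * jb n powr (- (1 + real k / 4))"
    if "k \<le> 4" "0 < a'" for k a'
    using that
  proof (induction k arbitrary: a')
    case 0
    have "cmod (conv (c t) (c t) n) \<le> M\<^sup>2 * jb n powr (1 - 1)" if "0 \<le> t" "t \<le> T" for t n
    proof -
      have "cmod (conv (c t) (c t) n) \<le> norm (c t) * norm (c t)" by (rule conv_bound)
      also have "\<dots> \<le> M * M" using M(2)[OF that] M(1) by (intro mult_mono) auto
      finally show ?thesis using jb_pos[of n] by (simp add: power2_eq_square)
    qed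
    from gain[OF order_refl 0(2) _ _ this] show ?case by simp
  next
    case (Suc k)
    then obtain C where C: "0 \<le> C" "\<And>t n. a' / 2 \<le> t \<Longrightarrow> t \<le> T \<Longrightarrow> cmod (cf (c t) n) \<le> C * jb n powr (- (1 + real k / 4))"
      using Suc.IH[of "a' / 2"] by auto
    have "cmod (conv (c t) (c t) n) \<le> C\<^sup>2 * JS * jb n powr (1 - (1 + real (Suc k) / 4))"
      if "a' / 2 \<le> t" "t \<le> T" for t n
      using conv_decay[OF _ C(1) C(2)[OF that], of n] by (simp add: add_divide_distrib diff_divide_distrib)
    note decay = this
    show ?case
      by (rule gain[where a''="a' / 2" and K="C\<^sup>2 * JS", OF _ _ _ _ decay])
         (use Suc.prems JS_ge1 in auto)
  qed
  from this[of 4 a] a show ?thesis by simp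
qed

subsection \<open>Termwise differentiation\<close>

text \<open>Replaces the net of finite sets by a sequence, as uniform limits and differentiation of
  limits require.\<close>

lemma symmetric_sums_tendsto:
  fixes f :: "int \<Rightarrow> 'a::{topological_comm_monoid_add,t2_space}"
  assumes "f summable_on UNIV"
  shows "(\<lambda>N. \<Sum>n=-int N..int N. f n) \<longlonglongrightarrow> infsum f UNIV"
proof -
  have "filterlim (\<lambda>N. {-int N..int N}) (finite_subsets_at_top UNIV) sequentially"
    unfolding filterlim_finite_subsets_at_top
  proof (intro allI impI)
    fix X :: "int set" assume X: "finite X \<and> X \<subseteq> UNIV"
    define m where "m = nat (\<Sum>x\<in>X. \<bar>x\<bar>)"
    have "\<bar>x\<bar> \<le> int m" if "x \<in> X" for x
    proof -
      have "\<bar>x\<bar> \<le> (\<Sum>x\<in>X. \<bar>x\<bar>)" using X that by (intro member_le_sum) auto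
      then show ?thesis by (simp add: m_def)
    qed
    then have "X \<subseteq> {-int N..int N}" if "m \<le> N" for N using that by force
    then show "\<forall>\<^sub>F N in sequentially. finite {-int N..int N} \<and> X \<subseteq> {-int N..int N} \<and> {-int N..int N} \<subseteq> UNIV"
      unfolding eventually_sequentially by auto
  qed
  from filterlim_compose[OF infsum_tendsto[OF assms] this] show ?thesis by (simp add: o_def)
qed

text \<open>Weierstrass M-test in quantitative form: the right-hand side is independent of any
  parameter on which \<open>f\<close> depends.\<close>

lemma infsum_tail_bound:
  fixes f :: "'a \<Rightarrow> 'b::banach"
  assumes "\<And>n. norm (f n) \<le> M n" "M summable_on UNIV" "finite F"
  shows "norm (infsum f UNIV - sum f F) \<le> infsum M UNIV - sum M F"
proof -
  have nf: "(\<lambda>n. norm (f n)) summable_on UNIV"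
    by (rule summable_on_comparison_test[OF assms(2)]) (auto simp: assms(1))
  have f: "f summable_on UNIV" by (rule abs_summable_summable[OF nf])
  have split: "infsum g UNIV = sum g F + infsum g (- F)" if "g summable_on UNIV" for g :: "'a \<Rightarrow> 'c::banach"
    using infsum_Un_disjoint[of g F "- F"] assms(3) summable_on_subset_banach[OF that, of "- F"] by simp
  have "norm (infsum f (- F)) \<le> infsum (\<lambda>n. norm (f n)) (- F)"
    by (rule norm_infsum_bound) (rule summable_on_subset_banach[OF nf], simp)
  also have "\<dots> \<le> infsum M (- F)"
    by (intro infsum_mono assms(1) summable_on_subset_banach[OF nf] summable_on_subset_banach[OF assms(2)]) auto
  finally show ?thesis using split[OF f] split[OF assms(2)] by simp
qed

lemma DERIV_infsum:
  fixes f f' :: "int \<Rightarrow> real \<Rightarrow> real"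
  assumes der: "\<And>n t. a < t \<Longrightarrow> t < b \<Longrightarrow> (f n has_real_derivative f' n t) (at t)"
    and bnd: "\<And>n t. a < t \<Longrightarrow> t < b \<Longrightarrow> \<bar>f' n t\<bar> \<le> M n" and M: "M summable_on UNIV"
    and sf: "\<And>t. a < t \<Longrightarrow> t < b \<Longrightarrow> (\<lambda>n. f n t) summable_on UNIV"
    and t: "a < t" "t < b"
  shows "((\<lambda>t. \<Sum>\<^sub>\<infinity>n. f n t) has_real_derivative (\<Sum>\<^sub>\<infinity>n. f' n t)) (at t)"
proof -
  let ?S = "{a<..<b}"
  have "\<exists>g. \<forall>x\<in>?S. (\<lambda>N. \<Sum>n=-int N..int N. f n x) \<longlonglongrightarrow> g x \<and>
      (g has_derivative (\<lambda>h. (\<Sum>\<^sub>\<infinity>n. f' n x) * h)) (at x within ?S)"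
  proof (rule has_derivative_sequence)
    show "convex ?S" by simp
    show "((\<lambda>x. \<Sum>n=-int N..int N. f n x) has_derivative (\<lambda>h. (\<Sum>n=-int N..int N. f' n x) * h)) (at x within ?S)"
      if "x \<in> ?S" for N x
    proof -
      have "((\<lambda>x. \<Sum>n=-int N..int N. f n x) has_real_derivative (\<Sum>n=-int N..int N. f' n x)) (at x)"
        by (intro DERIV_sum der) (use that in auto)
      then have "((\<lambda>x. \<Sum>n=-int N..int N. f n x) has_derivative (\<lambda>h. (\<Sum>n=-int N..int N. f' n x) * h)) (at x)"
        by (simp add: has_field_derivative_def)
      then show ?thesis by (rule has_derivative_at_withinI)
    qed
    show "\<forall>\<^sub>F N in sequentially. \<forall>x\<in>?S. \<forall>h. norm ((\<Sum>n=-int N..int N. f' n x) * h - (\<Sum>\<^sub>\<infinity>n. f' n x) * h) \<le> e * norm h"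
      if "0 < e" for e
    proof -
      have "(\<lambda>N. \<Sum>n=-int N..int N. M n) \<longlonglongrightarrow> infsum M UNIV" by (rule symmetric_sums_tendsto[OF M])
      then have "\<forall>\<^sub>F N in sequentially. dist (\<Sum>n=-int N..int N. M n) (infsum M UNIV) < e"
        using that by (rule tendstoD)
      then show ?thesis
      proof (rule eventually_mono, intro ballI allI)
        fix N x h assume N: "dist (\<Sum>n=-int N..int N. M n) (infsum M UNIV) < e" and x: "x \<in> ?S"
        have "norm ((\<Sum>\<^sub>\<infinity>n. f' n x) - (\<Sum>n=-int N..int N. f' n x)) \<le> infsum M UNIV - (\<Sum>n=-int N..int N. M n)"
          by (rule infsum_tail_bound) (use bnd x M in auto)
        also have "\<dots> \<le> e" using N unfolding dist_real_def by linarith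
        finally have "\<bar>(\<Sum>n=-int N..int N. f' n x) - (\<Sum>\<^sub>\<infinity>n. f' n x)\<bar> * \<bar>h\<bar> \<le> e * \<bar>h\<bar>"
          by (intro mult_right_mono) (auto simp: abs_minus_commute)
        then show "norm ((\<Sum>n=-int N..int N. f' n x) * h - (\<Sum>\<^sub>\<infinity>n. f' n x) * h) \<le> e * norm h"
          by (simp add: left_diff_distrib[symmetric] abs_mult)
      qed
    qed
    show "t \<in> ?S" using t by simp
    show "(\<lambda>N. \<Sum>n=-int N..int N. f n t) \<longlonglongrightarrow> (\<Sum>\<^sub>\<infinity>n. f n t)" by (rule symmetric_sums_tendsto[OF sf[OF t]])
  qed
  then obtain g where gg: "\<forall>x\<in>?S. (\<lambda>N. \<Sum>n=-int N..int N. f n x) \<longlonglongrightarrow> g x \<and>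
      (g has_derivative (\<lambda>h. (\<Sum>\<^sub>\<infinity>n. f' n x) * h)) (at x within ?S)" by blast
  then have g: "\<And>x. x \<in> ?S \<Longrightarrow> (\<lambda>N. \<Sum>n=-int N..int N. f n x) \<longlonglongrightarrow> g x" by blast
  have g': "(g has_derivative (\<lambda>h. (\<Sum>\<^sub>\<infinity>n. f' n t) * h)) (at t within ?S)"
    using bspec[OF gg, of t] t by simp
  have "g x = (\<Sum>\<^sub>\<infinity>n. f n x)" if "x \<in> ?S" for x
    using LIMSEQ_unique[OF g[OF that] symmetric_sums_tendsto[OF sf]] that by simp
  then have "((\<lambda>t. \<Sum>\<^sub>\<infinity>n. f n t) has_derivative (\<lambda>h. (\<Sum>\<^sub>\<infinity>n. f' n t) * h)) (at t within ?S)"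
    using t by (intro has_derivative_transform[OF _ _ g']) auto
  moreover have "at t within ?S = at t" using t by (intro at_within_open) auto
  ultimately show ?thesis unfolding has_field_derivative_def by simp
qed

section \<open>The Burgers flow with bounded feedback in sequence space\<close>

text \<open>With \<open>x = - n\<close>, \<open>y = k\<close>, \<open>z = n - k\<close> the triple sum is that of \<open>- x c\<^sub>x c\<^sub>y c\<^sub>z\<close> over
  \<open>x + y + z = 0\<close>; averaging over permutations replaces the factor \<open>x\<close> by \<open>(x + y + z) / 3 = 0\<close>.\<close>

lemma cubic_cancellation:
  assumes C: "0 \<le> C" and c: "\<And>n. cmod (cf c n) \<le> C * jb n powr (- 2)"
  shows "(\<lambda>n. of_int n * cnj (cf c n) * conv c c n) summable_on UNIV"
    and "(\<Sum>\<^sub>\<infinity>n. of_int n * cnj (cf c n) * conv c c n) = 0"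
proof -
  define P where "P = (\<lambda>(n, k). cf c (- n) * cf c k * cf c (n - k))"
  define X where "X = (\<lambda>(n, k). of_int n * P (n, k))"
  \<comment> \<open>Rearranging the double sum requires absolute convergence. The factor
    \<open>n\<close> leaves order 1 of the decay in \<open>n\<close>; order 3/2 is kept in
    \<open>k\<close>, and a further 1/2 from each of \<open>k\<close> and \<open>n - k\<close> is
    moved to \<open>n\<close>, which reaches order 3/2 as well.\<close>
  have bnd: "norm (X x) \<le> C ^ 3 * (jb (fst x) powr (- 3 / 2) * jb (snd x) powr (- 3 / 2))" for x
  proof (cases x)
    case (Pair n k)
    have "norm (X x) \<le> jb n powr 1 * ((C * jb n powr (- 2)) * (C * jb k powr (- 2)) * (C * jb (n - k) powr (- 2)))"
      unfolding Pair X_def P_def prod.case norm_mult using C jb_pos[of n] c[of "- n"]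
      by (intro mult_mono c) (auto simp: jb_def)
    also have "\<dots> = C ^ 3 * ((jb n powr 1 * jb n powr (- 2)) * (jb k powr (- 2) * jb (n - k) powr (- 2)))"
      by (simp add: power3_eq_cube)
    also have "jb n powr 1 * jb n powr (- 2) = jb n powr (- 1)" by (simp only: powr_add[symmetric]) simp
    finally have b: "norm (X x) \<le> C ^ 3 * (jb n powr (- 1) * (jb k powr (- 2) * jb (n - k) powr (- 2)))" .
    have "jb k powr (- 2) * jb (n - k) powr (- 2)
        \<le> (jb k powr (- 3 / 2) * jb k powr (- 1 / 2)) * (jb (n - k) powr (- 1 / 2) * 1)"
    proof -
      have "jb (n - k) powr (- 2) \<le> jb (n - k) powr (- 1 / 2)" by (rule jb_powr_le) simp
      moreover have "jb k powr (- 3 / 2) * jb k powr (- 1 / 2) = jb k powr (- 2)" by (simp add: powr_add[symmetric])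
      ultimately show ?thesis by (simp add: mult_left_mono)
    qed
    also have "\<dots> = jb k powr (- 3 / 2) * (jb k * jb (n - k)) powr (- 1 / 2)"
      using jb_pos[of k] jb_pos[of "n - k"] by (simp add: powr_mult)
    also have "\<dots> \<le> jb k powr (- 3 / 2) * jb n powr (- 1 / 2)"
      using jb_mult[of n k] jb_pos[of n] by (intro mult_left_mono powr_mono2') auto
    finally have "norm (X x) \<le> C ^ 3 * (jb n powr (- 1) * (jb k powr (- 3 / 2) * jb n powr (- 1 / 2)))"
      by (intro order_trans[OF b] mult_left_mono) (use C in auto)
    moreover have "jb n powr (- 1) * jb n powr (- 1 / 2) = jb n powr (- 3 / 2)" by (simp only: powr_add[symmetric]) simp
    ultimately show ?thesis using Pair by (metis fst_conv mult.assoc mult.commute snd_conv)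
  qed
  have "(\<lambda>x :: int \<times> int. jb (fst x) powr (- 3 / 2) * jb (snd x) powr (- 3 / 2)) summable_on (UNIV \<times> UNIV)"
  proof (rule summable_on_SigmaI)
    show "((\<lambda>k. jb (fst (n, k)) powr (- 3 / 2) * jb (snd (n, k)) powr (- 3 / 2)) has_sum jb n powr (- 3 / 2) * JS) UNIV" for n :: int
      unfolding JS_def fst_conv snd_conv by (intro has_sum_cmult_right has_sum_infsum summable_jb)
    show "(\<lambda>n. jb n powr (- 3 / 2) * JS) summable_on UNIV" by (intro summable_on_cmult_left summable_jb)
  qed simp
  then have "(\<lambda>x. C ^ 3 * (jb (fst x) powr (- 3 / 2) * jb (snd x) powr (- 3 / 2))) summable_on (UNIV \<times> UNIV)"
    by (rule summable_on_cmult_right)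
  from summable_on_comparison_test[OF this bnd] have nX: "(\<lambda>x. norm (X x)) summable_on (UNIV \<times> UNIV)" by simp
  have sX: "X summable_on UNIV" using abs_summable_summable[OF nX] by simp
  \<comment> \<open>The substitutions exchange \<open>- n\<close> with \<open>k\<close> and
    \<open>- n\<close> with \<open>n - k\<close>. The product \<open>P\<close> is invariant under
    both, while the factor \<open>n\<close> becomes \<open>- k\<close> and \<open>k - n\<close>, and
    the three factors add up to 0.\<close>
  have P: "P (- k, - n) = P (n, k)" "P (k - n, k) = P (n, k)" for n k by (simp_all add: P_def)
  have i1: "infsum (\<lambda>x. X (- snd x, - fst x)) UNIV = infsum X UNIV"
    by (rule infsum_reindex_bij_betw[of "\<lambda>x. (- snd x, - fst x)" UNIV UNIV X])
       (rule bij_betwI[where g="\<lambda>x. (- snd x, - fst x)"], auto)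
  have s1: "(\<lambda>x. X (- snd x, - fst x)) summable_on UNIV"
    by (subst summable_on_reindex_bij_betw[of "\<lambda>x. (- snd x, - fst x)" UNIV UNIV X])
       (rule bij_betwI[where g="\<lambda>x. (- snd x, - fst x)"], auto intro: sX)
  have i2: "infsum (\<lambda>x. X (snd x - fst x, snd x)) UNIV = infsum X UNIV"
    by (rule infsum_reindex_bij_betw[of "\<lambda>x. (snd x - fst x, snd x)" UNIV UNIV X])
       (rule bij_betwI[where g="\<lambda>x. (snd x - fst x, snd x)"], auto)
  have s2: "(\<lambda>x. X (snd x - fst x, snd x)) summable_on UNIV"
    by (subst summable_on_reindex_bij_betw[of "\<lambda>x. (snd x - fst x, snd x)" UNIV UNIV X])
       (rule bij_betwI[where g="\<lambda>x. (snd x - fst x, snd x)"], auto intro: sX)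
  have "X x + X (- snd x, - fst x) + X (snd x - fst x, snd x) = 0" for x
    by (cases x) (simp add: X_def P algebra_simps)
  then have "infsum (\<lambda>x. X x + X (- snd x, - fst x) + X (snd x - fst x, snd x)) UNIV = 0" by simp
  then have "3 * infsum X UNIV = 0"
    by (simp add: infsum_add sX s1 s2 summable_on_add i1 i2)
  then have X0: "infsum X (UNIV \<times> UNIV) = 0" by simp
  have inner: "(\<Sum>\<^sub>\<infinity>k. X (n, k)) = of_int n * cnj (cf c n) * conv c c n" for n
    unfolding X_def P_def conv_def prod.case infsum_cmult_right'[symmetric] by (simp add: cf_minus mult.assoc)
  have sX': "X summable_on (UNIV \<times> UNIV)" using sX by simp
  show "(\<lambda>n. of_int n * cnj (cf c n) * conv c c n) summable_on UNIV"
    unfolding inner[symmetric] by (rule summable_on_Sigma_banach[where f="\<lambda>n k. X (n, k)"]) (use sX' in simp)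
  show "(\<Sum>\<^sub>\<infinity>n. of_int n * cnj (cf c n) * conv c c n) = 0"
    unfolding inner[symmetric] infsum_Sigma_banach[OF sX'] by (rule X0)
qed

text \<open>Coefficients of order 2 have a convolution of order 5/4, enough to absorb one
  derivative.\<close>

lemma jb_mult_conv_bound:
  assumes C: "0 \<le> C" and c: "\<And>n. cmod (cf c n) \<le> C * jb n powr (- 2)"
  shows "jb n * cmod (conv c c n) \<le> C\<^sup>2 * JS"
proof -
  have "jb n * cmod (conv c c n) \<le> jb n powr 1 * (C\<^sup>2 * JS * jb n powr (- (2 - 3 / 4)))"
    using jb_pos[of n] conv_decay[OF _ C c, of n] by (intro mult_mono) auto
  also have "\<dots> = C\<^sup>2 * JS * (jb n powr 1 * jb n powr (- (2 - 3 / 4)))" by simp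
  also have "\<dots> = C\<^sup>2 * JS * jb n powr (- 1 / 4)" by (simp only: powr_add[symmetric]) simp
  also have "\<dots> \<le> C\<^sup>2 * JS * jb n powr 0" using JS_ge1 by (intro mult_left_mono jb_powr_le) auto
  finally show ?thesis using jb_pos[of n] by simp
qed

text \<open>The cubic cancellation survives multiplication by a scalar depending on time, so the
  factor \<open>r\<close> covers the equation and its truncation at once. Termwise differentiation
  is justified at positive times only, where smoothing supplies a summable majorant.\<close>

lemma energy_derivative:
  assumes c: "heat_flow c G"
    and G: "\<And>t n. 0 \<le> t \<Longrightarrow> t \<le> T \<Longrightarrow>
      G t n = of_real (r t) * (- (\<i> * of_int n / 2) * conv (c t) (c t) n) + h t n"
    and r: "\<And>t. 0 \<le> t \<Longrightarrow> t \<le> T \<Longrightarrow> \<bar>r t\<bar> \<le> 1"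
    and h: "\<And>t n. 0 \<le> t \<Longrightarrow> t \<le> T \<Longrightarrow> cmod (h t n) \<le> B" and t: "0 < t" "t < T"
  shows "\<exists>C\<ge>0. \<forall>n. cmod (cf (c t) n) \<le> C * jb n powr (- 2)"
    and "(\<lambda>n. - 2 * (real_of_int n)\<^sup>2 * (cmod (cf (c t) n))\<^sup>2 + 2 * Re (cnj (cf (c t) n) * h t n)) summable_on UNIV"
    and "((\<lambda>s. (norm (c s))\<^sup>2) has_real_derivative
      (\<Sum>\<^sub>\<infinity>n. - 2 * (real_of_int n)\<^sup>2 * (cmod (cf (c t) n))\<^sup>2 + 2 * Re (cnj (cf (c t) n) * h t n))) (at t)"
proof -
  have B: "0 \<le> B" using h[of 0 0] t norm_ge_zero order_trans by (metis less_imp_le order_refl)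
  have Gb: "cmod (G s n) \<le> B + \<bar>real_of_int n\<bar> * cmod (conv (c s) (c s) n)" if s: "0 \<le> s" "s \<le> T" for s n
  proof -
    have "cmod (G s n) \<le> \<bar>r s\<bar> * (\<bar>real_of_int n\<bar> / 2 * cmod (conv (c s) (c s) n)) + B"
      unfolding G[OF s] by (rule order_trans[OF norm_triangle_ineq]) (use h[OF s] in \<open>auto simp: norm_mult norm_divide\<close>)
    also have "\<bar>r s\<bar> * (\<bar>real_of_int n\<bar> / 2 * cmod (conv (c s) (c s) n)) \<le> 1 * (\<bar>real_of_int n\<bar> * cmod (conv (c s) (c s) n))"
      using r[OF s] by (intro mult_mono) (auto intro!: mult_nonneg_nonneg mult_right_mono)
    finally show ?thesis by simp
  qed
  \<comment> \<open>Smoothing holds from any positive time on; half of \<open>t\<close> leaves a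
    neighbourhood of \<open>t\<close> inside its range.\<close>
  define a where "a = t / 2"
  have a: "0 < a" "a < t" using t by (auto simp: a_def)
  obtain C where C: "0 \<le> C" "\<And>s n. a \<le> s \<Longrightarrow> s \<le> T \<Longrightarrow> cmod (cf (c s) n) \<le> C * jb n powr (- 2)"
    using heat_flow_smoothing[OF c B Gb a(1)] by blast
  have Ct: "cmod (cf (c t) n) \<le> C * jb n powr (- 2)" for n using C(2)[of t n] a t by simp
  then show "\<exists>C\<ge>0. \<forall>n. cmod (cf (c t) n) \<le> C * jb n powr (- 2)" using C(1) by blast
  define K where "K = C\<^sup>2 * JS"
  have K: "0 \<le> K" using JS_ge1 by (simp add: K_def)
  have Gb': "cmod (G s n) \<le> B + K" if s: "a \<le> s" "s \<le> T" for s n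
  proof -
    have "\<bar>real_of_int n\<bar> * cmod (conv (c s) (c s) n) \<le> jb n * cmod (conv (c s) (c s) n)"
      by (intro mult_right_mono) (auto simp: jb_def)
    also have "\<dots> \<le> K" unfolding K_def by (rule jb_mult_conv_bound[OF C(1) C(2)[OF s]])
    finally show ?thesis using Gb[of s n] s a by simp
  qed
  have n2: "(real_of_int n)\<^sup>2 * cmod (cf (c s) n) \<le> C" if s: "a \<le> s" "s \<le> T" for s n
  proof -
    have "(real_of_int n)\<^sup>2 * cmod (cf (c s) n) \<le> (jb n)\<^sup>2 * (C * jb n powr (- 2))"
      using jb_sq_ge[of n] by (intro mult_mono C(2)[OF s]) auto
    also have "\<dots> = C" using jb_pos[of n] by (simp add: powr_minus field_simps)
    finally show ?thesis .
  qed
  \<comment> \<open>Majorant of the derivative of the squared modulus: the coefficient has order 2,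
    and its time derivative is bounded by \<open>C\<close> for the Laplacian plus
    \<open>B + K\<close> for the source.\<close>
  define M where "M n = 2 * ((C * jb n powr (- 2)) * (C + B + K))" for n
  have Ms: "M summable_on UNIV"
    unfolding M_def by (intro summable_on_cmult_right summable_on_cmult_left jb_powr_summable) simp
  define f' where "f' n s = 2 * Re (cnj (cf (c s) n) * (- of_real ((real_of_int n)\<^sup>2) * cf (c s) n + G s n))" for n s
  have d: "((\<lambda>s. \<Sum>\<^sub>\<infinity>n. (cmod (cf (c s) n))\<^sup>2) has_real_derivative (\<Sum>\<^sub>\<infinity>n. f' n t)) (at t)"
  proof (rule DERIV_infsum[OF _ _ Ms _ a(2) t(2)])
    fix n s assume s: "a < s" "s < T"
    have "((\<lambda>s. cf (c s) n \<bullet> cf (c s) n) has_vector_derivative f' n s) (at s)"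
      by (rule has_vector_derivative_eq_rhs,
          rule bounded_bilinear.has_vector_derivative[OF bounded_bilinear_inner
            heat_flow_derivative_at[OF c] heat_flow_derivative_at[OF c]])
         (use s a in \<open>auto simp: f'_def inner_complex_def algebra_simps\<close>)
    then show "((\<lambda>s. (cmod (cf (c s) n))\<^sup>2) has_real_derivative f' n s) (at s)"
      by (simp add: has_real_derivative_iff_has_vector_derivative dot_square_norm)
    have "\<bar>f' n s\<bar> \<le> 2 * (cmod (cf (c s) n) * cmod (- of_real ((real_of_int n)\<^sup>2) * cf (c s) n + G s n))"
      unfolding f'_def abs_mult
      using abs_Re_le_cmod[of "cnj (cf (c s) n) * (- of_real ((real_of_int n)\<^sup>2) * cf (c s) n + G s n)"]
      by (simp add: norm_mult)
    also have "\<dots> \<le> M n"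
      unfolding M_def
    proof (intro mult_left_mono mult_mono)
      have "cmod (- of_real ((real_of_int n)\<^sup>2) * cf (c s) n + G s n) \<le> (real_of_int n)\<^sup>2 * cmod (cf (c s) n) + cmod (G s n)"
        by (rule order_trans[OF norm_triangle_ineq]) (simp add: norm_mult norm_power)
      then show "cmod (- of_real ((real_of_int n)\<^sup>2) * cf (c s) n + G s n) \<le> C + B + K"
        using n2[of s n] Gb'[of s n] s by simp
    qed (use C s in auto)
    finally show "\<bar>f' n s\<bar> \<le> M n" .
  qed (rule cf_summable)
  let ?X = "\<lambda>n. - 2 * (real_of_int n)\<^sup>2 * (cmod (cf (c t) n))\<^sup>2 + 2 * Re (cnj (cf (c t) n) * h t n)"
  let ?Y = "\<lambda>n. of_int n * cnj (cf (c t) n) * conv (c t) (c t) n"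
  have bX: "norm (?X n) \<le> M n" for n
  proof -
    have "\<bar>2 * Re (cnj (cf (c t) n) * h t n)\<bar> \<le> 2 * (cmod (cf (c t) n) * cmod (h t n))"
      unfolding abs_mult using abs_Re_le_cmod[of "cnj (cf (c t) n) * h t n"] by (simp add: norm_mult)
    also have "\<dots> \<le> 2 * (cmod (cf (c t) n) * B)" using h[of t n] t by (intro mult_left_mono) auto
    finally have 1: "\<bar>2 * Re (cnj (cf (c t) n) * h t n)\<bar> \<le> 2 * (cmod (cf (c t) n) * B)" .
    have 2: "\<bar>- 2 * (real_of_int n)\<^sup>2 * (cmod (cf (c t) n))\<^sup>2\<bar> \<le> 2 * (cmod (cf (c t) n) * C)"
      using mult_left_mono[OF n2[of t n], of "cmod (cf (c t) n)"] a t by (simp add: abs_mult power2_eq_square mult_ac)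
    have "norm (?X n) \<le> 2 * (cmod (cf (c t) n) * C) + 2 * (cmod (cf (c t) n) * B)"
      using 1 2 abs_triangle_ineq[of "- 2 * (real_of_int n)\<^sup>2 * (cmod (cf (c t) n))\<^sup>2" "2 * Re (cnj (cf (c t) n) * h t n)"]
      unfolding real_norm_def by linarith
    also have "\<dots> = 2 * (cmod (cf (c t) n) * (C + B))" by (simp add: algebra_simps)
    also have "\<dots> \<le> M n" unfolding M_def using Ct K B C by (intro mult_left_mono mult_mono) auto
    finally show ?thesis .
  qed
  have nX: "(\<lambda>n. norm (?X n)) summable_on UNIV" by (rule summable_on_comparison_test[OF Ms bX]) simp
  then show sX: "?X summable_on UNIV" by (rule abs_summable_summable)
  note Y = cubic_cancellation[OF C(1) Ct]
  have sZ: "(\<lambda>n. r t * Im (?Y n)) summable_on UNIV" by (intro summable_on_cmult_right summable_on_Im Y)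
  \<comment> \<open>The quadratic term contributes \<open>r t\<close> times the imaginary part of
    the cubic sum, which vanishes.\<close>
  have "(\<Sum>\<^sub>\<infinity>n. f' n t) = (\<Sum>\<^sub>\<infinity>n. ?X n + r t * Im (?Y n))"
  proof (rule infsum_cong)
    fix n
    have 1: "2 * Re (cnj z * (- of_real x * z)) = - 2 * x * (cmod z)\<^sup>2" for z x
      unfolding cmod_power2 by (simp add: power2_eq_square algebra_simps)
    have 2: "G t n = of_real (r t) * (- (\<i> * of_int n / 2) * conv (c t) (c t) n) + h t n"
      using G t by simp
    have 3: "2 * Re (z * (of_real x * (- (\<i> * of_int n / 2) * w))) = x * Im (of_int n * z * w)" for z w x
      by (simp add: field_simps)
    show "f' n t = ?X n + r t * Im (?Y n)"
      by (simp only: f'_def 2 distrib_left plus_complex.sel 1 3 add_ac)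
  qed
  also have "\<dots> = infsum ?X UNIV + infsum (\<lambda>n. r t * Im (?Y n)) UNIV" by (rule infsum_add[OF sX sZ])
  also have "infsum (\<lambda>n. r t * Im (?Y n)) UNIV = 0" by (simp add: infsum_cmult_right' infsum_Im Y del: Im_complex_of_real mult_eq_0_iff times_complex.sel)
  finally show "((\<lambda>s. (norm (c s))\<^sup>2) has_real_derivative infsum ?X UNIV) (at t)"
    using d by (simp add: norm_ell2_sq)
qed

subsection \<open>Global existence and uniqueness\<close>

text \<open>Gronwall's inequality in a form that serves both signs of \<open>k\<close>: growth in
  the global existence proof, decay in the stabilization.\<close>

lemma nonincreasing_exp_weight:
  fixes E :: "real \<Rightarrow> real"
  assumes "0 \<le> t" and cont: "continuous_on {0..t} E"
    and der: "\<And>s. 0 < s \<Longrightarrow> s < t \<Longrightarrow> \<exists>D. (E has_real_derivative D) (at s) \<and> D \<le> k * E s"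
  shows "E t \<le> exp (k * t) * E 0"
proof -
  have "exp (- k * 0) * E 0 \<ge> exp (- k * t) * E t"
  proof (rule DERIV_nonpos_imp_decreasing_open[OF assms(1)])
    show "continuous_on {0..t} (\<lambda>s. exp (- k * s) * E s)" by (intro continuous_intros cont)
    fix s assume s: "0 < s" "s < t"
    obtain D where D: "(E has_real_derivative D) (at s)" "D \<le> k * E s" using der[OF s] by blast
    have "((\<lambda>s. exp (- k * s) * E s) has_real_derivative exp (- k * s) * (D - k * E s)) (at s)"
      by (rule derivative_eq_intros D refl)+ (simp add: algebra_simps)
    moreover have "exp (- k * s) * (D - k * E s) \<le> 0" using D(2) by (simp add: mult_le_0_iff)
    ultimately show "\<exists>y. ((\<lambda>s. exp (- k * s) * E s) has_real_derivative y) (at s) \<and> y \<le> 0" by blast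
  qed
  then have "exp (k * t) * (exp (- k * t) * E t) \<le> exp (k * t) * E 0" by (intro mult_left_mono) auto
  then show ?thesis by (simp add: mult.assoc[symmetric] exp_add[symmetric])
qed

text \<open>Scaling factor of the radial retraction onto the ball of radius \<open>R\<close>.
  Truncating by a scalar leaves a multiple of the original quadratic term, so that the truncated
  term still does no work.\<close>

definition radial_factor :: "real \<Rightarrow> ell2 \<Rightarrow> real" where
  "radial_factor R c = (if norm c \<le> R then 1 else R / norm c)"

lemma radial_factor_bounds: "0 \<le> R \<Longrightarrow> 0 \<le> radial_factor R c \<and> radial_factor R c \<le> 1"
  by (auto simp: radial_factor_def divide_le_eq_1)

lemma radial_factor_norm: "0 \<le> R \<Longrightarrow> norm (radial_factor R c *\<^sub>R c) \<le> R"
  by (auto simp: radial_factor_def)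

text \<open>For \<open>norm c \<le> norm d\<close> the difference splits into the factor of
  \<open>c\<close> times \<open>c - d\<close>, and the difference of the factors times
  \<open>d\<close>. Each part is at most \<open>norm (c - d)\<close>.\<close>

lemma radial_factor_Lipschitz:
  assumes R: "0 \<le> R"
  shows "norm (radial_factor R c *\<^sub>R c - radial_factor R d *\<^sub>R d) \<le> 2 * norm (c - d)"
proof -
  have *: "norm (radial_factor R c *\<^sub>R c - radial_factor R d *\<^sub>R d) \<le> 2 * norm (c - d)"
    if cd: "norm c \<le> norm d" for c d
  proof -
    have "\<bar>radial_factor R c - radial_factor R d\<bar> * norm d \<le> norm d - norm c"
    proof (cases "norm d \<le> R")
      case True then show ?thesis using cd by (simp add: radial_factor_def)
    next
      case d: False
      show ?thesis
      proof (cases "norm c \<le> R")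
        case True
        moreover have "R / norm d \<le> 1" using d R by (auto simp: divide_le_eq_1)
        then have "\<bar>1 - R / norm d\<bar> = 1 - R / norm d" by simp
        moreover have "(1 - R / norm d) * norm d = norm d - R" using d R by (auto simp: field_simps)
        ultimately show ?thesis using d by (simp add: radial_factor_def)
      next
        case False
        then have c: "0 < norm c" "R < norm c" using R by linarith+
        have "R / norm d \<le> R / norm c" by (intro divide_left_mono mult_pos_pos) (use c cd R in linarith)+
        then have "\<bar>R / norm c - R / norm d\<bar> * norm d = (R / norm c - R / norm d) * norm d" by simp
        also have "\<dots> = R / norm c * (norm d - norm c)" using c cd by (cases "d = 0") (auto simp: field_simps)
        also have "\<dots> \<le> 1 * (norm d - norm c)" using c cd by (intro mult_right_mono) auto
        finally show ?thesis using False d by (simp add: radial_factor_def)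
      qed
    qed
    also have "\<dots> \<le> norm (c - d)" using norm_triangle_ineq2[of d c] by (simp add: norm_minus_commute)
    finally have 1: "norm ((radial_factor R c - radial_factor R d) *\<^sub>R d) \<le> norm (c - d)" by simp
    have 2: "norm (radial_factor R c *\<^sub>R (c - d)) \<le> norm (c - d)"
      using radial_factor_bounds[OF R, of c] by (simp add: mult_left_le_one_le)
    have "radial_factor R c *\<^sub>R c - radial_factor R d *\<^sub>R d
        = radial_factor R c *\<^sub>R (c - d) + (radial_factor R c - radial_factor R d) *\<^sub>R d"
      by (simp add: algebra_simps)
    then show ?thesis using 1 2 norm_triangle_ineq[of "radial_factor R c *\<^sub>R (c - d)"
        "(radial_factor R c - radial_factor R d) *\<^sub>R d"] by simp
  qed
  show ?thesis using *[of c d] *[of d c] by (metis linorder_linear norm_minus_commute)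
qed

locale feedback =
  fixes p q :: "int \<Rightarrow> complex" and k1 k2 :: "ell2 \<Rightarrow> real" and A :: real
  assumes p_minus: "p (- n) = cnj (p n)" and q_minus: "q (- n) = cnj (q n)"
    and p_bound: "cmod (p n) \<le> A" and q_bound: "cmod (q n) \<le> A"
    and k1: "bounded_linear k1" and k2: "bounded_linear k2"
begin

definition control :: "ell2 \<Rightarrow> int \<Rightarrow> complex" where
  "control c n = of_real (k1 c) * p n + of_real (k2 c) * q n"

definition force :: "ell2 \<Rightarrow> int \<Rightarrow> complex" where
  "force c n = - (\<i> * of_int n / 2) * conv c c n + control c n"

definition flow :: "(real \<Rightarrow> ell2) \<Rightarrow> bool" where
  "flow c \<longleftrightarrow> heat_flow c (\<lambda>t. force (c t))"

lemma A_nonneg: "0 \<le> A" using p_bound[of 0] norm_ge_zero order_trans by blast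

lemma control_diff: "control c n - control d n = control (c - d) n"
  by (simp add: control_def linear_diff[OF bounded_linear.linear[OF k1]] linear_diff[OF bounded_linear.linear[OF k2]] algebra_simps)

lemma control_bound: "\<exists>Q\<ge>0. \<forall>c n. cmod (control c n) \<le> Q * norm c"
proof -
  obtain B1 where B1: "0 \<le> B1" "\<And>c. norm (k1 c) \<le> norm c * B1" using bounded_linear.nonneg_bounded[OF k1] by blast
  obtain B2 where B2: "0 \<le> B2" "\<And>c. norm (k2 c) \<le> norm c * B2" using bounded_linear.nonneg_bounded[OF k2] by blast
  have "cmod (control c n) \<le> ((B1 + B2) * A) * norm c" for c n
  proof -
    have "cmod (control c n) \<le> \<bar>k1 c\<bar> * cmod (p n) + \<bar>k2 c\<bar> * cmod (q n)"
      unfolding control_def by (rule order_trans[OF norm_triangle_ineq]) (simp add: norm_mult)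
    also have "\<dots> \<le> (norm c * B1) * A + (norm c * B2) * A"
      using B1 B2 by (intro add_mono mult_mono p_bound q_bound) auto
    finally show ?thesis by (simp add: algebra_simps)
  qed
  then show ?thesis using B1 B2 A_nonneg by (intro exI[of _ "(B1 + B2) * A"]) auto
qed

definition Q :: real where "Q = (SOME Q. Q \<ge> 0 \<and> (\<forall>c n. cmod (control c n) \<le> Q * norm c))"

lemma Q: "0 \<le> Q" "cmod (control c n) \<le> Q * norm c"
  using someI_ex[of "\<lambda>Q. Q \<ge> 0 \<and> (\<forall>c n. cmod (control c n) \<le> Q * norm c)"] control_bound
  by (auto simp: Q_def)

lemma control_minus: "control c (- n) = cnj (control c n)"
  by (simp add: control_def p_minus q_minus)

lemma quadratic_Lipschitz:
  assumes "norm c \<le> M" "norm d \<le> M"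
  shows "cmod (- (\<i> * of_int n / 2) * conv c c n - - (\<i> * of_int n / 2) * conv d d n) \<le> M * jb n * norm (c - d)"
proof -
  have "- (\<i> * of_int n / 2) * conv c c n - - (\<i> * of_int n / 2) * conv d d n
      = - (\<i> * of_int n / 2) * (conv c c n - conv d d n)" by (simp add: algebra_simps)
  then have "cmod (- (\<i> * of_int n / 2) * conv c c n - - (\<i> * of_int n / 2) * conv d d n)
      = \<bar>real_of_int n\<bar> / 2 * cmod (conv c c n - conv d d n)" by (simp add: norm_mult norm_divide)
  also have "\<dots> \<le> jb n / 2 * ((M + M) * norm (c - d))"
  proof (rule mult_mono)
    show "cmod (conv c c n - conv d d n) \<le> (M + M) * norm (c - d)"
      by (rule order_trans[OF conv_quad_diff]) (use assms in \<open>auto intro!: mult_right_mono\<close>)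
  qed (use jb_pos[of n] in \<open>auto simp: jb_def\<close>)
  finally show ?thesis by (simp add: algebra_simps)
qed

lemma control_Lipschitz: "cmod (control c n - control d n) \<le> Q * jb n * norm (c - d)"
proof -
  have "cmod (control c n - control d n) \<le> Q * norm (c - d)" unfolding control_diff by (rule Q)
  also have "\<dots> \<le> Q * jb n * norm (c - d)"
    using mult_left_mono[OF jb_ge1[of n] Q(1)] by (intro mult_right_mono) auto
  finally show ?thesis .
qed

text \<open>The constant grows with the radius of the ball; this is what forces the detour through a
  truncation in the existence proof.\<close>

lemma force_Lipschitz:
  assumes "norm c \<le> M" "norm d \<le> M"
  shows "cmod (force c n - force d n) \<le> (M + Q) * jb n * norm (c - d)"
proof -
  have "force c n - force d n = (- (\<i> * of_int n / 2) * conv c c n - - (\<i> * of_int n / 2) * conv d d n)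
      + (control c n - control d n)" by (simp add: force_def)
  then show ?thesis
    using norm_triangle_le[OF add_mono[OF quadratic_Lipschitz[OF assms, of n] control_Lipschitz[of c n d]]]
    by (simp add: distrib_right)
qed

lemma flow_continuous: "flow c \<Longrightarrow> continuous_on {0..} c"
  by (simp add: flow_def heat_flow_def)

text \<open>On a compact time interval both curves stay in a ball, where the force is
  Lipschitz.\<close>

theorem flow_unique:
  assumes c: "flow c" and d: "flow d" and "c 0 = d 0" "0 \<le> t"
  shows "c t = d t"
proof -
  obtain M1 where M1: "0 \<le> M1" "\<And>s. 0 \<le> s \<Longrightarrow> s \<le> t \<Longrightarrow> norm (c s) \<le> M1"
    using heat_flow_bounded c unfolding flow_def by metis
  obtain M2 where M2: "0 \<le> M2" "\<And>s. 0 \<le> s \<Longrightarrow> s \<le> t \<Longrightarrow> norm (d s) \<le> M2"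
    using heat_flow_bounded d unfolding flow_def by metis
  show ?thesis
  proof (rule heat_flow_unique[OF c[unfolded flow_def] d[unfolded flow_def] assms(3), where L="M1 + M2 + Q" and T=t])
    show "0 \<le> M1 + M2 + Q" using M1 M2 Q(1) by simp
    fix s n assume "0 \<le> s" "s \<le> t"
    then show "cmod (force (c s) n - force (d s) n) \<le> (M1 + M2 + Q) * jb n * norm (c s - d s)"
      using M1(1) M2(1) M1(2)[of s] M2(2)[of s] by (intro force_Lipschitz) auto
  qed (use assms(4) in auto)
qed

definition growth :: real where "growth = 1 + 2 * Q\<^sup>2 * JS"

text \<open>Since the control coefficients are not square summable, Young's inequality is applied
  with the weights \<open>jb n\<close> and \<open>1 / jb n\<close>: half of the dissipation absorbs
  the first square up to \<open>(norm c)\<^sup>2\<close>, and the second is summable over the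
  modes.\<close>

lemma energy_rate:
  assumes "\<And>n. cmod (h n) \<le> Q * norm c"
    and s: "(\<lambda>n. - 2 * (real_of_int n)\<^sup>2 * (cmod (cf c n))\<^sup>2 + 2 * Re (cnj (cf c n) * h n)) summable_on UNIV"
  shows "(\<Sum>\<^sub>\<infinity>n. - 2 * (real_of_int n)\<^sup>2 * (cmod (cf c n))\<^sup>2 + 2 * Re (cnj (cf c n) * h n)) \<le> growth * (norm c)\<^sup>2"
proof -
  have t: "- 2 * (real_of_int n)\<^sup>2 * (cmod (cf c n))\<^sup>2 + 2 * Re (cnj (cf c n) * h n)
      \<le> (cmod (cf c n))\<^sup>2 + (2 * Q\<^sup>2 * (norm c)\<^sup>2) * jb n powr (- 2)" for n
  proof -
    define x y where "x = jb n * cmod (cf c n)" and "y = Q * norm c / jb n"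
    have j: "0 < jb n" by (rule jb_pos)
    have "Re (cnj (cf c n) * h n) \<le> cmod (cf c n) * cmod (h n)"
      using complex_Re_le_cmod[of "cnj (cf c n) * h n"] by (simp add: norm_mult)
    also have "\<dots> \<le> cmod (cf c n) * (Q * norm c)" by (intro mult_left_mono assms) auto
    also have "\<dots> = x * y" using j by (simp add: x_def y_def)
    finally have 1: "2 * Re (cnj (cf c n) * h n) \<le> 2 * (x * y)" by simp
    have 2: "2 * (x * y) \<le> x\<^sup>2 / 2 + 2 * y\<^sup>2"
      using zero_le_power2[of "x - 2 * y"] by (simp add: power2_diff power_mult_distrib field_simps)
    have 3: "x\<^sup>2 \<le> 2 * (1 + (real_of_int n)\<^sup>2) * (cmod (cf c n))\<^sup>2"
      unfolding x_def power_mult_distrib by (intro mult_right_mono jb_sq) auto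
    have 4: "2 * y\<^sup>2 = (2 * Q\<^sup>2 * (norm c)\<^sup>2) * jb n powr (- 2)"
      using j by (simp add: y_def power_divide power_mult_distrib powr_minus divide_inverse power_inverse)
    have 5: "2 * (1 + (real_of_int n)\<^sup>2) * (cmod (cf c n))\<^sup>2 = 2 * (cmod (cf c n))\<^sup>2 + 2 * (real_of_int n)\<^sup>2 * (cmod (cf c n))\<^sup>2"
      by (simp add: algebra_simps)
    show ?thesis using 1 2 3 4 5 zero_le_power2[of "real_of_int n * cmod (cf c n)"]
      unfolding power_mult_distrib by linarith
  qed
  have "(\<Sum>\<^sub>\<infinity>n. - 2 * (real_of_int n)\<^sup>2 * (cmod (cf c n))\<^sup>2 + 2 * Re (cnj (cf c n) * h n))
      \<le> (\<Sum>\<^sub>\<infinity>n. (cmod (cf c n))\<^sup>2 + (2 * Q\<^sup>2 * (norm c)\<^sup>2) * jb n powr (- 2))"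
    by (intro infsum_mono s t summable_on_add cf_summable summable_on_cmult_right jb_powr_summable) auto
  also have "\<dots> = (norm c)\<^sup>2 + (2 * Q\<^sup>2 * (norm c)\<^sup>2) * (\<Sum>\<^sub>\<infinity>n. jb n powr (- 2))"
    unfolding norm_ell2_sq infsum_cmult_right'[symmetric]
    by (rule infsum_add) (auto intro!: cf_summable summable_on_cmult_right jb_powr_summable)
  also have "\<dots> \<le> (norm c)\<^sup>2 + (2 * Q\<^sup>2 * (norm c)\<^sup>2) * JS"
    by (intro add_left_mono mult_left_mono jb_powr_sum_le) auto
  finally show ?thesis by (simp add: growth_def algebra_simps)
qed

section \<open>Global flow by truncation of the quadratic term\<close>

definition tforce :: "real \<Rightarrow> ell2 \<Rightarrow> int \<Rightarrow> complex" where
  "tforce R c n = of_real ((radial_factor R c)\<^sup>2) * (- (\<i> * of_int n / 2) * conv c c n) + control c n"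

lemma tforce_eq_conv:
  "tforce R c n = - (\<i> * of_int n / 2) * conv (radial_factor R c *\<^sub>R c) (radial_factor R c *\<^sub>R c) n + control c n"
  by (simp add: tforce_def conv_scaleR power2_eq_square)

lemma truncated_flow_exists:
  assumes R: "0 \<le> R"
  shows "\<exists>c. heat_flow c (\<lambda>t. tforce R (c t)) \<and> c 0 = c0"
proof (rule heat_flow_exists_Lipschitz[where L="2 * R + Q"])
  show "0 \<le> 2 * R + Q" using R Q(1) by simp
  fix c d :: ell2 and n
  let ?c = "radial_factor R c *\<^sub>R c" and ?d = "radial_factor R d *\<^sub>R d"
  have "cmod (- (\<i> * of_int n / 2) * conv ?c ?c n - - (\<i> * of_int n / 2) * conv ?d ?d n) \<le> R * jb n * norm (?c - ?d)"
    by (rule quadratic_Lipschitz) (simp_all only: radial_factor_norm[OF R])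
  also have "\<dots> \<le> R * jb n * (2 * norm (c - d))"
    using R jb_pos[of n] by (intro mult_left_mono radial_factor_Lipschitz) auto
  finally have 1: "cmod (- (\<i> * of_int n / 2) * conv ?c ?c n - - (\<i> * of_int n / 2) * conv ?d ?d n) \<le> R * jb n * (2 * norm (c - d))" .
  have "tforce R c n - tforce R d n = (- (\<i> * of_int n / 2) * conv ?c ?c n - - (\<i> * of_int n / 2) * conv ?d ?d n)
      + (control c n - control d n)" unfolding tforce_eq_conv by simp
  then have "cmod (tforce R c n - tforce R d n) \<le> R * jb n * (2 * norm (c - d)) + Q * jb n * norm (c - d)"
    using norm_triangle_le[OF add_mono[OF 1 control_Lipschitz[of c n d]]] by (simp only:)
  then show "cmod (tforce R c n - tforce R d n) \<le> (2 * R + Q) * jb n * norm (c - d)"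
    by (simp add: algebra_simps)
next
  show "tforce R 0 n = 0" for n
    by (simp add: tforce_eq_conv conv_def control_def linear_0 bounded_linear.linear k1 k2)
  show "tforce R c (- n) = cnj (tforce R c n)" for c n
    by (simp add: tforce_def conv_minus control_minus)
qed

text \<open>The rate \<open>growth\<close> does not involve \<open>R\<close>. The radius can
  therefore be chosen after the time horizon, so large that the truncation is inactive up to that
  time.\<close>

lemma truncated_flow_bound:
  assumes R: "0 \<le> R" and c: "heat_flow c (\<lambda>t. tforce R (c t))" and t: "0 \<le> t"
  shows "(norm (c t))\<^sup>2 \<le> exp (growth * t) * (norm (c 0))\<^sup>2"
proof (rule nonincreasing_exp_weight[OF t])
  have cc: "continuous_on {0..} c" using c by (simp add: heat_flow_def)
  show "continuous_on {0..t} (\<lambda>t. (norm (c t))\<^sup>2)"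
    by (intro continuous_intros continuous_on_subset[OF cc]) auto
  fix s assume s: "0 < s" "s < t"
  obtain M where M: "0 \<le> M" "\<And>s. 0 \<le> s \<Longrightarrow> s \<le> t \<Longrightarrow> norm (c s) \<le> M"
    using heat_flow_bounded[OF c] by metis
  have h: "cmod (control (c s) n) \<le> Q * M" if "0 \<le> s" "s \<le> t" for s n
    by (rule order_trans[OF Q(2)]) (use M(2)[OF that] Q(1) in \<open>auto intro: mult_left_mono\<close>)
  have r: "\<bar>(radial_factor R (c s))\<^sup>2\<bar> \<le> 1" for s
    using radial_factor_bounds[OF R, of "c s"] by (simp add: power_le_one)
  note e = energy_derivative[OF c tforce_def r h s]
  show "\<exists>D. ((\<lambda>t. (norm (c t))\<^sup>2) has_real_derivative D) (at s) \<and> D \<le> growth * (norm (c s))\<^sup>2"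
    using e(3) energy_rate[OF Q(2) e(2)] by blast
qed

theorem flow_exists: "\<exists>c. flow c \<and> c 0 = c0"
proof -
  \<comment> \<open>The a priori bound on \<open>[0, m]\<close>: up to time \<open>m\<close> the
    flow truncated at \<open>R m\<close> solves the original equation.\<close>
  define R where "R m = sqrt (exp (growth * real m) * (norm c0)\<^sup>2)" for m :: nat
  have R: "0 \<le> R m" for m by (simp add: R_def)
  have g: "0 \<le> growth" using JS_ge1 by (simp add: growth_def)
  obtain u where u: "\<And>m. heat_flow (u m) (\<lambda>t. tforce (R m) (u m t))" "\<And>m. u m 0 = c0"
    using truncated_flow_exists[OF R, of _ c0] by metis
  have ub: "norm (u m t) \<le> R m" if "0 \<le> t" "t \<le> real m" for m t
  proof -
    have "(norm (u m t))\<^sup>2 \<le> exp (growth * t) * (norm c0)\<^sup>2"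
      using truncated_flow_bound[OF R u(1) that(1)] u(2) by simp
    also have "\<dots> \<le> exp (growth * real m) * (norm c0)\<^sup>2"
      using that g by (intro mult_right_mono) (auto intro: mult_left_mono)
    finally show ?thesis unfolding R_def by (simp add: real_le_rsqrt)
  qed
  have tf: "tforce (R m) (u m t) n = force (u m t) n" if "0 \<le> t" "t \<le> real m" for m t n
    using ub[OF that] by (simp add: tforce_def force_def radial_factor_def)
  have eq: "u m t = u k t" if "0 \<le> t" "t \<le> real m" "m \<le> k" for m k t
  proof (rule heat_flow_unique[OF u(1) u(1), where L="R m + R k + Q" and T="real m"])
    show "0 \<le> R m + R k + Q" using R[of m] R[of k] Q(1) by simp
    fix s n assume s: "0 \<le> s" "s \<le> real m"
    have "cmod (force (u m s) n - force (u k s) n) \<le> (R m + R k + Q) * jb n * norm (u m s - u k s)"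
      using ub[of s m] ub[of s k] s that R[of m] R[of k] by (intro force_Lipschitz) auto
    then show "cmod (tforce (R m) (u m s) n - tforce (R k) (u k s) n) \<le> (R m + R k + Q) * jb n * norm (u m s - u k s)"
      using s that by (simp add: tf)
  qed (use that u(2) in auto)
  \<comment> \<open>Any index of at least \<open>t\<close> yields the same value at time
    \<open>t\<close>; rounding up picks one, and near a given time a single larger index represents
    \<open>c\<close>.\<close>
  define c where "c t = u (nat \<lceil>t\<rceil>) t" for t
  have cu: "c t = u m t" if "0 \<le> t" "t \<le> real m" for m t
  proof -
    have "nat \<lceil>t\<rceil> \<le> m" using that by (simp add: ceiling_le_iff nat_le_iff)
    moreover have "t \<le> real (nat \<lceil>t\<rceil>)" using that by (simp add: real_nat_ceiling_ge)
    ultimately show ?thesis unfolding c_def using eq that by blast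
  qed
  have loc: "\<exists>m d. 0 < d \<and> (\<forall>s\<ge>0. dist s t < d \<longrightarrow> u m s = c s) \<and> t \<le> real m" if "0 \<le> t" for t
  proof -
    obtain m where m: "t + 1 \<le> real m" using real_arch_simple by blast
    have "u m s = c s" if "0 \<le> s" "dist s t < 1" for s
      using cu[of s m] that m by (simp add: dist_real_def)
    then show ?thesis using m by (intro exI[of _ m] exI[of _ 1]) auto
  qed
  have "continuous (at t within {0..}) c" if t: "0 \<le> t" for t
  proof -
    obtain m d where md: "0 < d" "\<And>s. 0 \<le> s \<Longrightarrow> dist s t < d \<Longrightarrow> u m s = c s" using loc[OF t] by blast
    have "continuous (at t within {0..}) (u m)"
      using u(1)[of m] t by (simp add: heat_flow_def continuous_on_eq_continuous_within)
    then show ?thesis 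
      by (rule continuous_transform_within[OF _ md(1)]) (use t md(2) in auto)
  qed
  moreover have "((\<lambda>s. cf (c s) n) has_vector_derivative
      (- of_real ((real_of_int n)\<^sup>2) * cf (c t) n + force (c t) n)) (at t within {0..})" if t: "0 \<le> t" for t n
  proof -
    obtain m d where md: "0 < d" "\<And>s. 0 \<le> s \<Longrightarrow> dist s t < d \<Longrightarrow> u m s = c s" "t \<le> real m" using loc[OF t] by blast
    have e1: "u m t = c t" using md(2)[OF t] md(1) by simp
    have e2: "tforce (R m) (c t) n = force (c t) n" using tf[OF t md(3), of n] unfolding e1 .
    have "((\<lambda>s. cf (u m s) n) has_vector_derivative
      (- of_real ((real_of_int n)\<^sup>2) * cf (u m t) n + tforce (R m) (u m t) n)) (at t within {0..})"
      by (rule heat_flow_derivative[OF u(1) t]) simp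
    then have "((\<lambda>s. cf (u m s) n) has_vector_derivative
      (- of_real ((real_of_int n)\<^sup>2) * cf (c t) n + force (c t) n)) (at t within {0..})"
      unfolding e1 e2 .
    then show ?thesis
    proof (rule has_vector_derivative_transform_within[OF _ md(1)])
      show "t \<in> {0..}" using t by simp
      show "cf (u m s) n = cf (c s) n" if "s \<in> {0..}" "dist s t < d" for s
        using md(2)[of s] that by simp
    qed
  qed
  ultimately have "flow c"
    unfolding flow_def heat_flow_def continuous_on_eq_continuous_within by (intro conjI ballI allI impI) auto
  moreover have "c 0 = c0" using cu[of 0 0] u(2) by simp
  ultimately show ?thesis by blast
qed

lemma flow_energy:
  assumes c: "flow c" and s: "0 < s"
  shows "\<exists>C\<ge>0. \<forall>n. cmod (cf (c s) n) \<le> C * jb n powr (- 2)"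
    and "(\<lambda>n. - 2 * (real_of_int n)\<^sup>2 * (cmod (cf (c s) n))\<^sup>2 + 2 * Re (cnj (cf (c s) n) * control (c s) n)) summable_on UNIV"
    and "((\<lambda>s. (norm (c s))\<^sup>2) has_real_derivative
      (\<Sum>\<^sub>\<infinity>n. - 2 * (real_of_int n)\<^sup>2 * (cmod (cf (c s) n))\<^sup>2 + 2 * Re (cnj (cf (c s) n) * control (c s) n))) (at s)"
proof -
  obtain M where M: "0 \<le> M" "\<And>x. 0 \<le> x \<Longrightarrow> x \<le> s + 1 \<Longrightarrow> norm (c x) \<le> M"
    using heat_flow_bounded c unfolding flow_def by metis
  have h: "cmod (control (c x) n) \<le> Q * M" if "0 \<le> x" "x \<le> s + 1" for x n
    by (rule order_trans[OF Q(2)]) (use M(2)[OF that] Q(1) in \<open>auto intro: mult_left_mono\<close>)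
  have G: "force (c x) n = of_real 1 * (- (\<i> * of_int n / 2) * conv (c x) (c x) n) + control (c x) n" for x n
    by (simp add: force_def)
  have s1: "s < s + 1" by simp
  note e = energy_derivative[OF c[unfolded flow_def] G _ h s s1]
  show "\<exists>C\<ge>0. \<forall>n. cmod (cf (c s) n) \<le> C * jb n powr (- 2)" by (rule e(1)) auto
  show "(\<lambda>n. - 2 * (real_of_int n)\<^sup>2 * (cmod (cf (c s) n))\<^sup>2 + 2 * Re (cnj (cf (c s) n) * control (c s) n)) summable_on UNIV"
    by (rule e(2)) auto
  show "((\<lambda>s. (norm (c s))\<^sup>2) has_real_derivative
      (\<Sum>\<^sub>\<infinity>n. - 2 * (real_of_int n)\<^sup>2 * (cmod (cf (c s) n))\<^sup>2 + 2 * Re (cnj (cf (c s) n) * control (c s) n))) (at s)"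
    by (rule e(3)) auto
qed

lemma flow_smoothing:
  assumes c: "flow c" and a: "0 < a"
  shows "\<exists>C\<ge>0. \<forall>t n. a \<le> t \<longrightarrow> t \<le> T \<longrightarrow> cmod (cf (c t) n) \<le> C * jb n powr (- 2)"
proof -
  obtain M where M: "0 \<le> M" "\<And>x. 0 \<le> x \<Longrightarrow> x \<le> T \<Longrightarrow> norm (c x) \<le> M"
    using heat_flow_bounded c unfolding flow_def by metis
  show ?thesis
  proof (rule heat_flow_smoothing[OF c[unfolded flow_def] _ _ a, of "Q * M"])
    show "0 \<le> Q * M" using Q M by simp
    fix t n assume t: "0 \<le> t" "t \<le> T"
    have "cmod (force (c t) n) \<le> \<bar>real_of_int n\<bar> / 2 * cmod (conv (c t) (c t) n) + Q * norm (c t)"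
      unfolding force_def by (rule order_trans[OF norm_triangle_ineq]) (use Q(2) in \<open>auto simp: norm_mult norm_divide\<close>)
    also have "\<dots> \<le> \<bar>real_of_int n\<bar> * cmod (conv (c t) (c t) n) + Q * M"
      using M(2)[OF t] Q(1) by (intro add_mono mult_right_mono mult_left_mono) auto
    finally show "cmod (force (c t) n) \<le> Q * M + \<bar>real_of_int n\<bar> * cmod (conv (c t) (c t) n)" by simp
  qed
qed

end

section \<open>Single-input stabilization of finitely many modes\<close>

text \<open>The weights are the coefficients of the partial fraction decomposition of the right-hand side. Its
  product vanishes at \<open>z = al j\<close>, so they solve the Cauchy system \<open>\<Sum>i\<in>S. v i / (al i + al j) = 1\<close>.\<close>

lemma Cauchy_matrix_weights:
  fixes al :: "'i \<Rightarrow> real"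
  assumes "finite S" "\<And>i. i \<in> S \<Longrightarrow> 0 < al i" "inj_on al S"
  shows "\<exists>v. (\<forall>i\<in>S. v i \<noteq> 0) \<and> (\<forall>z. (\<forall>i\<in>S. z + al i \<noteq> 0) \<longrightarrow>
     (\<Sum>i\<in>S. v i / (z + al i)) = 1 - (\<Prod>i\<in>S. (z - al i) / (z + al i)))"
  using assms
proof (induction S rule: finite_induct)
  case (insert k S)
  then obtain v where v: "\<And>i. i \<in> S \<Longrightarrow> v i \<noteq> 0"
    "\<And>z. (\<forall>i\<in>S. z + al i \<noteq> 0) \<Longrightarrow> (\<Sum>i\<in>S. v i / (z + al i)) = 1 - (\<Prod>i\<in>S. (z - al i) / (z + al i))"
    by (auto simp: inj_on_insert)
  have k: "0 < al k" and pos: "\<And>i. i \<in> S \<Longrightarrow> 0 < al i" using insert.prems by auto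
  have ne: "al i \<noteq> al k" if "i \<in> S" for i using insert.prems(2) insert.hyps that by (auto simp: inj_on_def)
  \<comment> \<open>A further factor \<open>(z - al k) / (z + al k)\<close> multiplies the residue
    at \<open>- al i\<close> by its value there, and creates a residue at \<open>- al k\<close>
    given by the old product at that point.\<close>
  define v' where "v' i = (if i = k then 2 * al k * (1 + (\<Sum>i\<in>S. v i / (al k - al i)))
      else v i * (al i + al k) / (al i - al k))" for i
  \<comment> \<open>The induction hypothesis at \<open>z = - al k\<close> expresses the new weight
    by a product, nonzero because the values are positive and distinct.\<close>
  have "(\<Sum>i\<in>S. v i / (al k - al i)) = - (\<Sum>i\<in>S. v i / (- al k + al i))"
    unfolding sum_negf[symmetric] by (intro sum.cong refl) (metis minus_diff_eq minus_divide_right uminus_add_conv_diff)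
  also have "\<dots> = (\<Prod>i\<in>S. (- al k - al i) / (- al k + al i)) - 1" using ne by (subst v(2)) auto
  finally have "1 + (\<Sum>i\<in>S. v i / (al k - al i)) = (\<Prod>i\<in>S. (- al k - al i) / (- al k + al i))" by simp
  moreover have "- al k - al i \<noteq> 0" "- al k + al i \<noteq> 0" if "i \<in> S" for i
    using pos[OF that] k ne[OF that] by auto
  then have "(\<Prod>i\<in>S. (- al k - al i) / (- al k + al i)) \<noteq> 0"
    using insert.hyps(1) by simp
  ultimately have "v' k \<noteq> 0" using k by (simp add: v'_def)
  moreover have "v' i \<noteq> 0" if "i \<in> S" for i
  proof -
    have "i \<noteq> k" using that insert.hyps by auto
    then show ?thesis using that v(1)[OF that] ne[OF that] pos[OF that] k by (simp add: v'_def)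
  qed
  moreover have "(\<Sum>i\<in>insert k S. v' i / (z + al i)) = 1 - (\<Prod>i\<in>insert k S. (z - al i) / (z + al i))"
    if z: "\<forall>i\<in>insert k S. z + al i \<noteq> 0" for z
  proof -
    define T where "T = (\<Sum>i\<in>S. v i / (z + al i))"
    have zk: "z + al k \<noteq> 0" using z by simp
    have P: "(\<Prod>i\<in>S. (z - al i) / (z + al i)) = 1 - T" using v(2)[of z] z by (simp add: T_def)
    have "(\<Sum>i\<in>S. v' i / (z + al i)) = (\<Sum>i\<in>S. (z - al k) / (z + al k) * (v i / (z + al i))
        - 2 * al k / (z + al k) * (v i / (al k - al i)))"
    proof (rule sum.cong[OF refl])
      fix i assume i: "i \<in> S"
      have "i \<noteq> k" using i insert.hyps by auto
      moreover have "al k - al i \<noteq> 0" "al i - al k \<noteq> 0" "z + al i \<noteq> 0" using ne[OF i] z i by auto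
      ultimately show "v' i / (z + al i) = (z - al k) / (z + al k) * (v i / (z + al i))
        - 2 * al k / (z + al k) * (v i / (al k - al i))"
        using zk by (simp add: v'_def divide_simps) (simp add: algebra_simps)
    qed
    also have "\<dots> = (z - al k) / (z + al k) * T - 2 * al k / (z + al k) * (\<Sum>i\<in>S. v i / (al k - al i))"
      by (simp add: sum_subtractf sum_distrib_left T_def)
    finally have "(\<Sum>i\<in>insert k S. v' i / (z + al i))
        = 2 * al k / (z + al k) + (z - al k) / (z + al k) * T"
      using insert.hyps by (simp add: v'_def algebra_simps add_divide_distrib)
    also have "2 * al k / (z + al k) = 1 - (z - al k) / (z + al k)" using zk by (simp add: field_simps)
    also have "1 - (z - al k) / (z + al k) + (z - al k) / (z + al k) * T = 1 - (z - al k) / (z + al k) * (1 - T)"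
      by (simp only: right_diff_distrib)
    finally show ?thesis using insert.hyps P by simp
  qed
  ultimately show ?case by (intro exI[of _ v']) auto
qed (auto intro: exI[of _ "\<lambda>_. 1"])

text \<open>Eliminating the variable \<open>y k\<close> turns \<open>1 / (al i + al j)\<close> into \<open>r i * r j / (al i + al j)\<close> with
  \<open>r i = (al i - al k) / (al i + al k)\<close>, the matrix of the remaining indices rescaled.\<close>

lemma Cauchy_matrix_positive:
  fixes al :: "'i \<Rightarrow> real"
  assumes "finite S" "\<And>i. i \<in> S \<Longrightarrow> 0 < al i" "inj_on al S"
  shows "\<exists>m>0. \<forall>y. m * (\<Sum>i\<in>S. (y i)\<^sup>2) \<le> (\<Sum>i\<in>S. \<Sum>j\<in>S. y i * y j / (al i + al j))"
  using assms
proof (induction S rule: finite_induct)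
  case (insert k S)
  then obtain m where m: "0 < m"
    "\<And>y. m * (\<Sum>i\<in>S. (y i)\<^sup>2) \<le> (\<Sum>i\<in>S. \<Sum>j\<in>S. y i * y j / (al i + al j))"
    by (auto simp: inj_on_insert)
  have k: "0 < al k" and pos: "\<And>i. i \<in> S \<Longrightarrow> 0 < al i" using insert.prems by auto
  have ne: "al i \<noteq> al k" if "i \<in> S" for i using insert.prems(2) insert.hyps that by (auto simp: inj_on_def)
  define r where "r i = (al i - al k) / (al i + al k)" for i
  \<comment> \<open>Rescaling the remaining variables by \<open>r\<close> costs at most the smallest
    \<open>(r i)\<^sup>2\<close>, which is positive because the values are distinct.\<close>
  have "\<exists>\<rho>>0. \<forall>i\<in>S. \<rho> \<le> (r i)\<^sup>2"
  proof (cases "S = {}")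
    case False
    have "r i \<noteq> 0" if "i \<in> S" for i using ne[OF that] pos[OF that] k by (simp add: r_def)
    then show ?thesis using False insert.hyps(1) by (intro exI[of _ "Min ((\<lambda>i. (r i)\<^sup>2) ` S)"]) auto
  qed (auto intro: exI[of _ 1])
  then obtain \<rho> where \<rho>: "0 < \<rho>" "\<And>i. i \<in> S \<Longrightarrow> \<rho> \<le> (r i)\<^sup>2" by blast
  define T where "T = (\<Sum>i\<in>S. (1 / (al i + al k))\<^sup>2)"
  \<comment> \<open>The two bounds serve the two terms of the reduced form: \<open>2 * m'\<close>
    must not exceed the weight \<open>1 / (2 * al k)\<close> of \<open>W\<^sup>2\<close>, and
    \<open>m' * (8 * (al k)\<^sup>2 * T + 1)\<close> must not exceed the weight
    \<open>m * \<rho>\<close> of \<open>Y\<close>.\<close>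
  define m' where "m' = min (1 / (4 * al k)) (m * \<rho> / (8 * (al k)\<^sup>2 * T + 1))"
  have T: "0 \<le> T" by (simp add: T_def sum_nonneg)
  have D: "0 < 8 * (al k)\<^sup>2 * T + 1" using T by (simp add: add_nonneg_pos)
  have m': "0 < m'" "m' \<le> 1 / (4 * al k)" "m' * (8 * (al k)\<^sup>2 * T + 1) \<le> m * \<rho>"
  proof -
    show "0 < m'" using k m \<rho> D by (simp add: m'_def)
    show "m' \<le> 1 / (4 * al k)" by (simp add: m'_def)
    have "m' \<le> m * \<rho> / (8 * (al k)\<^sup>2 * T + 1)" by (simp add: m'_def)
    then show "m' * (8 * (al k)\<^sup>2 * T + 1) \<le> m * \<rho>" using D by (simp add: pos_le_divide_eq)
  qed
  have "m' * (\<Sum>i\<in>insert k S. (y i)\<^sup>2) \<le> (\<Sum>i\<in>insert k S. \<Sum>j\<in>insert k S. y i * y j / (al i + al j))" for y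
  proof -
    define t where "t = (\<Sum>i\<in>S. y i / (al i + al k))"
    define Y where "Y = (\<Sum>i\<in>S. (y i)\<^sup>2)"
    have Y: "0 \<le> Y" by (simp add: Y_def sum_nonneg)
    \<comment> \<open>Completes the square in \<open>y k\<close>: the terms of the form that contain
      it equal \<open>W\<^sup>2 / (2 * al k)\<close> minus \<open>2 * al k * t\<^sup>2\<close>,
      which the rest of the form compensates.\<close>
    define W where "W = y k + 2 * al k * t"
    have tt: "t\<^sup>2 = (\<Sum>i\<in>S. \<Sum>j\<in>S. y i / (al i + al k) * (y j / (al j + al k)))"
      by (simp add: t_def power2_eq_square sum_product)
    have "(\<Sum>i\<in>S. \<Sum>j\<in>S. y i * y j / (al i + al j))
        = (\<Sum>i\<in>S. \<Sum>j\<in>S. 2 * al k * (y i / (al i + al k) * (y j / (al j + al k)))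
            + (r i * y i) * (r j * y j) / (al i + al j))"
    proof (intro sum.cong refl)
      fix i j assume i: "i \<in> S" and j: "j \<in> S"
      have "al i + al k \<noteq> 0" "al j + al k \<noteq> 0" "al i + al j \<noteq> 0" using pos[OF i] pos[OF j] k by auto
      then show "y i * y j / (al i + al j) = 2 * al k * (y i / (al i + al k) * (y j / (al j + al k)))
            + (r i * y i) * (r j * y j) / (al i + al j)"
        by (simp add: r_def divide_simps) algebra
    qed
    also have "\<dots> = 2 * al k * t\<^sup>2 + (\<Sum>i\<in>S. \<Sum>j\<in>S. (r i * y i) * (r j * y j) / (al i + al j))"
      unfolding tt by (simp add: sum.distrib sum_distrib_left)
    finally have QE: "(\<Sum>i\<in>S. \<Sum>j\<in>S. y i * y j / (al i + al j))
        = 2 * al k * t\<^sup>2 + (\<Sum>i\<in>S. \<Sum>j\<in>S. (r i * y i) * (r j * y j) / (al i + al j))" .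
    have "(\<Sum>i\<in>S. \<Sum>j\<in>S. (r i * y i) * (r j * y j) / (al i + al j)) \<ge> m * \<rho> * Y"
    proof -
      have "m * (\<rho> * Y) \<le> m * (\<Sum>i\<in>S. (r i * y i)\<^sup>2)"
        unfolding Y_def sum_distrib_left[of \<rho>] using m \<rho>
        by (intro mult_left_mono sum_mono) (auto simp: power_mult_distrib intro: mult_right_mono)
      then show ?thesis using m(2)[of "\<lambda>i. r i * y i"] by (simp add: mult.assoc)
    qed
    then have QS: "(\<Sum>i\<in>S. \<Sum>j\<in>S. y i * y j / (al i + al j)) \<ge> 2 * al k * t\<^sup>2 + m * \<rho> * Y"
      unfolding QE by simp
    have c1: "(\<Sum>j\<in>S. y k * y j / (al k + al j)) = y k * t"
      by (simp add: t_def sum_distrib_left add.commute)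
    have c2: "(\<Sum>i\<in>S. y i * y k / (al i + al k)) = y k * t"
      by (simp add: t_def sum_distrib_left mult.commute)
    have "(\<Sum>i\<in>insert k S. \<Sum>j\<in>insert k S. y i * y j / (al i + al j))
        = (y k)\<^sup>2 / (2 * al k) + 2 * y k * t + (\<Sum>i\<in>S. \<Sum>j\<in>S. y i * y j / (al i + al j))"
      using insert.hyps by (simp add: sum.distrib c1 c2 power2_eq_square)
    also have "\<dots> \<ge> W\<^sup>2 / (2 * al k) + m * \<rho> * Y"
    proof -
      have "W\<^sup>2 / (2 * al k) = (y k)\<^sup>2 / (2 * al k) + 2 * y k * t + 2 * al k * t\<^sup>2"
        using k by (simp add: W_def power2_eq_square field_simps)
      then show ?thesis using QS by simp
    qed
    finally have low: "(\<Sum>i\<in>insert k S. \<Sum>j\<in>insert k S. y i * y j / (al i + al j)) \<ge> W\<^sup>2 / (2 * al k) + m * \<rho> * Y" .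
    have "t = (\<Sum>i\<in>S. (1 / (al i + al k)) * y i)" by (simp add: t_def)
    then have tY: "t\<^sup>2 \<le> T * Y" unfolding T_def Y_def by (metis Cauchy_Schwarz_ineq_sum)
    have "(y k)\<^sup>2 = 2 * W\<^sup>2 + 8 * ((al k)\<^sup>2 * t\<^sup>2) - (W + 2 * al k * t)\<^sup>2"
      by (simp add: W_def power2_eq_square algebra_simps)
    then have "(y k)\<^sup>2 \<le> 2 * W\<^sup>2 + 8 * ((al k)\<^sup>2 * t\<^sup>2)" by simp
    also have "(al k)\<^sup>2 * t\<^sup>2 \<le> (al k)\<^sup>2 * (T * Y)" by (intro mult_left_mono tY) auto
    finally have "(y k)\<^sup>2 + Y \<le> 2 * W\<^sup>2 + (8 * (al k)\<^sup>2 * T + 1) * Y" by (simp add: algebra_simps)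
    then have "m' * ((y k)\<^sup>2 + Y) \<le> m' * (2 * W\<^sup>2 + (8 * (al k)\<^sup>2 * T + 1) * Y)"
      using m'(1) by (intro mult_left_mono) auto
    also have "\<dots> = m' * (2 * W\<^sup>2) + (m' * (8 * (al k)\<^sup>2 * T + 1)) * Y" by (simp add: algebra_simps)
    also have "\<dots> \<le> 1 / (4 * al k) * (2 * W\<^sup>2) + m * \<rho> * Y"
      using m' Y by (intro add_mono mult_right_mono) auto
    also have "\<dots> = W\<^sup>2 / (2 * al k) + m * \<rho> * Y" by simp
    finally show ?thesis using low insert.hyps by (simp add: Y_def)
  qed
  then show ?case using m'(1) by blast
qed (auto intro: exI[of _ 1])

text \<open>Linear feedback by spectral reflection: the matrix \<open>P\<close> solves the Lyapunov
  equation D P + P D = w w^T for D = diag(al) entrywise, and the Cauchy weights make P b = w. Adding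
  both contributions, the terms beyond the rate \<open>mu\<close> are
  \<open>u\<^sup>2 - 2 * u\<^sup>2\<close>.\<close>

lemma finite_modes_Lyapunov:
  fixes b :: "nat \<Rightarrow> real"
  assumes S: "finite S" and mu: "\<And>i. i \<in> S \<Longrightarrow> (real i)\<^sup>2 < mu" and b: "\<And>i. i \<in> S \<Longrightarrow> b i \<noteq> 0"
  shows "\<exists>P w m. 0 < m \<and> (\<forall>i j. P i j = P j i) \<and>
     (\<forall>x. m * (\<Sum>i\<in>S. (x i)\<^sup>2) \<le> (\<Sum>i\<in>S. \<Sum>j\<in>S. P i j * x i * x j)) \<and>
     (\<forall>x u. u = - (\<Sum>i\<in>S. w i * x i) \<longrightarrow>
        2 * (\<Sum>i\<in>S. \<Sum>j\<in>S. P i j * (- (real i)\<^sup>2 * x i + b i * u) * x j)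
          = - 2 * mu * (\<Sum>i\<in>S. \<Sum>j\<in>S. P i j * x i * x j) - u\<^sup>2)"
proof -
  define al where "al i = mu - (real i)\<^sup>2" for i
  have al: "0 < al i" if "i \<in> S" for i using mu[OF that] by (simp add: al_def)
  have inj: "inj_on al S" by (auto simp: inj_on_def al_def)
  obtain v where v: "\<And>i. i \<in> S \<Longrightarrow> v i \<noteq> 0"
    "\<And>z. (\<forall>i\<in>S. z + al i \<noteq> 0) \<Longrightarrow> (\<Sum>i\<in>S. v i / (z + al i)) = 1 - (\<Prod>i\<in>S. (z - al i) / (z + al i))"
    using Cauchy_matrix_weights[OF S al inj] by blast
  obtain m where m: "0 < m"
    "\<And>y. m * (\<Sum>i\<in>S. (y i)\<^sup>2) \<le> (\<Sum>i\<in>S. \<Sum>j\<in>S. y i * y j / (al i + al j))"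
    using Cauchy_matrix_positive[OF S al inj] by blast
  \<comment> \<open>Division by \<open>b i\<close> is where every low mode has to be reached by the
    input.\<close>
  define w where "w i = v i / b i" for i
  define P where "P i j = w i * w j / (al i + al j)" for i j
  have w0: "w i \<noteq> 0" if "i \<in> S" for i using v(1)[OF that] b[OF that] by (simp add: w_def)
  have "\<exists>\<rho>>0. \<forall>i\<in>S. \<rho> \<le> (w i)\<^sup>2"
  proof (cases "S = {}")
    case False
    then show ?thesis using w0 S by (intro exI[of _ "Min ((\<lambda>i. (w i)\<^sup>2) ` S)"]) auto
  qed (auto intro: exI[of _ 1])
  then obtain \<rho> where \<rho>: "0 < \<rho>" "\<And>i. i \<in> S \<Longrightarrow> \<rho> \<le> (w i)\<^sup>2" by blast
  have ones: "(\<Sum>i\<in>S. v i / (al i + al j)) = 1" if "j \<in> S" for j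
  proof -
    have "(\<Sum>i\<in>S. v i / (al j + al i)) = 1 - (\<Prod>i\<in>S. (al j - al i) / (al j + al i))"
      using al[OF that] al by (intro v(2)) (force simp: add_pos_pos)
    also have "(\<Prod>i\<in>S. (al j - al i) / (al j + al i)) = 0" using S that by (auto intro!: prod_zero)
    finally show ?thesis by (simp add: add.commute)
  qed
  have low: "m * \<rho> * (\<Sum>i\<in>S. (x i)\<^sup>2) \<le> (\<Sum>i\<in>S. \<Sum>j\<in>S. P i j * x i * x j)" for x
  proof -
    have "m * (\<rho> * (\<Sum>i\<in>S. (x i)\<^sup>2)) \<le> m * (\<Sum>i\<in>S. (w i * x i)\<^sup>2)"
      unfolding sum_distrib_left[of \<rho>] using m \<rho>
      by (intro mult_left_mono sum_mono) (auto simp: power_mult_distrib intro: mult_right_mono)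
    also have "\<dots> \<le> (\<Sum>i\<in>S. \<Sum>j\<in>S. (w i * x i) * (w j * x j) / (al i + al j))" by (rule m(2))
    also have "\<dots> = (\<Sum>i\<in>S. \<Sum>j\<in>S. P i j * x i * x j)" by (intro sum.cong refl) (simp add: P_def)
    finally show ?thesis by (simp add: mult.assoc)
  qed
  have id: "2 * (\<Sum>i\<in>S. \<Sum>j\<in>S. P i j * (- (real i)\<^sup>2 * x i + b i * u) * x j)
          = - 2 * mu * (\<Sum>i\<in>S. \<Sum>j\<in>S. P i j * x i * x j) - u\<^sup>2"
    if u: "u = - (\<Sum>i\<in>S. w i * x i)" for x u
  proof -
    let ?A = "\<Sum>i\<in>S. \<Sum>j\<in>S. P i j * al i * x i * x j"
    let ?B = "\<Sum>i\<in>S. \<Sum>j\<in>S. P i j * x i * x j"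
    let ?C = "\<Sum>i\<in>S. \<Sum>j\<in>S. P i j * b i * x j"
    have "(\<Sum>i\<in>S. \<Sum>j\<in>S. P i j * (- (real i)\<^sup>2 * x i + b i * u) * x j)
        = (\<Sum>i\<in>S. \<Sum>j\<in>S. P i j * al i * x i * x j - mu * (P i j * x i * x j) + u * (P i j * b i * x j))"
      by (intro sum.cong refl) (simp add: al_def algebra_simps)
    also have "\<dots> = ?A - mu * ?B + u * ?C"
      by (simp add: sum.distrib sum_subtractf sum_distrib_left)
    finally have 1: "(\<Sum>i\<in>S. \<Sum>j\<in>S. P i j * (- (real i)\<^sup>2 * x i + b i * u) * x j) = ?A - mu * ?B + u * ?C" .
    \<comment> \<open>Adding the sum to its transpose produces the factor
      \<open>al i + al j\<close>, which cancels the denominator of \<open>P\<close>; what remains is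
      a product of two sums.\<close>
    have "?A = (\<Sum>i\<in>S. \<Sum>j\<in>S. P i j * al j * x i * x j)"
      by (subst sum.swap) (intro sum.cong refl, simp add: P_def add.commute mult.commute mult.left_commute)
    then have "2 * ?A = (\<Sum>i\<in>S. \<Sum>j\<in>S. P i j * al i * x i * x j + P i j * al j * x i * x j)"
      by (simp add: sum.distrib)
    also have "\<dots> = (\<Sum>i\<in>S. \<Sum>j\<in>S. (w i * x i) * (w j * x j))"
    proof (intro sum.cong refl)
      fix i j assume "i \<in> S" "j \<in> S"
      then have "al i + al j \<noteq> 0" using al[of i] al[of j] by simp
      then show "P i j * al i * x i * x j + P i j * al j * x i * x j = (w i * x i) * (w j * x j)"
        by (simp add: P_def divide_simps) algebra
    qed
    also have "\<dots> = u\<^sup>2" by (simp add: u power2_eq_square sum_product)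
    finally have 2: "2 * ?A = u\<^sup>2" .
    have "?C = (\<Sum>j\<in>S. \<Sum>i\<in>S. P i j * b i * x j)" by (rule sum.swap)
    also have "\<dots> = (\<Sum>j\<in>S. w j * x j * (\<Sum>i\<in>S. v i / (al i + al j)))"
      unfolding sum_distrib_left by (intro sum.cong refl) (simp add: P_def w_def b)
    also have "\<dots> = - u" by (simp add: ones u)
    finally show ?thesis using 1 2 by (simp add: power2_eq_square algebra_simps)
  qed
  have sym: "P i j = P j i" for i j by (simp add: P_def mult.commute add.commute)
  have "0 < m * \<rho>" using m \<rho> by simp
  then show ?thesis using low id sym by blast
qed

section \<open>Exponential decay of small solutions\<close>

text \<open>Continuity argument: at the first time at which \<open>E\<close> reaches
  \<open>r\<close>, the decay valid until then would give \<open>E \<le> E 0 < r\<close>. The rate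
  is \<open>2 * lam\<close> because \<open>E\<close> will be comparable to a squared norm.\<close>

lemma barrier_decay:
  fixes E :: "real \<Rightarrow> real"
  assumes cont: "continuous_on {0..} E" and lam: "0 \<le> lam" and E0: "0 \<le> E 0" "E 0 < r"
    and der: "\<And>s. 0 < s \<Longrightarrow> E s \<le> r \<Longrightarrow> \<exists>D. (E has_real_derivative D) (at s) \<and> D \<le> - (2 * lam) * E s"
    and t: "0 \<le> t"
  shows "E t \<le> exp (- (2 * lam) * t) * E 0"
proof -
  have decay: "E s \<le> exp (- (2 * lam) * s) * E 0" if "0 \<le> s" "\<And>x. 0 \<le> x \<Longrightarrow> x < s \<Longrightarrow> E x \<le> r" for s
    using that by (intro nonincreasing_exp_weight der continuous_on_subset[OF cont]) auto
  have "E x \<le> r" if "0 \<le> x" "x \<le> t" for x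
  proof (rule ccontr)
    assume nx: "\<not> E x \<le> r"
    define A where "A = {s \<in> {0..x}. r \<le> E s}"
    have "closed A"
      unfolding A_def
      by (intro continuous_on_closed_Collect_le continuous_on_const continuous_on_subset[OF cont]) auto
    have xA: "x \<in> A" using nx that by (auto simp: A_def)
    have bd: "bdd_below A" by (auto simp: A_def)
    define s where "s = Inf A"
    have sA: "s \<in> A" unfolding s_def by (rule closed_contains_Inf) (use xA bd \<open>closed A\<close> in auto)
    have "E y \<le> r" if "0 \<le> y" "y < s" for y
    proof (rule ccontr)
      assume "\<not> E y \<le> r"
      then have "y \<in> A" using that sA by (auto simp: A_def)
      then show False using cInf_lower[OF _ bd, of y] that by (simp add: s_def)
    qed
    then have "E s \<le> exp (- (2 * lam) * s) * E 0" using sA by (intro decay) (auto simp: A_def)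
    also have "\<dots> \<le> 1 * E 0" using sA lam E0 by (intro mult_right_mono) (auto simp: A_def)
    finally show False using E0 sA by (simp add: A_def)
  qed
  then show ?thesis using t by (intro decay) auto
qed

text \<open>The nonlinearity enters as a perturbation \<open>g\<close> of finitely many modes and is
  estimated entry by entry. The term \<open>- u\<^sup>2\<close> is retained, since the high modes
  will consume it.\<close>

lemma Lyapunov_derivative:
  fixes X :: "nat \<Rightarrow> real \<Rightarrow> real"
  assumes sym: "\<And>i j. P i j = P j i"
    and id: "\<And>x u. u = - (\<Sum>i\<in>S. w i * x i) \<Longrightarrow>
        2 * (\<Sum>i\<in>S. \<Sum>j\<in>S. P i j * (- (real i)\<^sup>2 * x i + b i * u) * x j)
          = - 2 * mu * (\<Sum>i\<in>S. \<Sum>j\<in>S. P i j * x i * x j) - u\<^sup>2"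
    and X: "\<And>i. i \<in> S \<Longrightarrow> (X i has_real_derivative (- (real i)\<^sup>2 * X i t + b i * u + g i)) (at t)"
    and u: "u = - (\<Sum>i\<in>S. w i * X i t)"
    and n: "\<And>i. i \<in> S \<Longrightarrow> \<bar>X i t\<bar> \<le> n" and G: "\<And>i. i \<in> S \<Longrightarrow> \<bar>g i\<bar> \<le> G" "0 \<le> G"
  shows "\<exists>D. ((\<lambda>s. \<Sum>i\<in>S. \<Sum>j\<in>S. P i j * X i s * X j s) has_real_derivative D) (at t) \<and>
    D \<le> - 2 * mu * (\<Sum>i\<in>S. \<Sum>j\<in>S. P i j * X i t * X j t) - u\<^sup>2 + 2 * (\<Sum>i\<in>S. \<Sum>j\<in>S. \<bar>P i j\<bar>) * (G * n)"
proof -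
  define X' where "X' i = - (real i)\<^sup>2 * X i t + b i * u + g i" for i
  have "((\<lambda>s. \<Sum>i\<in>S. \<Sum>j\<in>S. P i j * X i s * X j s) has_real_derivative
      (\<Sum>i\<in>S. \<Sum>j\<in>S. P i j * X' i * X j t + P i j * X i t * X' j)) (at t)"
    by (intro DERIV_sum) (rule derivative_eq_intros X[folded X'_def] refl | assumption | simp)+
  moreover have "(\<Sum>i\<in>S. \<Sum>j\<in>S. P i j * X' i * X j t + P i j * X i t * X' j)
      \<le> - 2 * mu * (\<Sum>i\<in>S. \<Sum>j\<in>S. P i j * X i t * X j t) - u\<^sup>2 + 2 * (\<Sum>i\<in>S. \<Sum>j\<in>S. \<bar>P i j\<bar>) * (G * n)"
  proof -
    have "(\<Sum>i\<in>S. \<Sum>j\<in>S. P i j * X i t * X' j) = (\<Sum>i\<in>S. \<Sum>j\<in>S. P i j * X' i * X j t)"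
      by (subst sum.swap) (intro sum.cong refl, metis sym mult.assoc mult.commute)
    then have "(\<Sum>i\<in>S. \<Sum>j\<in>S. P i j * X' i * X j t + P i j * X i t * X' j)
        = 2 * (\<Sum>i\<in>S. \<Sum>j\<in>S. P i j * X' i * X j t)" by (simp add: sum.distrib)
    also have "(\<Sum>i\<in>S. \<Sum>j\<in>S. P i j * X' i * X j t)
        = (\<Sum>i\<in>S. \<Sum>j\<in>S. P i j * (- (real i)\<^sup>2 * X i t + b i * u) * X j t) + (\<Sum>i\<in>S. \<Sum>j\<in>S. P i j * g i * X j t)"
      unfolding sum.distrib[symmetric] by (intro sum.cong refl) (simp add: X'_def algebra_simps)
    also have "(\<Sum>i\<in>S. \<Sum>j\<in>S. P i j * g i * X j t) \<le> (\<Sum>i\<in>S. \<Sum>j\<in>S. \<bar>P i j\<bar> * (G * n))"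
    proof (intro sum_mono)
      fix i j assume ij: "i \<in> S" "j \<in> S"
      have "P i j * g i * X j t \<le> \<bar>P i j\<bar> * (\<bar>g i\<bar> * \<bar>X j t\<bar>)"
        by (metis abs_ge_self abs_mult mult.assoc)
      also have "\<dots> \<le> \<bar>P i j\<bar> * (G * n)" using ij n G by (intro mult_left_mono mult_mono) auto
      finally show "P i j * g i * X j t \<le> \<bar>P i j\<bar> * (G * n)" .
    qed
    also have "(\<Sum>i\<in>S. \<Sum>j\<in>S. \<bar>P i j\<bar> * (G * n)) = (\<Sum>i\<in>S. \<Sum>j\<in>S. \<bar>P i j\<bar>) * (G * n)"
      by (simp add: sum_distrib_right)
    finally show ?thesis using id[OF u] by (simp add: distrib_left mult.assoc)
  qed
  ultimately show ?thesis by blast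
qed

lemma quadratic_form_bound:
  fixes x :: "nat \<Rightarrow> real"
  assumes "\<And>i. i \<in> S \<Longrightarrow> \<bar>x i\<bar> \<le> n"
  shows "(\<Sum>i\<in>S. \<Sum>j\<in>S. P i j * x i * x j) \<le> (\<Sum>i\<in>S. \<Sum>j\<in>S. \<bar>P i j\<bar>) * n\<^sup>2"
proof -
  have "(\<Sum>i\<in>S. \<Sum>j\<in>S. P i j * x i * x j) \<le> (\<Sum>i\<in>S. \<Sum>j\<in>S. \<bar>P i j\<bar> * n\<^sup>2)"
  proof (intro sum_mono)
    fix i j assume ij: "i \<in> S" "j \<in> S"
    have "P i j * x i * x j \<le> \<bar>P i j\<bar> * (\<bar>x i\<bar> * \<bar>x j\<bar>)" by (metis abs_ge_self abs_mult mult.assoc)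
    also have "\<dots> \<le> \<bar>P i j\<bar> * (n * n)"
      using assms[OF ij(1)] assms[OF ij(2)] by (intro mult_left_mono mult_mono) auto
    finally show "P i j * x i * x j \<le> \<bar>P i j\<bar> * n\<^sup>2" by (simp add: power2_eq_square)
  qed
  then show ?thesis by (simp add: sum_distrib_right)
qed

text \<open>Symmetry folds the negative modes onto the positive ones. The imaginary part of mode 0
  vanishes, which is why the sine block starts at 1 and the cosine block at 0.\<close>

lemma low_energy_bound:
  "(\<Sum>n=-int N..int N. (cmod (cf c n))\<^sup>2)
    \<le> 2 * (\<Sum>i\<in>{1..N}. (Im (cf c (int i)))\<^sup>2) + 2 * (\<Sum>i\<in>{0..N}. (Re (cf c (int i)))\<^sup>2)"
proof -
  let ?f = "\<lambda>n. (cmod (cf c n))\<^sup>2"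
  have sub: "{-int N..int N} \<subseteq> int ` {0..N} \<union> (\<lambda>i. - int i) ` {0..N}"
  proof
    fix n assume n: "n \<in> {-int N..int N}"
    show "n \<in> int ` {0..N} \<union> (\<lambda>i. - int i) ` {0..N}"
    proof (cases "0 \<le> n")
      case True
      then have "n = int (nat n)" "nat n \<in> {0..N}" using n by auto
      then show ?thesis by blast
    next
      case False
      then have "n = - int (nat (- n))" "nat (- n) \<in> {0..N}" using n by auto
      then show ?thesis by blast
    qed
  qed
  have "sum ?f {-int N..int N} \<le> sum ?f (int ` {0..N} \<union> (\<lambda>i. - int i) ` {0..N})"
    by (rule sum_mono2) (use sub in auto)
  also have "\<dots> \<le> sum ?f (int ` {0..N}) + sum ?f ((\<lambda>i. - int i) ` {0..N})"
    by (subst sum_Un) (auto intro!: sum_nonneg)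
  also have "sum ?f (int ` {0..N}) = (\<Sum>i\<in>{0..N}. ?f (int i))" by (subst sum.reindex) (auto simp: inj_on_def)
  also have "sum ?f ((\<lambda>i. - int i) ` {0..N}) = (\<Sum>i\<in>{0..N}. ?f (int i))"
    by (subst sum.reindex) (auto simp: inj_on_def cf_minus)
  also have "(\<Sum>i\<in>{0..N}. ?f (int i)) = (\<Sum>i\<in>{0..N}. (Re (cf c (int i)))\<^sup>2) + (\<Sum>i\<in>{0..N}. (Im (cf c (int i)))\<^sup>2)"
    by (simp add: cmod_power2 sum.distrib)
  also have "(\<Sum>i\<in>{0..N}. (Im (cf c (int i)))\<^sup>2) = (\<Sum>i\<in>{1..N}. (Im (cf c (int i)))\<^sup>2)"
  proof (rule sum.mono_neutral_right)
    have "Im (cf c 0) = 0" using cf_minus[of c 0] by (simp add: complex_eq_iff)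
    then show "\<forall>i\<in>{0..N} - {1..N}. (Im (cf c (int i)))\<^sup>2 = 0" by (auto simp: not_le)
  qed auto
  finally show ?thesis by simp
qed

section \<open>Nonlinear estimates for the closed loop\<close>

context feedback
begin

lemma flow_mode_derivative:
  assumes c: "flow c" and t: "0 < t"
  shows "((\<lambda>s. Re (cf (c s) n)) has_real_derivative
      (- (real_of_int n)\<^sup>2 * Re (cf (c t) n) + Re (control (c t) n) + Re (- (\<i> * of_int n / 2) * conv (c t) (c t) n))) (at t)"
    and "((\<lambda>s. Im (cf (c s) n)) has_real_derivative
      (- (real_of_int n)\<^sup>2 * Im (cf (c t) n) + Im (control (c t) n) + Im (- (\<i> * of_int n / 2) * conv (c t) (c t) n))) (at t)"
proof -
  have d: "((\<lambda>s. cf (c s) n) has_vector_derivative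
    (- of_real ((real_of_int n)\<^sup>2) * cf (c t) n + force (c t) n)) (at t)"
    using heat_flow_derivative_at[OF c[unfolded flow_def] t] .
  show "((\<lambda>s. Re (cf (c s) n)) has_real_derivative
      (- (real_of_int n)\<^sup>2 * Re (cf (c t) n) + Re (control (c t) n) + Re (- (\<i> * of_int n / 2) * conv (c t) (c t) n))) (at t)"
    unfolding has_real_derivative_iff_has_vector_derivative
    by (rule has_vector_derivative_eq_rhs, rule bounded_linear.has_vector_derivative[OF bounded_linear_Re d])
       (simp add: force_def del: of_real_power)
  show "((\<lambda>s. Im (cf (c s) n)) has_real_derivative
      (- (real_of_int n)\<^sup>2 * Im (cf (c t) n) + Im (control (c t) n) + Im (- (\<i> * of_int n / 2) * conv (c t) (c t) n))) (at t)"
    unfolding has_real_derivative_iff_has_vector_derivative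
    by (rule has_vector_derivative_eq_rhs, rule bounded_linear.has_vector_derivative[OF bounded_linear_Im d])
       (simp add: force_def del: of_real_power)
qed

text \<open>The high energy is treated as total minus low energy: the cubic terms cancel in the
  total, so only finitely many of them remain, with opposite sign and without an unbounded
  derivative. A direct estimate over the high modes would carry the factor \<open>n\<close>.\<close>

lemma high_energy_derivative:
  assumes c: "flow c" and t: "0 < t" and N: "2 * \<kappa> \<le> (real N + 1)\<^sup>2" and \<kappa>: "0 \<le> \<kappa>"
  shows "\<exists>D. ((\<lambda>s. (norm (c s))\<^sup>2 - (\<Sum>n=-int N..int N. (cmod (cf (c s) n))\<^sup>2)) has_real_derivative D) (at t) \<and>
    D \<le> - 2 * \<kappa> * ((norm (c t))\<^sup>2 - (\<Sum>n=-int N..int N. (cmod (cf (c t) n))\<^sup>2))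
        + 8 * A\<^sup>2 * JS * ((k1 (c t))\<^sup>2 + (k2 (c t))\<^sup>2) + (2 * real N + 1) * real N * (norm (c t)) ^ 3"
proof -
  let ?F = "{-int N..int N}"
  let ?e = "\<lambda>n. - 2 * (real_of_int n)\<^sup>2 * (cmod (cf (c t) n))\<^sup>2 + 2 * Re (cnj (cf (c t) n) * control (c t) n)"
  let ?b = "\<lambda>n. 2 * Re (cnj (cf (c t) n) * (- (\<i> * of_int n / 2) * conv (c t) (c t) n))"
  note e = flow_energy[OF c t]
  have "((\<lambda>s. (cmod (cf (c s) n))\<^sup>2) has_real_derivative ?e n + ?b n) (at t)" for n
  proof -
    have "((\<lambda>s. (Re (cf (c s) n))\<^sup>2 + (Im (cf (c s) n))\<^sup>2) has_real_derivative ?e n + ?b n) (at t)"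
      by (rule DERIV_cong[OF DERIV_add[OF DERIV_power[OF flow_mode_derivative(1)[OF c t], where n=2]
            DERIV_power[OF flow_mode_derivative(2)[OF c t], where n=2]]])
         (unfold cmod_power2, simp add: power2_eq_square field_simps)
    then show ?thesis by (simp add: cmod_power2)
  qed
  then have low: "((\<lambda>s. \<Sum>n\<in>?F. (cmod (cf (c s) n))\<^sup>2) has_real_derivative (\<Sum>n\<in>?F. ?e n + ?b n)) (at t)"
    by (intro DERIV_sum)
  have D: "((\<lambda>s. (norm (c s))\<^sup>2 - (\<Sum>n\<in>?F. (cmod (cf (c s) n))\<^sup>2)) has_real_derivative
      infsum ?e UNIV - (\<Sum>n\<in>?F. ?e n + ?b n)) (at t)"
    by (rule DERIV_diff[OF e(3) low])
  have split: "infsum g UNIV = sum g ?F + infsum g (- ?F)" if "g summable_on UNIV" for g :: "int \<Rightarrow> real"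
    using infsum_Un_disjoint[of g ?F "- ?F"] summable_on_subset_banach[OF that, of "- ?F"] by simp
  define U where "U = A * (\<bar>k1 (c t)\<bar> + \<bar>k2 (c t)\<bar>)"
  have U: "cmod (control (c t) n) \<le> U" for n
  proof -
    have "cmod (control (c t) n) \<le> \<bar>k1 (c t)\<bar> * cmod (p n) + \<bar>k2 (c t)\<bar> * cmod (q n)"
      unfolding control_def by (rule order_trans[OF norm_triangle_ineq]) (simp add: norm_mult)
    also have "\<dots> \<le> \<bar>k1 (c t)\<bar> * A + \<bar>k2 (c t)\<bar> * A" by (intro add_mono mult_left_mono p_bound q_bound) auto
    finally show ?thesis by (simp add: U_def algebra_simps)
  qed
  have U2: "4 * U\<^sup>2 \<le> 8 * A\<^sup>2 * ((k1 (c t))\<^sup>2 + (k2 (c t))\<^sup>2)"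
  proof -
    have "(\<bar>k1 (c t)\<bar> + \<bar>k2 (c t)\<bar>)\<^sup>2 \<le> 2 * ((k1 (c t))\<^sup>2 + (k2 (c t))\<^sup>2)"
      using sum_squares_bound[of "\<bar>k1 (c t)\<bar>" "\<bar>k2 (c t)\<bar>"] by (simp add: power2_sum)
    then have "4 * A\<^sup>2 * (\<bar>k1 (c t)\<bar> + \<bar>k2 (c t)\<bar>)\<^sup>2 \<le> 4 * A\<^sup>2 * (2 * ((k1 (c t))\<^sup>2 + (k2 (c t))\<^sup>2))"
      by (intro mult_left_mono) auto
    also have "\<dots> = 8 * A\<^sup>2 * ((k1 (c t))\<^sup>2 + (k2 (c t))\<^sup>2)" by simp
    finally show ?thesis unfolding U_def power_mult_distrib by (simp only: mult.assoc)
  qed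
  have hi: "?e n \<le> - 2 * \<kappa> * (cmod (cf (c t) n))\<^sup>2 + (4 * U\<^sup>2) * jb n powr (- 2)" if n: "n \<in> - ?F" for n
  proof -
    define x where "x = cmod (cf (c t) n)"
    define m where "m = \<bar>real_of_int n\<bar>"
    have "int N + 1 \<le> \<bar>n\<bar>" using n by auto
    then have "real_of_int (int N + 1) \<le> real_of_int \<bar>n\<bar>" by (rule of_int_le_iff[THEN iffD2])
    then have m: "real N + 1 \<le> m" by (simp add: m_def)
    then have m1: "1 \<le> m" by simp
    have "Re (cnj (cf (c t) n) * control (c t) n) \<le> x * cmod (control (c t) n)"
      using complex_Re_le_cmod[of "cnj (cf (c t) n) * control (c t) n"] by (simp add: norm_mult x_def)
    also have "\<dots> \<le> x * U" using U by (intro mult_left_mono) (auto simp: x_def)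
    finally have 1: "2 * Re (cnj (cf (c t) n) * control (c t) n) \<le> 2 * (x * U)" by simp
    \<comment> \<open>One half of the dissipation \<open>2 * m\<^sup>2 * x\<^sup>2\<close> absorbs
      the input, whose remainder \<open>(U / m)\<^sup>2\<close> is summable. The other half is at
      least \<open>2 * \<kappa> * x\<^sup>2\<close>.\<close>
    have 2: "2 * (x * U) \<le> (m * x)\<^sup>2 + (U / m)\<^sup>2"
      using sum_squares_bound[of "m * x" "U / m"] m1 by simp
    have "(U / m)\<^sup>2 \<le> (4 * U\<^sup>2) * jb n powr (- 2)"
    proof -
      have "jb n \<le> 2 * m" using m1 by (simp add: jb_def m_def)
      then have "(jb n)\<^sup>2 \<le> (2 * m)\<^sup>2" using jb_pos[of n] by (intro power_mono) auto
      then have "1 / m\<^sup>2 \<le> 4 * (1 / (jb n)\<^sup>2)" using m1 jb_pos[of n] by (simp add: field_simps)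
      from mult_left_mono[OF this, of "U\<^sup>2"] show ?thesis
        using jb_pos[of n] by (simp add: power_divide powr_minus inverse_eq_divide mult.commute)
    qed
    moreover have "2 * \<kappa> * x\<^sup>2 \<le> m\<^sup>2 * x\<^sup>2"
    proof (rule mult_right_mono)
      have "(real N + 1)\<^sup>2 \<le> m\<^sup>2" using m by (intro power_mono) auto
      then show "2 * \<kappa> \<le> m\<^sup>2" using N by simp
    qed simp
    ultimately show ?thesis using 1 2 unfolding x_def[symmetric]
      by (simp add: power_mult_distrib m_def)
  qed
  have s2: "(\<lambda>n. jb n powr (- 2)) summable_on - ?F"
    by (rule summable_on_subset_banach[OF jb_powr_summable]) auto
  have sc: "(\<lambda>n. (cmod (cf (c t) n))\<^sup>2) summable_on - ?F" by (rule summable_on_subset_banach[OF cf_summable]) auto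
  have "infsum ?e (- ?F) \<le> (\<Sum>\<^sub>\<infinity>n\<in>- ?F. - 2 * \<kappa> * (cmod (cf (c t) n))\<^sup>2 + (4 * U\<^sup>2) * jb n powr (- 2))"
    by (intro infsum_mono hi summable_on_subset_banach[OF e(2)] summable_on_add summable_on_cmult_right s2 sc) auto
  also have "\<dots> = - 2 * \<kappa> * (\<Sum>\<^sub>\<infinity>n\<in>- ?F. (cmod (cf (c t) n))\<^sup>2) + (4 * U\<^sup>2) * (\<Sum>\<^sub>\<infinity>n\<in>- ?F. jb n powr (- 2))"
    unfolding infsum_cmult_right'[symmetric] by (intro infsum_add summable_on_cmult_right s2 sc)
  also have "(\<Sum>\<^sub>\<infinity>n\<in>- ?F. (cmod (cf (c t) n))\<^sup>2) = (norm (c t))\<^sup>2 - (\<Sum>n\<in>?F. (cmod (cf (c t) n))\<^sup>2)"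
    using split[OF cf_summable] by (simp add: norm_ell2_sq)
  also have "(4 * U\<^sup>2) * (\<Sum>\<^sub>\<infinity>n\<in>- ?F. jb n powr (- 2)) \<le> (4 * U\<^sup>2) * JS"
  proof (rule mult_left_mono)
    have "(\<Sum>\<^sub>\<infinity>n\<in>- ?F. jb n powr (- 2)) \<le> (\<Sum>\<^sub>\<infinity>n. jb n powr (- 2))"
      by (rule infsum_mono_neutral[OF s2 jb_powr_summable]) auto
    also have "\<dots> \<le> JS" by (rule jb_powr_sum_le) simp
    finally show "(\<Sum>\<^sub>\<infinity>n\<in>- ?F. jb n powr (- 2)) \<le> JS" .
  qed simp
  also have "(4 * U\<^sup>2) * JS \<le> 8 * A\<^sup>2 * ((k1 (c t))\<^sup>2 + (k2 (c t))\<^sup>2) * JS"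
    using U2 JS_ge1 by (intro mult_right_mono) auto
  finally have 1: "infsum ?e (- ?F) \<le> - 2 * \<kappa> * ((norm (c t))\<^sup>2 - (\<Sum>n\<in>?F. (cmod (cf (c t) n))\<^sup>2))
      + 8 * A\<^sup>2 * ((k1 (c t))\<^sup>2 + (k2 (c t))\<^sup>2) * JS" by simp
  have "\<bar>?b n\<bar> \<le> real N * (norm (c t)) ^ 3" if n: "n \<in> ?F" for n
  proof -
    have "\<bar>?b n\<bar> \<le> 2 * cmod (cnj (cf (c t) n) * (- (\<i> * of_int n / 2) * conv (c t) (c t) n))"
      using abs_Re_le_cmod[of "cnj (cf (c t) n) * (- (\<i> * of_int n / 2) * conv (c t) (c t) n)"] by linarith
    also have "\<dots> = \<bar>real_of_int n\<bar> * (cmod (cf (c t) n) * cmod (conv (c t) (c t) n))"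
      by (simp add: norm_mult norm_divide)
    also have "\<dots> \<le> real N * (norm (c t) * (norm (c t) * norm (c t)))"
    proof (intro mult_mono cf_le_norm conv_bound)
      have "\<bar>n\<bar> \<le> int N" using n by auto
      then have "real_of_int \<bar>n\<bar> \<le> real_of_int (int N)" by (rule of_int_le_iff[THEN iffD2])
      then show "\<bar>real_of_int n\<bar> \<le> real N" by simp
    qed auto
    finally show ?thesis by (simp add: power3_eq_cube mult.assoc)
  qed
  then have "\<bar>\<Sum>n\<in>?F. ?b n\<bar> \<le> (\<Sum>n\<in>?F. real N * (norm (c t)) ^ 3)"
    by (intro order_trans[OF sum_abs] sum_mono)
  also have "\<dots> = (2 * real N + 1) * real N * (norm (c t)) ^ 3" by simp
  finally have 2: "\<bar>\<Sum>n\<in>?F. ?b n\<bar> \<le> (2 * real N + 1) * real N * (norm (c t)) ^ 3" .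
  have "infsum ?e UNIV - (\<Sum>n\<in>?F. ?e n + ?b n) = infsum ?e (- ?F) - (\<Sum>n\<in>?F. ?b n)"
    using split[OF e(2)] unfolding sum.distrib by linarith
  then have "infsum ?e UNIV - (\<Sum>n\<in>?F. ?e n + ?b n) \<le> - 2 * \<kappa> * ((norm (c t))\<^sup>2 - (\<Sum>n\<in>?F. (cmod (cf (c t) n))\<^sup>2))
      + 8 * A\<^sup>2 * JS * ((k1 (c t))\<^sup>2 + (k2 (c t))\<^sup>2) + (2 * real N + 1) * real N * (norm (c t)) ^ 3"
    using 1 2 by (simp only: mult.assoc mult.commute[of _ JS])
  then show ?thesis using D by blast
qed

text \<open>The linear estimates run at rate \<open>lam + 1\<close>, one more than needed: the
  excess \<open>2 * E\<close> absorbs the cubic remainder as long as the norm is small, and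
  \<open>barrier_decay\<close> keeps it small.\<close>

theorem small_flow_decay:
  fixes N :: nat
  assumes lam: "0 < lam" and N: "2 * (lam + 1) \<le> (real N + 1)\<^sup>2" and mu: "lam + 1 \<le> mu"
    and S: "S1 = {1..N}" "S2 = {0..N}"
    and m1: "0 < m1" and sym1: "\<And>i j. P1 i j = P1 j i"
    and low1: "\<And>x. m1 * (\<Sum>i\<in>S1. (x i)\<^sup>2) \<le> (\<Sum>i\<in>S1. \<Sum>j\<in>S1. P1 i j * x i * x j)"
    and id1: "\<And>x u. u = - (\<Sum>i\<in>S1. w1 i * x i) \<Longrightarrow>
        2 * (\<Sum>i\<in>S1. \<Sum>j\<in>S1. P1 i j * (- (real i)\<^sup>2 * x i + Im (p (int i)) * u) * x j)
          = - 2 * mu * (\<Sum>i\<in>S1. \<Sum>j\<in>S1. P1 i j * x i * x j) - u\<^sup>2"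
    and m2: "0 < m2" and sym2: "\<And>i j. P2 i j = P2 j i"
    and low2: "\<And>x. m2 * (\<Sum>i\<in>S2. (x i)\<^sup>2) \<le> (\<Sum>i\<in>S2. \<Sum>j\<in>S2. P2 i j * x i * x j)"
    and id2: "\<And>x u. u = - (\<Sum>i\<in>S2. w2 i * x i) \<Longrightarrow>
        2 * (\<Sum>i\<in>S2. \<Sum>j\<in>S2. P2 i j * (- (real i)\<^sup>2 * x i + Re (q (int i)) * u) * x j)
          = - 2 * mu * (\<Sum>i\<in>S2. \<Sum>j\<in>S2. P2 i j * x i * x j) - u\<^sup>2"
    and p0: "\<And>i. i \<le> N \<Longrightarrow> Re (p (int i)) = 0" and q0: "\<And>i. i \<le> N \<Longrightarrow> Im (q (int i)) = 0"
    and k1_eq: "\<And>c. k1 c = - (\<Sum>i\<in>S1. w1 i * Im (cf c (int i)))"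
    and k2_eq: "\<And>c. k2 c = - (\<Sum>i\<in>S2. w2 i * Re (cf c (int i)))"
  shows "\<exists>d>0. \<exists>K. \<forall>c. flow c \<longrightarrow> norm (c 0) < d \<longrightarrow>
    (\<forall>t\<ge>0. norm (c t) \<le> K * exp (- lam * t) * norm (c 0))"
proof -
  define V1 where "V1 c = (\<Sum>i\<in>S1. \<Sum>j\<in>S1. P1 i j * Im (cf c (int i)) * Im (cf c (int j)))" for c
  define V2 where "V2 c = (\<Sum>i\<in>S2. \<Sum>j\<in>S2. P2 i j * Re (cf c (int i)) * Re (cf c (int j)))" for c
  define H where "H c = (norm c)\<^sup>2 - (\<Sum>n=-int N..int N. (cmod (cf c n))\<^sup>2)" for c
  define A1 where "A1 = (\<Sum>i\<in>S1. \<Sum>j\<in>S1. \<bar>P1 i j\<bar>)"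
  define A2 where "A2 = (\<Sum>i\<in>S2. \<Sum>j\<in>S2. \<bar>P2 i j\<bar>)"
  \<comment> \<open>The coefficient of \<open>(k1)\<^sup>2 + (k2)\<^sup>2\<close> in the spillover,
    plus 1, so that the surplus of the low modes outweighs it.\<close>
  define M where "M = 8 * A\<^sup>2 * JS + 1"
  define E where "E c = M * (V1 c + V2 c) + H c" for c
  have A12: "0 \<le> A1" "0 \<le> A2" by (simp_all add: A1_def A2_def sum_nonneg)
  have M: "1 \<le> M" using JS_ge1 by (simp add: M_def)
  have V1_low: "(\<Sum>i\<in>S1. (Im (cf c (int i)))\<^sup>2) \<le> V1 c / m1" for c
    using low1[of "\<lambda>i. Im (cf c (int i))"] m1 by (simp add: V1_def pos_le_divide_eq mult.commute)
  have V2_low: "(\<Sum>i\<in>S2. (Re (cf c (int i)))\<^sup>2) \<le> V2 c / m2" for c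
    using low2[of "\<lambda>i. Re (cf c (int i))"] m2 by (simp add: V2_def pos_le_divide_eq mult.commute)
  have V1_0: "0 \<le> V1 c" for c
    using order_trans[OF sum_nonneg V1_low[of c]] m1 by (simp add: zero_le_divide_iff)
  have V2_0: "0 \<le> V2 c" for c
    using order_trans[OF sum_nonneg V2_low[of c]] m2 by (simp add: zero_le_divide_iff)
  have H0: "0 \<le> H c" "H c \<le> (norm c)\<^sup>2" for c
    using sum_cf_le_norm[of "{-int N..int N}" c] by (auto simp: H_def sum_nonneg)
  have re: "\<bar>Re (cf c n)\<bar> \<le> norm c" "\<bar>Im (cf c n)\<bar> \<le> norm c" for c n
    using abs_Re_le_cmod[of "cf c n"] abs_Im_le_cmod[of "cf c n"] cf_le_norm[of c n] by linarith+
  define c3 where "c3 = 1 + 2 / m1 + 2 / m2"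
  define c4 where "c4 = M * (A1 + A2) + 1"
  have c3: "1 \<le> c3" using m1 m2 by (simp add: c3_def)
  have c4: "1 \<le> c4" using M A12 by (simp add: c4_def)
  have norm_le_E: "(norm c)\<^sup>2 \<le> c3 * E c" for c
  proof -
    have EV: "V1 c \<le> E c" "V2 c \<le> E c" "H c \<le> E c"
      using mult_right_mono[OF M, of "V1 c + V2 c"] V1_0[of c] V2_0[of c] H0[of c] by (auto simp: E_def)
    have "(norm c)\<^sup>2 \<le> H c + (2 * (V1 c / m1) + 2 * (V2 c / m2))"
      using low_energy_bound[of c N] V1_low[of c] V2_low[of c] by (simp add: H_def S)
    also have "\<dots> \<le> E c + (2 * (E c / m1) + 2 * (E c / m2))"
      using EV m1 m2 by (intro add_mono mult_left_mono divide_right_mono) auto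
    finally show ?thesis by (simp add: c3_def algebra_simps)
  qed
  have E_le_norm: "E c \<le> c4 * (norm c)\<^sup>2" for c
  proof -
    have "V1 c \<le> A1 * (norm c)\<^sup>2" unfolding V1_def A1_def by (rule quadratic_form_bound) (rule re)
    moreover have "V2 c \<le> A2 * (norm c)\<^sup>2" unfolding V2_def A2_def by (rule quadratic_form_bound) (rule re)
    ultimately have "M * (V1 c + V2 c) \<le> M * (A1 * (norm c)\<^sup>2 + A2 * (norm c)\<^sup>2)"
      using M by (intro mult_left_mono) auto
    then show ?thesis using H0(2)[of c] by (simp add: E_def c4_def algebra_simps)
  qed
  \<comment> \<open>The first part collects the quadratic term acting on the two low-mode forms, the
    second the cubic terms of the low modes left over in the high energy.\<close>
  define c5 where "c5 = M * (A1 + A2) * real N + (2 * real N + 1) * real N"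
  have c5: "0 \<le> c5" using M A12 by (simp add: c5_def)
  have der: "\<exists>D. ((\<lambda>s. E (c s)) has_real_derivative D) (at t) \<and> D \<le> - 2 * (lam + 1) * E (c t) + c5 * (norm (c t)) ^ 3"
    if c: "flow c" and t: "0 < t" for c t
  proof -
    let ?n = "norm (c t)"
    have bb: "cmod (- (\<i> * of_int n / 2) * conv (c t) (c t) n) \<le> real N / 2 * ?n\<^sup>2" if "\<bar>n\<bar> \<le> int N" for n
    proof -
      have "real_of_int \<bar>n\<bar> \<le> real_of_int (int N)" using that by (rule of_int_le_iff[THEN iffD2])
      then have "\<bar>real_of_int n\<bar> / 2 * cmod (conv (c t) (c t) n) \<le> real N / 2 * (?n * ?n)"
        by (intro mult_mono conv_bound) auto
      then show ?thesis by (simp add: norm_mult norm_divide power2_eq_square)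
    qed
    have "\<exists>D. ((\<lambda>s. V1 (c s)) has_real_derivative D) (at t) \<and>
        D \<le> - 2 * mu * V1 (c t) - (k1 (c t))\<^sup>2 + 2 * A1 * (real N / 2 * ?n\<^sup>2 * ?n)"
      unfolding V1_def A1_def
    proof (rule Lyapunov_derivative[OF sym1 id1 _ k1_eq,
        where g="\<lambda>i. Im (- (\<i> * of_int (int i) / 2) * conv (c t) (c t) (int i))"])
      fix i assume i: "i \<in> S1"
      have ctl: "Im (control (c t) (int i)) = Im (p (int i)) * k1 (c t)"
        using i q0 S by (simp add: control_def)
      show "((\<lambda>s. Im (cf (c s) (int i))) has_real_derivative - (real i)\<^sup>2 * Im (cf (c t) (int i))
          + Im (p (int i)) * k1 (c t) + Im (- (\<i> * of_int (int i) / 2) * conv (c t) (c t) (int i))) (at t)"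
        using flow_mode_derivative(2)[OF c t, of "int i"] unfolding ctl of_int_of_nat_eq .
      show "\<bar>Im (- (\<i> * of_int (int i) / 2) * conv (c t) (c t) (int i))\<bar> \<le> real N / 2 * ?n\<^sup>2"
        by (rule order_trans[OF abs_Im_le_cmod bb]) (use i S in auto)
    qed (use re in auto)
    then obtain D1 where D1: "((\<lambda>s. V1 (c s)) has_real_derivative D1) (at t)"
      "D1 \<le> - 2 * mu * V1 (c t) - (k1 (c t))\<^sup>2 + 2 * A1 * (real N / 2 * ?n\<^sup>2 * ?n)" by blast
    have "\<exists>D. ((\<lambda>s. V2 (c s)) has_real_derivative D) (at t) \<and>
        D \<le> - 2 * mu * V2 (c t) - (k2 (c t))\<^sup>2 + 2 * A2 * (real N / 2 * ?n\<^sup>2 * ?n)"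
      unfolding V2_def A2_def
    proof (rule Lyapunov_derivative[OF sym2 id2 _ k2_eq,
        where g="\<lambda>i. Re (- (\<i> * of_int (int i) / 2) * conv (c t) (c t) (int i))"])
      fix i assume i: "i \<in> S2"
      have ctl: "Re (control (c t) (int i)) = Re (q (int i)) * k2 (c t)"
        using i p0 S by (simp add: control_def)
      show "((\<lambda>s. Re (cf (c s) (int i))) has_real_derivative - (real i)\<^sup>2 * Re (cf (c t) (int i))
          + Re (q (int i)) * k2 (c t) + Re (- (\<i> * of_int (int i) / 2) * conv (c t) (c t) (int i))) (at t)"
        using flow_mode_derivative(1)[OF c t, of "int i"] unfolding ctl of_int_of_nat_eq .
      show "\<bar>Re (- (\<i> * of_int (int i) / 2) * conv (c t) (c t) (int i))\<bar> \<le> real N / 2 * ?n\<^sup>2"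
        by (rule order_trans[OF abs_Re_le_cmod bb]) (use i S in auto)
    qed (use re in auto)
    then obtain D2 where D2: "((\<lambda>s. V2 (c s)) has_real_derivative D2) (at t)"
      "D2 \<le> - 2 * mu * V2 (c t) - (k2 (c t))\<^sup>2 + 2 * A2 * (real N / 2 * ?n\<^sup>2 * ?n)" by blast
    obtain D3 where D3: "((\<lambda>s. H (c s)) has_real_derivative D3) (at t)"
      "D3 \<le> - 2 * (lam + 1) * H (c t) + 8 * A\<^sup>2 * JS * ((k1 (c t))\<^sup>2 + (k2 (c t))\<^sup>2) + (2 * real N + 1) * real N * ?n ^ 3"
      using high_energy_derivative[OF c t N] lam unfolding H_def by auto
    have "((\<lambda>s. E (c s)) has_real_derivative M * (D1 + D2) + D3) (at t)"
      unfolding E_def by (intro DERIV_add DERIV_cmult D1 D2 D3)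
    moreover have "M * (D1 + D2) + D3 \<le> - 2 * (lam + 1) * E (c t) + c5 * ?n ^ 3"
    proof -
      define u where "u = (k1 (c t))\<^sup>2 + (k2 (c t))\<^sup>2"
      have u: "0 \<le> u" by (simp add: u_def)
      have "(lam + 1) * (V1 (c t) + V2 (c t)) \<le> mu * (V1 (c t) + V2 (c t))"
        using mu V1_0 V2_0 by (intro mult_right_mono) auto
      then have "D1 + D2 \<le> - 2 * (lam + 1) * (V1 (c t) + V2 (c t)) - u + (A1 + A2) * (real N * ?n ^ 3)"
        using D1(2) D2(2) by (simp add: u_def algebra_simps power2_eq_square power3_eq_cube)
      then have "M * (D1 + D2) \<le> M * (- 2 * (lam + 1) * (V1 (c t) + V2 (c t)) - u + (A1 + A2) * (real N * ?n ^ 3))"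
        using M by (intro mult_left_mono) auto
      also have "\<dots> = - 2 * (lam + 1) * (M * (V1 (c t) + V2 (c t))) - M * u + M * (A1 + A2) * real N * ?n ^ 3"
        by (simp add: algebra_simps)
      finally have "M * (D1 + D2) + D3 \<le> - 2 * (lam + 1) * (M * (V1 (c t) + V2 (c t))) - M * u + M * (A1 + A2) * real N * ?n ^ 3
          + (- 2 * (lam + 1) * H (c t) + 8 * A\<^sup>2 * JS * u + (2 * real N + 1) * real N * ?n ^ 3)"
        using D3(2) unfolding u_def by linarith
      also have "\<dots> = - 2 * (lam + 1) * E (c t) + c5 * ?n ^ 3 - u"
        by (simp add: E_def c5_def M_def algebra_simps)
      finally show ?thesis using u by simp
    qed
    ultimately show ?thesis by blast
  qed
  \<comment> \<open>Below this norm the cubic remainder is at most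
    \<open>c5 * c3 * \<rho> * E \<le> 2 * E\<close>, exactly the reserve in the rate; the energy
    level \<open>r\<close> guarantees the norm bound.\<close>
  define \<rho> where "\<rho> = 2 / (c5 * c3 + 1)"
  define r where "r = \<rho>\<^sup>2 / c3"
  have \<rho>: "0 < \<rho>" using c5 c3 by (simp add: \<rho>_def add_nonneg_pos)
  have r: "0 < r" using \<rho> c3 by (simp add: r_def)
  have \<rho>c: "c5 * c3 * \<rho> \<le> 2"
  proof -
    have "x * (2 / x) = 2" if "x \<noteq> 0" for x :: real using that by simp
    moreover have "c5 * c3 + 1 \<noteq> 0" using mult_nonneg_nonneg[of c5 c3] c5 c3 by linarith
    ultimately have "(c5 * c3 + 1) * \<rho> = 2" unfolding \<rho>_def by blast
    then show ?thesis using \<rho> by (simp add: distrib_right)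
  qed
  have decay: "norm (c t) \<le> sqrt (c3 * c4) * exp (- lam * t) * norm (c 0)"
    if c: "flow c" and small: "norm (c 0) < sqrt (r / c4)" and t: "0 \<le> t" for c t
  proof -
    have E0: "0 \<le> E c" for c using M V1_0[of c] V2_0[of c] H0[of c] by (simp add: E_def)
    have "E (c 0) \<le> c4 * (norm (c 0))\<^sup>2" by (rule E_le_norm)
    also have "\<dots> < c4 * (sqrt (r / c4))\<^sup>2"
      using c4 small by (intro mult_strict_left_mono power_strict_mono) auto
    also have "\<dots> = r" using c4 r by simp
    finally have E0r: "E (c 0) < r" .
    have cont: "continuous_on {0..} (\<lambda>s. E (c s))"
      unfolding E_def V1_def V2_def H_def
      by (intro continuous_intros flow_continuous[OF c] continuous_on_cf)
    have "E (c t) \<le> exp (- (2 * lam) * t) * E (c 0)"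
    proof (rule barrier_decay[OF cont _ E0 E0r _ t])
      fix s assume s: "0 < s" "E (c s) \<le> r"
      obtain D where D: "((\<lambda>s. E (c s)) has_real_derivative D) (at s)"
        "D \<le> - 2 * (lam + 1) * E (c s) + c5 * (norm (c s)) ^ 3" using der[OF c s(1)] by blast
      have "(norm (c s))\<^sup>2 \<le> c3 * r" using norm_le_E[of "c s"] mult_left_mono[OF s(2), of c3] c3 by linarith
      also have "\<dots> = \<rho>\<^sup>2" using c3 by (simp add: r_def)
      finally have n: "norm (c s) \<le> \<rho>" by (rule power2_le_imp_le) (use \<rho> in simp)
      have "c5 * (norm (c s)) ^ 3 = c5 * ((norm (c s))\<^sup>2 * norm (c s))" by (simp add: power2_eq_square power3_eq_cube)
      also have "\<dots> \<le> c5 * ((c3 * E (c s)) * \<rho>)"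
        using n c5 c3 E0[of "c s"] by (intro mult_left_mono mult_mono norm_le_E) auto
      also have "\<dots> = (c5 * c3 * \<rho>) * E (c s)" by simp
      also have "\<dots> \<le> 2 * E (c s)" using E0 \<rho>c by (intro mult_right_mono) auto
      finally have "D \<le> - (2 * lam) * E (c s)" using D(2) by (simp add: algebra_simps)
      then show "\<exists>D. ((\<lambda>s. E (c s)) has_real_derivative D) (at s) \<and> D \<le> - (2 * lam) * E (c s)" using D(1) by blast
    qed (use lam in simp)
    also have "\<dots> \<le> exp (- (2 * lam) * t) * (c4 * (norm (c 0))\<^sup>2)" by (intro mult_left_mono E_le_norm) auto
    finally have "(norm (c t))\<^sup>2 \<le> c3 * (exp (- (2 * lam) * t) * (c4 * (norm (c 0))\<^sup>2))"
      using norm_le_E[of "c t"] c3 by (meson mult_left_mono order_trans zero_le_one)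
    also have "\<dots> = (sqrt (c3 * c4) * exp (- lam * t) * norm (c 0))\<^sup>2"
      using c3 c4 by (simp add: power_mult_distrib exp_double[symmetric] mult_ac)
    finally show ?thesis by (rule power2_le_imp_le) (use c3 c4 in simp)
  qed
  have "0 < sqrt (r / c4)" using r c4 by simp
  then show ?thesis using decay by blast
qed

end

section \<open>Fourier series of square-integrable functions\<close>

abbreviation MT :: "real measure" where "MT \<equiv> lebesgue_on {0..2 * pi}"

lemma set_integrable_MT: "set_integrable lebesgue {0..2 * pi} f \<longleftrightarrow> integrable MT f" for f :: "real \<Rightarrow> real"
  unfolding set_integrable_def by (rule integrable_restrict_space[symmetric]) simp

lemma LINT_MT: "(LINT x:{0..2 * pi}|lebesgue. f x) = integral\<^sup>L MT f" for f :: "real \<Rightarrow> real"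
  unfolding set_lebesgue_integral_def by (rule integral_restrict_space[symmetric]) simp

lemma AE_MT_negligible: "negligible N \<Longrightarrow> (\<And>x. x \<in> {0..2 * pi} \<Longrightarrow> x \<notin> N \<Longrightarrow> P x) \<Longrightarrow> AE x in MT. P x"
  by (subst AE_restrict_space_iff) (auto intro!: AE_I'[of N] simp: negligible_iff_null_sets)

lemma integrable_MT_const: "integrable MT (\<lambda>x. c :: 'a::euclidean_space)"
  by (rule continuous_imp_integrable_real) simp

lemma measurable_MT_continuous: "continuous_on {0..2 * pi} f \<Longrightarrow> (f :: real \<Rightarrow> 'a::euclidean_space) \<in> borel_measurable MT"
  by (rule borel_measurable_integrable[OF continuous_imp_integrable_real])

text \<open>Square integrability over one period, without the periodicity of \<open>L2\<close>.
  Restricted continuous functions and products with bounded factors then fall under the same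
  notion.\<close>

definition sqint :: "(real \<Rightarrow> real) \<Rightarrow> bool" where
  "sqint f \<longleftrightarrow> f \<in> borel_measurable MT \<and> integrable MT (\<lambda>x. (f x)\<^sup>2)"

lemma sqint_integrable_mult:
  assumes "sqint f" "sqint g" shows "integrable MT (\<lambda>x. f x * g x)"
proof (rule Bochner_Integration.integrable_bound)
  show "integrable MT (\<lambda>x. (f x)\<^sup>2 + (g x)\<^sup>2)" using assms by (auto simp: sqint_def)
  show "(\<lambda>x. f x * g x) \<in> borel_measurable MT" using assms by (auto simp: sqint_def)
  have "\<bar>f x * g x\<bar> \<le> \<bar>(f x)\<^sup>2 + (g x)\<^sup>2\<bar>" for x
    using sum_squares_bound[of "\<bar>f x\<bar>" "\<bar>g x\<bar>"] abs_ge_zero[of "f x * g x"]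
    unfolding abs_mult power2_abs by linarith
  then show "AE x in MT. norm (f x * g x) \<le> norm ((f x)\<^sup>2 + (g x)\<^sup>2)" by simp
qed

lemma sqint_bounded:
  assumes "f \<in> borel_measurable MT" "\<And>x. x \<in> {0..2 * pi} \<Longrightarrow> \<bar>f x\<bar> \<le> K"
  shows "sqint f"
  unfolding sqint_def
proof
  show "integrable MT (\<lambda>x. (f x)\<^sup>2)"
  proof (rule Bochner_Integration.integrable_bound)
    show "integrable MT (\<lambda>x. K\<^sup>2)" by (rule integrable_MT_const)
    show "AE x in MT. norm ((f x)\<^sup>2) \<le> norm (K\<^sup>2)"
    proof (rule AE_I2)
      fix x assume "x \<in> space MT"
      then have "\<bar>f x\<bar> \<le> \<bar>K\<bar>" using assms(2)[of x] abs_ge_self[of K] by simp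
      then show "norm ((f x)\<^sup>2) \<le> norm (K\<^sup>2)" by (simp add: abs_le_square_iff)
    qed
  qed (use assms(1) in simp)
qed (rule assms(1))

lemma sqint_const: "sqint (\<lambda>x. c)"
  by (rule sqint_bounded[where K="\<bar>c\<bar>"]) auto

lemma sqint_integrable: "sqint f \<Longrightarrow> integrable MT f"
  using sqint_integrable_mult[of f "\<lambda>x. 1"] sqint_const by simp

lemma sqint_mult_bounded:
  assumes f: "sqint f" and g: "g \<in> borel_measurable MT" "\<And>x. x \<in> {0..2 * pi} \<Longrightarrow> \<bar>g x\<bar> \<le> K"
  shows "sqint (\<lambda>x. g x * f x)"
  unfolding sqint_def
proof
  show "(\<lambda>x. g x * f x) \<in> borel_measurable MT" using f g by (auto simp: sqint_def)
  show "integrable MT (\<lambda>x. (g x * f x)\<^sup>2)"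
  proof (rule Bochner_Integration.integrable_bound)
    show "integrable MT (\<lambda>x. K\<^sup>2 * (f x)\<^sup>2)" using f by (auto simp: sqint_def)
    show "AE x in MT. norm ((g x * f x)\<^sup>2) \<le> norm (K\<^sup>2 * (f x)\<^sup>2)"
    proof (rule AE_I2)
      fix x assume "x \<in> space MT"
      then have "\<bar>g x\<bar> \<le> K" using g by auto
      then have "(g x)\<^sup>2 \<le> K\<^sup>2" by (metis abs_ge_zero power2_abs power_mono)
      then show "norm ((g x * f x)\<^sup>2) \<le> norm (K\<^sup>2 * (f x)\<^sup>2)" by (simp add: power_mult_distrib mult_right_mono)
    qed
  qed (use f g in \<open>auto simp: sqint_def\<close>)
qed

lemma sqint_scale: "sqint f \<Longrightarrow> sqint (\<lambda>x. c * f x)"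
  by (rule sqint_mult_bounded[where K="\<bar>c\<bar>"]) auto

lemma sqint_add:
  assumes f: "sqint f" and g: "sqint g" shows "sqint (\<lambda>x. f x + g x)"
  unfolding sqint_def
proof
  have "(\<lambda>x. (f x + g x)\<^sup>2) = (\<lambda>x. (f x)\<^sup>2 + (g x)\<^sup>2 + 2 * (f x * g x))" by (auto simp: power2_sum)
  then show "integrable MT (\<lambda>x. (f x + g x)\<^sup>2)"
    using f g sqint_integrable_mult[OF f g] by (simp add: sqint_def)
qed (use f g in \<open>auto simp: sqint_def\<close>)

lemma sqint_diff: "sqint f \<Longrightarrow> sqint g \<Longrightarrow> sqint (\<lambda>x. f x - g x)"
  using sqint_add[of f "\<lambda>x. - 1 * g x"] sqint_scale[of g "- 1"] by simp

lemma sqint_continuous: "continuous_on {0..2 * pi} f \<Longrightarrow> sqint f"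
  unfolding sqint_def
  by (auto intro!: continuous_imp_integrable_real continuous_intros measurable_MT_continuous)

subsection \<open>Trigonometric polynomials\<close>

definition ch :: "int \<Rightarrow> real \<Rightarrow> complex" where "ch n x = cis (real_of_int n * x)"

lemma ch_add: "ch (m + n) x = ch m x * ch n x"
  by (simp add: ch_def cis_mult distrib_right)

lemma ch_minus: "ch (- n) x = cnj (ch n x)"
  by (simp add: ch_def cis_cnj)

lemma norm_ch [simp]: "norm (ch n x) = 1" by (simp add: ch_def)

lemma continuous_on_ch: "continuous_on S (ch n)"
  unfolding ch_def by (intro continuous_intros)

lemma integrable_ch: "integrable MT (ch n)"
  by (intro continuous_imp_integrable_real continuous_on_ch)

lemma integral_ch: "integral\<^sup>L MT (ch n) = (if n = 0 then 2 * of_real pi else 0)"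
proof -
  have "(ch n has_integral (if n = 0 then 2 * of_real pi else 0)) {0..2 * pi}"
  proof (cases "n = 0")
    case True
    have "((\<lambda>x. 1 :: complex) has_integral ((2 * pi) *\<^sub>R 1)) {0..2 * pi}"
      using has_integral_const_real[of "1 :: complex" 0 "2 * pi"] by simp
    moreover have "ch n = (\<lambda>x. 1)" using True by (auto simp: ch_def)
    ultimately show ?thesis using True by (simp add: scaleR_conv_of_real)
  next
    case False
    define F where "F x = cis (real_of_int n * x) / (\<i> * of_int n)" for x
    have "(F has_vector_derivative ch n x) (at x within {0..2 * pi})" for x
      unfolding F_def ch_def cis_conv_exp using False
      by (auto intro!: derivative_eq_intros has_vector_derivative_real_field simp: field_simps)
    then have "(ch n has_integral F (2 * pi) - F 0) {0..2 * pi}"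
      by (intro fundamental_theorem_of_calculus) auto
    moreover have "F (2 * pi) = F 0"
      using cis_multiple_2pi[of "real_of_int n"] by (simp add: F_def mult.commute mult.left_commute)
    ultimately show ?thesis using False by simp
  qed
  then show ?thesis using lebesgue_integral_eq_integral[OF integrable_ch[of n]] by (simp add: integral_unique)
qed

text \<open>Generated inductively so that closure under products is an induction;
  \<open>trig_sum\<close> recovers the finite sums of characters.\<close>

inductive trig :: "(real \<Rightarrow> complex) \<Rightarrow> bool" where
  mono: "trig (\<lambda>x. a * ch n x)"
| add: "trig f \<Longrightarrow> trig g \<Longrightarrow> trig (\<lambda>x. f x + g x)"

lemma trig_const: "trig (\<lambda>x. c)"
  using trig.mono[of c 0] by (simp add: ch_def)

lemma trig_mult_mono: "trig f \<Longrightarrow> trig (\<lambda>x. f x * (a * ch n x))"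
proof (induction rule: trig.induct)
  case (mono b m)
  have "(\<lambda>x. b * ch m x * (a * ch n x)) = (\<lambda>x. (b * a) * ch (m + n) x)" by (auto simp: ch_add)
  then show ?case using trig.mono by metis
next
  case (add f g)
  then show ?case using trig.add[OF add.IH] by (simp add: distrib_right)
qed

lemma trig_mult: "trig g \<Longrightarrow> trig f \<Longrightarrow> trig (\<lambda>x. f x * g x)"
proof (induction rule: trig.induct)
  case (mono a n)
  then show ?case by (rule trig_mult_mono)
next
  case (add g h)
  then show ?case using trig.add[of "\<lambda>x. f x * g x" "\<lambda>x. f x * h x"] by (simp add: distrib_left)
qed

text \<open>Real polynomials in the plane, restricted to the unit circle, are trigonometric
  polynomials. This gives access to the Stone-Weierstrass theorem on the circle.\<close>

lemma trig_real_polynomial_function: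
  "real_polynomial_function g \<Longrightarrow> trig (\<lambda>x. of_real (g (cis x)))"
proof (induction rule: real_polynomial_function.induct)
  case (linear f)
  have "f (cis x) = cos x * f 1 + sin x * f \<i>" for x
  proof -
    have "cis x = cos x *\<^sub>R 1 + sin x *\<^sub>R \<i>" by (simp add: complex_eq_iff)
    then show ?thesis using linear by (simp add: linear_add linear_scale bounded_linear.linear)
  qed
  moreover have "complex_of_real (cos x) = (ch 1 x + ch (- 1) x) / 2"
    "complex_of_real (sin x) = (ch 1 x - ch (- 1) x) / (2 * \<i>)" for x
    by (auto simp: ch_def complex_eq_iff)
  ultimately have "(\<lambda>x. of_real (f (cis x)))
      = (\<lambda>x. (of_real (f 1) / 2 + of_real (f \<i>) / (2 * \<i>)) * ch 1 x + (of_real (f 1) / 2 - of_real (f \<i>) / (2 * \<i>)) * ch (- 1) x)"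
    by (simp only: of_real_add of_real_mult) (simp add: algebra_simps add_divide_distrib diff_divide_distrib)
  then show ?case using trig.add[OF trig.mono trig.mono] by metis
next
  case (const c)
  show ?case by (rule trig_const)
next
  case (add f g)
  then show ?case using trig.add[OF add.IH] by simp
next
  case (mult f g)
  then show ?case using trig_mult[OF mult.IH(2,1)] by simp
qed

lemma trig_sum: "trig f \<Longrightarrow> \<exists>A a. finite A \<and> f = (\<lambda>x. \<Sum>n\<in>A. a n * ch n x)"
proof (induction rule: trig.induct)
  case (mono a n)
  show ?case by (rule exI[of _ "{n}"], rule exI[of _ "\<lambda>_. a"]) simp
next
  case (add f g)
  then obtain A a B b where A: "finite A" "f = (\<lambda>x. \<Sum>n\<in>A. a n * ch n x)"
    and B: "finite B" "g = (\<lambda>x. \<Sum>n\<in>B. b n * ch n x)" by blast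
  define c where "c n = (if n \<in> A then a n else 0) + (if n \<in> B then b n else 0)" for n
  have e: "(\<Sum>n\<in>D. d n * ch n x) = (\<Sum>n\<in>A \<union> B. (if n \<in> D then d n else 0) * ch n x)"
    if "D \<subseteq> A \<union> B" for D d x
    using that A(1) B(1) by (intro sum.mono_neutral_cong_left) auto
  have "(\<lambda>x. f x + g x) = (\<lambda>x. \<Sum>n\<in>A \<union> B. c n * ch n x)"
    unfolding A(2) B(2) e[of A a, OF Un_upper1] e[of B b, OF Un_upper2] c_def
    by (simp add: sum.distrib distrib_right)
  then show ?case using A(1) B(1) by (intro exI[of _ "A \<union> B"] exI[of _ c]) auto
qed

subsection \<open>Density\<close>

text \<open>The factor \<open>cutoff n (Re z)\<close> vanishes near \<open>z = 1\<close>, where \<open>Arg2pi\<close> jumps.\<close>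

definition cutoff :: "nat \<Rightarrow> real \<Rightarrow> real" where
  "cutoff n y = min 1 (max 0 (real n * (1 - y) - 1))"

text \<open>After multiplication by the cutoff, \<open>g\<close> descends along
  \<open>Arg2pi\<close> to a continuous function \<open>H\<close> on the circle, to which
  Stone-Weierstrass applies.\<close>

lemma trig_approx_cutoff:
  fixes g :: "real \<Rightarrow> real"
  assumes g: "continuous_on UNIV g" and e: "0 < e"
  shows "\<exists>T. trig T \<and> (\<forall>x\<in>{0..2 * pi}. cmod (of_real (g x * cutoff n (cos x)) - T x) < e)"
proof -
  define H where "H z = g (Arg2pi z) * cutoff n (Re z)" for z
  have cc: "continuous_on UNIV (\<lambda>z. cutoff n (Re z))" unfolding cutoff_def by (intro continuous_intros)
  have "continuous (at z within sphere 0 1) H" if z: "z \<in> sphere 0 1" for z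
  proof (cases "z = 1")
    case False
    have "z \<notin> \<real>\<^sub>\<ge>\<^sub>0"
    proof
      assume "z \<in> \<real>\<^sub>\<ge>\<^sub>0"
      then have "z = of_real (cmod z)" by (auto simp: nonneg_Reals_def)
      then show False using z False by simp
    qed
    then have "isCont Arg2pi z" by (rule continuous_at_Arg2pi)
    then have "isCont H z" unfolding H_def using g cc
      by (intro continuous_intros) (auto simp: continuous_on_eq_continuous_at isCont_o2)
    then show ?thesis by (rule continuous_at_imp_continuous_at_within)
  next
    case True
    have "open {w. real n * (1 - Re w) - 1 < 0}" by (intro open_Collect_less continuous_intros)
    moreover have "z \<in> {w. real n * (1 - Re w) - 1 < 0}" using True by simp
    ultimately have "\<forall>\<^sub>F w in nhds z. w \<in> {w. real n * (1 - Re w) - 1 < 0}" by (rule eventually_nhds_in_open)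
    then have "\<forall>\<^sub>F w in nhds z. H w = 0" by eventually_elim (simp add: H_def cutoff_def)
    then have "isCont H z \<longleftrightarrow> isCont (\<lambda>_. 0 :: real) z" by (rule isCont_cong)
    then show ?thesis by (simp add: continuous_at_imp_continuous_at_within)
  qed
  then have "continuous_on (sphere 0 1) H" by (simp add: continuous_on_eq_continuous_within)
  then obtain q where q: "real_polynomial_function q" "\<And>z. z \<in> sphere 0 1 \<Longrightarrow> \<bar>H z - q z\<bar> < e"
    using Stone_Weierstrass_real_polynomial_function[of "sphere 0 1" H e] e by auto
  have "cmod (of_real (g x * cutoff n (cos x)) - of_real (q (cis x))) < e" if x: "x \<in> {0..2 * pi}" for x
  proof -
    have "H (cis x) = g x * cutoff n (cos x)"
    \<comment> \<open>There \<open>cis x = 1\<close> has argument 0 and not \<open>2 * pi\<close>,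
      but the cutoff makes both sides 0.\<close>
    proof (cases "x = 2 * pi")
      case False
      then have "Arg2pi (cis x) = x" using x Arg2pi_unique[of 1 x "cis x"] by (simp add: cis_conv_exp)
      then show ?thesis by (simp add: H_def)
    qed (simp add: H_def cutoff_def)
    then have "\<bar>g x * cutoff n (cos x) - q (cis x)\<bar> < e" using q(2)[of "cis x"] by simp
    then show ?thesis by (metis norm_of_real of_real_diff)
  qed
  then show ?thesis using trig_real_polynomial_function[OF q(1)] by blast
qed

lemma cutoff_bounds: "0 \<le> cutoff n y" "cutoff n y \<le> 1" by (simp_all add: cutoff_def)

lemma cutoff_tendsto: assumes "y < 1" shows "(\<lambda>n. cutoff n y) \<longlonglongrightarrow> 1"
proof (rule tendsto_eventually)
  obtain N where N: "2 / (1 - y) \<le> real N" using real_arch_simple by blast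
  have "cutoff n y = 1" if "N \<le> n" for n
  proof -
    have "2 / (1 - y) \<le> real n" using N that by linarith
    then have "2 \<le> real n * (1 - y)" using assms by (simp add: pos_divide_le_eq)
    then show ?thesis by (simp add: cutoff_def)
  qed
  then show "\<forall>\<^sub>F n in sequentially. cutoff n y = 1" unfolding eventually_sequentially by blast
qed

definition clip :: "real \<Rightarrow> real \<Rightarrow> real" where "clip K y = max (- K) (min K y)"

lemma clip_bound: "0 \<le> K \<Longrightarrow> \<bar>clip K y\<bar> \<le> K" by (simp add: clip_def)

lemma clip_le: "0 \<le> K \<Longrightarrow> \<bar>clip K y\<bar> \<le> \<bar>y\<bar>" by (auto simp: clip_def)

lemma continuous_on_clip: "continuous_on S f \<Longrightarrow> continuous_on S (\<lambda>x. clip K (f x))"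
  unfolding clip_def by (intro continuous_intros)

lemma clip_measurable: "f \<in> borel_measurable M \<Longrightarrow> (\<lambda>x. clip K (f x)) \<in> borel_measurable M"
  unfolding clip_def by (intro borel_measurable_max borel_measurable_min borel_measurable_const)

lemma clip_approx:
  assumes f: "sqint f"
  shows "(\<lambda>k. integral\<^sup>L MT (\<lambda>x. (f x - clip (real k) (f x))\<^sup>2)) \<longlonglongrightarrow> 0"
proof -
  have "(\<lambda>k. integral\<^sup>L MT (\<lambda>x. (f x - clip (real k) (f x))\<^sup>2)) \<longlonglongrightarrow> integral\<^sup>L MT (\<lambda>x. 0)"
  proof (rule integral_dominated_convergence[where w="\<lambda>x. (2 * f x)\<^sup>2"])
    show "integrable MT (\<lambda>x. (2 * f x)\<^sup>2)" using f by (simp add: sqint_def power_mult_distrib)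
    show "(\<lambda>x. (f x - clip (real k) (f x))\<^sup>2) \<in> borel_measurable MT" for k
      using f clip_measurable[of f MT "real k"] by (auto simp: sqint_def)
    show "AE x in MT. (\<lambda>k. (f x - clip (real k) (f x))\<^sup>2) \<longlonglongrightarrow> 0"
    proof (rule AE_I2, rule tendsto_eventually)
      fix x
      obtain N where N: "\<bar>f x\<bar> \<le> real N" using real_arch_simple by blast
      have "(f x - clip (real k) (f x))\<^sup>2 = 0" if "N \<le> k" for k
      proof -
        have "\<bar>f x\<bar> \<le> real k" using N that by linarith
        then show ?thesis by (auto simp: clip_def)
      qed
      then show "\<forall>\<^sub>F k in sequentially. (f x - clip (real k) (f x))\<^sup>2 = 0" unfolding eventually_sequentially by blast
    qed
    show "AE x in MT. norm ((f x - clip (real k) (f x))\<^sup>2) \<le> (2 * f x)\<^sup>2" for k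
    proof (rule AE_I2)
      fix x
      have "\<bar>f x - clip (real k) (f x)\<bar> \<le> \<bar>2 * f x\<bar>" using clip_le[of "real k" "f x"] by simp
      then show "norm ((f x - clip (real k) (f x))\<^sup>2) \<le> (2 * f x)\<^sup>2" by (simp add: abs_le_square_iff)
    qed
  qed simp
  then show ?thesis by simp
qed

text \<open>A measurable function is the limit of continuous ones off a negligible set. Clipping
  them at the bound of \<open>f\<close> supplies a constant majorant, so that dominated convergence
  yields convergence in the mean square.\<close>

lemma cutoff_approx:
  assumes f: "f \<in> borel_measurable MT" and K: "0 \<le> K" "\<And>x. \<bar>f x\<bar> \<le> K"
  shows "\<exists>h. (\<forall>n. continuous_on UNIV (h n)) \<and>
    (\<lambda>n. integral\<^sup>L MT (\<lambda>x. (f x - h n x * cutoff n (cos x))\<^sup>2)) \<longlonglongrightarrow> 0"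
proof -
  have "f measurable_on {0..2 * pi}" using f by (simp add: measurable_on_iff_borel_measurable)
  then obtain N g where N: "negligible N" and g: "\<And>n. continuous_on UNIV (g n)"
    and lim: "\<And>x. x \<notin> N \<Longrightarrow> (\<lambda>n. g n x) \<longlonglongrightarrow> (if x \<in> {0..2 * pi} then f x else 0)"
    unfolding measurable_on_def by blast
  define h where "h n x = clip K (g n x)" for n x
  have h: "continuous_on UNIV (h n)" for n unfolding h_def by (intro continuous_on_clip g)
  have cm: "(\<lambda>x. h n x * cutoff n (cos x)) \<in> borel_measurable MT" for n
    unfolding cutoff_def
    by (intro measurable_MT_continuous continuous_intros continuous_on_subset[OF h]) auto
  have "(\<lambda>n. integral\<^sup>L MT (\<lambda>x. (f x - h n x * cutoff n (cos x))\<^sup>2)) \<longlonglongrightarrow> integral\<^sup>L MT (\<lambda>x. 0)"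
  proof (rule integral_dominated_convergence[where w="\<lambda>x. (2 * K)\<^sup>2"])
    show "integrable MT (\<lambda>x. (2 * K)\<^sup>2)" by (rule integrable_MT_const)
    show "(\<lambda>x. (f x - h n x * cutoff n (cos x))\<^sup>2) \<in> borel_measurable MT" for n
      using f cm[of n] by simp
    show "AE x in MT. (\<lambda>n. (f x - h n x * cutoff n (cos x))\<^sup>2) \<longlonglongrightarrow> 0"
    proof (rule AE_MT_negligible)
      \<comment> \<open>At the two end points the cosine equals 1 and the cutoff stays 0, so these
        points are excluded too.\<close>
      show "negligible (N \<union> {0, 2 * pi})" using N by (auto intro: negligible_Un)
      fix x assume x: "x \<in> {0..2 * pi}" "x \<notin> N \<union> {0, 2 * pi}"
      have "cos x < 1"
      proof (rule ccontr)
        assume "\<not> cos x < 1"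
        then have "cos x = 1" using cos_le_one[of x] by linarith
        then obtain m :: int where m: "x = of_int m * 2 * pi" using cos_one_2pi_int[of x] by blast
        have "0 < x" "x < 2 * pi" using x by auto
        then have "0 < real_of_int m * (2 * pi)" "real_of_int m * (2 * pi) < 1 * (2 * pi)" using m by auto
        then have "0 * (2 * pi) < real_of_int m * (2 * pi)" "real_of_int m * (2 * pi) < 1 * (2 * pi)" by simp_all
        then have "0 < real_of_int m" "real_of_int m < 1"
          using mult_right_less_imp_less[of 0 "2 * pi" "real_of_int m"]
            mult_right_less_imp_less[of "real_of_int m" "2 * pi" 1] by simp_all
        then show False by simp
      qed
      then have "(\<lambda>n. cutoff n (cos x)) \<longlonglongrightarrow> 1" by (rule cutoff_tendsto)
      moreover have "(\<lambda>n. h n x) \<longlonglongrightarrow> clip K (f x)"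
        using lim[of x] x unfolding h_def clip_def by (auto intro!: tendsto_intros)
      then have "(\<lambda>n. h n x) \<longlonglongrightarrow> f x" using K(2)[of x] by (auto simp: clip_def abs_le_iff)
      ultimately have "(\<lambda>n. (f x - h n x * cutoff n (cos x))\<^sup>2) \<longlonglongrightarrow> (f x - f x * 1)\<^sup>2"
        by (intro tendsto_intros)
      then show "(\<lambda>n. (f x - h n x * cutoff n (cos x))\<^sup>2) \<longlonglongrightarrow> 0" by simp
    qed
    show "AE x in MT. norm ((f x - h n x * cutoff n (cos x))\<^sup>2) \<le> (2 * K)\<^sup>2" for n
    proof (rule AE_I2)
      fix x
      have "\<bar>h n x * cutoff n (cos x)\<bar> \<le> K * 1"
        unfolding abs_mult using cutoff_bounds[of n "cos x"] K
        by (intro mult_mono) (auto simp: h_def clip_bound)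
      then have "\<bar>f x - h n x * cutoff n (cos x)\<bar> \<le> \<bar>2 * K\<bar>" using K(1) K(2)[of x] by linarith
      then show "norm ((f x - h n x * cutoff n (cos x))\<^sup>2) \<le> (2 * K)\<^sup>2" by (simp add: abs_le_square_iff)
    qed
  qed simp
  then show ?thesis using h by auto
qed

lemma trig_measurable: "trig T \<Longrightarrow> continuous_on S T"
  by (induction rule: trig.induct) (auto intro!: continuous_intros continuous_on_ch)

text \<open>Three errors: clipping \<open>f\<close>, replacing the clipped function by a continuous
  one with cutoff, and uniform approximation by a trigonometric polynomial. Each contributes at most
  a third of \<open>e\<close> after \<open>(a + b + c)\<^sup>2 \<le> 3 * (a\<^sup>2 + b\<^sup>2 +
  c\<^sup>2)\<close>.\<close>

lemma trig_dense:
  assumes f: "sqint f" and e: "0 < e"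
  shows "\<exists>T. trig T \<and> integrable MT (\<lambda>x. (cmod (of_real (f x) - T x))\<^sup>2) \<and>
    integral\<^sup>L MT (\<lambda>x. (cmod (of_real (f x) - T x))\<^sup>2) < e"
proof -
  have "\<forall>\<^sub>F k in sequentially. integral\<^sup>L MT (\<lambda>x. (f x - clip (real k) (f x))\<^sup>2) < e / 9"
    using clip_approx[OF f] by (rule order_tendstoD) (use e in simp)
  then obtain k where k: "integral\<^sup>L MT (\<lambda>x. (f x - clip (real k) (f x))\<^sup>2) < e / 9"
    by (auto simp: eventually_sequentially)
  define fk where "fk x = clip (real k) (f x)" for x
  have fkm: "fk \<in> borel_measurable MT" unfolding fk_def using f by (intro clip_measurable) (simp add: sqint_def)
  have fkb: "\<bar>fk x\<bar> \<le> real k" for x by (simp add: fk_def clip_bound)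
  obtain h where h: "\<And>n. continuous_on UNIV (h n)"
    "(\<lambda>n. integral\<^sup>L MT (\<lambda>x. (fk x - h n x * cutoff n (cos x))\<^sup>2)) \<longlonglongrightarrow> 0"
    using cutoff_approx[OF fkm _ fkb] by auto
  have "\<forall>\<^sub>F n in sequentially. integral\<^sup>L MT (\<lambda>x. (fk x - h n x * cutoff n (cos x))\<^sup>2) < e / 9"
    using h(2) by (rule order_tendstoD) (use e in simp)
  then obtain n where n: "integral\<^sup>L MT (\<lambda>x. (fk x - h n x * cutoff n (cos x))\<^sup>2) < e / 9"
    by (auto simp: eventually_sequentially)
  define hn where "hn x = h n x * cutoff n (cos x)" for x
  have hnc: "continuous_on S hn" for S unfolding hn_def cutoff_def
    by (intro continuous_intros continuous_on_subset[OF h(1)]) auto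
  \<comment> \<open>Makes \<open>3 * d\<^sup>2\<close> times the period \<open>2 * pi\<close> at
    most \<open>e / 3\<close>.\<close>
  define d where "d = sqrt (e / (18 * pi + 1))"
  have d: "0 < d" "d\<^sup>2 = e / (18 * pi + 1)" using e by (auto simp: d_def add_pos_pos)
  obtain T where T: "trig T" "\<And>x. x \<in> {0..2 * pi} \<Longrightarrow> cmod (of_real (hn x) - T x) < d"
    using trig_approx_cutoff[OF h(1) d(1), of n n] unfolding hn_def by blast
  have sq: "sqint fk" "sqint hn" using fkm fkb sqint_bounded sqint_continuous[OF hnc] by blast+
  have i1: "integrable MT (\<lambda>x. (f x - fk x)\<^sup>2)" using sqint_diff[OF f sq(1)] by (simp add: sqint_def)
  have i2: "integrable MT (\<lambda>x. (fk x - hn x)\<^sup>2)" using sqint_diff[OF sq] by (simp add: sqint_def)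
  let ?w = "\<lambda>x. 3 * (f x - fk x)\<^sup>2 + 3 * (fk x - hn x)\<^sup>2 + 3 * d\<^sup>2"
  have b: "(cmod (of_real (f x) - T x))\<^sup>2 \<le> ?w x" if x: "x \<in> {0..2 * pi}" for x
  proof -
    have "cmod (of_real (f x) - T x) \<le> \<bar>f x - fk x\<bar> + \<bar>fk x - hn x\<bar> + d"
    proof -
      have "of_real (f x) - T x = of_real (f x - fk x) + of_real (fk x - hn x) + (of_real (hn x) - T x)" by simp
      then have "cmod (of_real (f x) - T x) \<le> cmod (of_real (f x - fk x)) + cmod (of_real (fk x - hn x)) + cmod (of_real (hn x) - T x)"
        by (metis norm_triangle_mono order_refl norm_triangle_ineq)
      then show ?thesis using T(2)[OF x] unfolding norm_of_real by linarith
    qed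
    then have "(cmod (of_real (f x) - T x))\<^sup>2 \<le> (\<bar>f x - fk x\<bar> + \<bar>fk x - hn x\<bar> + d)\<^sup>2" by (rule power_mono) simp
    also have "\<dots> \<le> 3 * \<bar>f x - fk x\<bar>\<^sup>2 + 3 * \<bar>fk x - hn x\<bar>\<^sup>2 + 3 * d\<^sup>2"
    proof -
      have "(a + b + c)\<^sup>2 \<le> 3 * a\<^sup>2 + 3 * b\<^sup>2 + 3 * c\<^sup>2" for a b c :: real
      proof -
        have "3 * a\<^sup>2 + 3 * b\<^sup>2 + 3 * c\<^sup>2 - (a + b + c)\<^sup>2 = (a - b)\<^sup>2 + (b - c)\<^sup>2 + (a - c)\<^sup>2"
          by (simp add: power2_eq_square algebra_simps)
        moreover have "0 \<le> (a - b)\<^sup>2 + (b - c)\<^sup>2 + (a - c)\<^sup>2" by simp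
        ultimately show ?thesis by linarith
      qed
      then show ?thesis .
    qed
    finally show ?thesis by simp
  qed
  have iw: "integrable MT ?w"
    by (intro Bochner_Integration.integrable_add integrable_mult_right i1 i2 integrable_MT_const)
  have mT: "(\<lambda>x. (cmod (of_real (f x) - T x))\<^sup>2) \<in> borel_measurable MT"
    using f measurable_MT_continuous[OF trig_measurable[OF T(1)]] by (auto simp: sqint_def)
  have iT: "integrable MT (\<lambda>x. (cmod (of_real (f x) - T x))\<^sup>2)"
    by (rule Bochner_Integration.integrable_bound[OF iw mT]) (use b in \<open>fastforce intro!: AE_I2\<close>)
  have "integral\<^sup>L MT (\<lambda>x. (cmod (of_real (f x) - T x))\<^sup>2) \<le> integral\<^sup>L MT ?w"
    by (rule integral_mono[OF iT iw]) (use b in auto)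
  also have "\<dots> = 3 * integral\<^sup>L MT (\<lambda>x. (f x - fk x)\<^sup>2) + 3 * integral\<^sup>L MT (\<lambda>x. (fk x - hn x)\<^sup>2) + 6 * pi * d\<^sup>2"
    using i1 i2 integrable_MT_const[of "3 * d\<^sup>2"] by (simp add: measure_restrict_space)
  also have "\<dots> < 3 * (e / 9) + 3 * (e / 9) + 6 * pi * d\<^sup>2"
    using k n by (simp add: fk_def hn_def)
  also have "\<dots> \<le> e"
  proof -
    have "e * (18 * pi) \<le> e * (18 * pi + 1)" using e by simp
    then have "6 * pi * d\<^sup>2 \<le> e / 3" unfolding d(2) by (simp add: field_simps add_pos_pos)
    then show ?thesis by simp
  qed
  finally show ?thesis using T(1) iT by blast
qed

subsection \<open>Parseval's identity\<close>

definition fc :: "(real \<Rightarrow> real) \<Rightarrow> int \<Rightarrow> complex" where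
  "fc f n = integral\<^sup>L MT (\<lambda>x. of_real (f x) * ch (- n) x) / (2 * of_real pi)"

lemma integrable_mult_ch:
  assumes "integrable MT f" shows "integrable MT (\<lambda>x. of_real (f x) * ch n x)"
proof (rule Bochner_Integration.integrable_bound[OF assms])
  show "(\<lambda>x. of_real (f x) * ch n x) \<in> borel_measurable MT"
    using assms measurable_MT_continuous[OF continuous_on_ch] by (intro borel_measurable_times) auto
qed (simp add: norm_mult)

lemma integral_mult_ch: "integral\<^sup>L MT (\<lambda>x. of_real (f x) * ch n x) = 2 * of_real pi * fc f (- n)"
  by (simp add: fc_def)

lemma fc_minus: "fc f (- n) = cnj (fc f n)"
proof -
  have "cnj (integral\<^sup>L MT (\<lambda>x. of_real (f x) * ch (- n) x)) = integral\<^sup>L MT (\<lambda>x. cnj (of_real (f x) * ch (- n) x))"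
    by (rule Bochner_Integration.integral_cnj[symmetric])
  then show ?thesis by (simp add: fc_def ch_minus)
qed

lemma fourier_coeff_distr_of:
  assumes "integrable MT f" shows "fourier_coeff (distr_of f) n = fc f n"
proof -
  let ?I = "integral\<^sup>L MT (\<lambda>x. of_real (f x) * ch (- n) x)"
  note i = integrable_mult_ch[OF assms, of "- n"]
  have "Re ?I = integral\<^sup>L MT (\<lambda>x. f x * cos (real_of_int n * x))"
    using integral_bounded_linear[OF bounded_linear_Re i] by (simp add: ch_def)
  moreover have "Im ?I = - integral\<^sup>L MT (\<lambda>x. f x * sin (real_of_int n * x))"
    using integral_bounded_linear[OF bounded_linear_Im i] by (simp add: ch_def)
  ultimately show ?thesis using assms
    by (simp add: fourier_coeff_def fc_def distr_of.rep_eq cos_test.rep_eq sin_test.rep_eq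
        set_integrable_MT LINT_MT complex_eq_iff)
qed

lemma fc_add:
  assumes "integrable MT f" "integrable MT g" shows "fc (\<lambda>x. f x + g x) n = fc f n + fc g n"
  using integrable_mult_ch[OF assms(1), of "- n"] integrable_mult_ch[OF assms(2), of "- n"]
  by (simp add: fc_def distrib_right add_divide_distrib)

lemma fc_scale: "fc (\<lambda>x. r * f x) n = of_real r * fc f n"
  by (simp add: fc_def mult.assoc)

lemma fc_diff:
  assumes "integrable MT f" "integrable MT g" shows "fc (\<lambda>x. f x - g x) n = fc f n - fc g n"
  using integrable_mult_ch[OF assms(1), of "- n"] integrable_mult_ch[OF assms(2), of "- n"]
  by (simp add: fc_def left_diff_distrib diff_divide_distrib)

text \<open>Free coefficients \<open>a\<close> serve two purposes: \<open>a = fc f\<close> gives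
  Bessel's inequality, and the coefficients of a good approximant give its converse.\<close>

lemma Bessel_identity:
  assumes f: "sqint f" and A: "finite A"
  shows "integral\<^sup>L MT (\<lambda>x. (cmod (of_real (f x) - (\<Sum>n\<in>A. a n * ch n x)))\<^sup>2)
    = integral\<^sup>L MT (\<lambda>x. (f x)\<^sup>2) + 2 * pi * (\<Sum>n\<in>A. (cmod (a n - fc f n))\<^sup>2 - (cmod (fc f n))\<^sup>2)"
proof -
  note fi = sqint_integrable[OF f]
  have i0: "integrable MT (\<lambda>x. complex_of_real ((f x)\<^sup>2))"
    by (rule integrable_of_real) (use f in \<open>simp add: sqint_def\<close>)
  have i1: "integrable MT (\<lambda>x. cnj (a n) * (of_real (f x) * ch (- n) x))" for n
    by (intro integrable_mult_right integrable_mult_ch fi)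
  have i2: "integrable MT (\<lambda>x. a n * (of_real (f x) * ch n x))" for n
    by (intro integrable_mult_right integrable_mult_ch fi)
  have i3: "integrable MT (\<lambda>x. (a n * cnj (a m)) * ch (n - m) x)" for n m
    by (intro integrable_mult_right integrable_ch)
  have "of_real ((cmod (of_real (f x) - (\<Sum>n\<in>A. a n * ch n x)))\<^sup>2)
      = complex_of_real ((f x)\<^sup>2) - (\<Sum>n\<in>A. cnj (a n) * (of_real (f x) * ch (- n) x)) - (\<Sum>n\<in>A. a n * (of_real (f x) * ch n x))
        + (\<Sum>n\<in>A. \<Sum>m\<in>A. (a n * cnj (a m)) * ch (n - m) x)" for x
  proof -
    let ?T = "\<Sum>n\<in>A. a n * ch n x"
    have c: "cnj ?T = (\<Sum>n\<in>A. cnj (a n) * ch (- n) x)" by (simp add: ch_minus)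
    have "of_real ((cmod (of_real (f x) - ?T))\<^sup>2) = (of_real (f x) - ?T) * cnj (of_real (f x) - ?T)"
      by (rule complex_norm_square)
    also have "\<dots> = of_real ((f x)\<^sup>2) - of_real (f x) * cnj ?T - of_real (f x) * ?T + ?T * cnj ?T"
      by (simp only: complex_cnj_diff complex_cnj_complex_of_real) (simp add: algebra_simps power2_eq_square)
    also have "of_real (f x) * cnj ?T = (\<Sum>n\<in>A. cnj (a n) * (of_real (f x) * ch (- n) x))"
      unfolding c by (simp add: sum_distrib_left mult_ac)
    also have "of_real (f x) * ?T = (\<Sum>n\<in>A. a n * (of_real (f x) * ch n x))"
      by (simp add: sum_distrib_left mult_ac)
    also have "?T * cnj ?T = (\<Sum>n\<in>A. \<Sum>m\<in>A. (a n * cnj (a m)) * ch (n - m) x)"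
    proof -
      have "ch (n - m) x = ch n x * ch (- m) x" for n m using ch_add[of n "- m" x] by simp
      then show ?thesis unfolding c sum_product by (simp add: mult_ac)
    qed
    finally show ?thesis .
  qed
  then have "integral\<^sup>L MT (\<lambda>x. complex_of_real ((cmod (of_real (f x) - (\<Sum>n\<in>A. a n * ch n x)))\<^sup>2))
      = integral\<^sup>L MT (\<lambda>x. complex_of_real ((f x)\<^sup>2)) - (\<Sum>n\<in>A. cnj (a n) * (2 * of_real pi * fc f n))
        - (\<Sum>n\<in>A. a n * (2 * of_real pi * fc f (- n)))
        + (\<Sum>n\<in>A. \<Sum>m\<in>A. (a n * cnj (a m)) * (if n - m = 0 then 2 * of_real pi else 0))"
    by (simp add: i0 i1 i2 i3 integral_mult_ch integral_ch del: of_real_power)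
  also have "(\<Sum>n\<in>A. \<Sum>m\<in>A. (a n * cnj (a m)) * (if n - m = 0 then 2 * of_real pi else 0))
      = (\<Sum>n\<in>A. 2 * of_real pi * (a n * cnj (a n)))"
  proof (rule sum.cong[OF refl])
    fix n assume n: "n \<in> A"
    have "(\<Sum>m\<in>A. (a n * cnj (a m)) * (if n - m = 0 then 2 * of_real pi else 0))
        = (\<Sum>m\<in>A. if m = n then 2 * of_real pi * (a n * cnj (a n)) else 0)"
      by (intro sum.cong refl) auto
    then show "(\<Sum>m\<in>A. (a n * cnj (a m)) * (if n - m = 0 then 2 * of_real pi else 0)) = 2 * of_real pi * (a n * cnj (a n))"
      using n A by simp
  qed
  also have "integral\<^sup>L MT (\<lambda>x. complex_of_real ((f x)\<^sup>2)) - (\<Sum>n\<in>A. cnj (a n) * (2 * of_real pi * fc f n))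
        - (\<Sum>n\<in>A. a n * (2 * of_real pi * fc f (- n))) + (\<Sum>n\<in>A. 2 * of_real pi * (a n * cnj (a n)))
      = integral\<^sup>L MT (\<lambda>x. complex_of_real ((f x)\<^sup>2))
        + 2 * of_real pi * (\<Sum>n\<in>A. (a n - fc f n) * cnj (a n - fc f n) - fc f n * cnj (fc f n))"
    by (simp add: fc_minus sum_distrib_left algebra_simps sum.distrib sum_subtractf)
  also have "\<dots> = of_real (integral\<^sup>L MT (\<lambda>x. (f x)\<^sup>2)
      + 2 * pi * (\<Sum>n\<in>A. (cmod (a n - fc f n))\<^sup>2 - (cmod (fc f n))\<^sup>2))"
    by (simp add: complex_norm_square[symmetric] del: complex_cnj_diff of_real_power)
  finally show ?thesis unfolding integral_complex_of_real of_real_eq_iff .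
qed

lemma Bessel_inequality:
  assumes f: "sqint f" and A: "finite A"
  shows "2 * pi * (\<Sum>n\<in>A. (cmod (fc f n))\<^sup>2) \<le> integral\<^sup>L MT (\<lambda>x. (f x)\<^sup>2)"
proof -
  have "0 \<le> integral\<^sup>L MT (\<lambda>x. (cmod (of_real (f x) - (\<Sum>n\<in>A. fc f n * ch n x)))\<^sup>2)" by simp
  then show ?thesis unfolding Bessel_identity[OF assms] by (simp add: sum_negf)
qed

definition ft :: "(real \<Rightarrow> real) \<Rightarrow> ell2" where "ft f = Abs_ell2 (fc f)"

lemma cf_ft:
  assumes f: "sqint f" shows "cf (ft f) n = fc f n"
proof -
  have "(\<lambda>n. (cmod (fc f n))\<^sup>2) summable_on UNIV"
  proof (rule nonneg_bdd_above_summable_on)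
    show "bdd_above (sum (\<lambda>n. (cmod (fc f n))\<^sup>2) ` {F. F \<subseteq> UNIV \<and> finite F})"
    proof (rule bdd_aboveI2)
      fix F :: "int set" assume "F \<in> {F. F \<subseteq> UNIV \<and> finite F}"
      then show "(\<Sum>n\<in>F. (cmod (fc f n))\<^sup>2) \<le> integral\<^sup>L MT (\<lambda>x. (f x)\<^sup>2) / (2 * pi)"
        using Bessel_inequality[OF f, of F] by (simp add: pos_le_divide_eq mult.commute)
    qed
  qed simp
  then show ?thesis unfolding ft_def by (subst Abs_ell2_inverse) (auto simp: fc_minus)
qed

text \<open>In the nontrivial direction, a trigonometric polynomial within \<open>e\<close> of
  \<open>f\<close> is inserted into the Bessel identity and the squares
  \<open>(cmod (a n - fc f n))\<^sup>2\<close> are dropped.\<close>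

lemma Parseval:
  assumes f: "sqint f" shows "integral\<^sup>L MT (\<lambda>x. (f x)\<^sup>2) = 2 * pi * (norm (ft f))\<^sup>2"
proof (rule antisym)
  show "integral\<^sup>L MT (\<lambda>x. (f x)\<^sup>2) \<le> 2 * pi * (norm (ft f))\<^sup>2"
  proof (rule field_le_epsilon)
    fix e :: real assume "0 < e"
    then obtain T where T: "trig T" "integral\<^sup>L MT (\<lambda>x. (cmod (of_real (f x) - T x))\<^sup>2) < e"
      using trig_dense[OF f] by blast
    obtain A a where A: "finite A" "T = (\<lambda>x. \<Sum>n\<in>A. a n * ch n x)" using trig_sum[OF T(1)] by blast
    have "integral\<^sup>L MT (\<lambda>x. (f x)\<^sup>2) + 2 * pi * (\<Sum>n\<in>A. (cmod (a n - fc f n))\<^sup>2 - (cmod (fc f n))\<^sup>2) < e"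
      using T(2) unfolding A(2) Bessel_identity[OF f A(1)] .
    moreover have "2 * pi * (\<Sum>n\<in>A. (cmod (a n - fc f n))\<^sup>2 - (cmod (fc f n))\<^sup>2) \<ge> 2 * pi * (\<Sum>n\<in>A. - (cmod (fc f n))\<^sup>2)"
      by (intro mult_left_mono sum_mono) auto
    moreover have "2 * pi * (\<Sum>n\<in>A. (cmod (fc f n))\<^sup>2) \<le> 2 * pi * (norm (ft f))\<^sup>2"
      using sum_cf_le_norm[OF A(1), of "ft f"] cf_ft[OF f] by simp
    moreover have "2 * pi * (\<Sum>n\<in>A. - (cmod (fc f n))\<^sup>2) = - (2 * pi * (\<Sum>n\<in>A. (cmod (fc f n))\<^sup>2))"
      by (simp add: sum_negf)
    ultimately show "integral\<^sup>L MT (\<lambda>x. (f x)\<^sup>2) \<le> 2 * pi * (norm (ft f))\<^sup>2 + e" by linarith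
  qed
  have "(norm (ft f))\<^sup>2 \<le> integral\<^sup>L MT (\<lambda>x. (f x)\<^sup>2) / (2 * pi)"
    unfolding norm_ell2_sq
  proof (rule infsum_le_finite_sums[OF cf_summable])
    fix F :: "int set" assume "finite F"
    then show "(\<Sum>n\<in>F. (cmod (cf (ft f) n))\<^sup>2) \<le> integral\<^sup>L MT (\<lambda>x. (f x)\<^sup>2) / (2 * pi)"
      using Bessel_inequality[OF f, of F] cf_ft[OF f] by (simp add: pos_le_divide_eq mult.commute)
  qed
  then show "2 * pi * (norm (ft f))\<^sup>2 \<le> integral\<^sup>L MT (\<lambda>x. (f x)\<^sup>2)" by (simp add: pos_le_divide_eq mult.commute)
qed

lemma ft_add: "sqint f \<Longrightarrow> sqint g \<Longrightarrow> ft (\<lambda>x. f x + g x) = ft f + ft g"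
  by (rule ell2_eqI) (simp add: cf_ft sqint_add fc_add sqint_integrable)

lemma ft_diff: "sqint f \<Longrightarrow> sqint g \<Longrightarrow> ft (\<lambda>x. f x - g x) = ft f - ft g"
  by (rule ell2_eqI) (simp add: cf_ft sqint_diff fc_diff sqint_integrable)

lemma Parseval_inner:
  assumes f: "sqint f" and g: "sqint g"
  shows "integral\<^sup>L MT (\<lambda>x. f x * g x) = 2 * pi * (ft f \<bullet> ft g)"
proof -
  have "(\<lambda>x. (f x + g x)\<^sup>2) = (\<lambda>x. (f x)\<^sup>2 + (g x)\<^sup>2 + 2 * (f x * g x))" by (auto simp: power2_sum)
  then have "integral\<^sup>L MT (\<lambda>x. (f x + g x)\<^sup>2)
      = integral\<^sup>L MT (\<lambda>x. (f x)\<^sup>2) + integral\<^sup>L MT (\<lambda>x. (g x)\<^sup>2) + 2 * integral\<^sup>L MT (\<lambda>x. f x * g x)"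
    using f g sqint_integrable_mult[OF f g] by (simp add: sqint_def)
  then have "2 * pi * (norm (ft f + ft g))\<^sup>2
      = 2 * pi * (norm (ft f))\<^sup>2 + 2 * pi * (norm (ft g))\<^sup>2 + 2 * integral\<^sup>L MT (\<lambda>x. f x * g x)"
    using Parseval[OF sqint_add[OF f g]] by (simp add: Parseval f g ft_add)
  moreover have "(norm (ft f + ft g))\<^sup>2 = (norm (ft f))\<^sup>2 + (norm (ft g))\<^sup>2 + 2 * (ft f \<bullet> ft g)"
    by (simp add: power2_norm_eq_inner inner_add_left inner_add_right inner_commute)
  ultimately show ?thesis by (simp add: algebra_simps)
qed

lemma fc_mult_cos:
  assumes "integrable MT f"
  shows "fc (\<lambda>x. cos (real_of_int n * x) * f x) k = (fc f (k - n) + fc f (k + n)) / 2"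
proof -
  have "of_real (cos (real_of_int n * x) * f x) * ch (- k) x
      = (of_real (f x) * ch (- (k - n)) x + of_real (f x) * ch (- (k + n)) x) / 2" for x
  proof -
    have 1: "complex_of_real (cos (real_of_int n * x)) = (ch n x + ch (- n) x) / 2"
      by (simp add: ch_def complex_eq_iff)
    have 2: "ch (- (k - n)) x = ch n x * ch (- k) x" "ch (- (k + n)) x = ch (- n) x * ch (- k) x"
      using ch_add[of n "- k" x] ch_add[of "- n" "- k" x] by (simp_all add: algebra_simps)
    show ?thesis unfolding of_real_mult 1 2 by (simp add: algebra_simps add_divide_distrib)
  qed
  then show ?thesis
    using integrable_mult_ch[OF assms, of "- (k - n)"] integrable_mult_ch[OF assms, of "- (k + n)"]
    by (simp add: fc_def add_divide_distrib del: minus_diff_eq minus_add_distrib of_real_mult)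
qed

lemma fc_mult_sin:
  assumes "integrable MT f"
  shows "fc (\<lambda>x. sin (real_of_int n * x) * f x) k = (fc f (k - n) - fc f (k + n)) / (2 * \<i>)"
proof -
  have "of_real (sin (real_of_int n * x) * f x) * ch (- k) x
      = (of_real (f x) * ch (- (k - n)) x - of_real (f x) * ch (- (k + n)) x) / (2 * \<i>)" for x
  proof -
    have 1: "complex_of_real (sin (real_of_int n * x)) = (ch n x - ch (- n) x) / (2 * \<i>)"
      by (simp add: ch_def complex_eq_iff)
    have 2: "ch (- (k - n)) x = ch n x * ch (- k) x" "ch (- (k + n)) x = ch (- n) x * ch (- k) x"
      using ch_add[of n "- k" x] ch_add[of "- n" "- k" x] by (simp_all add: algebra_simps)
    show ?thesis unfolding of_real_mult 1 2 by (simp add: algebra_simps diff_divide_distrib)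
  qed
  then have "fc (\<lambda>x. sin (real_of_int n * x) * f x) k = (integral\<^sup>L MT (\<lambda>x. of_real (f x) * ch (- (k - n)) x)
      - integral\<^sup>L MT (\<lambda>x. of_real (f x) * ch (- (k + n)) x)) / (2 * \<i>) / (2 * of_real pi)"
    using integrable_mult_ch[OF assms, of "- (k - n)"] integrable_mult_ch[OF assms, of "- (k + n)"]
    by (simp add: fc_def del: minus_diff_eq minus_add_distrib of_real_mult)
  then show ?thesis unfolding fc_def by (simp only: diff_divide_distrib divide_divide_eq_left mult.commute)
qed

text \<open>The square of \<open>f\<close> is merely integrable, so Parseval does not apply to it
  directly. Its coefficients are instead read as inner products of \<open>f\<close> with
  \<open>cos (n x) f\<close> and \<open>sin (n x) f\<close>, whose coefficients are combinations of
  shifts of those of \<open>f\<close>.\<close>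

lemma fc_square:
  assumes f: "sqint f"
  shows "fc (\<lambda>x. (f x)\<^sup>2) n = conv (ft f) (ft f) n"
proof -
  define c where "c = ft f"
  define Z where "Z = conv c c n"
  note fi = sqint_integrable[OF f]
  let ?g1 = "\<lambda>x. cos (real_of_int n * x) * f x" and ?g2 = "\<lambda>x. sin (real_of_int n * x) * f x"
  have g1: "sqint ?g1" and g2: "sqint ?g2"
    by (intro sqint_mult_bounded[OF f, where K=1] measurable_MT_continuous continuous_intros; simp)+
  have X: "((\<lambda>k. cf c k * cnj (cf c (k - n))) has_sum Z) UNIV"
  proof -
    have "(\<lambda>k. cf c k * cf c (n - k)) = (\<lambda>k. cf c k * cnj (cf c (k - n)))"
      by (simp add: cf_minus[symmetric])
    then show ?thesis using has_sum_infsum[OF conv_summable[of c c n]] by (simp add: Z_def conv_def)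
  qed
  have Y: "((\<lambda>k. cf c k * cnj (cf c (k + n))) has_sum cnj Z) UNIV"
  proof -
    have "cf c (- n - k) = cnj (cf c (k + n))" for k
    proof -
      have "- n - k = - (k + n)" by simp
      then show ?thesis by (simp only: cf_minus)
    qed
    then have "((\<lambda>k. cf c k * cnj (cf c (k + n))) has_sum conv c c (- n)) UNIV"
      using has_sum_infsum[OF conv_summable[of c c "- n"]] by (simp add: conv_def)
    then show ?thesis by (simp add: Z_def conv_minus)
  qed
  have "c \<bullet> ft ?g1 = Re ((Z + cnj Z) * (1 / 2))"
    unfolding inner_ell2_def
  proof (rule infsumI)
    have "((\<lambda>k. Re ((cf c k * cnj (cf c (k - n)) + cf c k * cnj (cf c (k + n))) * (1 / 2))) has_sum Re ((Z + cnj Z) * (1 / 2))) UNIV"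
      by (intro has_sum_Re has_sum_cmult_left has_sum_add X Y)
    moreover have "(\<lambda>k. Re (cf c k * cnj (cf (ft ?g1) k)))
        = (\<lambda>k. Re ((cf c k * cnj (cf c (k - n)) + cf c k * cnj (cf c (k + n))) * (1 / 2)))"
      using f by (simp add: cf_ft[OF g1] fc_mult_cos[OF fi] c_def cf_ft[OF f] distrib_left del: Re_divide_numeral)
    ultimately show "((\<lambda>k. Re (cf c k * cnj (cf (ft ?g1) k))) has_sum Re ((Z + cnj Z) * (1 / 2))) UNIV" by simp
  qed
  then have 1: "c \<bullet> ft ?g1 = Re Z" by simp
  have "c \<bullet> ft ?g2 = Re ((Z - cnj Z) * (\<i> / 2))"
    unfolding inner_ell2_def
  proof (rule infsumI)
    have "((\<lambda>k. Re ((cf c k * cnj (cf c (k - n)) - cf c k * cnj (cf c (k + n))) * (\<i> / 2))) has_sum Re ((Z - cnj Z) * (\<i> / 2))) UNIV"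
      using has_sum_add[OF X has_sum_uminusI[OF Y]] by (intro has_sum_Re has_sum_cmult_left) simp
    moreover have "Re (cf c k * cnj (cf (ft ?g2) k))
        = Re ((cf c k * cnj (cf c (k - n)) - cf c k * cnj (cf c (k + n))) * (\<i> / 2))" for k
    proof -
      have "cnj ((u - v) / (2 * \<i>)) = (cnj u - cnj v) * (\<i> / 2)" for u v
        by (simp add: field_simps)
      then show ?thesis
        by (simp only: cf_ft[OF g2] fc_mult_sin[OF fi] c_def cf_ft[OF f]) (simp only: algebra_simps)
    qed
    ultimately show "((\<lambda>k. Re (cf c k * cnj (cf (ft ?g2) k))) has_sum Re ((Z - cnj Z) * (\<i> / 2))) UNIV"
      by (simp only:)
  qed
  then have 2: "c \<bullet> ft ?g2 = - Im Z" by simp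
  have fi2: "integrable MT (\<lambda>x. (f x)\<^sup>2)" using f by (simp add: sqint_def)
  note i = integrable_mult_ch[OF fi2, of "- n"]
  let ?I = "integral\<^sup>L MT (\<lambda>x. of_real ((f x)\<^sup>2) * ch (- n) x)"
  have "Re ?I = integral\<^sup>L MT (\<lambda>x. f x * ?g1 x)"
    using integral_bounded_linear[OF bounded_linear_Re i] by (simp add: ch_def power2_eq_square mult_ac)
  then have R: "Re ?I = 2 * pi * Re Z" using Parseval_inner[OF f g1] 1 by (simp add: c_def)
  have "Im ?I = - integral\<^sup>L MT (\<lambda>x. f x * ?g2 x)"
    using integral_bounded_linear[OF bounded_linear_Im i] by (simp add: ch_def power2_eq_square mult_ac)
  then have I: "Im ?I = 2 * pi * Im Z" using Parseval_inner[OF f g2] 2 by (simp add: c_def)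
  have "?I = 2 * of_real pi * Z" using R I by (simp add: complex_eq_iff)
  then show ?thesis by (simp add: fc_def Z_def c_def)
qed

subsection \<open>Functions in \<open>L\<^sup>2(\<T>)\<close>\<close>

lemma L2_sqint: "f \<in> L2 \<Longrightarrow> sqint f"
  by (auto simp: L2_def sqint_def set_integrable_MT intro: measurable_restrict_space1)

lemma L2_norm_ft: "sqint f \<Longrightarrow> L2_norm f = sqrt (2 * pi) * norm (ft f)"
  by (simp add: L2_norm_def LINT_MT Parseval real_sqrt_mult)

lemma L2_norm_diff_ft: "sqint f \<Longrightarrow> sqint g \<Longrightarrow> L2_norm (\<lambda>x. f x - g x) = sqrt (2 * pi) * norm (ft f - ft g)"
  by (simp add: L2_norm_ft sqint_diff ft_diff)

lemma periodic_int: 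
  assumes "\<And>x. f (x + 2 * pi) = f x" shows "f (x + real_of_int m * (2 * pi)) = (f x :: real)"
proof -
  have n: "f (x + real k * (2 * pi)) = f x" for k :: nat and x
  proof (induction k)
    case (Suc k)
    have "f (x + real (Suc k) * (2 * pi)) = f ((x + real k * (2 * pi)) + 2 * pi)" by (simp add: algebra_simps)
    then show ?case using assms Suc by simp
  qed simp
  show ?thesis
  proof (cases "m \<ge> 0")
    case True
    then show ?thesis using n[of x "nat m"] by simp
  next
    case False
    then show ?thesis using n[of "x + real_of_int m * (2 * pi)" "nat (- m)"] by (simp add: algebra_simps)
  qed
qed

text \<open>Equal coefficients give equality almost everywhere on one period by Parseval.
  Periodicity spreads the exceptional set over countably many translates, still negligible.\<close>

lemma AE_eq_iff_ft_eq:
  assumes f: "sqint f" "\<And>x. f (x + 2 * pi) = f x" and g: "sqint g" "\<And>x. g (x + 2 * pi) = g x"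
  shows "(AE x in lebesgue. f x = g x) \<longleftrightarrow> ft f = ft g"
proof
  assume "AE x in lebesgue. f x = g x"
  then have ae: "AE x in MT. f x = g x" by (subst AE_restrict_space_iff) auto
  have "fc f n = fc g n" for n
  proof -
    have "integral\<^sup>L MT (\<lambda>x. of_real (f x) * ch (- n) x) = integral\<^sup>L MT (\<lambda>x. of_real (g x) * ch (- n) x)"
      using integrable_mult_ch[OF sqint_integrable[OF f(1)]] integrable_mult_ch[OF sqint_integrable[OF g(1)]] ae
      by (intro integral_cong_AE) auto
    then show ?thesis by (simp add: fc_def)
  qed
  then show "ft f = ft g" by (intro ell2_eqI) (simp add: cf_ft f g)
next
  assume eq: "ft f = ft g"
  have sq: "sqint (\<lambda>x. f x - g x)" by (rule sqint_diff[OF f(1) g(1)])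
  have "integral\<^sup>L MT (\<lambda>x. (f x - g x)\<^sup>2) = 0" by (simp add: Parseval[OF sq] ft_diff f g eq)
  then have "AE x in MT. (f x - g x)\<^sup>2 = 0"
    using sq by (subst (asm) integral_nonneg_eq_0_iff_AE) (auto simp: sqint_def)
  then have "AE x in lebesgue. x \<in> {0..2 * pi} \<longrightarrow> f x = g x" by (subst (asm) AE_restrict_space_iff) auto
  then obtain N where N: "N \<in> null_sets lebesgue" "{x. \<not> (x \<in> {0..2 * pi} \<longrightarrow> f x = g x)} \<subseteq> N"
    unfolding eventually_ae_filter by auto
  have neg: "negligible (\<Union>m::int. (+) (real_of_int m * (2 * pi)) ` N)"
    using N(1) by (intro negligible_countable_Union) (auto simp: negligible_translation negligible_iff_null_sets[symmetric])
  have "{x. f x \<noteq> g x} \<subseteq> (\<Union>m::int. (+) (real_of_int m * (2 * pi)) ` N)"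
  proof
    fix x assume "x \<in> {x. f x \<noteq> g x}"
    then have x: "f x \<noteq> g x" by simp
    define m where "m = \<lfloor>x / (2 * pi)\<rfloor>"
    define y where "y = x + real_of_int (- m) * (2 * pi)"
    have "real_of_int m \<le> x / (2 * pi)" "x / (2 * pi) < real_of_int m + 1" by (simp_all add: m_def)
    then have "real_of_int m * (2 * pi) \<le> x" "x \<le> (real_of_int m + 1) * (2 * pi)"
      by (simp_all add: pos_le_divide_eq pos_divide_less_eq)
    then have "y \<in> {0..2 * pi}" by (simp add: y_def algebra_simps)
    moreover have "f y \<noteq> g y" using x periodic_int[of f, OF f(2)] periodic_int[of g, OF g(2)] unfolding y_def by metis
    ultimately have "y \<in> N" using N(2) by auto
    then have "x \<in> (+) (real_of_int m * (2 * pi)) ` N" by (intro image_eqI[of _ _ y]) (simp_all add: y_def)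
    then show "x \<in> (\<Union>m::int. (+) (real_of_int m * (2 * pi)) ` N)" by blast
  qed
  then show "AE x in lebesgue. f x = g x"
    using neg by (intro AE_I'[of "\<Union>m::int. (+) (real_of_int m * (2 * pi)) ` N"]) (auto simp: negligible_iff_null_sets)
qed

subsection \<open>Synthesis of rapidly convergent Fourier series\<close>

text \<open>For coefficients of order 2 the series converges uniformly and is real by symmetry; see
  \<open>syn_real\<close> for the removal of \<open>Re\<close>.\<close>

definition syn :: "ell2 \<Rightarrow> real \<Rightarrow> real" where "syn c x = Re (\<Sum>\<^sub>\<infinity>n. cf c n * ch n x)"

lemma syn_periodic: "syn c (x + 2 * pi) = syn c x"
proof -
  have "ch n (x + 2 * pi) = ch n x" for n
  proof -
    have "ch n (x + 2 * pi) = ch n x * cis (2 * pi * real_of_int n)" by (simp add: ch_def cis_mult algebra_simps)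
    then show ?thesis by simp
  qed
  then show ?thesis by (simp add: syn_def)
qed

context
  fixes c :: ell2 and C :: real
  assumes decay: "\<And>n. cmod (cf c n) \<le> C * jb n powr (- 2)"
begin

lemma syn_terms: "norm (cf c n * ch n x) \<le> C * jb n powr (- 2)" using decay by (simp add: norm_mult)

lemma syn_bound_summable: "(\<lambda>n. C * jb n powr (- 2)) summable_on UNIV"
  by (intro summable_on_cmult_right jb_powr_summable) simp

lemma syn_real: "of_real (syn c x) = (\<Sum>\<^sub>\<infinity>n. cf c n * ch n x)"
proof -
  have "(\<Sum>\<^sub>\<infinity>n. cf c n * ch n x) = (\<Sum>\<^sub>\<infinity>n. cf c (- n) * ch (- n) x)"
    by (rule infsum_reindex_bij_betw[symmetric, of uminus]) (rule bij_betwI[where g=uminus], auto)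
  also have "\<dots> = cnj (\<Sum>\<^sub>\<infinity>n. cf c n * ch n x)"
    unfolding infsum_cnj[symmetric] by (simp add: cf_minus ch_minus)
  finally show ?thesis by (simp add: syn_def complex_eq_iff)
qed

definition tail :: "nat \<Rightarrow> real" where
  "tail N = (\<Sum>\<^sub>\<infinity>n. C * jb n powr (- 2)) - (\<Sum>n=-int N..int N. C * jb n powr (- 2))"

lemma tail_tendsto: "tail \<longlonglongrightarrow> 0"
proof -
  have "tail \<longlonglongrightarrow> (\<Sum>\<^sub>\<infinity>n. C * jb n powr (- 2)) - (\<Sum>\<^sub>\<infinity>n. C * jb n powr (- 2))"
    unfolding tail_def by (intro tendsto_intros symmetric_sums_tendsto syn_bound_summable)
  then show ?thesis by simp
qed

lemma syn_tail: "cmod (of_real (syn c x) - (\<Sum>n=-int N..int N. cf c n * ch n x)) \<le> tail N"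
  unfolding syn_real tail_def by (rule infsum_tail_bound[OF syn_terms syn_bound_summable]) simp

lemma syn_continuous: "continuous_on UNIV (syn c)"
proof -
  have "uniform_limit UNIV (\<lambda>N x. \<Sum>n=-int N..int N. cf c n * ch n x) (\<lambda>x. complex_of_real (syn c x)) sequentially"
  proof (rule uniform_limitI)
    fix e :: real assume "0 < e"
    then have "\<forall>\<^sub>F N in sequentially. tail N < e" by (intro order_tendstoD(2)[OF tail_tendsto])
    then show "\<forall>\<^sub>F N in sequentially. \<forall>x\<in>UNIV. dist (\<Sum>n=-int N..int N. cf c n * ch n x) (complex_of_real (syn c x)) < e"
    proof eventually_elim
      case (elim N)
      show ?case using le_less_trans[OF syn_tail elim] by (simp add: dist_norm norm_minus_commute)
    qed
  qed
  then have "continuous_on UNIV (\<lambda>x. complex_of_real (syn c x))"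
    by (rule uniform_limit_theorem[rotated]) (auto intro!: continuous_intros continuous_on_ch always_eventually)
  from continuous_on_Re[OF this] show ?thesis by simp
qed

lemma syn_sqint: "sqint (syn c)"
  by (rule sqint_continuous) (rule continuous_on_subset[OF syn_continuous], simp)

lemma fc_syn: "fc (syn c) n = cf c n"
proof -
  \<comment> \<open>For \<open>N \<ge> \<bar>n\<bar>\<close> the partial sum has coefficient exactly
    \<open>cf c n\<close>, so the error is bounded by the uniform tail, which tends to 0.\<close>
  have b: "cmod (fc (syn c) n - cf c n) \<le> tail N" if N: "\<bar>n\<bar> \<le> int N" for N
  proof -
    let ?S = "\<lambda>x. \<Sum>m=-int N..int N. cf c m * ch m x"
    have iS: "integrable MT (\<lambda>x. ?S x * ch (- n) x)"
      by (intro continuous_imp_integrable_real continuous_intros continuous_on_ch)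
    have "integral\<^sup>L MT (\<lambda>x. ?S x * ch (- n) x) = integral\<^sup>L MT (\<lambda>x. \<Sum>m=-int N..int N. cf c m * ch (m - n) x)"
      using ch_add[of _ "- n"] by (simp add: sum_distrib_right mult.assoc)
    also have "\<dots> = (\<Sum>m=-int N..int N. cf c m * (if m - n = 0 then 2 * of_real pi else 0))"
      by (simp add: integrable_ch integral_ch)
    also have "\<dots> = (\<Sum>m=-int N..int N. if m = n then cf c n * (2 * of_real pi) else 0)"
      by (intro sum.cong refl) auto
    also have "\<dots> = cf c n * (2 * of_real pi)"
    proof -
      have "n \<in> {-int N..int N}" using N by auto
      then show ?thesis by simp
    qed
    finally have e: "integral\<^sup>L MT (\<lambda>x. ?S x * ch (- n) x) = cf c n * (2 * of_real pi)" .
    have ig: "integrable MT (\<lambda>x. of_real (syn c x) * ch (- n) x)"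
      by (rule integrable_mult_ch[OF sqint_integrable[OF syn_sqint]])
    have "(fc (syn c) n - cf c n) * (2 * of_real pi) = integral\<^sup>L MT (\<lambda>x. of_real (syn c x) * ch (- n) x - ?S x * ch (- n) x)"
      using ig iS e by (simp add: fc_def left_diff_distrib)
    also have "cmod \<dots> \<le> integral\<^sup>L MT (\<lambda>x. norm (of_real (syn c x) * ch (- n) x - ?S x * ch (- n) x))"
      by (rule integral_norm_bound)
    also have "\<dots> \<le> integral\<^sup>L MT (\<lambda>x. tail N)"
    proof (rule integral_mono)
      show "integrable MT (\<lambda>x. norm (of_real (syn c x) * ch (- n) x - ?S x * ch (- n) x))" using ig iS by auto
      show "integrable MT (\<lambda>x. tail N)" by (rule integrable_MT_const)
      show "norm (of_real (syn c x) * ch (- n) x - ?S x * ch (- n) x) \<le> tail N" for x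
        using syn_tail[of x N] by (simp add: left_diff_distrib[symmetric] norm_mult)
    qed
    also have "\<dots> = tail N * (2 * pi)" by (simp add: measure_restrict_space)
    finally show ?thesis by (simp add: norm_mult)
  qed
  have "(\<lambda>N. cmod (fc (syn c) n - cf c n)) \<longlonglongrightarrow> cmod (fc (syn c) n - cf c n)" by simp
  then have "cmod (fc (syn c) n - cf c n) \<le> 0"
    by (rule tendsto_le[OF sequentially_bot tail_tendsto])
       (use b in \<open>auto simp: eventually_sequentially intro!: exI[of _ "nat \<bar>n\<bar>"]\<close>)
  then show ?thesis by simp
qed

lemma ft_syn: "ft (syn c) = c"
  by (rule ell2_eqI) (simp add: cf_ft[OF syn_sqint] fc_syn)

lemma syn_L2: "syn c \<in> L2"
  unfolding L2_def
proof (intro CollectI conjI allI)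
  show "syn c \<in> borel_measurable lebesgue"
    using borel_measurable_continuous_onI[OF syn_continuous] by (simp add: measurable_completion)
  show "set_integrable lebesgue {0..2 * pi} (\<lambda>x. (syn c x)\<^sup>2)"
    unfolding set_integrable_MT using syn_sqint by (simp add: sqint_def)
qed (rule syn_periodic)

end

section \<open>The fundamental lemma of the calculus of variations\<close>

subsection \<open>Smooth bump functions\<close>

text \<open>The functions \<open>p(x) w\<^sup>-\<^sup>k exp(-1/w)\<close> on \<open>(a, b)\<close> with \<open>w = (x - a)(b - x)\<close> form a family closed
  under differentiation, whence their smoothness.\<close>

definition bump :: "real \<Rightarrow> real \<Rightarrow> nat \<Rightarrow> real poly \<Rightarrow> real \<Rightarrow> real" where
  "bump a b k p x = (if a < x \<and> x < b then
     poly p x * exp (- (1 / ((x - a) * (b - x)))) / ((x - a) * (b - x)) ^ k else 0)"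

text \<open>Numerator of the derivative over \<open>w ^ (k + 2)\<close>: the three terms come from
  \<open>exp (- 1 / w)\<close>, from \<open>p\<close> and from \<open>w ^ (- k)\<close>, in this
  order.\<close>

definition bump_deriv :: "real \<Rightarrow> real \<Rightarrow> nat \<Rightarrow> real poly \<Rightarrow> real poly" where
  "bump_deriv a b k p = (let W = [:- a, 1:] * [:b, - 1:] in
     p * pderiv W + pderiv p * W\<^sup>2 - smult (real k) (p * pderiv W * W))"

lemma power_le_exp:
  assumes "0 \<le> (y :: real)" "0 < n" shows "(y / real n) ^ n \<le> exp y"
proof -
  have "(y / real n) ^ n \<le> (exp (y / real n)) ^ n"
  proof (rule power_mono)
    show "y / real n \<le> exp (y / real n)" using exp_ge_add_one_self[of "y / real n"] by linarith
  qed (use assms in simp)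
  also have "\<dots> = exp y" using assms(2) by (simp add: exp_of_nat_mult[symmetric])
  finally show ?thesis .
qed

lemma DERIV_zero_quadratic:
  fixes f :: "real \<Rightarrow> real"
  assumes "\<And>y. \<bar>f y\<bar> \<le> K * (y - x)\<^sup>2"
  shows "(f has_real_derivative 0) (at x)"
proof -
  have fx: "f x = 0" using assms[of x] by simp
  have "((\<lambda>y. (f y - f x) / (y - x)) \<longlongrightarrow> 0) (at x)"
  proof (rule Lim_null_comparison)
    have "\<bar>f y\<bar> / \<bar>y - x\<bar> \<le> \<bar>K\<bar> * \<bar>y - x\<bar>" if "y \<noteq> x" for y
    proof -
      have "\<bar>f y\<bar> \<le> \<bar>K\<bar> * \<bar>y - x\<bar> * \<bar>y - x\<bar>"
        using assms[of y] mult_right_mono[OF abs_ge_self[of K], of "(y - x)\<^sup>2"] by (simp add: power2_eq_square mult.assoc)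
      then show ?thesis using that by (simp add: pos_divide_le_eq)
    qed
    then show "\<forall>\<^sub>F y in at x. norm ((f y - f x) / (y - x)) \<le> \<bar>K\<bar> * \<bar>y - x\<bar>"
      by (auto simp: eventually_at_filter fx)
    have "((\<lambda>y. \<bar>K\<bar> * \<bar>y - x\<bar>) \<longlongrightarrow> \<bar>K\<bar> * \<bar>x - x\<bar>) (at x)" by (intro tendsto_intros)
    then show "((\<lambda>y. \<bar>K\<bar> * \<bar>y - x\<bar>) \<longlongrightarrow> 0) (at x)" by simp
  qed
  then show ?thesis by (simp add: has_field_derivative_iff)
qed

text \<open>Quadratic vanishing at both end points makes the derivative there exist and be 0, which
  glues the formula inside to the zero function outside.\<close>

lemma bump_bound:
  assumes "a < b"
  shows "\<exists>K. \<forall>x. \<bar>bump a b k p x\<bar> \<le> K * (x - a)\<^sup>2 \<and> \<bar>bump a b k p x\<bar> \<le> K * (x - b)\<^sup>2"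
proof -
  have "compact (poly p ` {a..b})" by (intro compact_continuous_image continuous_intros) auto
  from compact_imp_bounded[OF this] obtain P where P: "\<And>x. a \<le> x \<Longrightarrow> x \<le> b \<Longrightarrow> \<bar>poly p x\<bar> \<le> P"
    unfolding bounded_iff by (metis atLeastAtMost_iff imageI real_norm_def)
  have P0: "0 \<le> P" using P[of a] assms by simp
  \<comment> \<open>In \<open>exp (- 1 / w) \<le> m ^ m * w ^ m\<close>, the power \<open>k\<close>
    cancels the denominator and 2 remain for the quadratic bound.\<close>
  define m where "m = k + 2"
  define K where "K = P * real m ^ m * (b - a)\<^sup>2"
  have K0: "0 \<le> K" using P0 by (simp add: K_def)
  have "\<bar>bump a b k p x\<bar> \<le> K * (x - a)\<^sup>2 \<and> \<bar>bump a b k p x\<bar> \<le> K * (x - b)\<^sup>2" for x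
  proof (cases "a < x \<and> x < b")
    case True
    define w where "w = (x - a) * (b - x)"
    have w: "0 < w" using True by (simp add: w_def)
    have "((1 / w) / real m) ^ m \<le> exp (1 / w)" using w by (intro power_le_exp) (auto simp: m_def)
    then have "1 \<le> exp (1 / w) * (w ^ m * real m ^ m)"
    proof -
      have "0 < w ^ m * real m ^ m" using w by (simp add: m_def)
      moreover have "((1 / w) / real m) ^ m = 1 / (w ^ m * real m ^ m)" by (simp add: power_divide power_mult_distrib)
      ultimately show ?thesis
        using \<open>((1 / w) / real m) ^ m \<le> exp (1 / w)\<close> by (simp only: pos_divide_le_eq)
    qed
    then have "exp (- (1 / w)) \<le> w ^ m * real m ^ m"
      by (simp add: exp_minus inverse_eq_divide pos_divide_le_eq mult.commute)
    then have "exp (- (1 / w)) / w ^ k \<le> w ^ m * real m ^ m / w ^ k" using w by (intro divide_right_mono) auto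
    also have "\<dots> = w\<^sup>2 * real m ^ m" using w by (simp add: m_def power_add power2_eq_square)
    finally have e: "exp (- (1 / w)) / w ^ k \<le> w\<^sup>2 * real m ^ m" .
    have "\<bar>bump a b k p x\<bar> = \<bar>poly p x\<bar> * (exp (- (1 / w)) / w ^ k)"
      using True w by (simp add: bump_def w_def[symmetric] abs_mult abs_divide)
    also have "\<dots> \<le> P * (w\<^sup>2 * real m ^ m)" using True P w e P0 by (intro mult_mono) auto
    finally have b: "\<bar>bump a b k p x\<bar> \<le> P * real m ^ m * w\<^sup>2" by (simp add: mult_ac)
    have "w\<^sup>2 \<le> (b - a)\<^sup>2 * (x - a)\<^sup>2" "w\<^sup>2 \<le> (b - a)\<^sup>2 * (x - b)\<^sup>2"
    proof -
      have "(b - x)\<^sup>2 \<le> (b - a)\<^sup>2" "(x - a)\<^sup>2 \<le> (b - a)\<^sup>2" using True by (intro power_mono; simp)+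
      note le = this
      show "w\<^sup>2 \<le> (b - a)\<^sup>2 * (x - a)\<^sup>2"
        using mult_left_mono[OF le(1), of "(x - a)\<^sup>2"] by (simp add: w_def power_mult_distrib mult.commute)
      show "w\<^sup>2 \<le> (b - a)\<^sup>2 * (x - b)\<^sup>2"
        using mult_right_mono[OF le(2), of "(b - x)\<^sup>2"] by (simp add: w_def power_mult_distrib power2_commute[of x b])
    qed
    then have "P * real m ^ m * w\<^sup>2 \<le> P * real m ^ m * ((b - a)\<^sup>2 * (x - a)\<^sup>2)"
      "P * real m ^ m * w\<^sup>2 \<le> P * real m ^ m * ((b - a)\<^sup>2 * (x - b)\<^sup>2)"
      using P0 by (intro mult_left_mono; simp)+
    then show ?thesis using b by (simp add: K_def mult.assoc)
  next
    case False
    then have "bump a b k p x = 0" by (auto simp: bump_def)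
    then show ?thesis using K0 by simp
  qed
  then show ?thesis by blast
qed

lemma bump_DERIV:
  assumes ab: "a < b"
  shows "(bump a b k p has_real_derivative bump a b (k + 2) (bump_deriv a b k p) x) (at x)"
proof -
  consider "a < x \<and> x < b" | "x = a \<or> x = b" | "x < a \<or> b < x" by linarith
  then show ?thesis
  proof cases
    case 1
    define w where "w y = (y - a) * (b - y)" for y
    have w: "0 < w x" using 1 by (simp add: w_def)
    have dw: "(w has_real_derivative (a + b - 2 * x)) (at x)"
      unfolding w_def by (auto intro!: derivative_eq_intros)
    have "((\<lambda>y. poly p y * exp (- (1 / w y)) / w y ^ k) has_real_derivative
        bump a b (k + 2) (bump_deriv a b k p) x) (at x)"
    proof -
      have dE: "((\<lambda>y. exp (- (1 / w y))) has_real_derivative exp (- (1 / w x)) * ((a + b - 2 * x) / (w x)\<^sup>2)) (at x)"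
        by (rule DERIV_cong[OF DERIV_fun_exp[OF DERIV_minus[OF DERIV_divide[OF DERIV_const dw]]]])
           (use w in \<open>simp_all add: power2_eq_square algebra_simps diff_divide_distrib add_divide_distrib\<close>)
      have dk: "((\<lambda>y. w y ^ k) has_real_derivative real k * (a + b - 2 * x) * w x ^ (k - 1)) (at x)"
        using DERIV_power[OF dw, of k] by (simp add: mult_ac)
      have wk: "w x ^ k \<noteq> 0" using w by simp
      have "((\<lambda>y. poly p y * exp (- (1 / w y)) / w y ^ k) has_real_derivative
        ((poly (pderiv p) x * exp (- (1 / w x)) + exp (- (1 / w x)) * ((a + b - 2 * x) / (w x)\<^sup>2) * poly p x) * w x ^ k
          - poly p x * exp (- (1 / w x)) * (real k * (a + b - 2 * x) * w x ^ (k - 1))) / (w x ^ k * w x ^ k)) (at x)"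
        by (rule DERIV_divide[OF DERIV_mult[OF poly_DERIV dE] dk wk])
      also have "((poly (pderiv p) x * exp (- (1 / w x)) + exp (- (1 / w x)) * ((a + b - 2 * x) / (w x)\<^sup>2) * poly p x) * w x ^ k
          - poly p x * exp (- (1 / w x)) * (real k * (a + b - 2 * x) * w x ^ (k - 1))) / (w x ^ k * w x ^ k)
        = (poly p x * (a + b - 2 * x) + poly (pderiv p) x * (w x)\<^sup>2 - real k * (poly p x * (a + b - 2 * x) * w x))
            * exp (- (1 / w x)) / w x ^ (k + 2)"
      proof (cases k)
        case 0
        have "(p' * E + E * (w' / w\<^sup>2) * P) = (P * w' + p' * w\<^sup>2) * E / w\<^sup>2" if "w \<noteq> 0" for p' E w' P w :: real
          using that by (simp add: field_simps)
        then show ?thesis using 0 w by (simp add: numeral_2_eq_2[symmetric])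
      next
        case (Suc j)
        have "((p' * E + E * (w' / w\<^sup>2) * P) * (w * u) - P * E * (n * w' * u)) / ((w * u) * (w * u))
          = (P * w' + p' * w\<^sup>2 - n * (P * w' * w)) * E / ((w * u) * w\<^sup>2)"
          if "w \<noteq> 0" "u \<noteq> 0" for p' E w' P w u n :: real
          using that by (simp add: field_simps power2_eq_square)
        from this[of "w x" "w x ^ j"] show ?thesis using Suc w by (simp add: power_add power2_eq_square)
      qed
      also have "\<dots> = bump a b (k + 2) (bump_deriv a b k p) x"
        using 1 by (simp add: bump_def bump_deriv_def Let_def w_def pderiv_mult pderiv_pCons algebra_simps)
      finally show ?thesis .
    qed
    moreover have "\<forall>\<^sub>F y in nhds x. poly p y * exp (- (1 / w y)) / w y ^ k = bump a b k p y"
    proof -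
      have "\<forall>\<^sub>F y in nhds x. y \<in> {a<..<b}" using 1 by (intro eventually_nhds_in_open) auto
      then show ?thesis by eventually_elim (simp add: bump_def w_def)
    qed
    ultimately show ?thesis by (subst (asm) DERIV_cong_ev[OF refl _ refl])
  next
    case 2
    obtain K where K: "\<And>x. \<bar>bump a b k p x\<bar> \<le> K * (x - a)\<^sup>2 \<and> \<bar>bump a b k p x\<bar> \<le> K * (x - b)\<^sup>2"
      using bump_bound[OF ab] by blast
    have "(bump a b k p has_real_derivative 0) (at x)" using 2 K by (auto intro: DERIV_zero_quadratic)
    then show ?thesis using 2 by (auto simp: bump_def)
  next
    case 3
    have "\<forall>\<^sub>F y in nhds x. y \<in> - {a..b}" using 3 by (intro eventually_nhds_in_open) auto
    then have ev: "\<forall>\<^sub>F y in nhds x. 0 = bump a b k p y" by eventually_elim (auto simp: bump_def)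
    have "((\<lambda>y. 0) has_real_derivative 0) (at x)" by simp
    then have "(bump a b k p has_real_derivative 0) (at x)" by (subst (asm) DERIV_cong_ev[OF refl ev refl])
    then show ?thesis using 3 by (auto simp: bump_def)
  qed
qed

lemma bump_smooth:
  assumes ab: "a < b" shows "smooth (bump a b k p)"
proof -
  have "\<exists>k' p'. (deriv ^^ n) (bump a b k p) = bump a b k' p'" for n
  proof (induction n)
    case 0 then show ?case by auto
  next
    case (Suc n)
    then obtain k' p' where "(deriv ^^ n) (bump a b k p) = bump a b k' p'" by blast
    then have "(deriv ^^ Suc n) (bump a b k p) = bump a b (k' + 2) (bump_deriv a b k' p')"
      using DERIV_imp_deriv[OF bump_DERIV[OF ab]] by auto
    then show ?case by blast
  qed
  then show ?thesis unfolding smooth_def using bump_DERIV[OF ab] real_differentiable_def by metis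
qed

lemma smooth_antiderivative:
  assumes g: "smooth g" and f: "\<And>x. (f has_real_derivative g x) (at x)"
  shows "smooth f"
  unfolding smooth_def
proof (intro allI)
  have d: "deriv f = g" using f by (auto intro: DERIV_imp_deriv)
  fix n x show "(deriv ^^ n) f differentiable (at x)"
  proof (cases n)
    case 0 then show ?thesis using f real_differentiable_def by auto
  next
    case (Suc m)
    then have "(deriv ^^ n) f = (deriv ^^ m) g" using d by (simp add: funpow_swap1)
    then show ?thesis using smooth_differentiable[OF g] by simp
  qed
qed

lemma smooth_DERIV: "smooth f \<Longrightarrow> (f has_real_derivative deriv f x) (at x)"
  using smooth_has_deriv[of f 0 x] by simp

lemma smooth_continuous: "smooth f \<Longrightarrow> continuous_on S f"
  by (intro continuous_at_imp_continuous_on ballI DERIV_isCont) (rule smooth_DERIV)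

subsection \<open>Weak derivatives of continuous functions\<close>

lemma LINT_compact_support:
  fixes g :: "real \<Rightarrow> real"
  assumes "0 < a" and "\<And>t. t \<notin> {a..b} \<Longrightarrow> g t = 0" and "g absolutely_integrable_on {a..b}"
  shows "(LINT t:{0<..}|lebesgue. g t) = integral {a..b} g"
proof -
  have "(\<lambda>t. indicator {0<..} t *\<^sub>R g t) = (\<lambda>t. indicator {a..b} t *\<^sub>R g t)"
    using assms(1,2) by (auto simp: indicator_def)
  then show ?thesis
    using set_lebesgue_integral_eq_integral(2)[OF assms(3)] by (simp add: set_lebesgue_integral_def)
qed

lemma time_test_deriv_support:
  assumes "smooth \<theta>" "\<And>t. t \<notin> {a..b} \<Longrightarrow> \<theta> t = 0" "t \<notin> {a..b}"
  shows "deriv \<theta> t = 0"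
proof -
  have "\<forall>\<^sub>F y in nhds t. y \<in> - {a..b}" using assms(3) by (intro eventually_nhds_in_open) auto
  then have "\<forall>\<^sub>F y in nhds t. \<theta> y = 0" by eventually_elim (use assms(2) in auto)
  then have "deriv \<theta> t = deriv (\<lambda>_. 0) t" by (rule deriv_cong_ev) simp
  then show ?thesis by simp
qed

lemma integration_by_parts_test:
  assumes th: "smooth \<theta>" "\<And>t. t \<notin> {a..b} \<Longrightarrow> \<theta> t = 0" and ab: "0 < a" "a < b"
    and F: "\<And>t. 0 < t \<Longrightarrow> (F has_real_derivative G t) (at t)" and G: "continuous_on {0<..} G"
  shows "integral {a..b} (\<lambda>t. deriv \<theta> t * F t) = - integral {a..b} (\<lambda>t. \<theta> t * G t)"
proof -
  \<comment> \<open>The hypothesis concerns the complement of the closed interval; at its end points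
    the values vanish by continuity.\<close>
  have ends: "\<theta> a = 0" "\<theta> b = 0"
  proof -
    have c: "isCont \<theta> x" for x using smooth_DERIV[OF th(1)] DERIV_isCont by blast
    have l: "(\<theta> \<longlongrightarrow> \<theta> a) (at_left a)" using c[of a] by (simp add: isCont_def filterlim_at_split)
    have "\<forall>\<^sub>F x in at_left a. \<theta> x = 0"
      by (auto simp: eventually_at_filter th(2) intro!: always_eventually)
    then have "(\<theta> \<longlongrightarrow> 0) (at_left a)" by (rule tendsto_eventually)
    then show "\<theta> a = 0" using tendsto_unique[OF _ l] by simp
    have r: "(\<theta> \<longlongrightarrow> \<theta> b) (at_right b)" using c[of b] by (simp add: isCont_def filterlim_at_split)
    have "\<forall>\<^sub>F x in at_right b. \<theta> x = 0"
      by (auto simp: eventually_at_filter th(2) intro!: always_eventually)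
    then have "(\<theta> \<longlongrightarrow> 0) (at_right b)" by (rule tendsto_eventually)
    then show "\<theta> b = 0" using tendsto_unique[OF _ r] by simp
  qed
  have "((\<lambda>t. deriv \<theta> t * F t + \<theta> t * G t) has_integral \<theta> b * F b - \<theta> a * F a) {a..b}"
  proof (rule fundamental_theorem_of_calculus)
    fix t assume "t \<in> {a..b}"
    then have "((\<lambda>t. \<theta> t * F t) has_real_derivative deriv \<theta> t * F t + G t * \<theta> t) (at t)"
      using ab by (intro DERIV_mult smooth_DERIV th F) auto
    then show "((\<lambda>t. \<theta> t * F t) has_vector_derivative deriv \<theta> t * F t + \<theta> t * G t) (at t within {a..b})"
      by (auto simp: has_real_derivative_iff_has_vector_derivative mult.commute intro: has_vector_derivative_at_within)
  qed (use ab in simp)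
  moreover have "(\<lambda>t. deriv \<theta> t * F t) integrable_on {a..b}"
    using ab DERIV_isCont[OF F]
    by (intro integrable_continuous_real continuous_intros smooth_continuous[OF smooth_deriv[OF th(1)]] continuous_at_imp_continuous_on) auto
  moreover have "(\<lambda>t. \<theta> t * G t) integrable_on {a..b}"
    using ab by (intro integrable_continuous_real continuous_intros smooth_continuous[OF th(1)] continuous_on_subset[OF G]) auto
  ultimately have "integral {a..b} (\<lambda>t. deriv \<theta> t * F t) + integral {a..b} (\<lambda>t. \<theta> t * G t) = 0"
    using integral_add[of "\<lambda>t. deriv \<theta> t * F t" "{a..b}" "\<lambda>t. \<theta> t * G t"]
    by (simp add: integral_unique ends)
  then show ?thesis by simp
qed

lemma integral_has_derivative_interior:
  fixes G :: "real \<Rightarrow> real"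
  assumes G: "continuous_on {0..} G" and t: "0 < t"
  shows "((\<lambda>u. integral {0..u} G) has_real_derivative G t) (at t)"
proof -
  have "((\<lambda>u. integral {0..u} G) has_vector_derivative G t) (at t within {0..t + 1})"
    using t by (intro integral_has_vector_derivative continuous_on_subset[OF G]) auto
  moreover have "at t within {0..t + 1} = at t" using t by (intro at_within_Icc_at) auto
  ultimately show ?thesis by (simp add: has_real_derivative_iff_has_vector_derivative)
qed

text \<open>Du Bois-Reymond: \<open>H = F - \<integral> G\<close> has weak derivative 0. If
  \<open>H\<close> took a smaller value at one point than at another, a test function whose
  derivative is a balanced difference of bumps beside the two points would detect it.\<close>

theorem weak_derivative_continuous:
  fixes F G :: "real \<Rightarrow> real"
  assumes F: "continuous_on {0..} F" and G: "continuous_on {0..} G"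
    and weak: "\<And>\<theta> a b. smooth \<theta> \<Longrightarrow> 0 < a \<Longrightarrow> a < b \<Longrightarrow> (\<And>t. t \<notin> {a..b} \<Longrightarrow> \<theta> t = 0) \<Longrightarrow>
      integral {a..b} (\<lambda>t. deriv \<theta> t * F t) = - integral {a..b} (\<lambda>t. \<theta> t * G t)"
    and t: "0 \<le> t"
  shows "F t = F 0 + integral {0..t} G"
proof -
  define H where "H t = F t - integral {0..t} G" for t
  have I: "continuous_on {0..b} (\<lambda>t. integral {0..t} G)" for b
    by (intro indefinite_integral_continuous_1 integrable_continuous_real continuous_on_subset[OF G]) auto
  have contH: "continuous_on {0..b} H" for b
    unfolding H_def by (intro continuous_intros I continuous_on_subset[OF F]) auto
  have weakH: "integral {a..b} (\<lambda>t. deriv \<theta> t * H t) = 0"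
    if th: "smooth \<theta>" "\<And>t. t \<notin> {a..b} \<Longrightarrow> \<theta> t = 0" and ab: "0 < a" "a < b" for \<theta> a b
  proof -
    have "integral {a..b} (\<lambda>t. deriv \<theta> t * integral {0..t} G) = - integral {a..b} (\<lambda>t. \<theta> t * G t)"
      by (rule integration_by_parts_test[OF th ab integral_has_derivative_interior[OF G]])
         (auto intro: continuous_on_subset[OF G])
    moreover have "integral {a..b} (\<lambda>t. deriv \<theta> t * F t) = - integral {a..b} (\<lambda>t. \<theta> t * G t)"
      by (rule weak[OF th(1) ab th(2)])
    moreover have "(\<lambda>t. deriv \<theta> t * F t) integrable_on {a..b}" "(\<lambda>t. deriv \<theta> t * integral {0..t} G) integrable_on {a..b}"
      using ab by (intro integrable_continuous_real continuous_intros smooth_continuous[OF smooth_deriv[OF th(1)]]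
        continuous_on_subset[OF F] continuous_on_subset[OF I[of b]]; auto)+
    then have "integral {a..b} (\<lambda>t. deriv \<theta> t * F t - deriv \<theta> t * integral {0..t} G)
        = integral {a..b} (\<lambda>t. deriv \<theta> t * F t) - integral {a..b} (\<lambda>t. deriv \<theta> t * integral {0..t} G)"
      by (rule integral_diff)
    ultimately show ?thesis by (simp add: H_def right_diff_distrib)
  qed
  have le: "H \<beta> \<le> H \<alpha>" if pos: "0 < \<alpha>" "0 < \<beta>" for \<alpha> \<beta>
  proof (rule ccontr)
    assume "\<not> H \<beta> \<le> H \<alpha>"
    then have lt: "H \<alpha> < H \<beta>" by simp
    \<comment> \<open>A level strictly between the two values: by continuity \<open>H\<close> stays
      below it near \<open>\<alpha>\<close> and above it near \<open>\<beta>\<close>, and the bumps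
      are placed there.\<close>
    define m where "m = (H \<alpha> + H \<beta>) / 2"
    have m: "H \<alpha> < m" "m < H \<beta>" using lt by (simp_all add: m_def)
    define B where "B = max \<alpha> \<beta> + 1"
    have cont: "isCont H x" if "0 < x" "x < B" for x
      using continuous_on_interior[OF contH[of B], of x] that by (simp add: interior_atLeastAtMost_real)
    have "\<exists>d>0. \<forall>x. dist x \<alpha> < d \<longrightarrow> dist (H x) (H \<alpha>) < m - H \<alpha>"
      using cont[of \<alpha>] pos m unfolding continuous_at_eps_delta by (simp add: B_def)
    then obtain d1 where d1: "0 < d1" "\<And>x. dist x \<alpha> < d1 \<Longrightarrow> dist (H x) (H \<alpha>) < m - H \<alpha>" by blast
    have "\<exists>d>0. \<forall>x. dist x \<beta> < d \<longrightarrow> dist (H x) (H \<beta>) < H \<beta> - m"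
      using cont[of \<beta>] pos m unfolding continuous_at_eps_delta by (simp add: B_def)
    then obtain d2 where d2: "0 < d2" "\<And>x. dist x \<beta> < d2 \<Longrightarrow> dist (H x) (H \<beta>) < H \<beta> - m" by blast
    define e where "e = min d1 d2 / 2"
    have e: "0 < e" "e < d1" "e < d2" using d1 d2 by (auto simp: e_def)
    define r1 where "r1 = bump \<alpha> (\<alpha> + e) 0 1"
    define r2 where "r2 = bump \<beta> (\<beta> + e) 0 1"
    define a where "a = min \<alpha> \<beta>"
    define b where "b = max \<alpha> \<beta> + e"
    have ab: "0 < a" "a < b" using pos e by (auto simp: a_def b_def)
    have sm: "smooth r1" "smooth r2" unfolding r1_def r2_def using e by (auto intro: bump_smooth)
    have cr: "continuous_on S r1" "continuous_on S r2" for S using sm by (auto intro: smooth_continuous)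
    have rn: "0 \<le> r1 x" "0 \<le> r2 x" for x by (auto simp: r1_def r2_def bump_def)
    have rp: "0 < r1 (\<alpha> + e / 2)" "0 < r2 (\<beta> + e / 2)" using e by (auto simp: r1_def r2_def bump_def)
    have inab: "\<alpha> + e / 2 \<in> {a..b}" "\<beta> + e / 2 \<in> {a..b}" using e by (auto simp: a_def b_def)
    have supp: "r1 x = 0" "r2 x = 0" if "x \<le> a \<or> b \<le> x" for x
      using that by (auto simp: r1_def r2_def bump_def a_def b_def)
    have zero: "f x = 0" if "continuous_on {a..b} f" "\<And>x. x \<in> {a..b} \<Longrightarrow> 0 \<le> f x" "integral {a..b} f = 0" "x \<in> {a..b}"
      for f :: "real \<Rightarrow> real" and x
    proof (rule has_integral_0_cbox_imp_0[of a b f])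
      show "(f has_integral 0) (cbox a b)"
        using integrable_integral[OF integrable_continuous_real[OF that(1)]] that(3) by simp
    qed (use that ab in auto)
    define J1 where "J1 = integral {a..b} r1"
    define J2 where "J2 = integral {a..b} r2"
    have J: "0 < J1" "0 < J2"
    proof -
      have "0 \<le> J1" "0 \<le> J2" unfolding J1_def J2_def
        using rn cr by (auto intro!: integral_nonneg integrable_continuous_real)
      moreover have "J1 \<noteq> 0" using zero[OF cr(1) rn(1) _ inab(1)] rp(1) by (auto simp: J1_def)
      moreover have "J2 \<noteq> 0" using zero[OF cr(2) rn(2) _ inab(2)] rp(2) by (auto simp: J2_def)
      ultimately show "0 < J1" "0 < J2" by auto
    qed
    \<comment> \<open>The crossed weights give total integral 0, so that the antiderivative
      \<open>\<theta>\<close> vanishes beyond \<open>b\<close> as well and is an admissible test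
      function.\<close>
    define g where "g x = J2 * r1 x - J1 * r2 x" for x
    have smg: "smooth g" unfolding g_def using smooth_lincomb[OF sm, of J2 "- J1"] by simp
    have cg: "continuous_on S g" for S by (rule smooth_continuous[OF smg])
    have gsupp: "g x = 0" if "x \<le> a \<or> b \<le> x" for x using supp[OF that] by (simp add: g_def)
    have gint: "g integrable_on {x..y}" for x y by (rule integrable_continuous_real[OF cg])
    have total: "integral {a..b} g = 0"
    proof -
      have "integral {a..b} g = J2 * J1 - J1 * J2" unfolding g_def J1_def J2_def
        by (subst integral_diff) (auto intro!: integrable_continuous_real continuous_intros cr)
      then show ?thesis by simp
    qed
    define \<theta> where "\<theta> x = integral {0..x} g" for x
    have th0: "\<theta> x = 0" if "x \<le> a" for x
      unfolding \<theta>_def by (subst integral_cong[where g="\<lambda>_. 0"]) (use gsupp that in auto)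
    have thb: "\<theta> x = 0" if "b < x" for x
    proof -
      have "\<theta> x = integral {0..a} g + (integral {a..b} g + integral {b..x} g)"
        unfolding \<theta>_def using ab that
          Henstock_Kurzweil_Integration.integral_combine[of 0 a x g, OF _ _ gint]
          Henstock_Kurzweil_Integration.integral_combine[of a b x g, OF _ _ gint] by simp
      moreover have "integral {0..a} g = 0" using th0[of a] by (simp add: \<theta>_def)
      moreover have "integral {b..x} g = 0"
        by (subst integral_cong[where g="\<lambda>_. 0"]) (use gsupp in auto)
      ultimately show ?thesis using total by simp
    qed
    have thsupp: "\<theta> x = 0" if "x \<notin> {a..b}" for x using that th0[of x] thb[of x] by force
    have dth: "(\<theta> has_real_derivative g x) (at x)" for x
    proof (cases "0 < x")
      case True
      then show ?thesis unfolding \<theta>_def by (rule integral_has_derivative_interior[OF cg])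
    next
      case False
      have "\<forall>\<^sub>F y in nhds x. y \<in> {..<a}" using False ab by (intro eventually_nhds_in_open) auto
      then have ev: "\<forall>\<^sub>F y in nhds x. 0 = \<theta> y" by eventually_elim (use th0 in auto)
      have "((\<lambda>y. 0) has_real_derivative 0) (at x)" by simp
      then have "(\<theta> has_real_derivative 0) (at x)" by (subst (asm) DERIV_cong_ev[OF refl ev refl])
      then show ?thesis using gsupp[of x] False ab by simp
    qed
    have smt: "smooth \<theta>" by (rule smooth_antiderivative[OF smg dth])
    have "deriv \<theta> = g" using dth by (auto intro: DERIV_imp_deriv)
    then have gH: "integral {a..b} (\<lambda>t. g t * H t) = 0" using weakH[OF smt thsupp ab] by simp
    have cH: "continuous_on {a..b} H" by (rule continuous_on_subset[OF contH[of b]]) (use ab in auto)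
    \<comment> \<open>Subtracting \<open>m\<close> costs nothing since \<open>g\<close> has integral
      0, and makes both contributions nonnegative: where \<open>r1\<close> lives
      \<open>H < m\<close>, where \<open>r2\<close> lives \<open>H > m\<close>.\<close>
    let ?f = "\<lambda>x. g x * (m - H x)"
    have "integral {a..b} ?f = integral {a..b} (\<lambda>x. m * g x - g x * H x)" by (simp add: algebra_simps)
    also have "\<dots> = m * integral {a..b} g - integral {a..b} (\<lambda>t. g t * H t)"
      by (subst integral_diff) (auto intro!: integrable_continuous_real continuous_intros cg cH)
    finally have f0: "integral {a..b} ?f = 0" using total gH by simp
    have H1: "H x < m" if "0 < r1 x" for x
    proof -
      have "dist x \<alpha> < d1" using that e by (auto simp: r1_def bump_def dist_real_def split: if_splits)
      from d1(2)[OF this] show ?thesis by (simp add: dist_real_def abs_less_iff)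
    qed
    have H2: "m < H x" if "0 < r2 x" for x
    proof -
      have "dist x \<beta> < d2" using that e by (auto simp: r2_def bump_def dist_real_def split: if_splits)
      from d2(2)[OF this] show ?thesis by (simp add: dist_real_def abs_less_iff)
    qed
    have fn: "0 \<le> J2 * (r1 x * (m - H x))" "0 \<le> J1 * (r2 x * (H x - m))" for x
    proof -
      have "0 \<le> r1 x * (m - H x)" using rn(1)[of x] H1[of x] by (cases "r1 x = 0") auto
      then show "0 \<le> J2 * (r1 x * (m - H x))" using J by simp
      have "0 \<le> r2 x * (H x - m)" using rn(2)[of x] H2[of x] by (cases "r2 x = 0") auto
      then show "0 \<le> J1 * (r2 x * (H x - m))" using J by simp
    qed
    have fe: "?f x = J2 * (r1 x * (m - H x)) + J1 * (r2 x * (H x - m))" for x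
      by (simp add: g_def algebra_simps)
    have "?f (\<alpha> + e / 2) = 0"
      proof (rule zero[OF _ _ f0 inab(1)])
      show "continuous_on {a..b} ?f" by (intro continuous_intros cg cH)
      show "0 \<le> ?f x" for x unfolding fe using fn by (rule add_nonneg_nonneg)
    qed
    then have "J2 * (r1 (\<alpha> + e / 2) * (m - H (\<alpha> + e / 2))) \<le> 0"
      using fe[of "\<alpha> + e / 2"] fn(2)[of "\<alpha> + e / 2"] by linarith
    moreover have "0 < J2 * (r1 (\<alpha> + e / 2) * (m - H (\<alpha> + e / 2)))"
      using J rp(1) H1[OF rp(1)] by simp
    ultimately show False by simp
  qed
  have const: "H t = H 1" if "0 < t" for t using le[of t 1] le[of 1 t] that by simp
  \<comment> \<open>Test functions are supported away from time 0, so the initial value is recovered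
    from continuity.\<close>
  have H0: "H 0 = H 1"
  proof -
    have "(\<lambda>n. H (1 / real (Suc n))) \<longlonglongrightarrow> H 0"
    proof (rule continuous_on_tendsto_compose[OF contH[of 1]])
      show "(\<lambda>n. 1 / real (Suc n)) \<longlonglongrightarrow> 0"
        using LIMSEQ_inverse_real_of_nat unfolding inverse_eq_divide .
    qed auto
    moreover have "H (1 / real (Suc n)) = H 1" for n by (rule const) simp
    ultimately show ?thesis using LIMSEQ_unique[OF _ tendsto_const] by simp
  qed
  have "H t = H 0" using const[of t] H0 t by (cases "t = 0") auto
  then show ?thesis by (simp add: H_def)
qed

section \<open>From Burgers solutions to flows\<close>

lemma dist_apply_linear: "linear (dist_apply u)"
  using dist_apply[of u] by auto

lemma fourier_coeff_add: "fourier_coeff (u + v) n = fourier_coeff u n + fourier_coeff v n"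
  by (simp add: fourier_coeff_def plus_distribution.rep_eq complex_eq_iff add_divide_distrib diff_divide_distrib)

lemma fourier_coeff_diff: "fourier_coeff (u - v) n = fourier_coeff u n - fourier_coeff v n"
  by (simp add: fourier_coeff_def minus_distribution.rep_eq complex_eq_iff diff_divide_distrib)

lemma fourier_coeff_scaleR: "fourier_coeff (r *\<^sub>R u) n = of_real r * fourier_coeff u n"
  by (simp add: fourier_coeff_def scaleR_distribution.rep_eq complex_eq_iff)

lemma test_deriv_cos: "test_deriv (cos_test n) = (- real_of_int n) *\<^sub>R sin_test n"
proof -
  have "deriv (\<lambda>x. cos (real_of_int n * x)) = (\<lambda>x. - real_of_int n * sin (real_of_int n * x))"
    by (rule ext, rule DERIV_imp_deriv) (auto intro!: derivative_eq_intros)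
  then show ?thesis
    by (simp add: test_apply_inject[symmetric] test_deriv.rep_eq cos_test.rep_eq scaleR_test_fun.rep_eq sin_test.rep_eq uminus_test_fun.rep_eq)
qed

lemma test_deriv_sin: "test_deriv (sin_test n) = real_of_int n *\<^sub>R cos_test n"
proof -
  have "deriv (\<lambda>x. sin (real_of_int n * x)) = (\<lambda>x. real_of_int n * cos (real_of_int n * x))"
    by (rule ext, rule DERIV_imp_deriv) (auto intro!: derivative_eq_intros)
  then show ?thesis
    by (simp add: test_apply_inject[symmetric] test_deriv.rep_eq cos_test.rep_eq scaleR_test_fun.rep_eq sin_test.rep_eq)
qed

lemma fourier_coeff_deriv: "fourier_coeff (dist_deriv u) n = \<i> * of_int n * fourier_coeff u n"
  by (simp add: fourier_coeff_def dist_deriv.rep_eq test_deriv_cos test_deriv_sin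
      linear_scale[OF dist_apply_linear] complex_eq_iff del: scaleR_minus_left)

lemma fourier_coeff_minus: "fourier_coeff u (- n) = cnj (fourier_coeff u n)"
proof -
  have "cos_test (- n) = cos_test n" "sin_test (- n) = - sin_test n"
    by (simp_all add: test_apply_inject[symmetric] cos_test.rep_eq sin_test.rep_eq uminus_test_fun.rep_eq)
  then show ?thesis by (simp add: fourier_coeff_def linear_neg[OF dist_apply_linear] complex_eq_iff)
qed

lemma dist_apply_cos: "dist_apply u (cos_test n) = 2 * pi * Re (fourier_coeff u n)"
  by (simp add: fourier_coeff_def)

lemma dist_apply_sin: "dist_apply u (sin_test n) = - (2 * pi * Im (fourier_coeff u n))"
  by (simp add: fourier_coeff_def)

lemma fourier_coeff_sqint: "sqint f \<Longrightarrow> fourier_coeff (distr_of f) n = cf (ft f) n"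
  by (simp add: fourier_coeff_distr_of sqint_integrable cf_ft)

lemma fourier_coeff_half_square:
  assumes f: "sqint f"
  shows "fourier_coeff (distr_of (\<lambda>x. (f x)\<^sup>2 / 2)) n = conv (ft f) (ft f) n / 2"
proof -
  have "integrable MT (\<lambda>x. (f x)\<^sup>2 / 2)" using f by (simp add: sqint_def)
  then have "fourier_coeff (distr_of (\<lambda>x. (f x)\<^sup>2 / 2)) n = fc (\<lambda>x. 1 / 2 * (f x)\<^sup>2) n"
    by (simp add: fourier_coeff_distr_of)
  then show ?thesis by (simp only: fc_scale fc_square[OF f]) simp
qed

lemma AE_positive_negligible:
  assumes "AE t in lebesgue_on {0<..}. P t"
  shows "\<exists>N. negligible N \<and> (\<forall>t>0. t \<notin> N \<longrightarrow> P (t :: real))"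
proof -
  have "AE t in lebesgue. t \<in> {0<..} \<longrightarrow> P t" using assms by (subst (asm) AE_restrict_space_iff) auto
  then obtain N where "N \<in> null_sets lebesgue" "{x. \<not> (x \<in> {0<..} \<longrightarrow> P x)} \<subseteq> N"
    unfolding eventually_ae_filter by auto
  then show ?thesis by (intro exI[of _ N]) (auto simp: negligible_iff_null_sets)
qed

lemma integral_equation_derivative:
  fixes F G :: "real \<Rightarrow> real"
  assumes G: "continuous_on {0..} G" and F: "\<And>t. 0 \<le> t \<Longrightarrow> F t = F 0 + integral {0..t} G" and t: "0 \<le> t"
  shows "(F has_real_derivative G t) (at t within {0..})"
proof -
  have "((\<lambda>u. integral {0..u} G) has_vector_derivative G t) (at t within {0..t + 1})"
    using t by (intro integral_has_vector_derivative continuous_on_subset[OF G]) auto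
  then have "((\<lambda>u. integral {0..u} G) has_vector_derivative G t) (at t within {0..})"
    using at_within_initial[of t "t + 1"] by simp
  then have "((\<lambda>u. F 0 + integral {0..u} G) has_vector_derivative G t) (at t within {0..})"
    by (simp add: has_vector_derivative_add_const add.commute[of "F 0"])
  then have "(F has_vector_derivative G t) (at t within {0..})"
  proof (rule has_vector_derivative_transform[rotated 2])
    show "F u = F 0 + integral {0..u} G" if "u \<in> {0..}" for u using that by (intro F) simp
  qed (use t in simp)
  then show ?thesis by (simp add: has_real_derivative_iff_has_vector_derivative)
qed

lemma (in feedback) force_continuous:
  assumes c: "continuous_on S c" shows "continuous_on S (\<lambda>t. force (c t) n)"
proof -
  have "continuous_on S (\<lambda>t. conv (c t) (c t) n)"
    unfolding continuous_on_def
  proof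
    fix t assume t: "t \<in> S"
    have ct: "(c \<longlongrightarrow> c t) (at t within S)" using c t by (simp add: continuous_on_def)
    have "((\<lambda>s. conv (c s) (c s) n - conv (c t) (c t) n) \<longlongrightarrow> 0) (at t within S)"
    proof (rule Lim_null_comparison)
      show "\<forall>\<^sub>F s in at t within S. cmod (conv (c s) (c s) n - conv (c t) (c t) n) \<le> (norm (c s) + norm (c t)) * norm (c s - c t)"
        by (intro always_eventually allI conv_quad_diff)
      have "((\<lambda>s. (norm (c s) + norm (c t)) * norm (c s - c t)) \<longlongrightarrow> (norm (c t) + norm (c t)) * norm (c t - c t)) (at t within S)"
        by (intro tendsto_intros ct)
      then show "((\<lambda>s. (norm (c s) + norm (c t)) * norm (c s - c t)) \<longlongrightarrow> 0) (at t within S)" by simp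
    qed
    then show "((\<lambda>t. conv (c t) (c t) n) \<longlongrightarrow> conv (c t) (c t) n) (at t within S)" by (rule Lim_null[THEN iffD2])
  qed
  then show ?thesis unfolding force_def control_def
    by (intro continuous_intros bounded_linear.continuous_on[OF k1] bounded_linear.continuous_on[OF k2] c)
qed

text \<open>Bridge between distributions and sequences. The functionals are compared on regular
  distributions of square-integrable functions, which is where solutions take their values.\<close>

locale closed_loop = feedback p q k1 k2 A
  for p q :: "int \<Rightarrow> complex" and k1 k2 :: "ell2 \<Rightarrow> real" and A :: real +
  fixes \<phi>1 \<phi>2 :: distribution and K1 K2 :: "distribution \<Rightarrow> real"
  assumes p_eq: "p n = fourier_coeff \<phi>1 n" and q_eq: "q n = fourier_coeff \<phi>2 n"
    and K1_eq: "sqint f \<Longrightarrow> K1 (distr_of f) = k1 (ft f)" and K2_eq: "sqint f \<Longrightarrow> K2 (distr_of f) = k2 (ft f)"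
begin

definition rate :: "ell2 \<Rightarrow> int \<Rightarrow> complex" where
  "rate c n = - of_real ((real_of_int n)\<^sup>2) * cf c n + force c n"

lemma rate_continuous: "continuous_on S c \<Longrightarrow> continuous_on S (\<lambda>t. rate (c t) n)"
  unfolding rate_def by (intro continuous_intros continuous_on_cf force_continuous)

lemma fourier_coeff_equation:
  assumes f: "sqint f"
    and eq: "v - dist_deriv (dist_deriv (distr_of f)) + dist_deriv (distr_of (\<lambda>x. (f x)\<^sup>2 / 2))
             = K1 (distr_of f) *\<^sub>R \<phi>1 + K2 (distr_of f) *\<^sub>R \<phi>2"
  shows "fourier_coeff v n = rate (ft f) n"
proof -
  have "fourier_coeff (v - dist_deriv (dist_deriv (distr_of f)) + dist_deriv (distr_of (\<lambda>x. (f x)\<^sup>2 / 2))) n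
      = fourier_coeff (K1 (distr_of f) *\<^sub>R \<phi>1 + K2 (distr_of f) *\<^sub>R \<phi>2) n" by (simp only: eq)
  then have "fourier_coeff v n - \<i> * of_int n * (\<i> * of_int n * cf (ft f) n) + \<i> * of_int n * (conv (ft f) (ft f) n / 2)
      = control (ft f) n"
    by (simp only: fourier_coeff_add fourier_coeff_diff fourier_coeff_scaleR fourier_coeff_deriv fourier_coeff_sqint[OF f]
      fourier_coeff_half_square[OF f] control_def p_eq q_eq K1_eq[OF f] K2_eq[OF f])
  then show ?thesis unfolding rate_def force_def by (simp add: algebra_simps power2_eq_square)
qed

text \<open>Continuity of \<open>y\<close> into \<open>L2\<close> makes the coefficients and their
  rates continuous in time. The weak derivative of each mode is thus a continuous function, and the
  mode is classically differentiable up to time 0; the sine and cosine tests determine its imaginary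
  and real parts.\<close>

theorem burgers_solution_flow:
  assumes sol: "burgers_solution \<phi>1 \<phi>2 K1 K2 y0 y"
  shows "flow (\<lambda>t. ft (y t))"
proof -
  define c where "c t = ft (y t)" for t
  have C0: "C0_L2 y" using sol by (simp add: burgers_solution_def)
  then have sq: "sqint (y t)" if "0 \<le> t" for t using that by (auto simp: C0_L2_def intro: L2_sqint)
  have cont: "continuous_on {0..} c"
    unfolding continuous_on_def
  proof
    fix t :: real assume t: "t \<in> {0..}"
    have "((\<lambda>s. L2_norm (\<lambda>x. y s x - y t x) / sqrt (2 * pi)) \<longlongrightarrow> 0 / sqrt (2 * pi)) (at t within {0..})"
      using C0 t by (intro tendsto_intros) (auto simp: C0_L2_def)
    moreover have "\<forall>\<^sub>F s in at t within {0..}. L2_norm (\<lambda>x. y s x - y t x) / sqrt (2 * pi) = norm (c s - c t)"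
      using sq t by (auto simp: eventually_at_filter L2_norm_diff_ft c_def intro!: always_eventually)
    ultimately have "((\<lambda>s. norm (c s - c t)) \<longlongrightarrow> 0) (at t within {0..})"
      using Lim_transform_eventually by fastforce
    then show "(c \<longlongrightarrow> c t) (at t within {0..})" by (metis Lim_null tendsto_norm_zero_cancel)
  qed
  obtain v where v: "weak_time_deriv (\<lambda>t. distr_of (y t)) v"
    "AE t in lebesgue_on {0<..}. v t - dist_deriv (dist_deriv (distr_of (y t))) + dist_deriv (distr_of (\<lambda>x. (y t x)\<^sup>2 / 2))
             = K1 (distr_of (y t)) *\<^sub>R \<phi>1 + K2 (distr_of (y t)) *\<^sub>R \<phi>2"
    using sol unfolding burgers_solution_def by blast
  obtain N where N: "negligible N" "\<And>t. 0 < t \<Longrightarrow> t \<notin> N \<Longrightarrow>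
      v t - dist_deriv (dist_deriv (distr_of (y t))) + dist_deriv (distr_of (\<lambda>x. (y t x)\<^sup>2 / 2))
             = K1 (distr_of (y t)) *\<^sub>R \<phi>1 + K2 (distr_of (y t)) *\<^sub>R \<phi>2"
    using AE_positive_negligible[OF v(2)] by blast
  have vn: "fourier_coeff (v t) n = rate (c t) n" if "0 < t" "t \<notin> N" for t n
    unfolding c_def by (rule fourier_coeff_equation[OF sq N(2)]) (use that in auto)
  \<comment> \<open>The weak equation in the form required by the fundamental lemma: the pairings
    are replaced by continuous functions \<open>F\<close> and \<open>G\<close>, where
    \<open>G\<close> agrees with the pairing of \<open>v\<close> off the null set on which the
    equation may fail.\<close>
  have weak: "integral {a..b} (\<lambda>t. deriv \<theta> t * F t) = - integral {a..b} (\<lambda>t. \<theta> t * G t)"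
    if th: "smooth \<theta>" "0 < a" "a < b" "\<And>t. t \<notin> {a..b} \<Longrightarrow> \<theta> t = 0"
      and F: "\<And>t. 0 < t \<Longrightarrow> dist_apply (distr_of (y t)) \<psi> = F t" "continuous_on {0..} F"
      and G: "\<And>t. 0 < t \<Longrightarrow> t \<notin> N \<Longrightarrow> dist_apply (v t) \<psi> = G t" "continuous_on {0..} G"
    for \<theta> \<psi> a b F G
  proof -
    have tt: "time_test \<theta>" unfolding time_test_def using th by blast
    have i1: "(\<lambda>t. deriv \<theta> t * F t) absolutely_integrable_on {a..b}"
      using th(2) by (intro absolutely_integrable_continuous_real continuous_intros
          smooth_continuous[OF smooth_deriv[OF th(1)]] continuous_on_subset[OF F(2)]) auto
    have i2: "(\<lambda>t. \<theta> t * G t) absolutely_integrable_on {a..b}"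
      using th(2) by (intro absolutely_integrable_continuous_real continuous_intros
          smooth_continuous[OF th(1)] continuous_on_subset[OF G(2)]) auto
    have j1: "(\<lambda>t. deriv \<theta> t * dist_apply (distr_of (y t)) \<psi>) absolutely_integrable_on {a..b}"
      by (rule absolutely_integrable_spike[OF i1 negligible_empty]) (use F(1) th(2) in auto)
    have j2: "(\<lambda>t. \<theta> t * dist_apply (v t) \<psi>) absolutely_integrable_on {a..b}"
      by (rule absolutely_integrable_spike[OF i2 N(1)]) (use G(1) th(2) in auto)
    have "integral {a..b} (\<lambda>t. deriv \<theta> t * F t) = integral {a..b} (\<lambda>t. deriv \<theta> t * dist_apply (distr_of (y t)) \<psi>)"
      by (rule integral_cong) (use F(1) th(2) in auto)
    also have "\<dots> = (LINT t:{0<..}|lebesgue. deriv \<theta> t * dist_apply (distr_of (y t)) \<psi>)"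
      by (rule LINT_compact_support[symmetric, OF th(2) _ j1]) (use time_test_deriv_support[OF th(1,4)] in auto)
    also have "\<dots> = - (LINT t:{0<..}|lebesgue. \<theta> t * dist_apply (v t) \<psi>)"
      using v(1) tt unfolding weak_time_deriv_def by blast
    also have "(LINT t:{0<..}|lebesgue. \<theta> t * dist_apply (v t) \<psi>) = integral {a..b} (\<lambda>t. \<theta> t * dist_apply (v t) \<psi>)"
      by (rule LINT_compact_support[OF th(2) _ j2]) (use th(4) in auto)
    also have "\<dots> = integral {a..b} (\<lambda>t. \<theta> t * G t)"
      by (rule integral_spike[OF N(1)]) (use G(1) th(2) in auto)
    finally show ?thesis .
  qed
  have yn: "fourier_coeff (distr_of (y t)) n = cf (c t) n" if "0 < t" for t n
    unfolding c_def by (rule fourier_coeff_sqint) (use sq that in simp)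
  have der: "((\<lambda>s. cf (c s) n) has_vector_derivative rate (c t) n) (at t within {0..})" if t: "0 \<le> t" for t n
    unfolding has_vector_derivative_complex_iff
  proof
    note cn = continuous_on_cf[OF cont, of n] and rn = rate_continuous[OF cont, of n]
    have R: "((\<lambda>t. 2 * pi * Re (cf (c t) n)) has_real_derivative 2 * pi * Re (rate (c t) n)) (at t within {0..})"
    proof (rule integral_equation_derivative[OF _ weak_derivative_continuous t])
      show "integral {a..b} (\<lambda>t. deriv \<theta> t * (2 * pi * Re (cf (c t) n))) = - integral {a..b} (\<lambda>t. \<theta> t * (2 * pi * Re (rate (c t) n)))"
        if "smooth \<theta>" "0 < a" "a < b" "\<And>t. t \<notin> {a..b} \<Longrightarrow> \<theta> t = 0" for \<theta> a b
        by (rule weak[OF that, where \<psi>="cos_test n"])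
           (auto simp: dist_apply_cos yn vn intro!: continuous_intros cn rn)
    qed (auto intro!: continuous_intros cn rn)
    have I: "((\<lambda>t. - (2 * pi * Im (cf (c t) n))) has_real_derivative - (2 * pi * Im (rate (c t) n))) (at t within {0..})"
    proof (rule integral_equation_derivative[OF _ weak_derivative_continuous t])
      show "integral {a..b} (\<lambda>t. deriv \<theta> t * - (2 * pi * Im (cf (c t) n))) = - integral {a..b} (\<lambda>t. \<theta> t * - (2 * pi * Im (rate (c t) n)))"
        if "smooth \<theta>" "0 < a" "a < b" "\<And>t. t \<notin> {a..b} \<Longrightarrow> \<theta> t = 0" for \<theta> a b
        by (rule weak[OF that, where \<psi>="sin_test n"])
           (auto simp: dist_apply_sin yn vn intro!: continuous_intros cn rn)
    qed (auto intro!: continuous_intros cn rn)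
    show "((\<lambda>s. Re (cf (c s) n)) has_real_derivative Re (rate (c t) n)) (at t within {0..})"
      using DERIV_cmult[OF R, of "1 / (2 * pi)"] by simp
    show "((\<lambda>s. Im (cf (c s) n)) has_real_derivative Im (rate (c t) n)) (at t within {0..})"
      using DERIV_cmult[OF I, of "- 1 / (2 * pi)"] by simp
  qed
  show ?thesis unfolding flow_def heat_flow_def using cont der unfolding rate_def c_def by blast
qed

end

section \<open>Fourier expansion of distributions\<close>

lemma test_smooth: "smooth (test_apply \<psi>)" using test_apply[of \<psi>] by auto

lemma test_sqint: "sqint (test_apply \<psi>)"
  by (rule sqint_continuous[OF smooth_continuous[OF test_smooth]])

lemma fc_test_deriv: "fc (test_apply (test_deriv \<psi>)) n = \<i> * of_int n * fc (test_apply \<psi>) n"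
proof -
  let ?f = "test_apply \<psi>" and ?g = "test_apply (test_deriv \<psi>)"
  have per: "?f (x + 2 * pi) = ?f x" for x using test_apply[of \<psi>] by auto
  define F where "F x = ?f x *\<^sub>R cis (real_of_int (- n) * x)" for x
  have dF: "(F has_vector_derivative (of_real (?g x) * ch (- n) x - \<i> * of_int n * (of_real (?f x) * ch (- n) x))) (at x within S)" for x S
  proof -
    have 1: "(?f has_field_derivative ?g x) (at x within S)"
      using smooth_DERIV[OF test_smooth, of \<psi> x] by (auto simp: test_deriv.rep_eq intro: has_field_derivative_at_within)
    have 2: "((\<lambda>x. cis (real_of_int (- n) * x)) has_vector_derivative (- (\<i> * of_int n)) * ch (- n) x) (at x within S)"
      unfolding has_vector_derivative_complex_iff ch_def by (auto intro!: derivative_eq_intros)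
    show ?thesis unfolding F_def
      by (rule has_vector_derivative_eq_rhs, rule has_vector_derivative_scaleR[OF 1 2])
         (simp add: ch_def scaleR_conv_of_real algebra_simps)
  qed
  have i1: "integrable MT (\<lambda>x. of_real (?g x) * ch (- n) x)" by (intro integrable_mult_ch sqint_integrable test_sqint)
  have i2: "integrable MT (\<lambda>x. of_real (?f x) * ch (- n) x)" by (intro integrable_mult_ch sqint_integrable test_sqint)
  let ?h = "\<lambda>x. of_real (?g x) * ch (- n) x - \<i> * of_int n * (of_real (?f x) * ch (- n) x)"
  have "(?h has_integral F (2 * pi) - F 0) {0..2 * pi}" by (rule fundamental_theorem_of_calculus) (auto intro: dF)
  moreover have "F (2 * pi) = F 0"
    using per[of 0] cis_multiple_2pi[of "real_of_int (- n)"] by (simp add: F_def mult.commute mult.left_commute)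
  ultimately have "integral {0..2 * pi} ?h = 0" by (simp add: integral_unique)
  moreover have "integral\<^sup>L MT ?h = integral {0..2 * pi} ?h"
    using i1 i2 by (intro lebesgue_integral_eq_integral) auto
  moreover have "integral\<^sup>L MT ?h = integral\<^sup>L MT (\<lambda>x. of_real (?g x) * ch (- n) x) - \<i> * of_int n * integral\<^sup>L MT (\<lambda>x. of_real (?f x) * ch (- n) x)"
    using i1 i2 by simp
  ultimately show ?thesis by (simp add: fc_def)
qed

text \<open>Two integrations by parts. Order 2 makes the pairing of a test function with any bounded
  coefficient sequence absolutely convergent.\<close>

lemma fc_test_decay: "\<exists>D\<ge>0. \<forall>n. cmod (fc (test_apply \<psi>) n) \<le> D * jb n powr (- 2)"
proof -
  define a where "a = norm (ft (test_apply \<psi>))"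
  define b where "b = norm (ft (test_apply (test_deriv (test_deriv \<psi>))))"
  have "cmod (fc (test_apply \<psi>) n) \<le> (2 * (a + b)) * jb n powr (- 2)" for n
  proof -
    have "(real_of_int n)\<^sup>2 * cmod (fc (test_apply \<psi>) n) = cmod (fc (test_apply (test_deriv (test_deriv \<psi>))) n)"
      by (simp add: fc_test_deriv norm_mult power2_eq_square)
    also have "\<dots> \<le> b" using cf_le_norm[of "ft (test_apply (test_deriv (test_deriv \<psi>)))" n]
      by (simp add: b_def cf_ft test_sqint)
    finally have 1: "(real_of_int n)\<^sup>2 * cmod (fc (test_apply \<psi>) n) \<le> b" .
    have 2: "cmod (fc (test_apply \<psi>) n) \<le> a" using cf_le_norm[of "ft (test_apply \<psi>)" n]
      by (simp add: a_def cf_ft test_sqint)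
    have "(jb n)\<^sup>2 * cmod (fc (test_apply \<psi>) n) \<le> 2 * (1 + (real_of_int n)\<^sup>2) * cmod (fc (test_apply \<psi>) n)"
      by (intro mult_right_mono jb_sq) auto
    also have "\<dots> \<le> 2 * (a + b)" using 1 2 by (simp add: algebra_simps)
    finally show ?thesis using jb_pos[of n] by (simp add: powr_minus divide_simps mult.commute)
  qed
  then show ?thesis by (intro exI[of _ "2 * (a + b)"]) (auto simp: a_def b_def)
qed

definition pairing :: "distribution \<Rightarrow> test_fun \<Rightarrow> int \<Rightarrow> real" where
  "pairing T \<psi> n = 2 * pi * Re (fourier_coeff T n * cnj (fc (test_apply \<psi>) n))"

text \<open>Validity of the Fourier expansion when tested on smooth functions. It is stable under
  the operations in the equation, so it only has to be verified for square-integrable functions and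
  for the two profiles. Symmetric partial sums match the given sine and cosine series.\<close>

definition expands :: "distribution \<Rightarrow> bool" where
  "expands T \<longleftrightarrow> (\<forall>\<psi>. (\<lambda>N. \<Sum>n=-int N..int N. pairing T \<psi> n) \<longlonglongrightarrow> dist_apply T \<psi>)"

lemma expands_add: "expands S \<Longrightarrow> expands T \<Longrightarrow> expands (S + T)"
  unfolding expands_def pairing_def fourier_coeff_add plus_distribution.rep_eq
  by (auto simp: distrib_right distrib_left sum.distrib intro!: tendsto_add)

lemma expands_scaleR: assumes "expands T" shows "expands (r *\<^sub>R T)"
  unfolding expands_def
proof
  fix \<psi>
  have "(\<lambda>N. r * (\<Sum>n=-int N..int N. pairing T \<psi> n)) \<longlonglongrightarrow> r * dist_apply T \<psi>"
    using assms by (intro tendsto_mult tendsto_const) (auto simp: expands_def)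
  moreover have "r * (\<Sum>n=-int N..int N. pairing T \<psi> n) = (\<Sum>n=-int N..int N. pairing (r *\<^sub>R T) \<psi> n)" for N
  proof -
    have "Re (of_real r * z * w) = r * Re (z * w)" for z w by (simp add: algebra_simps)
    then have "pairing (r *\<^sub>R T) \<psi> n = r * pairing T \<psi> n" for n
      by (simp only: pairing_def fourier_coeff_scaleR mult.left_commute[of r])
    then show ?thesis by (simp add: sum_distrib_left)
  qed
  ultimately show "(\<lambda>N. \<Sum>n=-int N..int N. pairing (r *\<^sub>R T) \<psi> n) \<longlonglongrightarrow> dist_apply (r *\<^sub>R T) \<psi>"
    by (simp add: scaleR_distribution.rep_eq)
qed

lemma expands_diff: "expands S \<Longrightarrow> expands T \<Longrightarrow> expands (S - T)"
  using expands_add[of S "(- 1) *\<^sub>R T"] expands_scaleR[of T "- 1"] by simp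

lemma expands_deriv: assumes "expands T" shows "expands (dist_deriv T)"
  unfolding expands_def
proof
  fix \<psi>
  have "(\<lambda>N. - (\<Sum>n=-int N..int N. pairing T (test_deriv \<psi>) n)) \<longlonglongrightarrow> - dist_apply T (test_deriv \<psi>)"
    using assms by (intro tendsto_minus) (auto simp: expands_def)
  moreover have "- pairing T (test_deriv \<psi>) n = pairing (dist_deriv T) \<psi> n" for n
    by (simp add: pairing_def fc_test_deriv fourier_coeff_deriv algebra_simps)
  ultimately show "(\<lambda>N. \<Sum>n=-int N..int N. pairing (dist_deriv T) \<psi> n) \<longlonglongrightarrow> dist_apply (dist_deriv T) \<psi>"
    by (simp add: dist_deriv.rep_eq sum_negf[symmetric])
qed

lemma dist_apply_distr_of: "integrable MT f \<Longrightarrow> dist_apply (distr_of f) \<psi> = integral\<^sup>L MT (\<lambda>x. f x * test_apply \<psi> x)"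
  by (simp add: distr_of.rep_eq set_integrable_MT LINT_MT)

lemma expands_sqint: assumes f: "sqint f" shows "expands (distr_of f)"
  unfolding expands_def
proof
  fix \<psi>
  have "dist_apply (distr_of f) \<psi> = 2 * pi * (ft f \<bullet> ft (test_apply \<psi>))"
    by (simp add: dist_apply_distr_of sqint_integrable f Parseval_inner test_sqint)
  also have "\<dots> = (\<Sum>\<^sub>\<infinity>n. pairing (distr_of f) \<psi> n)"
    unfolding inner_ell2_def pairing_def infsum_cmult_right'[symmetric]
    by (simp add: fourier_coeff_sqint f cf_ft test_sqint)
  finally have e: "dist_apply (distr_of f) \<psi> = (\<Sum>\<^sub>\<infinity>n. pairing (distr_of f) \<psi> n)" .
  have "pairing (distr_of f) \<psi> summable_on UNIV"
    unfolding pairing_def using cf_Re_summable[of "ft f" "ft (test_apply \<psi>)"]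
    by (intro summable_on_cmult_right) (simp add: fourier_coeff_sqint f cf_ft test_sqint)
  then show "(\<lambda>N. \<Sum>n=-int N..int N. pairing (distr_of f) \<psi> n) \<longlonglongrightarrow> dist_apply (distr_of f) \<psi>"
    unfolding e by (rule symmetric_sums_tendsto)
qed

lemma expands_dist_apply:
  assumes "expands T" "pairing T \<psi> summable_on UNIV"
  shows "dist_apply T \<psi> = (\<Sum>\<^sub>\<infinity>n. pairing T \<psi> n)"
  using LIMSEQ_unique[OF _ symmetric_sums_tendsto[OF assms(2)]] assms(1) by (auto simp: expands_def)

section \<open>Fourier coefficients and expansion of the two input profiles\<close>

lemma symmetric_sum_Suc:
  "(\<Sum>n=-int N..int N. f n) = f 0 + (\<Sum>j<N. f (int (Suc j)) + f (- int (Suc j)))" for f :: "int \<Rightarrow> 'a::comm_monoid_add"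
proof (induction N)
  case (Suc N)
  have "{- int (Suc N)..int (Suc N)} = insert (int (Suc N)) (insert (- int (Suc N)) {-int N..int N})" by auto
  then have "(\<Sum>n=-int (Suc N)..int (Suc N). f n) = f (int (Suc N)) + (f (- int (Suc N)) + (\<Sum>n=-int N..int N. f n))"
    by (subst \<open>{- int (Suc N)..int (Suc N)} = _\<close>) (subst sum.insert, simp, simp, subst sum.insert, auto)
  then show ?case unfolding Suc.IH by (simp add: add_ac)
qed simp

lemma pairing_minus: "pairing T \<psi> (- n) = pairing T \<psi> n"
  by (simp add: pairing_def fourier_coeff_minus fc_minus)

lemma fc_cos: "fc (\<lambda>x. cos (real_of_int n * x)) m = ((if m = n then 1 else 0) + (if m = - n then 1 else 0)) / 2"
proof -
  have "integrable MT (\<lambda>x. 1 :: real)" by (rule integrable_MT_const)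
  from fc_mult_cos[OF this, of n m] show ?thesis
    by (auto simp: fc_def integral_ch)
qed

lemma fc_sin: "fc (\<lambda>x. sin (real_of_int n * x)) m = ((if m = n then 1 else 0) - (if m = - n then 1 else 0)) / (2 * \<i>)"
proof -
  have "integrable MT (\<lambda>x. 1 :: real)" by (rule integrable_MT_const)
  from fc_mult_sin[OF this, of n m] show ?thesis
    by (auto simp: fc_def integral_ch)
qed

lemma dist_apply_sine:
  "dist_apply (distr_of (\<lambda>x. a * sin (real n * x))) \<psi> = a * - (2 * pi * Im (fc (test_apply \<psi>) (int n)))"
proof -
  have i: "integrable MT (\<lambda>x. a * sin (real n * x))" "integrable MT (test_apply \<psi>)"
    by (intro continuous_imp_integrable_real continuous_intros sqint_integrable[OF test_sqint])+
  have "integral\<^sup>L MT (\<lambda>x. a * sin (real n * x) * test_apply \<psi> x) = a * integral\<^sup>L MT (\<lambda>x. test_apply \<psi> x * sin (real n * x))"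
    unfolding integral_mult_right_zero[symmetric] by (simp add: mult_ac)
  also have "integral\<^sup>L MT (\<lambda>x. test_apply \<psi> x * sin (real n * x)) = dist_apply (distr_of (test_apply \<psi>)) (sin_test (int n))"
    by (simp add: dist_apply_distr_of i sin_test.rep_eq)
  finally show ?thesis by (simp add: dist_apply_distr_of[OF i(1)] dist_apply_sin fourier_coeff_distr_of i)
qed

lemma dist_apply_cosine:
  "dist_apply (distr_of (\<lambda>x. a * cos (real n * x))) \<psi> = a * (2 * pi * Re (fc (test_apply \<psi>) (int n)))"
proof -
  have i: "integrable MT (\<lambda>x. a * cos (real n * x))" "integrable MT (test_apply \<psi>)"
    by (intro continuous_imp_integrable_real continuous_intros sqint_integrable[OF test_sqint])+
  have "integral\<^sup>L MT (\<lambda>x. a * cos (real n * x) * test_apply \<psi> x) = a * integral\<^sup>L MT (\<lambda>x. test_apply \<psi> x * cos (real n * x))"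
    unfolding integral_mult_right_zero[symmetric] by (simp add: mult_ac)
  also have "integral\<^sup>L MT (\<lambda>x. test_apply \<psi> x * cos (real n * x)) = dist_apply (distr_of (test_apply \<psi>)) (cos_test (int n))"
    by (simp add: dist_apply_distr_of i cos_test.rep_eq)
  finally show ?thesis by (simp add: dist_apply_distr_of[OF i(1)] dist_apply_cos fourier_coeff_distr_of i)
qed

text \<open>Orthogonality: tested on a sine or cosine, the series has at most one nonzero term. In
  the expansion the modes \<open>n\<close> and \<open>- n\<close> contribute equally, each carrying
  half of the sine term.\<close>

lemma sine_series:
  assumes s: "dist_sums (\<lambda>n. distr_of (\<lambda>x. a (Suc n) * sin (real (Suc n) * x))) \<phi>"
  shows "fourier_coeff \<phi> 0 = 0" and "fourier_coeff \<phi> (int (Suc k)) = - \<i> * of_real (a (Suc k)) / 2"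
    and "expands \<phi>"
proof -
  have S: "(\<lambda>n. a (Suc n) * - (2 * pi * Im (fc (test_apply \<psi>) (int (Suc n))))) sums dist_apply \<phi> \<psi>" for \<psi>
    using s unfolding dist_sums_def dist_apply_sine by blast
  have C: "dist_apply \<phi> (cos_test n) = 0" for n
  proof -
    have "(\<lambda>k. a (Suc k) * - (2 * pi * Im (fc (test_apply (cos_test n)) (int (Suc k))))) = (\<lambda>k. 0)"
      unfolding cos_test.rep_eq fc_cos by (rule ext) auto
    then show ?thesis using S[of "cos_test n"] sums_unique2[OF _ sums_zero] by simp
  qed
  have Z: "dist_apply \<phi> (sin_test 0) = 0"
  proof -
    have "sin_test 0 = 0" by (simp add: test_apply_inject[symmetric] sin_test.rep_eq zero_test_fun.rep_eq)
    then show ?thesis by (simp add: linear_0[OF dist_apply_linear])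
  qed
  have D: "dist_apply \<phi> (sin_test (int (Suc k))) = pi * a (Suc k)" for k
  proof -
    have "(\<lambda>n. if n = k then pi * a (Suc n) else 0) sums (pi * a (Suc k))" by (rule sums_single)
    moreover have "(\<lambda>n. a (Suc n) * - (2 * pi * Im (fc (test_apply (sin_test (int (Suc k)))) (int (Suc n)))))
        = (\<lambda>n. if n = k then pi * a (Suc n) else 0)"
      unfolding sin_test.rep_eq fc_sin by (rule ext) auto
    ultimately show ?thesis using S[of "sin_test (int (Suc k))"] sums_unique2 by simp
  qed
  show f0: "fourier_coeff \<phi> 0 = 0" by (simp add: fourier_coeff_def C Z complex_eq_iff)
  show fk: "fourier_coeff \<phi> (int (Suc k)) = - \<i> * of_real (a (Suc k)) / 2" for k
    unfolding fourier_coeff_def C D by (simp add: complex_eq_iff)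
  show "expands \<phi>"
    unfolding expands_def
  proof
    fix \<psi>
    have "(\<Sum>n=-int N..int N. pairing \<phi> \<psi> n) = (\<Sum>k<N. a (Suc k) * - (2 * pi * Im (fc (test_apply \<psi>) (int (Suc k)))))" for N
    proof -
      have "pairing \<phi> \<psi> (int (Suc k)) = a (Suc k) * - (2 * pi * Im (fc (test_apply \<psi>) (int (Suc k)))) / 2" for k
        unfolding pairing_def fk by simp
      moreover have "pairing \<phi> \<psi> 0 = 0" by (simp add: pairing_def f0)
      ultimately show ?thesis unfolding symmetric_sum_Suc pairing_minus by (simp add: mult_ac)
    qed
    then show "(\<lambda>N. \<Sum>n=-int N..int N. pairing \<phi> \<psi> n) \<longlonglongrightarrow> dist_apply \<phi> \<psi>"
      using S[of \<psi>] unfolding sums_def by simp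
  qed
qed

lemma cosine_series:
  assumes s: "dist_sums (\<lambda>n. distr_of (\<lambda>x. a n * cos (real n * x))) \<phi>"
  shows "fourier_coeff \<phi> 0 = of_real (a 0)" and "fourier_coeff \<phi> (int (Suc k)) = of_real (a (Suc k)) / 2"
    and "expands \<phi>"
proof -
  have S: "(\<lambda>n. a n * (2 * pi * Re (fc (test_apply \<psi>) (int n)))) sums dist_apply \<phi> \<psi>" for \<psi>
    using s unfolding dist_sums_def dist_apply_cosine by blast
  have C: "dist_apply \<phi> (sin_test n) = 0" for n
  proof -
    have "(\<lambda>k. a k * (2 * pi * Re (fc (test_apply (sin_test n)) (int k)))) = (\<lambda>k. 0)"
      unfolding sin_test.rep_eq fc_sin by (rule ext) auto
    then show ?thesis using S[of "sin_test n"] sums_unique2[OF _ sums_zero] by simp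
  qed
  have Z: "dist_apply \<phi> (cos_test 0) = 2 * pi * a 0"
  proof -
    have "(\<lambda>n. if n = 0 then 2 * pi * a n else 0) sums (2 * pi * a 0)" by (rule sums_single)
    moreover have "(\<lambda>n. a n * (2 * pi * Re (fc (test_apply (cos_test 0)) (int n)))) = (\<lambda>n. if n = 0 then 2 * pi * a n else 0)"
      unfolding cos_test.rep_eq fc_cos by (rule ext) auto
    ultimately show ?thesis using S[of "cos_test 0"] sums_unique2 by simp
  qed
  have D: "dist_apply \<phi> (cos_test (int (Suc k))) = pi * a (Suc k)" for k
  proof -
    have "(\<lambda>n. if n = Suc k then pi * a n else 0) sums (pi * a (Suc k))" by (rule sums_single)
    moreover have "(\<lambda>n. a n * (2 * pi * Re (fc (test_apply (cos_test (int (Suc k)))) (int n))))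
        = (\<lambda>n. if n = Suc k then pi * a n else 0)"
      unfolding cos_test.rep_eq fc_cos by (rule ext) auto
    ultimately show ?thesis using S[of "cos_test (int (Suc k))"] sums_unique2 by simp
  qed
  show f0: "fourier_coeff \<phi> 0 = of_real (a 0)" unfolding fourier_coeff_def C Z by (simp add: complex_eq_iff)
  show fk: "fourier_coeff \<phi> (int (Suc k)) = of_real (a (Suc k)) / 2" for k
    unfolding fourier_coeff_def C D by (simp add: complex_eq_iff)
  show "expands \<phi>"
    unfolding expands_def
  proof
    fix \<psi>
    \<comment> \<open>The modes up to \<open>N\<close> include the constant term, hence
      \<open>N + 1\<close> terms of the cosine series and a shifted sequence of partial
      sums.\<close>
    have "(\<Sum>n=-int N..int N. pairing \<phi> \<psi> n) = (\<Sum>k<Suc N. a k * (2 * pi * Re (fc (test_apply \<psi>) (int k))))" for N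
    proof -
      have "pairing \<phi> \<psi> (int (Suc k)) = a (Suc k) * (2 * pi * Re (fc (test_apply \<psi>) (int (Suc k)))) / 2" for k
        unfolding pairing_def fk by simp
      moreover have "pairing \<phi> \<psi> 0 = a 0 * (2 * pi * Re (fc (test_apply \<psi>) (int 0)))" by (simp add: pairing_def f0)
      ultimately show ?thesis unfolding symmetric_sum_Suc pairing_minus sum.lessThan_Suc_shift by (simp add: mult_ac)
    qed
    then show "(\<lambda>N. \<Sum>n=-int N..int N. pairing \<phi> \<psi> n) \<longlonglongrightarrow> dist_apply \<phi> \<psi>"
      using LIMSEQ_Suc[OF S[of \<psi>, unfolded sums_def]] by simp
  qed
qed

section \<open>Sobolev-valued functions with continuous Fourier coefficients\<close>

lemma continuous_on_infsum:
  fixes f :: "int \<Rightarrow> 'a::topological_space \<Rightarrow> real"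
  assumes "\<And>n. continuous_on S (f n)" and bnd: "\<And>n t. t \<in> S \<Longrightarrow> \<bar>f n t\<bar> \<le> M n" and M: "M summable_on UNIV"
  shows "continuous_on S (\<lambda>t. \<Sum>\<^sub>\<infinity>n. f n t)"
proof (rule uniform_limit_theorem)
  show "\<forall>\<^sub>F N in sequentially. continuous_on S (\<lambda>t. \<Sum>n=-int N..int N. f n t)"
    by (intro always_eventually allI continuous_intros assms(1))
  show "uniform_limit S (\<lambda>N t. \<Sum>n=-int N..int N. f n t) (\<lambda>t. \<Sum>\<^sub>\<infinity>n. f n t) sequentially"
  proof (rule uniform_limitI)
    fix e :: real assume "0 < e"
    then have "\<forall>\<^sub>F N in sequentially. dist (\<Sum>n=-int N..int N. M n) (infsum M UNIV) < e"
      by (intro tendstoD[OF symmetric_sums_tendsto[OF M]])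
    then show "\<forall>\<^sub>F N in sequentially. \<forall>t\<in>S. dist (\<Sum>n=-int N..int N. f n t) (\<Sum>\<^sub>\<infinity>n. f n t) < e"
    proof (eventually_elim, intro ballI)
      fix N t assume N: "dist (\<Sum>n=-int N..int N. M n) (infsum M UNIV) < e" and t: "t \<in> S"
      have "norm ((\<Sum>\<^sub>\<infinity>n. f n t) - (\<Sum>n=-int N..int N. f n t)) \<le> infsum M UNIV - (\<Sum>n=-int N..int N. M n)"
        by (rule infsum_tail_bound) (use bnd t M in auto)
      also have "\<dots> < e" using N unfolding dist_real_def by linarith
      finally show "dist (\<Sum>n=-int N..int N. f n t) (\<Sum>\<^sub>\<infinity>n. f n t) < e" by (simp add: dist_norm norm_minus_commute)
    qed
  qed
qed simp

text \<open>The points \<open>grid k t\<close> take finitely many values and tend to \<open>t\<close>: composition with \<open>grid k\<close>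
  approximates a continuous function by simple ones.\<close>

definition grid :: "nat \<Rightarrow> real \<Rightarrow> real" where
  "grid k t = (if t < real (Suc k) then (real_of_int \<lfloor>t * real (Suc k)\<rfloor> + 1) / real (Suc k) else 1)"

lemma grid_simple: "simple_function (lebesgue_on {0<..}) (grid k)"
proof (rule simple_function_borel_measurable)
  have "grid k \<in> borel_measurable borel"
    unfolding grid_def by (intro measurable_If borel_measurable_divide borel_measurable_add
        borel_measurable_const measurable_compose[OF _ borel_measurable_real_floor] borel_measurable_times) auto
  then show "grid k \<in> borel_measurable (lebesgue_on {0<..})"
    by (intro measurable_restrict_space1 measurable_completion) simp
  have "grid k ` {0<..} \<subseteq> insert 1 ((\<lambda>m. (real_of_int m + 1) / real (Suc k)) ` {0..int (Suc k * Suc k)})"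
  proof
    fix x assume "x \<in> grid k ` {0<..}"
    then obtain t where t: "0 < t" "x = grid k t" by auto
    show "x \<in> insert 1 ((\<lambda>m. (real_of_int m + 1) / real (Suc k)) ` {0..int (Suc k * Suc k)})"
    proof (cases "t < real (Suc k)")
      case True
      have "t * real (Suc k) \<le> real (Suc k) * real (Suc k)" using True by (intro mult_right_mono) auto
      then have "\<lfloor>t * real (Suc k)\<rfloor> \<le> \<lfloor>real_of_int (int (Suc k * Suc k))\<rfloor>" by (intro floor_mono) (simp only: of_int_of_nat_eq of_nat_mult of_int_mult)
      then have "\<lfloor>t * real (Suc k)\<rfloor> \<in> {0..int (Suc k * Suc k)}" using t by (simp only: floor_of_int) simp
      then show ?thesis using True t by (auto simp: grid_def)
    qed (simp add: t grid_def)
  qed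
  from finite_subset[OF this] show "finite (grid k ` space (lebesgue_on {0<..}))" by simp
qed

lemma grid_bounds: "t < real (Suc k) \<Longrightarrow> t \<le> grid k t \<and> grid k t \<le> t + 1 / real (Suc k)"
proof -
  assume t: "t < real (Suc k)"
  have "real_of_int \<lfloor>t * real (Suc k)\<rfloor> \<le> t * real (Suc k)" "t * real (Suc k) \<le> real_of_int \<lfloor>t * real (Suc k)\<rfloor> + 1"
    by linarith+
  then show ?thesis using t by (simp add: grid_def pos_le_divide_eq pos_divide_le_eq distrib_right)
qed

text \<open>Rounding up, and the value 1 beyond the horizon, keep the grid points in the open
  half-line, where the curve is known to lie in the Sobolev space.\<close>

lemma grid_pos: "0 < t \<Longrightarrow> 0 < grid k t"
  using grid_bounds[of t k] by (cases "t < real (Suc k)") (auto simp: grid_def)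

lemma grid_tendsto: "(\<lambda>k. grid k t) \<longlonglongrightarrow> t"
proof -
  obtain N where N: "t < real N" using reals_Archimedean2 by blast
  have ev: "\<forall>\<^sub>F k in sequentially. t \<le> grid k t \<and> grid k t \<le> t + 1 / real (Suc k)"
    unfolding eventually_sequentially by (intro exI[of _ N] allI impI grid_bounds) (use N in linarith)
  have l: "(\<lambda>k. t + 1 / real (Suc k)) \<longlonglongrightarrow> t + 0"
    using LIMSEQ_inverse_real_of_nat unfolding inverse_eq_divide by (intro tendsto_intros)
  show ?thesis
    by (rule real_tendsto_sandwich[of "\<lambda>_. t" _ _ "\<lambda>k. t + 1 / real (Suc k)"])
       (use ev l in \<open>auto elim: eventually_mono\<close>)
qed

text \<open>The weighted coefficients turn \<open>H\<^sup>s\<close> isometrically into \<open>ell2\<close>.\<close>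

lemma L2_locI:
  assumes coeff: "\<And>n. continuous_on {0<..} (\<lambda>t. fourier_coeff (u t) n)"
    and dom: "\<And>a b. 0 < a \<Longrightarrow> \<exists>M. M summable_on UNIV \<and> (\<forall>t n. a \<le> t \<longrightarrow> t \<le> b \<longrightarrow>
      (1 + (real_of_int n)\<^sup>2) powr s * (cmod (fourier_coeff (u t) n))\<^sup>2 \<le> M n)"
  shows "L2_loc s u"
proof -
  define w where "w n = sqrt ((1 + (real_of_int n)\<^sup>2) powr s)" for n :: int
  have w2: "(cmod (of_real (w n) * z))\<^sup>2 = (1 + (real_of_int n)\<^sup>2) powr s * (cmod z)\<^sup>2" for n z
    by (simp add: w_def norm_mult power_mult_distrib)
  have sum: "(\<lambda>n. (cmod (of_real (w n) * fourier_coeff (u t) n))\<^sup>2) summable_on UNIV" if t: "0 < t" for t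
  proof -
    obtain M where M: "M summable_on UNIV" "\<And>t' n. t \<le> t' \<Longrightarrow> t' \<le> t \<Longrightarrow>
      (1 + (real_of_int n)\<^sup>2) powr s * (cmod (fourier_coeff (u t') n))\<^sup>2 \<le> M n" using dom[OF t, of t] by blast
    show ?thesis by (rule summable_on_comparison_test[OF M(1)]) (use M(2)[of t] in \<open>auto simp: w2\<close>)
  qed
  define D where "D t = Abs_ell2 (\<lambda>n. of_real (w n) * fourier_coeff (u t) n)" for t
  have cD: "cf (D t) n = of_real (w n) * fourier_coeff (u t) n" if "0 < t" for t n
  proof -
    have "w (- n) = w n" for n by (simp add: w_def)
    then show ?thesis unfolding D_def using sum[OF that] by (subst Abs_ell2_inverse) (auto simp: fourier_coeff_minus)
  qed
  have normD: "sobolev_norm s (u t - u t') = norm (D t - D t')" if "0 < t" "0 < t'" for t t'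
    unfolding sobolev_norm_def norm_ell2_eq cf_diff cD[OF that(1)] cD[OF that(2)] right_diff_distrib[symmetric] w2
    by (simp add: fourier_coeff_diff)
  have normD0: "sobolev_norm s (u t) = norm (D t)" if "0 < t" for t
    unfolding sobolev_norm_def norm_ell2_eq cD[OF that] w2 ..
  have inS: "u t \<in> sobolev s" if "0 < t" for t using sum[OF that] by (simp add: sobolev_def w2)
  have contD: "continuous_on {a..b} D" if a: "0 < a" for a b
  proof -
    obtain M where M: "M summable_on UNIV" "\<And>t n. a \<le> t \<Longrightarrow> t \<le> b \<Longrightarrow>
      (1 + (real_of_int n)\<^sup>2) powr s * (cmod (fourier_coeff (u t) n))\<^sup>2 \<le> M n" using dom[OF a, of b] by blast
    show ?thesis
    proof (rule ell2_continuous_onI[OF _ _ M(1)])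
      have "continuous_on {a..b} (\<lambda>t. of_real (w n) * fourier_coeff (u t) n)" for n
        by (intro continuous_intros continuous_on_subset[OF coeff]) (use a in auto)
      then show "continuous_on {a..b} (\<lambda>t. cf (D t) n)" for n
        by (rule continuous_on_eq) (use a cD in auto)
      show "(cmod (cf (D t) n))\<^sup>2 \<le> M n" if "t \<in> {a..b}" for n t
        using that a M(2)[of t n] by (simp add: cD w2)
    qed
  qed
  have "sobolev_measurable s u"
    unfolding sobolev_measurable_def
  proof (intro exI conjI allI impI)
    show "simple_function (lebesgue_on {0<..}) (\<lambda>t. u (grid k t))" for k
      by (rule simple_function_compose1[OF grid_simple])
    show "u (grid k t) \<in> sobolev s" if "0 < t" for k t by (rule inS[OF grid_pos[OF that]])
    show "AE t in lebesgue_on {0<..}. u t \<in> sobolev s \<and> (\<lambda>k. sobolev_norm s (u (grid k t) - u t)) \<longlonglongrightarrow> 0"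
    proof (rule AE_I2)
      fix t :: real assume "t \<in> space (lebesgue_on {0<..})"
      then have t: "0 < t" by simp
      have "isCont D t"
        using continuous_on_interior[OF contD[of "t / 2" "t + 1"], of t] t by (simp add: interior_atLeastAtMost_real)
      then have "(\<lambda>k. D (grid k t)) \<longlonglongrightarrow> D t" by (rule isCont_tendsto_compose[OF _ grid_tendsto])
      then have "(\<lambda>k. norm (D (grid k t) - D t)) \<longlonglongrightarrow> 0" by (simp add: tendsto_norm_zero Lim_null[symmetric])
      then show "u t \<in> sobolev s \<and> (\<lambda>k. sobolev_norm s (u (grid k t) - u t)) \<longlonglongrightarrow> 0"
        using inS[OF t] by (simp add: normD t grid_pos)
    qed
  qed
  moreover have "set_integrable lebesgue {a..b} (\<lambda>t. (sobolev_norm s (u t))\<^sup>2)" if a: "0 < a" for a b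
  proof -
    have "(\<lambda>t. (norm (D t))\<^sup>2) absolutely_integrable_on {a..b}"
      by (intro absolutely_integrable_continuous_real continuous_intros contD a)
    then show ?thesis
      by (rule absolutely_integrable_spike[OF _ negligible_empty]) (use a normD0 in auto)
  qed
  ultimately show ?thesis unfolding L2_loc_def by blast
qed

section \<open>From flows to Burgers solutions\<close>

context closed_loop
begin

lemma rate_bounded:
  assumes c: "flow c" and a: "0 < a"
  shows "\<exists>R\<ge>0. \<forall>t n. a \<le> t \<longrightarrow> t \<le> b \<longrightarrow> cmod (rate (c t) n) \<le> R"
proof -
  obtain C where C: "0 \<le> C" "\<And>t n. a \<le> t \<Longrightarrow> t \<le> b \<Longrightarrow> cmod (cf (c t) n) \<le> C * jb n powr (- 2)"
    using flow_smoothing[OF c a, of b] by blast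
  obtain M where M: "0 \<le> M" "\<And>t. 0 \<le> t \<Longrightarrow> t \<le> b \<Longrightarrow> norm (c t) \<le> M"
    using heat_flow_bounded[OF c[unfolded flow_def], of b] by blast
  have "cmod (rate (c t) n) \<le> C + (C\<^sup>2 * JS + Q * M)" if t: "a \<le> t" "t \<le> b" for t n
  proof -
    have "(real_of_int n)\<^sup>2 * cmod (cf (c t) n) \<le> (jb n)\<^sup>2 * (C * jb n powr (- 2))"
      using jb_sq_ge[of n] by (intro mult_mono C(2)[OF t]) auto
    also have "\<dots> = C" using jb_pos[of n] by (simp add: powr_minus field_simps)
    finally have 1: "cmod (- of_real ((real_of_int n)\<^sup>2) * cf (c t) n) \<le> C" by (simp add: norm_mult norm_power)
    have "cmod (- (\<i> * of_int n / 2) * conv (c t) (c t) n) = \<bar>real_of_int n\<bar> / 2 * cmod (conv (c t) (c t) n)"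
      by (simp add: norm_mult norm_divide)
    also have "\<dots> \<le> jb n * cmod (conv (c t) (c t) n)" by (intro mult_right_mono) (auto simp: jb_def)
    also have "\<dots> \<le> C\<^sup>2 * JS" by (rule jb_mult_conv_bound[OF C(1) C(2)[OF t]])
    finally have 2: "cmod (- (\<i> * of_int n / 2) * conv (c t) (c t) n) \<le> C\<^sup>2 * JS" .
    have "cmod (control (c t) n) \<le> Q * norm (c t)" by (rule Q(2))
    also have "\<dots> \<le> Q * M" using M(2)[of t] a t Q(1) by (intro mult_left_mono) auto
    finally have 3: "cmod (control (c t) n) \<le> Q * M" .
    have "cmod (force (c t) n) \<le> C\<^sup>2 * JS + Q * M"
      unfolding force_def by (rule norm_triangle_le[OF add_mono[OF 2 3]])
    then show ?thesis unfolding rate_def by (rule norm_triangle_le[OF add_mono[OF 1]])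
  qed
  moreover have "0 \<le> C + (C\<^sup>2 * JS + Q * M)" using C M Q(1) JS_ge1 by simp
  ultimately show ?thesis by blast
qed

text \<open>The initial datum is kept as it stands at time 0, where its Fourier series need not
  converge pointwise; at positive times smoothing makes the synthesis continuous.\<close>

theorem flow_burgers_solution:
  assumes c: "flow c" and y0: "y0 \<in> L2" and c0: "c 0 = ft y0"
    and \<phi>: "expands \<phi>1" "expands \<phi>2"
  shows "burgers_solution \<phi>1 \<phi>2 K1 K2 y0 (\<lambda>t. if t \<le> 0 then y0 else syn (c t))"
proof -
  define y where "y t = (if t \<le> 0 then y0 else syn (c t))" for t
  have dec: "\<exists>C. \<forall>n. cmod (cf (c t) n) \<le> C * jb n powr (- 2)" if "0 < t" for t
    using flow_energy(1)[OF c that] by blast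
  have L2y: "y t \<in> L2" for t
  proof (cases "t \<le> 0")
    case True then show ?thesis using y0 by (simp add: y_def)
  next
    case False
    then obtain C where "\<And>n. cmod (cf (c t) n) \<le> C * jb n powr (- 2)" using dec[of t] by auto
    from syn_L2[OF this] show ?thesis using False by (simp add: y_def)
  qed
  have sq: "sqint (y t)" for t by (rule L2_sqint[OF L2y])
  have fty: "ft (y t) = c t" if t: "0 \<le> t" for t
  proof (cases "t = 0")
    case True then show ?thesis using c0 by (simp add: y_def)
  next
    case False
    then obtain C where "\<And>n. cmod (cf (c t) n) \<le> C * jb n powr (- 2)" using dec[of t] t by auto
    from ft_syn[OF this] show ?thesis using False t by (simp add: y_def)
  qed
  have coeff: "fourier_coeff (distr_of (y t)) n = cf (c t) n" if "0 \<le> t" for t n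
    using fourier_coeff_sqint[OF sq] fty[OF that] by simp
  have cont: "continuous_on {0..} c" by (rule flow_continuous[OF c])
  have C0: "C0_L2 y"
    unfolding C0_L2_def
  proof (intro conjI allI impI L2y)
    fix t :: real assume t: "0 \<le> t"
    have "((\<lambda>s. sqrt (2 * pi) * norm (c s - c t)) \<longlongrightarrow> sqrt (2 * pi) * norm (c t - c t)) (at t within {0..})"
      using cont t by (intro tendsto_intros) (auto simp: continuous_on_def)
    moreover have "\<forall>\<^sub>F s in at t within {0..}. sqrt (2 * pi) * norm (c s - c t) = L2_norm (\<lambda>x. y s x - y t x)"
      using t by (auto simp: eventually_at_filter L2_norm_diff_ft sq fty intro!: always_eventually)
    ultimately have "((\<lambda>s. L2_norm (\<lambda>x. y s x - y t x)) \<longlongrightarrow> sqrt (2 * pi) * norm (c t - c t)) (at t within {0..})"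
      by (rule Lim_transform_eventually)
    then show "((\<lambda>s. L2_norm (\<lambda>x. y s x - y t x)) \<longlongrightarrow> 0) (at t within {0..})" by simp
  qed
  have L2u: "L2_loc s (\<lambda>t. distr_of (y t))" if s: "s \<le> 1" for s
  proof (rule L2_locI)
    show "continuous_on {0<..} (\<lambda>t. fourier_coeff (distr_of (y t)) n)" for n
      by (rule continuous_on_eq[OF continuous_on_cf[OF continuous_on_subset[OF cont], of "{0<..}" n]]) (auto simp: coeff)
    fix a b :: real assume a: "0 < a"
    obtain C where C: "0 \<le> C" "\<And>t n. a \<le> t \<Longrightarrow> t \<le> b \<Longrightarrow> cmod (cf (c t) n) \<le> C * jb n powr (- 2)"
      using flow_smoothing[OF c a, of b] by blast
    have "(1 + (real_of_int n)\<^sup>2) powr s * (cmod (fourier_coeff (distr_of (y t)) n))\<^sup>2 \<le> C\<^sup>2 * jb n powr (- 2)"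
      if t: "a \<le> t" "t \<le> b" for t n
    proof -
      have "(1 + (real_of_int n)\<^sup>2) powr s \<le> (1 + (real_of_int n)\<^sup>2) powr 1" using s by (intro powr_mono) auto
      also have "\<dots> \<le> (jb n)\<^sup>2" using jb_sq_ge[of n] by (simp add: add_nonneg_nonneg)
      finally have "(1 + (real_of_int n)\<^sup>2) powr s * (cmod (cf (c t) n))\<^sup>2 \<le> (jb n)\<^sup>2 * (C * jb n powr (- 2))\<^sup>2"
        by (intro mult_mono power_mono C(2)[OF t]) auto
      also have "\<dots> = C\<^sup>2 * jb n powr (- 2)"
        using jb_pos[of n] by (simp add: powr_minus power_mult_distrib field_simps)
      finally show ?thesis using coeff a t by simp
    qed
    then show "\<exists>M. M summable_on UNIV \<and> (\<forall>t n. a \<le> t \<longrightarrow> t \<le> b \<longrightarrow>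
        (1 + (real_of_int n)\<^sup>2) powr s * (cmod (fourier_coeff (distr_of (y t)) n))\<^sup>2 \<le> M n)"
      by (intro exI[of _ "\<lambda>n. C\<^sup>2 * jb n powr (- 2)"]) (auto intro!: summable_on_cmult_right jb_powr_summable)
  qed
  \<comment> \<open>Chosen so that the equation holds identically. What has to be proved is that it
    is the time derivative.\<close>
  define v where "v t = dist_deriv (dist_deriv (distr_of (y t))) - dist_deriv (distr_of (\<lambda>x. (y t x)\<^sup>2 / 2))
      + (K1 (distr_of (y t)) *\<^sub>R \<phi>1 + K2 (distr_of (y t)) *\<^sub>R \<phi>2)" for t
  have veq: "v t - dist_deriv (dist_deriv (distr_of (y t))) + dist_deriv (distr_of (\<lambda>x. (y t x)\<^sup>2 / 2))
             = K1 (distr_of (y t)) *\<^sub>R \<phi>1 + K2 (distr_of (y t)) *\<^sub>R \<phi>2" for t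
    by (simp add: v_def)
  have vcoeff: "fourier_coeff (v t) n = rate (c t) n" if "0 \<le> t" for t n
    using fourier_coeff_equation[OF sq veq] fty[OF that] by simp
  have L2v: "L2_loc (- 1) v"
  proof (rule L2_locI)
    show "continuous_on {0<..} (\<lambda>t. fourier_coeff (v t) n)" for n
      by (rule continuous_on_eq[OF rate_continuous[OF continuous_on_subset[OF cont], of "{0<..}" n]]) (auto simp: vcoeff)
    fix a b :: real assume a: "0 < a"
    obtain R where R: "0 \<le> R" "\<And>t n. a \<le> t \<Longrightarrow> t \<le> b \<Longrightarrow> cmod (rate (c t) n) \<le> R"
      using rate_bounded[OF c a, of b] by blast
    have "(1 + (real_of_int n)\<^sup>2) powr (- 1) * (cmod (fourier_coeff (v t) n))\<^sup>2 \<le> 2 * R\<^sup>2 * jb n powr (- 2)"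
      if t: "a \<le> t" "t \<le> b" for t n
    proof -
      have "(1 + (real_of_int n)\<^sup>2) powr (- 1) \<le> 2 * jb n powr (- 2)"
        using jb_sq[of n] jb_pos[of n] by (simp add: powr_minus field_simps add_pos_nonneg)
      then have "(1 + (real_of_int n)\<^sup>2) powr (- 1) * (cmod (rate (c t) n))\<^sup>2 \<le> (2 * jb n powr (- 2)) * R\<^sup>2"
        by (intro mult_mono power_mono R(2)[OF t]) auto
      then show ?thesis using vcoeff a t by (simp add: mult_ac)
    qed
    then show "\<exists>M. M summable_on UNIV \<and> (\<forall>t n. a \<le> t \<longrightarrow> t \<le> b \<longrightarrow>
        (1 + (real_of_int n)\<^sup>2) powr (- 1) * (cmod (fourier_coeff (v t) n))\<^sup>2 \<le> M n)"
      by (intro exI[of _ "\<lambda>n. 2 * R\<^sup>2 * jb n powr (- 2)"]) (auto intro!: summable_on_cmult_right jb_powr_summable)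
  qed
  have "weak_time_deriv (\<lambda>t. distr_of (y t)) v"
    unfolding weak_time_deriv_def
  proof (intro allI impI)
    fix \<theta> \<psi> assume tt: "time_test \<theta>"
    then obtain a b where th: "smooth \<theta>" and ab: "0 < a" "a < b" and supp: "\<And>t. t \<notin> {a..b} \<Longrightarrow> \<theta> t = 0"
      unfolding time_test_def by blast
    define z where "z n = cnj (fc (test_apply \<psi>) n)" for n
    obtain D where D: "0 \<le> D" "\<And>n. cmod (z n) \<le> D * jb n powr (- 2)"
      using fc_test_decay[of \<psi>] by (auto simp: z_def)
    \<comment> \<open>The term of mode \<open>n\<close> in the pairing with \<open>\<psi>\<close>,
      as a function of the coefficient. The decay of \<open>z\<close> lets series over bounded
      coefficients be differentiated term by term in time.\<close>
    define T where "T x n = 2 * pi * Re (x * z n)" for x n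
    have Tb: "\<bar>T x n\<bar> \<le> (2 * pi * r * D) * jb n powr (- 2)" if "cmod x \<le> r" for x r n
    proof -
      have "\<bar>Re (x * z n)\<bar> \<le> cmod x * cmod (z n)" using abs_Re_le_cmod[of "x * z n"] by (simp add: norm_mult)
      also have "\<dots> \<le> r * (D * jb n powr (- 2))" using that D order_trans[OF norm_ge_zero that] by (intro mult_mono) auto
      finally have "2 * pi * \<bar>Re (x * z n)\<bar> \<le> 2 * pi * (r * (D * jb n powr (- 2)))" by (intro mult_left_mono) auto
      then show ?thesis by (simp add: T_def abs_mult mult.assoc)
    qed
    have Ms: "(\<lambda>n. K * jb n powr (- 2)) summable_on UNIV" for K
      by (intro summable_on_cmult_right jb_powr_summable) simp
    have Ts: "(\<lambda>n. T (f n) n) summable_on UNIV" if "\<And>n. cmod (f n) \<le> r" for f r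
      by (rule abs_summable_summable, rule summable_on_comparison_test[OF Ms[of "2 * pi * r * D"]])
         (use Tb[OF that] in auto)
    have m: "dist_apply (distr_of (y t)) \<psi> = (\<Sum>\<^sub>\<infinity>n. T (cf (c t) n) n)" if t: "0 < t" for t
    proof -
      have e: "pairing (distr_of (y t)) \<psi> = (\<lambda>n. T (cf (c t) n) n)"
        using t by (auto simp: pairing_def T_def z_def coeff)
      show ?thesis using expands_dist_apply[OF expands_sqint[OF sq], of t \<psi>] Ts[of "cf (c t)", OF cf_le_norm] unfolding e by blast
    qed
    have w: "dist_apply (v t) \<psi> = (\<Sum>\<^sub>\<infinity>n. T (rate (c t) n) n)" if t: "0 < t" for t
    proof -
      obtain C where C: "\<And>n. cmod (cf (c t) n) \<le> C * jb n powr (- 2)" using dec[OF t] by blast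
      have "sqint (\<lambda>x. (y t x)\<^sup>2 / 2)"
        using t by (intro sqint_continuous) (auto simp: y_def intro!: continuous_intros continuous_on_subset[OF syn_continuous[OF C]])
      then have ex: "expands (v t)"
        unfolding v_def by (intro expands_add expands_diff expands_scaleR expands_deriv expands_sqint sq \<phi>)
      have e: "pairing (v t) \<psi> = (\<lambda>n. T (rate (c t) n) n)"
        using t by (auto simp: pairing_def T_def z_def vcoeff)
      obtain R where R: "\<And>n. cmod (rate (c t) n) \<le> R" using rate_bounded[OF c t, of t] by auto
      show ?thesis using expands_dist_apply[OF ex, of \<psi>] Ts[of "rate (c t)", OF R] unfolding e by blast
    qed
    have dm: "((\<lambda>t. dist_apply (distr_of (y t)) \<psi>) has_real_derivative dist_apply (v t) \<psi>) (at t)" if t: "0 < t" for t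
    proof -
      obtain R where R: "\<And>s n. t / 2 \<le> s \<Longrightarrow> s \<le> t + 1 \<Longrightarrow> cmod (rate (c s) n) \<le> R"
        using rate_bounded[OF c, of "t / 2" "t + 1"] t by auto
      have "((\<lambda>s. \<Sum>\<^sub>\<infinity>n. T (cf (c s) n) n) has_real_derivative (\<Sum>\<^sub>\<infinity>n. T (rate (c t) n) n)) (at t)"
      proof (rule DERIV_infsum[OF _ _ Ms[of "2 * pi * R * D"]])
        fix n s assume s: "t / 2 < s" "s < t + 1"
        have bl: "bounded_linear (\<lambda>x. T x n)" unfolding T_def
          by (intro bounded_linear_const_mult bounded_linear_compose[OF bounded_linear_Re] bounded_linear_mult_left)
        have "((\<lambda>s. cf (c s) n) has_vector_derivative rate (c s) n) (at s)"
          unfolding rate_def using heat_flow_derivative_at[OF c[unfolded flow_def]] s t by simp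
        from bounded_linear.has_vector_derivative[OF bl this]
        show "((\<lambda>s. T (cf (c s) n) n) has_real_derivative T (rate (c s) n) n) (at s)"
          by (simp add: has_real_derivative_iff_has_vector_derivative)
        show "\<bar>T (rate (c s) n) n\<bar> \<le> 2 * pi * R * D * jb n powr (- 2)" by (rule Tb[OF R]) (use s in auto)
      next
        show "(\<lambda>n. T (cf (c s) n) n) summable_on UNIV" for s by (rule Ts[of "cf (c s)", OF cf_le_norm])
      qed (use t in auto)
      then show ?thesis
        unfolding w[OF t]
        by (rule has_field_derivative_transform_within_open[where S="{0<..}"]) (use t m in auto)
    qed
    have cw: "continuous_on {0<..} (\<lambda>t. dist_apply (v t) \<psi>)"
    proof (subst continuous_on_eq_continuous_at)
      show "\<forall>t\<in>{0<..}. isCont (\<lambda>t. dist_apply (v t) \<psi>) t"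
      proof
        fix t :: real assume "t \<in> {0<..}"
        then have t: "0 < t" by simp
        obtain R where R: "\<And>s n. t / 2 \<le> s \<Longrightarrow> s \<le> t + 1 \<Longrightarrow> cmod (rate (c s) n) \<le> R"
          using rate_bounded[OF c, of "t / 2" "t + 1"] t by auto
        have "continuous_on {t / 2..t + 1} (\<lambda>s. \<Sum>\<^sub>\<infinity>n. T (rate (c s) n) n)"
        proof (rule continuous_on_infsum[OF _ _ Ms[of "2 * pi * R * D"]])
          show "continuous_on {t / 2..t + 1} (\<lambda>s. T (rate (c s) n) n)" for n
            unfolding T_def by (intro continuous_intros rate_continuous continuous_on_subset[OF cont]) (use t in auto)
          show "\<bar>T (rate (c s) n) n\<bar> \<le> 2 * pi * R * D * jb n powr (- 2)" if "s \<in> {t / 2..t + 1}" for n s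
            by (rule Tb[OF R]) (use that in auto)
        qed
        then have "continuous_on {t / 2..t + 1} (\<lambda>s. dist_apply (v s) \<psi>)"
          by (rule continuous_on_eq) (use t w in auto)
        then show "isCont (\<lambda>t. dist_apply (v t) \<psi>) t"
          by (rule continuous_on_interior) (use t in \<open>simp add: interior_atLeastAtMost_real\<close>)
      qed
    qed simp
    have cm: "continuous_on {a..b} (\<lambda>t. dist_apply (distr_of (y t)) \<psi>)"
      using DERIV_isCont[OF dm] ab by (intro continuous_at_imp_continuous_on) auto
    have i1: "(\<lambda>t. deriv \<theta> t * dist_apply (distr_of (y t)) \<psi>) absolutely_integrable_on {a..b}"
      by (intro absolutely_integrable_continuous_real continuous_intros cm smooth_continuous[OF smooth_deriv[OF th]])
    have i2: "(\<lambda>t. \<theta> t * dist_apply (v t) \<psi>) absolutely_integrable_on {a..b}"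
      by (intro absolutely_integrable_continuous_real continuous_intros continuous_on_subset[OF cw] smooth_continuous[OF th])
         (use ab in auto)
    have "(LINT t:{0<..}|lebesgue. deriv \<theta> t * dist_apply (distr_of (y t)) \<psi>)
        = integral {a..b} (\<lambda>t. deriv \<theta> t * dist_apply (distr_of (y t)) \<psi>)"
      by (rule LINT_compact_support[OF ab(1) _ i1]) (use time_test_deriv_support[OF th supp] in \<open>metis mult_zero_left\<close>)
    also have "\<dots> = - integral {a..b} (\<lambda>t. \<theta> t * dist_apply (v t) \<psi>)"
      by (rule integration_by_parts_test[OF th supp ab dm cw])
    also have "integral {a..b} (\<lambda>t. \<theta> t * dist_apply (v t) \<psi>) = (LINT t:{0<..}|lebesgue. \<theta> t * dist_apply (v t) \<psi>)"
      by (rule LINT_compact_support[symmetric, OF ab(1) _ i2]) (simp add: supp)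
    finally show "(LINT t:{0<..}|lebesgue. deriv \<theta> t * dist_apply (distr_of (y t)) \<psi>)
        = - (LINT t:{0<..}|lebesgue. \<theta> t * dist_apply (v t) \<psi>)" .
  qed
  moreover have "AE x in lebesgue. y 0 x = y0 x" by (simp add: y_def)
  ultimately have "burgers_solution \<phi>1 \<phi>2 K1 K2 y0 y"
    unfolding burgers_solution_def using C0 L2u[of 1] L2u[of "- 1"] L2v veq by auto
  then show ?thesis by (simp add: y_def[abs_def])
qed

end

section \<open>The stabilization theorem\<close>

lemma fourier_coeff_le_sobolev_norm:
  assumes "u \<in> sobolev s" "0 \<le> s" shows "cmod (fourier_coeff u n) \<le> sobolev_norm s u"
proof -
  let ?f = "\<lambda>n::int. (1 + (real_of_int n)\<^sup>2) powr s * (cmod (fourier_coeff u n))\<^sup>2"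
  have "1 \<le> (1 + (real_of_int n)\<^sup>2) powr s" using assms(2) by (intro ge_one_powr_ge_zero) auto
  then have "(cmod (fourier_coeff u n))\<^sup>2 \<le> ?f n"
    using mult_right_mono[of 1 "(1 + (real_of_int n)\<^sup>2) powr s" "(cmod (fourier_coeff u n))\<^sup>2"] by simp
  also have "?f n = sum ?f {n}" by simp
  also have "\<dots> \<le> infsum ?f UNIV" using assms(1) by (intro finite_sum_le_infsum) (auto simp: sobolev_def)
  finally show ?thesis unfolding sobolev_norm_def by (rule real_le_rsqrt)
qed

text \<open>Here \<open>f\<close> stands for \<open>Re\<close> or \<open>Im\<close>. A single
  coefficient is bounded by any Sobolev norm of nonnegative order.\<close>

lemma bounded_functional_plus_finite_modes:
  fixes w :: "nat \<Rightarrow> real"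
  assumes f: "\<And>u v n. f (fourier_coeff (u + v) n) = f (fourier_coeff u n) + f (fourier_coeff v n)"
    "\<And>r u n. f (fourier_coeff (r *\<^sub>R u) n) = r * f (fourier_coeff u n)" "\<And>z. \<bar>f z\<bar> \<le> cmod z" and "0 \<le> s"
  shows "bounded_functional_plus s (\<lambda>u. - (\<Sum>i\<in>S. w i * f (fourier_coeff u (int i))))"
  unfolding bounded_functional_plus_def
proof (intro allI impI conjI ballI)
  fix \<epsilon> :: real assume e: "0 < \<epsilon>"
  show "- (\<Sum>i\<in>S. w i * f (fourier_coeff (u + v) (int i)))
      = - (\<Sum>i\<in>S. w i * f (fourier_coeff u (int i))) + - (\<Sum>i\<in>S. w i * f (fourier_coeff v (int i)))" for u v
    by (simp add: f distrib_left sum.distrib)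
  show "- (\<Sum>i\<in>S. w i * f (fourier_coeff (r *\<^sub>R u) (int i))) = r * - (\<Sum>i\<in>S. w i * f (fourier_coeff u (int i)))" for r u
    by (simp add: f sum_distrib_left mult.left_commute)
  have "\<bar>- (\<Sum>i\<in>S. w i * f (fourier_coeff u (int i)))\<bar> \<le> (\<Sum>i\<in>S. \<bar>w i\<bar>) * sobolev_norm (s + \<epsilon>) u"
    if u: "u \<in> sobolev (s + \<epsilon>)" for u
  proof -
    have "\<bar>- (\<Sum>i\<in>S. w i * f (fourier_coeff u (int i)))\<bar> \<le> (\<Sum>i\<in>S. \<bar>w i * f (fourier_coeff u (int i))\<bar>)"
      unfolding abs_minus_cancel by (rule sum_abs)
    also have "\<dots> \<le> (\<Sum>i\<in>S. \<bar>w i\<bar> * sobolev_norm (s + \<epsilon>) u)"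
      unfolding abs_mult using assms(4) e
      by (intro sum_mono mult_left_mono order_trans[OF f(3) fourier_coeff_le_sobolev_norm[OF u]]) auto
    finally show ?thesis by (simp add: sum_distrib_right)
  qed
  then show "\<exists>C. \<forall>u\<in>sobolev (s + \<epsilon>). \<bar>- (\<Sum>i\<in>S. w i * f (fourier_coeff u (int i)))\<bar> \<le> C * sobolev_norm (s + \<epsilon>) u"
    by blast
qed

lemma int_cases_symmetric:
  assumes "P 0" "\<And>k. P (int (Suc k))" "\<And>n. P n \<Longrightarrow> P (- n)" shows "P (n :: int)"
proof -
  have nat: "P (int k)" for k using assms(1,2) by (cases k) auto
  show ?thesis
  proof (cases "0 \<le> n")
    case True then show ?thesis using nat[of "nat n"] by simp
  next
    case False then show ?thesis using assms(3)[OF nat[of "nat (- n)"]] by simp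
  qed
qed

theorem theorem1p4:
  fixes \<phi>1 \<phi>2 :: distribution and a1 a2 :: "nat \<Rightarrow> real" and c C lam :: real
  assumes "\<And>\<epsilon>. \<epsilon> > 0 \<Longrightarrow> \<phi>1 \<in> sobolev (- 1 / 2 - \<epsilon>)"
    and "\<And>\<epsilon>. \<epsilon> > 0 \<Longrightarrow> \<phi>2 \<in> sobolev (- 1 / 2 - \<epsilon>)"
    and "dist_sums (\<lambda>n. distr_of (\<lambda>x. a1 (Suc n) * sin (real (Suc n) * x))) \<phi>1"
    and "dist_sums (\<lambda>n. distr_of (\<lambda>x. a2 n * cos (real n * x))) \<phi>2"
    and "a2 0 \<noteq> 0"
    and "c > 0" and "C > 0"
    and "\<And>n. n \<ge> 1 \<Longrightarrow> c < \<bar>a1 n\<bar> \<and> \<bar>a1 n\<bar> < C"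
    and "\<And>n. n \<ge> 1 \<Longrightarrow> c < \<bar>a2 n\<bar> \<and> \<bar>a2 n\<bar> < C"
    and "lam > 0"
  shows "\<exists>K1 K2. bounded_functional_plus (1 / 2) K1 \<and> bounded_functional_plus (1 / 2) K2 \<and>
    (\<forall>y0\<in>L2. \<exists>y. burgers_solution \<phi>1 \<phi>2 K1 K2 y0 y \<and>
       (\<forall>z. burgers_solution \<phi>1 \<phi>2 K1 K2 y0 z \<longrightarrow> (\<forall>t\<ge>0. AE x in lebesgue. z t x = y t x))) \<and>
    (\<exists>\<delta>>0. \<exists>C'. \<forall>y0\<in>L2. L2_norm y0 < \<delta> \<longrightarrow>
       (\<forall>y. burgers_solution \<phi>1 \<phi>2 K1 K2 y0 y \<longrightarrow>
          (\<forall>t\<ge>0. L2_norm (y t) \<le> C' * exp (- lam * t) * L2_norm y0)))"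
proof -
  define p where "p = fourier_coeff \<phi>1"
  define q where "q = fourier_coeff \<phi>2"
  note sine = sine_series[OF assms(3)] and cosine = cosine_series[OF assms(4)]
  have p: "p 0 = 0" "\<And>k. p (int (Suc k)) = - \<i> * of_real (a1 (Suc k)) / 2" using sine by (simp_all only: p_def)
  have q: "q 0 = of_real (a2 0)" "\<And>k. q (int (Suc k)) = of_real (a2 (Suc k)) / 2" using cosine by (simp_all only: q_def)
  have pm: "p (- n) = cnj (p n)" "q (- n) = cnj (q n)" for n by (simp_all add: p_def q_def fourier_coeff_minus)
  \<comment> \<open>\<open>C\<close> bounds the coefficients with \<open>n \<ge> 1\<close> only; the
    constant term of \<open>\<phi>2\<close> is added separately.\<close>
  define A where "A = C + \<bar>a2 0\<bar>"
  have pb: "cmod (p n) \<le> A" for n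
  proof (rule int_cases_symmetric[of "\<lambda>n. cmod (p n) \<le> A"])
    show "cmod (p 0) \<le> A" using \<open>C > 0\<close> by (simp add: p A_def)
    show "cmod (p (int (Suc k))) \<le> A" for k
      using assms(8)[of "Suc k"] abs_ge_zero[of "a2 0"] \<open>C > 0\<close> unfolding p A_def by (simp add: norm_mult norm_divide del: abs_ge_zero)
  qed (simp add: pm)
  have qb: "cmod (q n) \<le> A" for n
  proof (rule int_cases_symmetric[of "\<lambda>n. cmod (q n) \<le> A"])
    show "cmod (q 0) \<le> A" using \<open>C > 0\<close> by (simp add: q A_def)
    show "cmod (q (int (Suc k))) \<le> A" for k
      using assms(9)[of "Suc k"] abs_ge_zero[of "a2 0"] \<open>C > 0\<close> unfolding q A_def by (simp add: norm_mult norm_divide del: abs_ge_zero)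
  qed (simp add: pm)
  have p0: "Re (p (int i)) = 0" and q0: "Im (q (int i)) = 0" for i
  proof -
    have "Re (p (int i)) = 0 \<and> Im (q (int i)) = 0"
    proof (cases i)
      case 0 then show ?thesis by (simp only: of_nat_0 p(1) q(1)) simp
    next
      case (Suc k) show ?thesis unfolding Suc p(2) q(2) by (simp add: Re_divide_numeral Im_divide_numeral)
    qed
    then show "Re (p (int i)) = 0" "Im (q (int i)) = 0" by simp_all
  qed
  \<comment> \<open>Beyond mode \<open>N\<close>, half of the dissipation already has rate at least
    \<open>2 * (lam + 1)\<close>, the other half being reserved for the inputs.\<close>
  define N where "N = nat \<lceil>2 * (lam + 1)\<rceil>"
  have N: "2 * (lam + 1) \<le> (real N + 1)\<^sup>2"
  proof -
    have "2 * (lam + 1) \<le> real N" unfolding N_def by (rule real_nat_ceiling_ge)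
    also have "\<dots> \<le> (real N + 1)\<^sup>2" by (simp add: power2_eq_square algebra_simps)
    finally show ?thesis .
  qed
  \<comment> \<open>Larger than every \<open>i\<^sup>2\<close> with \<open>i \<le> N\<close>, so
    that the entries \<open>mu - i\<^sup>2\<close> of the Cauchy matrix are positive, and at least
    the rate \<open>lam + 1\<close>.\<close>
  define mu where "mu = (real N)\<^sup>2 + lam + 1"
  have mu: "lam + 1 \<le> mu" "\<And>i. i \<le> N \<Longrightarrow> (real i)\<^sup>2 < mu"
  proof -
    show "lam + 1 \<le> mu" by (simp add: mu_def)
    fix i assume "i \<le> N"
    then have "(real i)\<^sup>2 \<le> (real N)\<^sup>2" by (intro power_mono) auto
    then show "(real i)\<^sup>2 < mu" unfolding mu_def using \<open>lam > 0\<close> by linarith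
  qed
  have b1: "Im (p (int i)) \<noteq> 0" if i: "i \<in> {1..N}" for i
  proof -
    obtain k where k: "i = Suc k" using i by (cases i) auto
    show ?thesis using assms(8)[of i] \<open>c > 0\<close> unfolding k p by auto
  qed
  have b2: "Re (q (int i)) \<noteq> 0" if "i \<in> {0..N}" for i
  proof (cases i)
    case 0 then show ?thesis using \<open>a2 0 \<noteq> 0\<close> q by simp
  next
    case (Suc k)
    show ?thesis using assms(9)[of i] \<open>c > 0\<close> unfolding Suc q by auto
  qed
  obtain P1 w1 m1 where 1: "0 < m1" "\<And>i j. P1 i j = P1 j i"
    "\<And>x. m1 * (\<Sum>i\<in>{1..N}. (x i)\<^sup>2) \<le> (\<Sum>i\<in>{1..N}. \<Sum>j\<in>{1..N}. P1 i j * x i * x j)"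
    "\<And>x u. u = - (\<Sum>i\<in>{1..N}. w1 i * x i) \<Longrightarrow>
        2 * (\<Sum>i\<in>{1..N}. \<Sum>j\<in>{1..N}. P1 i j * (- (real i)\<^sup>2 * x i + Im (p (int i)) * u) * x j)
          = - 2 * mu * (\<Sum>i\<in>{1..N}. \<Sum>j\<in>{1..N}. P1 i j * x i * x j) - u\<^sup>2"
    using finite_modes_Lyapunov[of "{1..N}" mu "\<lambda>i. Im (p (int i))"] mu(2) b1 by auto
  obtain P2 w2 m2 where 2: "0 < m2" "\<And>i j. P2 i j = P2 j i"
    "\<And>x. m2 * (\<Sum>i\<in>{0..N}. (x i)\<^sup>2) \<le> (\<Sum>i\<in>{0..N}. \<Sum>j\<in>{0..N}. P2 i j * x i * x j)"
    "\<And>x u. u = - (\<Sum>i\<in>{0..N}. w2 i * x i) \<Longrightarrow>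
        2 * (\<Sum>i\<in>{0..N}. \<Sum>j\<in>{0..N}. P2 i j * (- (real i)\<^sup>2 * x i + Re (q (int i)) * u) * x j)
          = - 2 * mu * (\<Sum>i\<in>{0..N}. \<Sum>j\<in>{0..N}. P2 i j * x i * x j) - u\<^sup>2"
    using finite_modes_Lyapunov[of "{0..N}" mu "\<lambda>i. Re (q (int i))"] mu(2) b2 by auto
  define k1 where "k1 e = - (\<Sum>i\<in>{1..N}. w1 i * Im (cf e (int i)))" for e
  define k2 where "k2 e = - (\<Sum>i\<in>{0..N}. w2 i * Re (cf e (int i)))" for e
  define K1 where "K1 u = - (\<Sum>i\<in>{1..N}. w1 i * Im (fourier_coeff u (int i)))" for u
  define K2 where "K2 u = - (\<Sum>i\<in>{0..N}. w2 i * Re (fourier_coeff u (int i)))" for u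
  have bl1: "bounded_linear k1" unfolding k1_def
    by (intro bounded_linear_minus bounded_linear_sum bounded_linear_const_mult
        bounded_linear_compose[OF bounded_linear_Im bounded_linear_cf])
  have bl2: "bounded_linear k2" unfolding k2_def
    by (intro bounded_linear_minus bounded_linear_sum bounded_linear_const_mult
        bounded_linear_compose[OF bounded_linear_Re bounded_linear_cf])
  interpret closed_loop p q k1 k2 A \<phi>1 \<phi>2 K1 K2
  proof (intro closed_loop.intro feedback.intro closed_loop_axioms.intro)
    show "K1 (distr_of f) = k1 (ft f)" "K2 (distr_of f) = k2 (ft f)" if "sqint f" for f
      using that by (simp_all add: K1_def k1_def K2_def k2_def fourier_coeff_sqint)
  qed (use pm pb qb bl1 bl2 in \<open>auto simp: p_def q_def\<close>)
  have ft0: "ft (z 0) = ft y0" "sqint (z t)" "z t (x + 2 * pi) = z t x"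
    if z: "burgers_solution \<phi>1 \<phi>2 K1 K2 y0 z" "y0 \<in> L2" "0 \<le> t" for y0 z t x
  proof -
    have L: "z s \<in> L2" if "0 \<le> s" for s using z that by (auto simp: burgers_solution_def C0_L2_def)
    show "sqint (z t)" "z t (x + 2 * pi) = z t x" using L[OF z(3)] L2_sqint by (auto simp: L2_def)
    have "AE x in lebesgue. z 0 x = y0 x" using z by (simp add: burgers_solution_def)
    then show "ft (z 0) = ft y0"
      using L[of 0] z(2) by (subst (asm) AE_eq_iff_ft_eq) (auto simp: L2_def intro: L2_sqint)
  qed
  have bf: "bounded_functional_plus (1 / 2) K1" "bounded_functional_plus (1 / 2) K2"
    unfolding K1_def[abs_def] K2_def[abs_def]
    by (rule bounded_functional_plus_finite_modes;
        simp add: fourier_coeff_add fourier_coeff_scaleR abs_Re_le_cmod abs_Im_le_cmod)+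
  have wellposed: "\<exists>y. burgers_solution \<phi>1 \<phi>2 K1 K2 y0 y \<and>
       (\<forall>z. burgers_solution \<phi>1 \<phi>2 K1 K2 y0 z \<longrightarrow> (\<forall>t\<ge>0. AE x in lebesgue. z t x = y t x))" if y0: "y0 \<in> L2" for y0
  proof -
    obtain e where e: "flow e" "e 0 = ft y0" using flow_exists by blast
    let ?y = "\<lambda>t. if t \<le> 0 then y0 else syn (e t)"
    have sol: "burgers_solution \<phi>1 \<phi>2 K1 K2 y0 ?y"
      by (rule flow_burgers_solution[OF e(1) y0 e(2) sine(3) cosine(3)])
    have "AE x in lebesgue. z t x = ?y t x" if z: "burgers_solution \<phi>1 \<phi>2 K1 K2 y0 z" and t: "0 \<le> t" for z t
    proof (subst AE_eq_iff_ft_eq)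
      show "ft (z t) = ft (?y t)"
        by (rule flow_unique[OF burgers_solution_flow[OF z] burgers_solution_flow[OF sol] _ t])
           (use ft0(1)[OF z y0 t] ft0(1)[OF sol y0 t] in simp)
    qed (rule ft0[OF z y0 t] ft0[OF sol y0 t])+
    then show ?thesis using sol by blast
  qed
  obtain d K where d: "0 < d" and K: "\<And>e t. flow e \<Longrightarrow> norm (e 0) < d \<Longrightarrow> 0 \<le> t \<Longrightarrow> norm (e t) \<le> K * exp (- lam * t) * norm (e 0)"
    using small_flow_decay[OF \<open>lam > 0\<close> N mu(1) refl refl 1 2 p0 q0 k1_def k2_def] by blast
  \<comment> \<open>The factor \<open>sqrt (2 * pi)\<close> between the two norms rescales the
    smallness threshold and cancels in the estimate.\<close>
  have decay: "L2_norm (y t) \<le> K * exp (- lam * t) * L2_norm y0"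
    if y0: "y0 \<in> L2" "L2_norm y0 < sqrt (2 * pi) * d" and y: "burgers_solution \<phi>1 \<phi>2 K1 K2 y0 y" and t: "0 \<le> t" for y0 y t
  proof -
    have n0: "L2_norm y0 = sqrt (2 * pi) * norm (ft (y 0))"
      using ft0(1)[OF y y0(1) t] L2_norm_ft[OF L2_sqint[OF y0(1)]] by simp
    then have "norm (ft (y 0)) < d" using y0(2) by simp
    then have "sqrt (2 * pi) * norm (ft (y t)) \<le> sqrt (2 * pi) * (K * exp (- lam * t) * norm (ft (y 0)))"
      by (intro mult_left_mono K[OF burgers_solution_flow[OF y] _ t]) auto
    then show ?thesis using L2_norm_ft[OF ft0(2)[OF y y0(1) t]] n0 by (simp add: mult_ac)
  qed
  have "0 < sqrt (2 * pi) * d" using d by simp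
  then show ?thesis using bf wellposed decay by blast
qed

end
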